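(* Let $A$ be a ring, $Crg_A$ the category of $A$-corings and $U:Crg_A\to{}_A\mathcal{M}_A$ the forgetful functor to $A$-bimodules. (i) Let $C$ be an $A$-coring. Then every $A$-sub-bimodule $S$ of $C$ is contained in a subcoring $D$ of $C$ which is pure as a left and as a right $A$-submodule, and such that $|D|\le\max\{|S|,|A|,\aleph_0\}$. (ii) $Crg_A$ is generated by all corings of cardinality $\le\max\{|A|,\aleph_0\}$. (iii) There is a cofree coring $C(V)$ on every $A$-bimodule $V$; moreover $$C(V)=\varinjlim_{f:U(G)\to V\ |\ G\in Crg_A,\ |G|\le\max\{|A|,\aleph_0\}}G .$$ (iv) The category $Crg_A$ is complete. If $F:\mathcal{A}\to Crg_A$ is a functor from a small category, with $C_a=F(a)$, let $(P,q_a:P\to C_a)=\varprojlim_a C_a=\varprojlim UF$ be the limit of $A$-bimodules, and let $f:C(P)\to P$ be the canonical bimodule map of the cofree coring on $P$. The limit of $F$ is $$C(P)_0=\varinjlim_{[h:H\to C(P)]\ |\ h,\ q_afh\in Crg_A}H$$ with canonical maps $(q_afp_0)_a$, where $(C(P)_0,p_0)=(\mathcal{H}_0(P,(q_af)_a),p_0)$ is given by the construction $\mathcal{H}_0$ described in the context.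
   Context: $|X|$ denotes cardinality. ${}_A\mathcal{M}_A$ is the monoidal category of $A$-bimodules with tensor product $\otimes_A$ and unit object $A$. An $A$-coring is a comonoid (coassociative counital coalgebra) in ${}_A\mathcal{M}_A$; morphisms of corings are bimodule maps compatible with comultiplication and counit. A subcoring $D$ of a coring $C$ is an $A$-sub-bimodule of $C$, itself a coring, such that the inclusion $D\hookrightarrow C$ is a morphism of corings. A submodule $N$ of a left $A$-module $M$ is pure if for every right $A$-module $Q$ the induced map $Q\otimes_AN\to Q\otimes_AM$ is injective; similarly for right modules. A category is generated by a set of objects if for any two distinct parallel morphisms $u\neq v:X\to Y$ there are an object $G$ in the set and $g:G\to X$ with $ug\neq vg$ (here one takes representatives of isomorphism classes of the corings of the indicated cardinality). A cofree coring on a bimodule $V$ is a coring $C(V)$ with a bimodule map $U(C(V))\to V$ through which every bimodule map $U(C)\to V$ from a coring $C$ factors via a unique coring morphism $C\to C(V)$; i.e. $C(-)$ is right adjoint to $U$. The colimit in (iii) is taken in $Crg_A$ over the category of pairs $(G,f)$, with $G$ a coring of the indicated cardinality and $f:U(G)\to V$ a bimodule map, a morphism $(G,f)\to(G',f')$ being a coring morphism $\varphi:G\to G'$ with $f'\varphi=f$; the canonical map $C(V)\to V$ is induced by the maps $f$. The colimit in (iv) is formed in the same way over the coring morphisms $h:H\to C(P)$ such that $q_afh:H\to C_a$ is a morphism of corings for all $a$ (the forgetful functor $U$ is suppressed from the notation). Construction $\mathcal{H}_0$: given an $A$-bimodule $N$, corings $(C_i)_{i\in I}$ and bimodule maps $f_i:N\to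 U(C_i)$, let $\mathcal{H}$ be the category of pairs $(E,p)$ with $E$ a coring and $p:U(E)\to N$ a bimodule map such that every $f_ip$ is a morphism of corings; a morphism $(E,p)\to(E',p')$ is a coring morphism $h:E\to E'$ with $p'h=p$. Then $(\mathcal{H}_0(N,(f_i)_i),p_0)$ denotes the final object of $\mathcal{H}$; its underlying coring is the colimit of $G$ over the pairs $(G,p)$ in $\mathcal{H}$ with $G$ in a fixed set of generators of $Crg_A$, and $p_0$ is the map to $N$ induced by the maps $p$.
   Formalization: In (iv), H_0(P,(q_a f)_a) is ill-typed, as q_a f is defined on C(P); instead (C(P)_0,p_0) is final among coring maps p:E→C(P) with all q_a f p coring maps, and (C(P)_0,f p_0) is H_0(P,(q_a)_a). *)

theory Defs
  imports
    "HOL-Algebra.Ring"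
    "HOL-Algebra.AbelCoset"
    "HOL-Algebra.Free_Abelian_Groups"
    "HOL-Library.Equipollence"
begin

section \<open>Modules and bimodules over a noncommutative ring\<close>

text \<open>
  One record carries a left and a right action. As for the modules of HOL-Algebra, the fields
  \<open>mult\<close> and \<open>one\<close> inherited from rings are ignored. The locale \<open>left_module\<close> constrains only the
  left action and \<open>right_module\<close> only the right one, so that one-sided modules are records whose
  other action is irrelevant.
\<close>

record ('a, 'b) bimodule = "'b ring" +
  lact :: "'a \<Rightarrow> 'b \<Rightarrow> 'b"
  ract :: "'b \<Rightarrow> 'a \<Rightarrow> 'b"

locale left_module = A?: ring A + M?: abelian_group M
  for A :: "('a, 's) ring_scheme" and M :: "('a, 'm, 'z) bimodule_scheme" +
  assumes lact_closed: "a \<in> carrier A \<Longrightarrow> x \<in> carrier M \<Longrightarrow> lact M a x \<in> carrier M"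
    and lact_add: "a \<in> carrier A \<Longrightarrow> x \<in> carrier M \<Longrightarrow> y \<in> carrier M \<Longrightarrow>
        lact M a (x \<oplus>\<^bsub>M\<^esub> y) = lact M a x \<oplus>\<^bsub>M\<^esub> lact M a y"
    and add_lact: "a \<in> carrier A \<Longrightarrow> b \<in> carrier A \<Longrightarrow> x \<in> carrier M \<Longrightarrow>
        lact M (a \<oplus>\<^bsub>A\<^esub> b) x = lact M a x \<oplus>\<^bsub>M\<^esub> lact M b x"
    and mult_lact: "a \<in> carrier A \<Longrightarrow> b \<in> carrier A \<Longrightarrow> x \<in> carrier M \<Longrightarrow>
        lact M (a \<otimes>\<^bsub>A\<^esub> b) x = lact M a (lact M b x)"
    and one_lact: "x \<in> carrier M \<Longrightarrow> lact M \<one>\<^bsub>A\<^esub> x = x"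

locale right_module = A?: ring A + M?: abelian_group M
  for A :: "('a, 's) ring_scheme" and M :: "('a, 'm, 'z) bimodule_scheme" +
  assumes ract_closed: "a \<in> carrier A \<Longrightarrow> x \<in> carrier M \<Longrightarrow> ract M x a \<in> carrier M"
    and ract_add: "a \<in> carrier A \<Longrightarrow> x \<in> carrier M \<Longrightarrow> y \<in> carrier M \<Longrightarrow>
        ract M (x \<oplus>\<^bsub>M\<^esub> y) a = ract M x a \<oplus>\<^bsub>M\<^esub> ract M y a"
    and add_ract: "a \<in> carrier A \<Longrightarrow> b \<in> carrier A \<Longrightarrow> x \<in> carrier M \<Longrightarrow>
        ract M x (a \<oplus>\<^bsub>A\<^esub> b) = ract M x a \<oplus>\<^bsub>M\<^esub> ract M x b"
    and mult_ract: "a \<in> carrier A \<Longrightarrow> b \<in> carrier A \<Longrightarrow> x \<in> carrier M \<Longrightarrow>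
        ract M x (a \<otimes>\<^bsub>A\<^esub> b) = ract M (ract M x a) b"
    and one_ract: "x \<in> carrier M \<Longrightarrow> ract M x \<one>\<^bsub>A\<^esub> = x"

locale bimodule = left_module A M + right_module A M
  for A :: "('a, 's) ring_scheme" and M :: "('a, 'm, 'z) bimodule_scheme" +
  assumes lact_ract: "a \<in> carrier A \<Longrightarrow> b \<in> carrier A \<Longrightarrow> x \<in> carrier M \<Longrightarrow>
        ract M (lact M a x) b = lact M a (ract M x b)"

text \<open>Morphisms are extensional functions on the carriers, so that equality of morphisms is
  equality of functions; composition is \<^const>\<open>compose\<close> and identities are restricted.\<close>

definition bimodule_hom ::
  "('a, 's) ring_scheme \<Rightarrow> ('a, 'm, 'y) bimodule_scheme \<Rightarrow> ('a, 'n, 'z) bimodule_scheme \<Rightarrow> ('m \<Rightarrow> 'n) set"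
  where "bimodule_hom A M N = {f \<in> carrier M \<rightarrow>\<^sub>E carrier N.
    (\<forall>x\<in>carrier M. \<forall>y\<in>carrier M. f (x \<oplus>\<^bsub>M\<^esub> y) = f x \<oplus>\<^bsub>N\<^esub> f y) \<and>
    (\<forall>a\<in>carrier A. \<forall>x\<in>carrier M. f (lact M a x) = lact N a (f x)) \<and>
    (\<forall>a\<in>carrier A. \<forall>x\<in>carrier M. f (ract M x a) = ract N (f x) a)}"

definition sub_bimodule ::
  "('a, 's) ring_scheme \<Rightarrow> 'm set \<Rightarrow> ('a, 'm, 'z) bimodule_scheme \<Rightarrow> bool"
  where "sub_bimodule A S M \<longleftrightarrow> additive_subgroup S M \<and>
    (\<forall>a\<in>carrier A. \<forall>x\<in>S. lact M a x \<in> S \<and> ract M x a \<in> S)"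

definition regular :: "('a, 's) ring_scheme \<Rightarrow> ('a, 'a) bimodule"
  where "regular A = \<lparr>carrier = carrier A, monoid.mult = (\<otimes>\<^bsub>A\<^esub>), monoid.one = \<one>\<^bsub>A\<^esub>,
    ring.zero = \<zero>\<^bsub>A\<^esub>, ring.add = (\<oplus>\<^bsub>A\<^esub>), lact = (\<otimes>\<^bsub>A\<^esub>), ract = (\<otimes>\<^bsub>A\<^esub>)\<rparr>"


section \<open>Abelian groups given by generators and relations\<close>

definition pres_rel :: "'s set \<Rightarrow> ('s \<Rightarrow>\<^sub>0 int) set \<Rightarrow> ('s \<Rightarrow>\<^sub>0 int) set"
  where "pres_rel S R = generate (free_Abelian_group S) R"

definition pres_group :: "'s set \<Rightarrow> ('s \<Rightarrow>\<^sub>0 int) set \<Rightarrow> ('s \<Rightarrow>\<^sub>0 int) set ring"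
  where "pres_group S R = \<lparr>carrier = carrier (free_Abelian_group S Mod pres_rel S R),
    monoid.mult = undefined, monoid.one = undefined,
    ring.zero = \<one>\<^bsub>free_Abelian_group S Mod pres_rel S R\<^esub>,
    ring.add = (\<otimes>\<^bsub>free_Abelian_group S Mod pres_rel S R\<^esub>)\<rparr>"

definition pres_gen :: "'s set \<Rightarrow> ('s \<Rightarrow>\<^sub>0 int) set \<Rightarrow> 's \<Rightarrow> ('s \<Rightarrow>\<^sub>0 int) set"
  where "pres_gen S R s = pres_rel S R #>\<^bsub>free_Abelian_group S\<^esub> frag_of s"

text \<open>The additive map out of a presented group which sends the generator \<open>s\<close> to \<open>b s\<close>. It is
  meaningful only if \<open>b\<close> respects the relations: the image below is then a singleton.\<close>

definition pres_lift :: "('b, 'z) ring_scheme \<Rightarrow> ('s \<Rightarrow> 'b) \<Rightarrow> ('s \<Rightarrow>\<^sub>0 int) set \<Rightarrow> 'b"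
  where "pres_lift G b X = the_elem
    ((\<lambda>x. \<Oplus>\<^bsub>G\<^esub>s\<in>Poly_Mapping.keys x. [Poly_Mapping.lookup x s] \<cdot>\<^bsub>G\<^esub> b s) ` X)"


section \<open>Tensor products over \<open>A\<close>\<close>

definition tensor_rels ::
  "('a, 's) ring_scheme \<Rightarrow> ('a, 'm, 'y) bimodule_scheme \<Rightarrow> ('a, 'n, 'z) bimodule_scheme
    \<Rightarrow> ('m \<times> 'n \<Rightarrow>\<^sub>0 int) set"
  where "tensor_rels A M N =
    {frag_of (x \<oplus>\<^bsub>M\<^esub> x', y) - frag_of (x, y) - frag_of (x', y) | x x' y.
        x \<in> carrier M \<and> x' \<in> carrier M \<and> y \<in> carrier N} \<union>
    {frag_of (x, y \<oplus>\<^bsub>N\<^esub> y') - frag_of (x, y) - frag_of (x, y') | x y y'.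
        x \<in> carrier M \<and> y \<in> carrier N \<and> y' \<in> carrier N} \<union>
    {frag_of (ract M x a, y) - frag_of (x, lact N a y) | x a y.
        x \<in> carrier M \<and> a \<in> carrier A \<and> y \<in> carrier N}"

definition tensor_group ::
  "('a, 's) ring_scheme \<Rightarrow> ('a, 'm, 'y) bimodule_scheme \<Rightarrow> ('a, 'n, 'z) bimodule_scheme
    \<Rightarrow> ('m \<times> 'n \<Rightarrow>\<^sub>0 int) set ring"
  where "tensor_group A M N = pres_group (carrier M \<times> carrier N) (tensor_rels A M N)"

definition tens ::
  "('a, 's) ring_scheme \<Rightarrow> ('a, 'm, 'y) bimodule_scheme \<Rightarrow> ('a, 'n, 'z) bimodule_scheme
    \<Rightarrow> 'm \<Rightarrow> 'n \<Rightarrow> ('m \<times> 'n \<Rightarrow>\<^sub>0 int) set"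
  where "tens A M N x y = pres_gen (carrier M \<times> carrier N) (tensor_rels A M N) (x, y)"

text \<open>The underlying group only uses the right action of \<open>M\<close> and the left action of \<open>N\<close>; the
  actions on the product are induced by the remaining two.\<close>

definition tensor ::
  "('a, 's) ring_scheme \<Rightarrow> ('a, 'm, 'y) bimodule_scheme \<Rightarrow> ('a, 'n, 'z) bimodule_scheme
    \<Rightarrow> ('a, ('m \<times> 'n \<Rightarrow>\<^sub>0 int) set) bimodule"
  where "tensor A M N = ring.extend (tensor_group A M N)
    \<lparr>lact = (\<lambda>a. pres_lift (tensor_group A M N) (\<lambda>(x, y). tens A M N (lact M a x) y)),
     ract = (\<lambda>t a. pres_lift (tensor_group A M N) (\<lambda>(x, y). tens A M N x (ract N y a)) t)\<rparr>"

text \<open>\<open>tensor_map A M N M' N' f g\<close> is \<open>f \<otimes> g : M \<otimes> N \<rightarrow> M' \<otimes> N'\<close>.\<close>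

definition tensor_map ::
  "('a, 's) ring_scheme \<Rightarrow> ('a, 'm, 'w) bimodule_scheme \<Rightarrow> ('a, 'n, 'x) bimodule_scheme
    \<Rightarrow> ('a, 'm2, 'y) bimodule_scheme \<Rightarrow> ('a, 'n2, 'z) bimodule_scheme
    \<Rightarrow> ('m \<Rightarrow> 'm2) \<Rightarrow> ('n \<Rightarrow> 'n2) \<Rightarrow> ('m \<times> 'n \<Rightarrow>\<^sub>0 int) set \<Rightarrow> ('m2 \<times> 'n2 \<Rightarrow>\<^sub>0 int) set"
  where "tensor_map A M N M' N' f g = (\<lambda>t\<in>carrier (tensor A M N).
    pres_lift (tensor A M' N') (\<lambda>(x, y). tens A M' N' (f x) (g y)) t)"

text \<open>The canonical isomorphism \<open>(L \<otimes> M) \<otimes> N \<rightarrow> L \<otimes> (M \<otimes> N)\<close>.\<close>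

definition tensor_assoc ::
  "('a, 's) ring_scheme \<Rightarrow> ('a, 'l, 'x) bimodule_scheme \<Rightarrow> ('a, 'm, 'y) bimodule_scheme
    \<Rightarrow> ('a, 'n, 'z) bimodule_scheme
    \<Rightarrow> (('l \<times> 'm \<Rightarrow>\<^sub>0 int) set \<times> 'n \<Rightarrow>\<^sub>0 int) set \<Rightarrow> ('l \<times> ('m \<times> 'n \<Rightarrow>\<^sub>0 int) set \<Rightarrow>\<^sub>0 int) set"
  where "tensor_assoc A L M N = (\<lambda>t\<in>carrier (tensor A (tensor A L M) N).
    pres_lift (tensor A L (tensor A M N))
      (\<lambda>(u, z). pres_lift (tensor A L (tensor A M N))
        (\<lambda>(x, y). tens A L (tensor A M N) x (tens A M N y z)) u) t)"

text \<open>The canonical isomorphisms \<open>A \<otimes> M \<rightarrow> M\<close> and \<open>M \<otimes> A \<rightarrow> M\<close>.\<close>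

definition tensor_lunit ::
  "('a, 's) ring_scheme \<Rightarrow> ('a, 'm, 'z) bimodule_scheme \<Rightarrow> ('a \<times> 'm \<Rightarrow>\<^sub>0 int) set \<Rightarrow> 'm"
  where "tensor_lunit A M = (\<lambda>t\<in>carrier (tensor A (regular A) M).
    pres_lift M (\<lambda>(a, x). lact M a x) t)"

definition tensor_runit ::
  "('a, 's) ring_scheme \<Rightarrow> ('a, 'm, 'z) bimodule_scheme \<Rightarrow> ('m \<times> 'a \<Rightarrow>\<^sub>0 int) set \<Rightarrow> 'm"
  where "tensor_runit A M = (\<lambda>t\<in>carrier (tensor A M (regular A)).
    pres_lift M (\<lambda>(x, a). ract M x a) t)"


section \<open>Purity\<close>

text \<open>HOL cannot quantify over types inside a formula, so the modules \<open>Q\<close> range over those with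
  carrier in the type given by the token \<open>'q itself\<close>. The inclusion \<open>N \<rightarrow> M\<close> is taken on records;
  the operations of \<open>N\<close> have to agree with those of \<open>M\<close> on the carrier of \<open>N\<close>.\<close>

definition pure_left ::
  "'q itself \<Rightarrow> ('a, 's) ring_scheme \<Rightarrow> ('a, 'm, 'y) bimodule_scheme
    \<Rightarrow> ('a, 'm, 'z) bimodule_scheme \<Rightarrow> bool"
  where "pure_left T A N M \<longleftrightarrow> (\<forall>Q :: ('a, 'q) bimodule. right_module A Q \<longrightarrow>
    inj_on (tensor_map A Q N Q M (\<lambda>q\<in>carrier Q. q) (\<lambda>x\<in>carrier N. x)) (carrier (tensor A Q N)))"

definition pure_right ::
  "'q itself \<Rightarrow> ('a, 's) ring_scheme \<Rightarrow> ('a, 'm, 'y) bimodule_scheme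
    \<Rightarrow> ('a, 'm, 'z) bimodule_scheme \<Rightarrow> bool"
  where "pure_right T A N M \<longleftrightarrow> (\<forall>Q :: ('a, 'q) bimodule. left_module A Q \<longrightarrow>
    inj_on (tensor_map A N Q M Q (\<lambda>x\<in>carrier N. x) (\<lambda>q\<in>carrier Q. q)) (carrier (tensor A N Q)))"


section \<open>Corings\<close>

text \<open>A coring extends the record of its underlying bimodule, so that the forgetful functor
  \<open>U\<close> stays implicit.\<close>

record ('a, 'c) coring = "('a, 'c) bimodule" +
  comult :: "'c \<Rightarrow> ('c \<times> 'c \<Rightarrow>\<^sub>0 int) set"
  counit :: "'c \<Rightarrow> 'a"

locale coring = bimodule A C for A :: "('a, 's) ring_scheme" and C :: "('a, 'c) coring" +
  assumes comult_hom: "comult C \<in> bimodule_hom A C (tensor A C C)"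
    and counit_hom: "counit C \<in> bimodule_hom A C (regular A)"
    and coassoc: "x \<in> carrier C \<Longrightarrow>
      tensor_assoc A C C C
        (tensor_map A C C (tensor A C C) C (comult C) (\<lambda>y\<in>carrier C. y) (comult C x)) =
      tensor_map A C C C (tensor A C C) (\<lambda>y\<in>carrier C. y) (comult C) (comult C x)"
    and left_counit: "x \<in> carrier C \<Longrightarrow>
      tensor_lunit A C
        (tensor_map A C C (regular A) C (counit C) (\<lambda>y\<in>carrier C. y) (comult C x)) = x"
    and right_counit: "x \<in> carrier C \<Longrightarrow>
      tensor_runit A C
        (tensor_map A C C C (regular A) (\<lambda>y\<in>carrier C. y) (counit C) (comult C x)) = x"

definition coring_hom ::
  "('a, 's) ring_scheme \<Rightarrow> ('a, 'c) coring \<Rightarrow> ('a, 'd) coring \<Rightarrow> ('c \<Rightarrow> 'd) set"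
  where "coring_hom A C D = {f \<in> bimodule_hom A C D.
    (\<forall>x\<in>carrier C. comult D (f x) = tensor_map A C C D D f f (comult C x)) \<and>
    (\<forall>x\<in>carrier C. counit D (f x) = counit C x)}"

text \<open>The comultiplication of a subcoring is extra structure, as \<open>D \<otimes> D \<rightarrow> C \<otimes> C\<close> need not be
  injective; hence \<open>D\<close> is a record and not just a subset of \<open>C\<close>.\<close>

definition subcoring :: "('a, 's) ring_scheme \<Rightarrow> ('a, 'c) coring \<Rightarrow> ('a, 'c) coring \<Rightarrow> bool"
  where "subcoring A D C \<longleftrightarrow> coring A D \<and> sub_bimodule A (carrier D) C \<and>
    (\<lambda>x\<in>carrier D. x) \<in> coring_hom A D C"

definition coring_iso ::
  "('a, 's) ring_scheme \<Rightarrow> ('a, 'c) coring \<Rightarrow> ('a, 'd) coring \<Rightarrow> bool"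
  where "coring_iso A C D \<longleftrightarrow> (\<exists>f\<in>coring_hom A C D. \<exists>g\<in>coring_hom A D C.
    compose (carrier C) g f = (\<lambda>x\<in>carrier C. x) \<and> compose (carrier D) f g = (\<lambda>x\<in>carrier D. x))"

text \<open>The corings \<open>G\<close> with \<open>|G| \<le> max {|A|, \<aleph>\<^sub>0}\<close> (that is, \<open>|G| \<le> |A|\<close> or \<open>|G| \<le> \<aleph>\<^sub>0\<close>), all taken
  with carrier in \<open>'a + nat\<close>, which is large enough to contain an isomorphic copy of each of them.\<close>

definition small_corings :: "('a, 's) ring_scheme \<Rightarrow> ('a, 'a + nat) coring set"
  where "small_corings A =
    {G. coring A G \<and> (carrier G \<lesssim> carrier A \<or> carrier G \<lesssim> (UNIV :: nat set))}"


section \<open>Colimits of corings\<close>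

text \<open>A diagram is given by objects \<open>G i\<close> for \<open>i\<close> in \<open>J\<close> and sets \<open>arr i j\<close> of coring morphisms from
  \<open>G i\<close> to \<open>G j\<close>. Again the token gives the type of the corings against which the universal
  property is tested.\<close>

definition coring_colimit ::
  "'e itself \<Rightarrow> ('a, 's) ring_scheme \<Rightarrow> 'i set \<Rightarrow> ('i \<Rightarrow> ('a, 'g) coring)
    \<Rightarrow> ('i \<Rightarrow> 'i \<Rightarrow> ('g \<Rightarrow> 'g) set) \<Rightarrow> ('a, 'l) coring \<Rightarrow> ('i \<Rightarrow> 'g \<Rightarrow> 'l) \<Rightarrow> bool"
  where "coring_colimit T A J G arr L inc \<longleftrightarrow>
    coring A L \<and>
    (\<forall>i\<in>J. inc i \<in> coring_hom A (G i) L) \<and>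
    (\<forall>i\<in>J. \<forall>j\<in>J. \<forall>\<phi>\<in>arr i j. compose (carrier (G i)) (inc j) \<phi> = inc i) \<and>
    (\<forall>(E :: ('a, 'e) coring) k.
      coring A E \<and> (\<forall>i\<in>J. k i \<in> coring_hom A (G i) E) \<and>
      (\<forall>i\<in>J. \<forall>j\<in>J. \<forall>\<phi>\<in>arr i j. compose (carrier (G i)) (k j) \<phi> = k i) \<longrightarrow>
      (\<exists>!h. h \<in> coring_hom A L E \<and> (\<forall>i\<in>J. compose (carrier (G i)) h (inc i) = k i)))"

text \<open>The standard model of the colimit: the colimit of the underlying bimodules (the direct sum of
  the \<open>G i\<close> modulo the identifications along the arrows), with the induced coring structure.\<close>

definition colim_gens :: "'i set \<Rightarrow> ('i \<Rightarrow> ('a, 'g) coring) \<Rightarrow> ('i \<times> 'g) set"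
  where "colim_gens J G = (SIGMA i:J. carrier (G i))"

definition colim_rels ::
  "'i set \<Rightarrow> ('i \<Rightarrow> ('a, 'g) coring) \<Rightarrow> ('i \<Rightarrow> 'i \<Rightarrow> ('g \<Rightarrow> 'g) set) \<Rightarrow> ('i \<times> 'g \<Rightarrow>\<^sub>0 int) set"
  where "colim_rels J G arr =
    {frag_of (i, x \<oplus>\<^bsub>G i\<^esub> y) - frag_of (i, x) - frag_of (i, y) | i x y.
        i \<in> J \<and> x \<in> carrier (G i) \<and> y \<in> carrier (G i)} \<union>
    {frag_of (i, x) - frag_of (j, \<phi> x) | i j \<phi> x.
        i \<in> J \<and> j \<in> J \<and> \<phi> \<in> arr i j \<and> x \<in> carrier (G i)}"

definition colim_in ::
  "'i set \<Rightarrow> ('i \<Rightarrow> ('a, 'g) coring) \<Rightarrow> ('i \<Rightarrow> 'i \<Rightarrow> ('g \<Rightarrow> 'g) set)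
    \<Rightarrow> 'i \<Rightarrow> 'g \<Rightarrow> ('i \<times> 'g \<Rightarrow>\<^sub>0 int) set"
  where "colim_in J G arr i =
    (\<lambda>x\<in>carrier (G i). pres_gen (colim_gens J G) (colim_rels J G arr) (i, x))"

definition colim_bimodule ::
  "'i set \<Rightarrow> ('i \<Rightarrow> ('a, 'g) coring) \<Rightarrow> ('i \<Rightarrow> 'i \<Rightarrow> ('g \<Rightarrow> 'g) set)
    \<Rightarrow> ('a, ('i \<times> 'g \<Rightarrow>\<^sub>0 int) set) bimodule"
  where "colim_bimodule J G arr =
    (let L = pres_group (colim_gens J G) (colim_rels J G arr) in
     ring.extend L
       \<lparr>lact = (\<lambda>a. pres_lift L (\<lambda>(i, x). colim_in J G arr i (lact (G i) a x))),
        ract = (\<lambda>t a. pres_lift L (\<lambda>(i, x). colim_in J G arr i (ract (G i) x a)) t)\<rparr>)"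

definition colim_coring ::
  "('a, 's) ring_scheme \<Rightarrow> 'i set \<Rightarrow> ('i \<Rightarrow> ('a, 'g) coring) \<Rightarrow> ('i \<Rightarrow> 'i \<Rightarrow> ('g \<Rightarrow> 'g) set)
    \<Rightarrow> ('a, ('i \<times> 'g \<Rightarrow>\<^sub>0 int) set) coring"
  where "colim_coring A J G arr =
    (let L = colim_bimodule J G arr in
     bimodule.extend L
       \<lparr>comult = (\<lambda>t\<in>carrier L. pres_lift (tensor A L L)
          (\<lambda>(i, x). tensor_map A (G i) (G i) L L (colim_in J G arr i) (colim_in J G arr i)
             (comult (G i) x)) t),
        counit = (\<lambda>t\<in>carrier L. pres_lift (regular A) (\<lambda>(i, x). counit (G i) x) t)\<rparr>)"

text \<open>All colimits of interest run over a class \<open>J\<close> of pairs \<open>(G, p)\<close>, where \<open>p\<close> is a map from \<open>G\<close> to a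
  fixed target, and over all coring morphisms over the target.\<close>

definition pair_arr ::
  "('a, 's) ring_scheme \<Rightarrow> ('a, 'g) coring \<times> ('g \<Rightarrow> 'n) \<Rightarrow> ('a, 'g) coring \<times> ('g \<Rightarrow> 'n)
    \<Rightarrow> ('g \<Rightarrow> 'g) set"
  where "pair_arr A X Y =
    {\<phi> \<in> coring_hom A (fst X) (fst Y). compose (carrier (fst X)) (snd Y) \<phi> = snd X}"

type_synonym ('a, 'g, 'n) pair_colim_elem =
  "((('a, 'g) coring \<times> ('g \<Rightarrow> 'n)) \<times> 'g \<Rightarrow>\<^sub>0 int) set"

definition pair_colim ::
  "('a, 's) ring_scheme \<Rightarrow> (('a, 'g) coring \<times> ('g \<Rightarrow> 'n)) set
    \<Rightarrow> ('a, ('a, 'g, 'n) pair_colim_elem) coring"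
  where "pair_colim A J = colim_coring A J fst (pair_arr A)"

definition pair_in ::
  "('a, 's) ring_scheme \<Rightarrow> (('a, 'g) coring \<times> ('g \<Rightarrow> 'n)) set
    \<Rightarrow> ('a, 'g) coring \<times> ('g \<Rightarrow> 'n) \<Rightarrow> 'g \<Rightarrow> ('a, 'g, 'n) pair_colim_elem"
  where "pair_in A J = colim_in J fst (pair_arr A)"

text \<open>The map from the colimit to the target \<open>N\<close> induced by the maps \<open>p\<close>.\<close>

definition pair_map ::
  "('a, 's) ring_scheme \<Rightarrow> (('a, 'g) coring \<times> ('g \<Rightarrow> 'n)) set \<Rightarrow> ('n, 'z) ring_scheme
    \<Rightarrow> ('a, 'g, 'n) pair_colim_elem \<Rightarrow> 'n"
  where "pair_map A J N = (\<lambda>t\<in>carrier (pair_colim A J). pres_lift N (\<lambda>((G, p), x). p x) t)"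


section \<open>Cofree corings\<close>

definition is_cofree ::
  "'e itself \<Rightarrow> ('a, 's) ring_scheme \<Rightarrow> ('a, 'v, 'z) bimodule_scheme \<Rightarrow> ('a, 'c) coring
    \<Rightarrow> ('c \<Rightarrow> 'v) \<Rightarrow> bool"
  where "is_cofree T A V C p \<longleftrightarrow> coring A C \<and> p \<in> bimodule_hom A C V \<and>
    (\<forall>(E :: ('a, 'e) coring) f. coring A E \<and> f \<in> bimodule_hom A E V \<longrightarrow>
      (\<exists>!h. h \<in> coring_hom A E C \<and> compose (carrier E) p h = f))"

definition cofree_pairs ::
  "('a, 's) ring_scheme \<Rightarrow> ('a, 'v, 'z) bimodule_scheme
    \<Rightarrow> (('a, 'a + nat) coring \<times> ('a + nat \<Rightarrow> 'v)) set"
  where "cofree_pairs A V = {(G, f). G \<in> small_corings A \<and> f \<in> bimodule_hom A G V}"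

definition cofree_coring ::
  "('a, 's) ring_scheme \<Rightarrow> ('a, 'v, 'z) bimodule_scheme
    \<Rightarrow> ('a, ('a, 'a + nat, 'v) pair_colim_elem) coring"
  where "cofree_coring A V = pair_colim A (cofree_pairs A V)"

definition cofree_map ::
  "('a, 's) ring_scheme \<Rightarrow> ('a, 'v, 'z) bimodule_scheme
    \<Rightarrow> ('a, 'a + nat, 'v) pair_colim_elem \<Rightarrow> 'v"
  where "cofree_map A V = pair_map A (cofree_pairs A V) V"


section \<open>Small categories and limits\<close>

record ('o, 'r) category =
  Ob :: "'o set"
  Ar :: "'r set"
  Dom :: "'r \<Rightarrow> 'o"
  Cod :: "'r \<Rightarrow> 'o"
  Idn :: "'o \<Rightarrow> 'r"
  Cmp :: "'r \<Rightarrow> 'r \<Rightarrow> 'r"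

text \<open>\<open>Cmp K v u\<close> is the composite of \<open>u\<close> followed by \<open>v\<close>.\<close>

locale category =
  fixes K :: "('o, 'r) category"
  assumes Dom_in: "u \<in> Ar K \<Longrightarrow> Dom K u \<in> Ob K"
    and Cod_in: "u \<in> Ar K \<Longrightarrow> Cod K u \<in> Ob K"
    and Idn_in: "a \<in> Ob K \<Longrightarrow> Idn K a \<in> Ar K"
    and Dom_Idn: "a \<in> Ob K \<Longrightarrow> Dom K (Idn K a) = a"
    and Cod_Idn: "a \<in> Ob K \<Longrightarrow> Cod K (Idn K a) = a"
    and Cmp_in: "u \<in> Ar K \<Longrightarrow> v \<in> Ar K \<Longrightarrow> Cod K u = Dom K v \<Longrightarrow> Cmp K v u \<in> Ar K"
    and Dom_Cmp: "u \<in> Ar K \<Longrightarrow> v \<in> Ar K \<Longrightarrow> Cod K u = Dom K v \<Longrightarrow> Dom K (Cmp K v u) = Dom K u"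
    and Cod_Cmp: "u \<in> Ar K \<Longrightarrow> v \<in> Ar K \<Longrightarrow> Cod K u = Dom K v \<Longrightarrow> Cod K (Cmp K v u) = Cod K v"
    and Cmp_Idn: "u \<in> Ar K \<Longrightarrow> Cmp K u (Idn K (Dom K u)) = u"
    and Idn_Cmp: "u \<in> Ar K \<Longrightarrow> Cmp K (Idn K (Cod K u)) u = u"
    and Cmp_assoc: "u \<in> Ar K \<Longrightarrow> v \<in> Ar K \<Longrightarrow> w \<in> Ar K \<Longrightarrow> Cod K u = Dom K v \<Longrightarrow>
      Cod K v = Dom K w \<Longrightarrow> Cmp K w (Cmp K v u) = Cmp K (Cmp K w v) u"

locale coring_functor = A?: ring A + K?: category K
  for A :: "('a, 's) ring_scheme" and K :: "('o, 'r) category"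
    and F :: "'o \<Rightarrow> ('a, 'c) coring" and Fm :: "'r \<Rightarrow> 'c \<Rightarrow> 'c" +
  assumes F_coring: "a \<in> Ob K \<Longrightarrow> coring A (F a)"
    and Fm_hom: "u \<in> Ar K \<Longrightarrow> Fm u \<in> coring_hom A (F (Dom K u)) (F (Cod K u))"
    and Fm_Idn: "a \<in> Ob K \<Longrightarrow> Fm (Idn K a) = (\<lambda>x\<in>carrier (F a). x)"
    and Fm_Cmp: "u \<in> Ar K \<Longrightarrow> v \<in> Ar K \<Longrightarrow> Cod K u = Dom K v \<Longrightarrow>
      Fm (Cmp K v u) = compose (carrier (F (Dom K u))) (Fm v) (Fm u)"

definition coring_limit ::
  "'e itself \<Rightarrow> ('a, 's) ring_scheme \<Rightarrow> ('o, 'r) category \<Rightarrow> ('o \<Rightarrow> ('a, 'c) coring)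
    \<Rightarrow> ('r \<Rightarrow> 'c \<Rightarrow> 'c) \<Rightarrow> ('a, 'l) coring \<Rightarrow> ('o \<Rightarrow> 'l \<Rightarrow> 'c) \<Rightarrow> bool"
  where "coring_limit T A K F Fm L pr \<longleftrightarrow>
    coring A L \<and>
    (\<forall>a\<in>Ob K. pr a \<in> coring_hom A L (F a)) \<and>
    (\<forall>u\<in>Ar K. compose (carrier L) (Fm u) (pr (Dom K u)) = pr (Cod K u)) \<and>
    (\<forall>(E :: ('a, 'e) coring) r.
      coring A E \<and> (\<forall>a\<in>Ob K. r a \<in> coring_hom A E (F a)) \<and>
      (\<forall>u\<in>Ar K. compose (carrier E) (Fm u) (r (Dom K u)) = r (Cod K u)) \<longrightarrow>
      (\<exists>!h. h \<in> coring_hom A E L \<and> (\<forall>a\<in>Ob K. compose (carrier E) (pr a) h = r a)))"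

definition bimodule_limit ::
  "'e itself \<Rightarrow> ('a, 's) ring_scheme \<Rightarrow> ('o, 'r) category \<Rightarrow> ('o \<Rightarrow> ('a, 'c, 'z) bimodule_scheme)
    \<Rightarrow> ('r \<Rightarrow> 'c \<Rightarrow> 'c) \<Rightarrow> ('a, 'l) bimodule \<Rightarrow> ('o \<Rightarrow> 'l \<Rightarrow> 'c) \<Rightarrow> bool"
  where "bimodule_limit T A K F Fm L pr \<longleftrightarrow>
    bimodule A L \<and>
    (\<forall>a\<in>Ob K. pr a \<in> bimodule_hom A L (F a)) \<and>
    (\<forall>u\<in>Ar K. compose (carrier L) (Fm u) (pr (Dom K u)) = pr (Cod K u)) \<and>
    (\<forall>(E :: ('a, 'e) bimodule) r.
      bimodule A E \<and> (\<forall>a\<in>Ob K. r a \<in> bimodule_hom A E (F a)) \<and>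
      (\<forall>u\<in>Ar K. compose (carrier E) (Fm u) (r (Dom K u)) = r (Cod K u)) \<longrightarrow>
      (\<exists>!h. h \<in> bimodule_hom A E L \<and> (\<forall>a\<in>Ob K. compose (carrier E) (pr a) h = r a)))"

text \<open>The standard model of the limit of bimodules, as compatible families.\<close>

definition lim_bimodule ::
  "('o, 'r) category \<Rightarrow> ('o \<Rightarrow> ('a, 'c, 'z) bimodule_scheme) \<Rightarrow> ('r \<Rightarrow> 'c \<Rightarrow> 'c)
    \<Rightarrow> ('a, 'o \<Rightarrow> 'c) bimodule"
  where "lim_bimodule K F Fm =
    \<lparr>carrier = {x \<in> (\<Pi>\<^sub>E a\<in>Ob K. carrier (F a)). \<forall>u\<in>Ar K. Fm u (x (Dom K u)) = x (Cod K u)},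
     monoid.mult = undefined, monoid.one = undefined,
     ring.zero = (\<lambda>a\<in>Ob K. \<zero>\<^bsub>F a\<^esub>),
     ring.add = (\<lambda>x y. \<lambda>a\<in>Ob K. x a \<oplus>\<^bsub>F a\<^esub> y a),
     lact = (\<lambda>b x. \<lambda>a\<in>Ob K. lact (F a) b (x a)),
     ract = (\<lambda>x b. \<lambda>a\<in>Ob K. ract (F a) (x a) b)\<rparr>"

definition lim_proj ::
  "('o, 'r) category \<Rightarrow> ('o \<Rightarrow> ('a, 'c, 'z) bimodule_scheme) \<Rightarrow> ('r \<Rightarrow> 'c \<Rightarrow> 'c)
    \<Rightarrow> 'o \<Rightarrow> ('o \<Rightarrow> 'c) \<Rightarrow> 'c"
  where "lim_proj K F Fm a = (\<lambda>x\<in>carrier (lim_bimodule K F Fm). x a)"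


section \<open>The category of the construction \<open>H\<^sub>0\<close>\<close>

text \<open>\<open>H_obj A N I C f E p\<close>: the pair \<open>(E, p)\<close> belongs to the category \<open>H\<close> attached to the bimodule
  maps \<open>f i : N \<rightarrow> C i\<close>.\<close>

definition H_obj ::
  "('a, 's) ring_scheme \<Rightarrow> ('a, 'n, 'z) bimodule_scheme \<Rightarrow> 'i set \<Rightarrow> ('i \<Rightarrow> ('a, 'c) coring)
    \<Rightarrow> ('i \<Rightarrow> 'n \<Rightarrow> 'c) \<Rightarrow> ('a, 'e) coring \<Rightarrow> ('e \<Rightarrow> 'n) \<Rightarrow> bool"
  where "H_obj A N I C f E p \<longleftrightarrow> coring A E \<and> p \<in> bimodule_hom A E N \<and>
    (\<forall>i\<in>I. compose (carrier E) (f i) p \<in> coring_hom A E (C i))"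

definition H_final ::
  "'e itself \<Rightarrow> ('a, 's) ring_scheme \<Rightarrow> ('a, 'n, 'z) bimodule_scheme \<Rightarrow> 'i set
    \<Rightarrow> ('i \<Rightarrow> ('a, 'c) coring) \<Rightarrow> ('i \<Rightarrow> 'n \<Rightarrow> 'c) \<Rightarrow> ('a, 'l) coring \<Rightarrow> ('l \<Rightarrow> 'n) \<Rightarrow> bool"
  where "H_final T A N I C f L p0 \<longleftrightarrow> H_obj A N I C f L p0 \<and>
    (\<forall>(E :: ('a, 'e) coring) p. H_obj A N I C f E p \<longrightarrow>
      (\<exists>!h. h \<in> coring_hom A E L \<and> compose (carrier E) p0 h = p))"

text \<open>The variant in which \<open>N\<close> is a coring and \<open>p\<close> itself is required to be a morphism of corings,
  i.e. the category \<open>H\<close> for the family \<open>f\<close> enlarged by the identity of \<open>N\<close>. (This is a separate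
  definition because \<open>N\<close> and the \<open>C i\<close> have carriers in different types.)\<close>

definition H'_obj ::
  "('a, 's) ring_scheme \<Rightarrow> ('a, 'n) coring \<Rightarrow> 'i set \<Rightarrow> ('i \<Rightarrow> ('a, 'c) coring)
    \<Rightarrow> ('i \<Rightarrow> 'n \<Rightarrow> 'c) \<Rightarrow> ('a, 'e) coring \<Rightarrow> ('e \<Rightarrow> 'n) \<Rightarrow> bool"
  where "H'_obj A N I C f E p \<longleftrightarrow> H_obj A N I C f E p \<and> p \<in> coring_hom A E N"

definition H'_final ::
  "'e itself \<Rightarrow> ('a, 's) ring_scheme \<Rightarrow> ('a, 'n) coring \<Rightarrow> 'i set
    \<Rightarrow> ('i \<Rightarrow> ('a, 'c) coring) \<Rightarrow> ('i \<Rightarrow> 'n \<Rightarrow> 'c) \<Rightarrow> ('a, 'l) coring \<Rightarrow> ('l \<Rightarrow> 'n) \<Rightarrow> bool"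
  where "H'_final T A N I C f L p0 \<longleftrightarrow> H'_obj A N I C f L p0 \<and>
    (\<forall>(E :: ('a, 'e) coring) p. H'_obj A N I C f E p \<longrightarrow>
      (\<exists>!h. h \<in> coring_hom A E L \<and> compose (carrier E) p0 h = p))"

definition H'_pairs ::
  "('a, 's) ring_scheme \<Rightarrow> ('a, 'n) coring \<Rightarrow> 'i set \<Rightarrow> ('i \<Rightarrow> ('a, 'c) coring)
    \<Rightarrow> ('i \<Rightarrow> 'n \<Rightarrow> 'c) \<Rightarrow> (('a, 'a + nat) coring \<times> ('a + nat \<Rightarrow> 'n)) set"
  where "H'_pairs A N I C f = {(H, h). H \<in> small_corings A \<and> H'_obj A N I C f H h}"

end

theory Submission
  imports Defs
begin

text \<open>A subset \<open>D\<close> of a coring \<open>C\<close> is pure on both sides as soon as every finite fragment of \<open>C\<close> (finitely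
  many elements and scalars) can be mapped into \<open>D\<close>, respecting the operations that occur in the fragment
  and fixing its elements that already lie in \<open>D\<close>: a relation in a tensor product involves only such a
  fragment, so it can be pushed down to \<open>D\<close>. A Loewenheim--Skolem closure produces, from any subset,
  such a \<open>D\<close> of controlled size that is moreover closed under the tensor components of the
  comultiplication, and the same pushing of relations makes \<open>D \<otimes> D\<close> and \<open>D \<otimes> (D \<otimes> D)\<close> embed into
  those of \<open>C\<close>, so that \<open>D\<close> inherits a coring structure.

  Hence each coring is covered by its small pieces, and any two elements, or equal tensors, can be
  compared inside one piece. The colimit of the small corings over a bimodule \<open>V\<close>, taken among bimodules,
  is a coring; mapping a coring into it piece by piece gives the existence part of the universal
  property, and uniqueness holds because the endomorphism of the colimit obtained in this way is the identity.
  Limits are obtained from the cofree coring on the limit of bimodules in the same manner, with only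
  those small corings over it whose projections are morphisms of corings.\<close>

section \<open>Additive maps\<close>

text \<open>The obstacle is that \<open>D \<otimes> D\<close> need not embed into
  \<open>C \<otimes> C\<close>: a sub-bimodule containing the tensor components of its
  comultiplications may still fail to be a coring, and coassociativity is tested in a threefold
  product. Asking that every finite pattern of \<open>C\<close> be copied into \<open>D\<close>
  settles all these embeddings at once. Such a pattern is a finite system of equations, that is, a
  finite list over countable data and \<open>A\<close>; this is where the bound max {|S|, |A|,
  aleph_0} comes from. Tensors are treated as words modulo relations, so that "a relation involves
  only finitely many elements" becomes an induction over derivations. Small corings live in the type
  \<open>'a + nat\<close>, whereas the corings of a universal property and the modules that test
  purity may live in any type; copies along injections mediate. The cofree coring and the limit
  share one argument about a class of pairs, whose main input is that the class contains the small
  corings over its own colimit.\<close>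

definition additive_map ::
  "('m, 'y) ring_scheme \<Rightarrow> ('n, 'z) ring_scheme \<Rightarrow> ('m \<Rightarrow> 'n) \<Rightarrow> bool"
  where "additive_map M N f \<longleftrightarrow> f \<in> carrier M \<rightarrow> carrier N \<and>
    (\<forall>x\<in>carrier M. \<forall>y\<in>carrier M. f (x \<oplus>\<^bsub>M\<^esub> y) = f x \<oplus>\<^bsub>N\<^esub> f y)"

lemma additive_mapI:
  assumes "\<And>x. x \<in> carrier M \<Longrightarrow> f x \<in> carrier N"
    and "\<And>x y. x \<in> carrier M \<Longrightarrow> y \<in> carrier M \<Longrightarrow> f (x \<oplus>\<^bsub>M\<^esub> y) = f x \<oplus>\<^bsub>N\<^esub> f y"
  shows "additive_map M N f"
  using assms by (auto simp: additive_map_def)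

lemma additive_closed: "additive_map M N f \<Longrightarrow> x \<in> carrier M \<Longrightarrow> f x \<in> carrier N"
  by (auto simp: additive_map_def)

lemma additive_add:
  "additive_map M N f \<Longrightarrow> x \<in> carrier M \<Longrightarrow> y \<in> carrier M \<Longrightarrow> f (x \<oplus>\<^bsub>M\<^esub> y) = f x \<oplus>\<^bsub>N\<^esub> f y"
  by (auto simp: additive_map_def)

text \<open>Lets \<open>pres_lift\<close>, whose values off the carrier are arbitrary, be replaced
  by its restriction to the carrier, as extensional morphisms require.\<close>

lemma additive_cong:
  assumes "additive_map M N f" "abelian_monoid M" "\<And>x. x \<in> carrier M \<Longrightarrow> g x = f x"
  shows "additive_map M N g"
  using assms abelian_monoid.a_closed[OF assms(2)] by (auto simp: additive_map_def)

lemma additive_comp: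
  "additive_map M N f \<Longrightarrow> additive_map N L g \<Longrightarrow> additive_map M L (\<lambda>x. g (f x))"
  by (auto simp: additive_map_def Pi_iff)

lemma additive_zero:
  assumes M: "abelian_group M" and N: "abelian_group N" and f: "additive_map M N f"
  shows "f \<zero>\<^bsub>M\<^esub> = \<zero>\<^bsub>N\<^esub>"
proof -
  interpret M: abelian_group M by fact
  interpret N: abelian_group N by fact
  have "f \<zero>\<^bsub>M\<^esub> \<oplus>\<^bsub>N\<^esub> f \<zero>\<^bsub>M\<^esub> = f \<zero>\<^bsub>M\<^esub> \<oplus>\<^bsub>N\<^esub> \<zero>\<^bsub>N\<^esub>"
    using additive_add[OF f, of "\<zero>\<^bsub>M\<^esub>" "\<zero>\<^bsub>M\<^esub>"] additive_closed[OF f] by simp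
  then show ?thesis
    using additive_closed[OF f, of "\<zero>\<^bsub>M\<^esub>"] N.add.l_cancel_one[of "f \<zero>\<^bsub>M\<^esub>" "f \<zero>\<^bsub>M\<^esub>"] by simp
qed

lemma additive_minus:
  assumes M: "abelian_group M" and N: "abelian_group N" and f: "additive_map M N f"
    and x: "x \<in> carrier M"
  shows "f (\<ominus>\<^bsub>M\<^esub> x) = \<ominus>\<^bsub>N\<^esub> f x"
proof -
  interpret M: abelian_group M by fact
  interpret N: abelian_group N by fact
  have "f (\<ominus>\<^bsub>M\<^esub> x) \<oplus>\<^bsub>N\<^esub> f x = \<zero>\<^bsub>N\<^esub>"
    using additive_add[OF f, of "\<ominus>\<^bsub>M\<^esub> x" x] x additive_zero[OF M N f] by (simp add: M.l_neg)
  then show ?thesis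
    using N.minus_equality additive_closed[OF f] x by simp
qed

lemma additive_inj_on:
  assumes M: "abelian_group M" and N: "abelian_group N" and f: "additive_map M N f"
    and ker: "\<And>x. x \<in> carrier M \<Longrightarrow> f x = \<zero>\<^bsub>N\<^esub> \<Longrightarrow> x = \<zero>\<^bsub>M\<^esub>"
  shows "inj_on f (carrier M)"
proof (rule inj_onI)
  interpret M: abelian_group M by fact
  interpret N: abelian_group N by fact
  fix x y assume xy: "x \<in> carrier M" "y \<in> carrier M" "f x = f y"
  have "f (x \<oplus>\<^bsub>M\<^esub> \<ominus>\<^bsub>M\<^esub> y) = f x \<oplus>\<^bsub>N\<^esub> \<ominus>\<^bsub>N\<^esub> f y"
    using additive_add[OF f, of x "\<ominus>\<^bsub>M\<^esub> y"] additive_minus[OF M N f] xy by simp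
  then have "x \<oplus>\<^bsub>M\<^esub> \<ominus>\<^bsub>M\<^esub> y = \<zero>\<^bsub>M\<^esub>"
    using ker xy additive_closed[OF f xy(2)] by (simp add: N.r_neg)
  then show "x = y"
    using xy M.minus_equality[of x "\<ominus>\<^bsub>M\<^esub> y"] by simp
qed


section \<open>Abelian groups given by generators and relations\<close>

text \<open>The homomorphism from the free abelian group that extends \<open>b\<close>.
  \<open>pres_lift\<close> collects its values over a coset, so calculations with
  \<open>pres_lift\<close> are done here on representatives.\<close>

definition free_lift :: "('b, 'z) ring_scheme \<Rightarrow> ('s \<Rightarrow> 'b) \<Rightarrow> ('s \<Rightarrow>\<^sub>0 int) \<Rightarrow> 'b"
  where "free_lift G b x =
    (\<Oplus>\<^bsub>G\<^esub>s\<in>Poly_Mapping.keys x. [Poly_Mapping.lookup x s] \<cdot>\<^bsub>G\<^esub> b s)"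

lemma pres_lift_free_lift: "pres_lift G b X = the_elem (free_lift G b ` X)"
  by (simp add: pres_lift_def free_lift_def image_def)

context abelian_group
begin

lemma add_pow_0_int: "[(0::int)] \<cdot> x = \<zero>"
  by (simp add: add_pow_def)

text \<open>Cancellation can make the support of a sum smaller than the union of the supports, so
  values are compared as sums over a common finite index set, whose extra indices carry the
  coefficient 0.\<close>

lemma free_lift_superset:
  assumes "finite T" "Poly_Mapping.keys x \<subseteq> T" "\<And>s. s \<in> T \<Longrightarrow> b s \<in> carrier G"
  shows "free_lift G b x = (\<Oplus>s\<in>T. [Poly_Mapping.lookup x s] \<cdot> b s)"
  unfolding free_lift_def
  by (rule add.finprod_mono_neutral_cong_left) (use assms in \<open>auto simp: in_keys_iff add_pow_0_int\<close>)

lemma free_lift_closed: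
  "(\<And>s. s \<in> Poly_Mapping.keys x \<Longrightarrow> b s \<in> carrier G) \<Longrightarrow> free_lift G b x \<in> carrier G"
  unfolding free_lift_def by (rule finsum_closed) auto

lemma free_lift_add:
  assumes b: "\<And>s. s \<in> S \<Longrightarrow> b s \<in> carrier G"
    and x: "Poly_Mapping.keys x \<subseteq> S" and y: "Poly_Mapping.keys y \<subseteq> S"
  shows "free_lift G b (x + y) = free_lift G b x \<oplus> free_lift G b y"
proof -
  let ?T = "Poly_Mapping.keys x \<union> Poly_Mapping.keys y"
  have T: "finite ?T" "\<And>s. s \<in> ?T \<Longrightarrow> b s \<in> carrier G"
    using assms by auto
  have "free_lift G b (x + y) = (\<Oplus>s\<in>?T. [Poly_Mapping.lookup (x + y) s] \<cdot> b s)"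
    by (rule free_lift_superset[OF T(1) keys_add T(2)])
  also have "\<dots> = (\<Oplus>s\<in>?T. [Poly_Mapping.lookup x s] \<cdot> b s \<oplus> [Poly_Mapping.lookup y s] \<cdot> b s)"
    by (rule finsum_cong') (use T in \<open>auto simp: lookup_add add.int_pow_mult\<close>)
  also have "\<dots> = (\<Oplus>s\<in>?T. [Poly_Mapping.lookup x s] \<cdot> b s) \<oplus> (\<Oplus>s\<in>?T. [Poly_Mapping.lookup y s] \<cdot> b s)"
    by (rule finsum_addf) (use T in auto)
  also have "\<dots> = free_lift G b x \<oplus> free_lift G b y"
    using free_lift_superset[where x=x and b=b, OF T(1) _ T(2)] free_lift_superset[where x=y and b=b, OF T(1) _ T(2)] by simp
  finally show ?thesis .
qed

lemma free_lift_of: "b s \<in> carrier G \<Longrightarrow> free_lift G b (frag_of s) = b s"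
  by (simp add: free_lift_def keys_frag_of)

lemma free_lift_zero: "free_lift G b 0 = \<zero>"
  by (simp add: free_lift_def)

lemma free_lift_diff:
  assumes b: "\<And>s. s \<in> S \<Longrightarrow> b s \<in> carrier G"
    and x: "Poly_Mapping.keys x \<subseteq> S" and y: "Poly_Mapping.keys y \<subseteq> S"
  shows "free_lift G b (x - y) = free_lift G b x \<ominus> free_lift G b y"
proof -
  have xy: "Poly_Mapping.keys (x - y) \<subseteq> S"
    using keys_diff[of x y] x y by auto
  have c: "free_lift G b (x - y) \<in> carrier G" "free_lift G b y \<in> carrier G"
    using xy y b by (auto intro!: free_lift_closed)
  have "free_lift G b x = free_lift G b (x - y) \<oplus> free_lift G b y"
    using free_lift_add[of S b "x - y" y] b xy y by simp
  then show ?thesis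
    using c by (simp add: a_minus_def a_assoc r_neg)
qed

end

section \<open>Presented abelian groups: classes of words, and maps out of the quotient\<close>

definition pres_class :: "'s set \<Rightarrow> ('s \<Rightarrow>\<^sub>0 int) set \<Rightarrow> ('s \<Rightarrow>\<^sub>0 int) \<Rightarrow> ('s \<Rightarrow>\<^sub>0 int) set"
  where "pres_class S R z = pres_rel S R #>\<^bsub>free_Abelian_group S\<^esub> z"

lemma pres_gen_class: "pres_gen S R s = pres_class S R (frag_of s)"
  by (simp add: pres_gen_def pres_class_def)

text \<open>Relators must be words in \<open>S\<close>: then \<open>generate\<close> is a subgroup
  of the free group on \<open>S\<close>, and commutativity makes it normal.\<close>

locale presentation =
  fixes S :: "'s set" and R :: "('s \<Rightarrow>\<^sub>0 int) set"
  assumes keys_rel: "r \<in> R \<Longrightarrow> Poly_Mapping.keys r \<subseteq> S"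
begin

lemma rel_subset: "R \<subseteq> carrier (free_Abelian_group S)"
  using keys_rel by auto

lemma pres_rel_subgroup: "subgroup (pres_rel S R) (free_Abelian_group S)"
  unfolding pres_rel_def by (rule group.generate_is_subgroup[OF _ rel_subset]) simp

lemma pres_rel_normal: "pres_rel S R \<lhd> free_Abelian_group S"
  by (rule comm_group.subgroup_imp_normal[OF abelian_free_Abelian_group pres_rel_subgroup])

lemma pres_rel_incl: "r \<in> R \<Longrightarrow> r \<in> pres_rel S R"
  by (simp add: pres_rel_def generate.incl)

lemma pres_rel_zero: "0 \<in> pres_rel S R"
  using subgroup.one_closed[OF pres_rel_subgroup] by simp

lemma pres_rel_keys: "z \<in> pres_rel S R \<Longrightarrow> Poly_Mapping.keys z \<subseteq> S"
  using subsetD[OF subgroup.subset[OF pres_rel_subgroup], THEN carrier_free_Abelian_group_iff[THEN iffD1]] .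

lemma pres_rel_add: "z \<in> pres_rel S R \<Longrightarrow> w \<in> pres_rel S R \<Longrightarrow> z + w \<in> pres_rel S R"
  using subgroup.m_closed[OF pres_rel_subgroup] by auto

lemma pres_rel_minus: "z \<in> pres_rel S R \<Longrightarrow> - z \<in> pres_rel S R"
  using subgroup.m_inv_closed[OF pres_rel_subgroup] pres_rel_keys inv_free_Abelian_group by metis

lemma pres_rel_diff: "z \<in> pres_rel S R \<Longrightarrow> w \<in> pres_rel S R \<Longrightarrow> z - w \<in> pres_rel S R"
  using pres_rel_add[of z "- w"] pres_rel_minus by simp

text \<open>In an additively written abelian group, closure under negation of any member subsumes
  the clause of \<open>generate\<close> for inverses of relators.\<close>

lemma pres_rel_induct [consumes 1, case_names zero rel minus add]:
  assumes z: "z \<in> pres_rel S R"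
    and "P 0" "\<And>r. r \<in> R \<Longrightarrow> P r"
    and "\<And>z. z \<in> pres_rel S R \<Longrightarrow> P z \<Longrightarrow> P (- z)"
    and "\<And>z w. z \<in> pres_rel S R \<Longrightarrow> w \<in> pres_rel S R \<Longrightarrow> P z \<Longrightarrow> P w \<Longrightarrow> P (z + w)"
  shows "P z"
  using z unfolding pres_rel_def
proof (induction rule: generate.induct)
  case (inv r)
  then show ?case
    using assms(3,4)[of r] keys_rel pres_rel_incl by simp
next
  case (eng z w)
  then show ?case
    using assms(5) by (simp add: pres_rel_def)
qed (use assms in auto)

sublocale quotient: normal "pres_rel S R" "free_Abelian_group S"
  by (rule pres_rel_normal)

lemma pres_class_eq: "pres_class S R z = (\<lambda>h. h + z) ` pres_rel S R"
  by (auto simp: pres_class_def r_coset_def)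

lemma carrier_pres_group:
  "carrier (pres_group S R) = pres_class S R ` {z. Poly_Mapping.keys z \<subseteq> S}"
  by (auto simp: pres_group_def FactGroup_def RCOSETS_def pres_class_def)

lemma pres_class_closed: "Poly_Mapping.keys z \<subseteq> S \<Longrightarrow> pres_class S R z \<in> carrier (pres_group S R)"
  by (auto simp: carrier_pres_group)

lemma pres_class_surj:
  assumes "t \<in> carrier (pres_group S R)"
  obtains z where "Poly_Mapping.keys z \<subseteq> S" "t = pres_class S R z"
  using assms by (auto simp: carrier_pres_group)

lemma pres_class_add:
  assumes "Poly_Mapping.keys z \<subseteq> S" "Poly_Mapping.keys w \<subseteq> S"
  shows "pres_class S R (z + w) = pres_class S R z \<oplus>\<^bsub>pres_group S R\<^esub> pres_class S R w"
  using quotient.rcos_sum[of z w] assms by (simp add: pres_class_def pres_group_def FactGroup_def)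

lemma pres_class_zero: "pres_class S R 0 = \<zero>\<^bsub>pres_group S R\<^esub>"
proof -
  have "pres_rel S R #>\<^bsub>free_Abelian_group S\<^esub> \<one>\<^bsub>free_Abelian_group S\<^esub> = pres_rel S R"
    by (rule quotient.coset_mult_one) (rule subgroup.subset[OF pres_rel_subgroup])
  then show ?thesis
    by (simp add: pres_class_def pres_group_def FactGroup_def)
qed

lemma pres_class_eq_iff:
  assumes "Poly_Mapping.keys z \<subseteq> S" "Poly_Mapping.keys w \<subseteq> S"
  shows "pres_class S R z = pres_class S R w \<longleftrightarrow> z - w \<in> pres_rel S R"
proof
  assume "pres_class S R z = pres_class S R w"
  moreover have "z \<in> pres_class S R z"
    using pres_rel_zero by (auto simp: pres_class_eq)
  ultimately show "z - w \<in> pres_rel S R"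
    by (auto simp: pres_class_eq)
next
  assume zw: "z - w \<in> pres_rel S R"
  have "h + z \<in> pres_class S R w" if "h \<in> pres_rel S R" for h
    unfolding pres_class_eq
    by (rule image_eqI[of _ _ "h + (z - w)"]) (use that zw pres_rel_add in auto)
  moreover have "h + w \<in> pres_class S R z" if "h \<in> pres_rel S R" for h
    unfolding pres_class_eq
    by (rule image_eqI[of _ _ "h - (z - w)"]) (use that zw pres_rel_diff in auto)
  ultimately show "pres_class S R z = pres_class S R w"
    by (auto simp: pres_class_eq)
qed

lemma pres_class_eq_zero_iff:
  "Poly_Mapping.keys z \<subseteq> S \<Longrightarrow> pres_class S R z = \<zero>\<^bsub>pres_group S R\<^esub> \<longleftrightarrow> z \<in> pres_rel S R"
  using pres_class_eq_iff[of z 0] by (simp add: pres_class_zero)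

lemma abelian_group_pres_group: "abelian_group (pres_group S R)"
proof (rule comm_group_abelian_groupI)
  have "comm_group (free_Abelian_group S Mod pres_rel S R)"
    by (rule comm_group.abelian_FactGroup[OF abelian_free_Abelian_group pres_rel_subgroup])
  moreover have "add_monoid (pres_group S R) = (free_Abelian_group S Mod pres_rel S R)"
    by (simp add: pres_group_def FactGroup_def)
  ultimately show "comm_group (add_monoid (pres_group S R))"
    by simp
qed

lemma pres_class_minus:
  assumes "Poly_Mapping.keys z \<subseteq> S"
  shows "pres_class S R (- z) = \<ominus>\<^bsub>pres_group S R\<^esub> pres_class S R z"
proof -
  interpret G: abelian_group "pres_group S R" by (rule abelian_group_pres_group)
  show ?thesis
    using pres_class_add[of "- z" z] assms
    by (intro G.minus_equality[symmetric] pres_class_closed) (simp_all add: pres_class_zero)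
qed

lemma pres_gen_closed: "s \<in> S \<Longrightarrow> pres_gen S R s \<in> carrier (pres_group S R)"
  by (simp add: pres_gen_class pres_class_closed)

lemma pres_induct [consumes 1, case_names zero gen minus_gen add]:
  assumes t: "t \<in> carrier (pres_group S R)"
    and "P \<zero>\<^bsub>pres_group S R\<^esub>" "\<And>s. s \<in> S \<Longrightarrow> P (pres_gen S R s)"
    and "\<And>s. s \<in> S \<Longrightarrow> P (\<ominus>\<^bsub>pres_group S R\<^esub> pres_gen S R s)"
    and add: "\<And>t u. t \<in> carrier (pres_group S R) \<Longrightarrow> u \<in> carrier (pres_group S R) \<Longrightarrow> P t \<Longrightarrow> P u \<Longrightarrow>
      P (t \<oplus>\<^bsub>pres_group S R\<^esub> u)"
  shows "P t"
proof -
  interpret G: abelian_group "pres_group S R" by (rule abelian_group_pres_group)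
  obtain z where z: "Poly_Mapping.keys z \<subseteq> S" "t = pres_class S R z"
    by (rule pres_class_surj[OF t])
  \<comment> \<open>\<open>frag_induction\<close> builds words by differences, whereas
    \<open>P\<close> is only known to respect sums, so a word and its negative are treated
    together.\<close>
  have "Poly_Mapping.keys z \<subseteq> S \<and> P (pres_class S R z) \<and> P (pres_class S R (- z))"
    using z(1)
  proof (induction z rule: frag_induction)
    case zero
    then show ?case
      using assms by (simp add: pres_class_zero)
  next
    case (one s)
    then show ?case
      using assms by (simp add: pres_gen_class pres_class_minus)
  next
    case (diff z w)
    then show ?case
      using add[of "pres_class S R z" "pres_class S R (- w)"]
        add[of "pres_class S R w" "pres_class S R (- z)"]
        pres_class_add[of z "- w"] pres_class_add[of w "- z"] keys_diff[of z w]
      by (auto simp: pres_class_closed)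
  qed
  then show ?thesis
    using z(2) by simp
qed

lemma pres_additive_eqI:
  assumes G: "abelian_group G" and f: "additive_map (pres_group S R) G f"
    and g: "additive_map (pres_group S R) G g"
    and eq: "\<And>s. s \<in> S \<Longrightarrow> f (pres_gen S R s) = g (pres_gen S R s)"
    and t: "t \<in> carrier (pres_group S R)"
  shows "f t = g t"
  using t
proof (induction rule: pres_induct)
  case zero
  then show ?case
    using additive_zero[OF abelian_group_pres_group G f] additive_zero[OF abelian_group_pres_group G g] by simp
next
  case (minus_gen s)
  then show ?case
    using additive_minus[OF abelian_group_pres_group G f] additive_minus[OF abelian_group_pres_group G g] eq
    by (simp add: pres_gen_closed)
qed (use f g eq in \<open>auto simp: additive_add\<close>)

context
  fixes G :: "('b, 'z) ring_scheme" and b :: "'s \<Rightarrow> 'b"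
  assumes G: "abelian_group G" and b: "\<And>s. s \<in> S \<Longrightarrow> b s \<in> carrier G"
    and respects: "\<And>r. r \<in> R \<Longrightarrow> free_lift G b r = \<zero>\<^bsub>G\<^esub>"
begin

interpretation G: abelian_group G by (rule G)

lemma free_lift_pres_rel: "z \<in> pres_rel S R \<Longrightarrow> free_lift G b z = \<zero>\<^bsub>G\<^esub>"
proof (induction rule: pres_rel_induct)
  case (minus z)
  then show ?case
    using G.free_lift_diff[of S b 0 z] b pres_rel_keys by (simp add: G.free_lift_zero a_minus_def)
next
  case (add z w)
  then show ?case
    using G.free_lift_add[of S b z w] b pres_rel_keys by simp
qed (simp_all add: G.free_lift_zero respects)

text \<open>The relations map to zero, so \<open>free_lift\<close> is constant on each coset; this
  is what gives \<open>the_elem\<close> in \<open>pres_lift\<close> its meaning.\<close>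

lemma pres_lift_class:
  assumes z: "Poly_Mapping.keys z \<subseteq> S"
  shows "pres_lift G b (pres_class S R z) = free_lift G b z"
proof -
  have "free_lift G b (h + z) = free_lift G b z" if "h \<in> pres_rel S R" for h
    using G.free_lift_add[of S b h z] b z that pres_rel_keys
    by (simp add: free_lift_pres_rel G.free_lift_closed subset_iff)
  then have "free_lift G b ` pres_class S R z = {free_lift G b z}"
    using pres_rel_zero by (force simp: pres_class_eq)
  then show ?thesis
    by (simp add: pres_lift_free_lift)
qed

lemma pres_lift_gen: "s \<in> S \<Longrightarrow> pres_lift G b (pres_gen S R s) = b s"
  by (simp add: pres_gen_class pres_lift_class G.free_lift_of b)

lemma additive_pres_lift: "additive_map (pres_group S R) G (pres_lift G b)"
proof (rule additive_mapI)
  fix x assume "x \<in> carrier (pres_group S R)"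
  then obtain z where "Poly_Mapping.keys z \<subseteq> S" "x = pres_class S R z"
    by (rule pres_class_surj)
  then show "pres_lift G b x \<in> carrier G"
    using b by (simp add: pres_lift_class G.free_lift_closed subset_iff)
next
  fix x y assume "x \<in> carrier (pres_group S R)" "y \<in> carrier (pres_group S R)"
  then obtain z w where zw: "Poly_Mapping.keys z \<subseteq> S" "x = pres_class S R z"
      "Poly_Mapping.keys w \<subseteq> S" "y = pres_class S R w"
    by (metis pres_class_surj)
  moreover have "Poly_Mapping.keys (z + w) \<subseteq> S"
    using zw keys_add[of z w] by auto
  ultimately show "pres_lift G b (x \<oplus>\<^bsub>pres_group S R\<^esub> y) = pres_lift G b x \<oplus>\<^bsub>G\<^esub> pres_lift G b y"
    using G.free_lift_add[of S b z w] b by (simp add: pres_lift_class flip: pres_class_add)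
qed

end

end

text \<open>All relations of tensor products and of colimits have the shape u - v - w (additivity)
  or u - v (an identification). The four lemmas from here on settle each shape once, for maps out of
  the group and for equations inside it.\<close>

lemma (in abelian_group) free_lift_rel3:
  assumes "b u \<in> carrier G" "b v \<in> carrier G" "b w \<in> carrier G" "b u = b v \<oplus> b w"
  shows "free_lift G b (frag_of u - frag_of v - frag_of w) = \<zero>"
proof -
  have k: "Poly_Mapping.keys (frag_of u - frag_of v) \<subseteq> {u, v, w}"
    using keys_diff[of "frag_of u" "frag_of v"] by (auto simp: keys_frag_of)
  have b: "s \<in> {u, v, w} \<Longrightarrow> b s \<in> carrier G" for s
    using assms by auto
  have "free_lift G b (frag_of u - frag_of v - frag_of w) = (b u \<ominus> b v) \<ominus> b w"
    using free_lift_diff[of "{u, v, w}" b "frag_of u - frag_of v" "frag_of w", OF b k]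
      free_lift_diff[of "{u, v, w}" b "frag_of u" "frag_of v", OF b]
    by (simp add: keys_frag_of free_lift_of assms(1-3))
  also have "b u \<ominus> b v = b w"
    using assms by (simp add: a_minus_def a_comm[of "b v" "b w"] a_assoc r_neg)
  also have "b w \<ominus> b w = \<zero>"
    using assms by (simp add: a_minus_def r_neg)
  finally show ?thesis .
qed

lemma (in abelian_group) free_lift_rel2:
  assumes "b u \<in> carrier G" "b v \<in> carrier G" "b u = b v"
  shows "free_lift G b (frag_of u - frag_of v) = \<zero>"
proof -
  have b: "s \<in> {u, v} \<Longrightarrow> b s \<in> carrier G" for s
    using assms by auto
  show ?thesis
    using free_lift_diff[of "{u, v}" b "frag_of u" "frag_of v", OF b]
    by (simp add: keys_frag_of free_lift_of assms a_minus_def r_neg)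
qed

lemma (in presentation) pres_gen_rel3:
  assumes "frag_of u - frag_of v - frag_of w \<in> R" "u \<in> S" "v \<in> S" "w \<in> S"
  shows "pres_gen S R u = pres_gen S R v \<oplus>\<^bsub>pres_group S R\<^esub> pres_gen S R w"
proof -
  have "Poly_Mapping.keys (frag_of v + frag_of w) \<subseteq> S"
    using keys_add[of "frag_of v" "frag_of w"] assms by (auto simp: keys_frag_of)
  then have "pres_class S R (frag_of u) = pres_class S R (frag_of v + frag_of w)"
    using assms pres_rel_incl[OF assms(1)] by (subst pres_class_eq_iff) (simp_all add: diff_diff_eq)
  then show ?thesis
    using assms by (simp add: pres_gen_class pres_class_add)
qed

lemma (in presentation) pres_gen_rel2:
  assumes "frag_of u - frag_of v \<in> R" "u \<in> S" "v \<in> S"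
  shows "pres_gen S R u = pres_gen S R v"
  using pres_class_eq_iff[of "frag_of u" "frag_of v"] pres_rel_incl[OF assms(1)] assms
  by (simp add: pres_gen_class)


section \<open>Linear maps\<close>

lemma right_module_abelian: "right_module A M \<Longrightarrow> abelian_group M"
  by (simp add: right_module_def)

lemma left_module_abelian: "left_module A M \<Longrightarrow> abelian_group M"
  by (simp add: left_module_def)

lemma bimodule_left: "bimodule A M \<Longrightarrow> left_module A M"
  by (simp add: bimodule_def)

lemma bimodule_right: "bimodule A M \<Longrightarrow> right_module A M"
  by (simp add: bimodule_def)

lemma bimodule_abelian: "bimodule A M \<Longrightarrow> abelian_group M"
  by (rule left_module_abelian[OF bimodule_left])

lemma bimodule_ring: "bimodule A M \<Longrightarrow> ring A"
  by (simp add: bimodule_def left_module_def)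

lemma left_moduleI:
  assumes "ring A" "abelian_group M"
    and "\<And>a x. a \<in> carrier A \<Longrightarrow> x \<in> carrier M \<Longrightarrow> lact M a x \<in> carrier M"
    and "\<And>a x y. a \<in> carrier A \<Longrightarrow> x \<in> carrier M \<Longrightarrow> y \<in> carrier M \<Longrightarrow>
        lact M a (x \<oplus>\<^bsub>M\<^esub> y) = lact M a x \<oplus>\<^bsub>M\<^esub> lact M a y"
    and "\<And>a b x. a \<in> carrier A \<Longrightarrow> b \<in> carrier A \<Longrightarrow> x \<in> carrier M \<Longrightarrow>
        lact M (a \<oplus>\<^bsub>A\<^esub> b) x = lact M a x \<oplus>\<^bsub>M\<^esub> lact M b x"
    and "\<And>a b x. a \<in> carrier A \<Longrightarrow> b \<in> carrier A \<Longrightarrow> x \<in> carrier M \<Longrightarrow>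
        lact M (a \<otimes>\<^bsub>A\<^esub> b) x = lact M a (lact M b x)"
    and "\<And>x. x \<in> carrier M \<Longrightarrow> lact M \<one>\<^bsub>A\<^esub> x = x"
  shows "left_module A M"
  using assms by (simp add: left_module_def left_module_axioms_def)

lemma right_moduleI:
  assumes "ring A" "abelian_group M"
    and "\<And>a x. a \<in> carrier A \<Longrightarrow> x \<in> carrier M \<Longrightarrow> ract M x a \<in> carrier M"
    and "\<And>a x y. a \<in> carrier A \<Longrightarrow> x \<in> carrier M \<Longrightarrow> y \<in> carrier M \<Longrightarrow>
        ract M (x \<oplus>\<^bsub>M\<^esub> y) a = ract M x a \<oplus>\<^bsub>M\<^esub> ract M y a"
    and "\<And>a b x. a \<in> carrier A \<Longrightarrow> b \<in> carrier A \<Longrightarrow> x \<in> carrier M \<Longrightarrow>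
        ract M x (a \<oplus>\<^bsub>A\<^esub> b) = ract M x a \<oplus>\<^bsub>M\<^esub> ract M x b"
    and "\<And>a b x. a \<in> carrier A \<Longrightarrow> b \<in> carrier A \<Longrightarrow> x \<in> carrier M \<Longrightarrow>
        ract M x (a \<otimes>\<^bsub>A\<^esub> b) = ract M (ract M x a) b"
    and "\<And>x. x \<in> carrier M \<Longrightarrow> ract M x \<one>\<^bsub>A\<^esub> = x"
  shows "right_module A M"
  using assms by (simp add: right_module_def right_module_axioms_def)

lemma bimoduleI:
  assumes "left_module A M" "right_module A M"
    and "\<And>a b x. a \<in> carrier A \<Longrightarrow> b \<in> carrier A \<Longrightarrow> x \<in> carrier M \<Longrightarrow>
        ract M (lact M a x) b = lact M a (ract M x b)"
  shows "bimodule A M"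
  using assms by (simp add: bimodule_def bimodule_axioms_def)

text \<open>One-sided and not extensional: \<open>f \<otimes> g\<close> makes sense as soon as
  \<open>f\<close> is linear on the right and \<open>g\<close> on the left, and the modules that
  test purity have only one meaningful action.\<close>

definition right_linear ::
  "('a, 's) ring_scheme \<Rightarrow> ('a, 'm, 'y) bimodule_scheme \<Rightarrow> ('a, 'n, 'z) bimodule_scheme \<Rightarrow> ('m \<Rightarrow> 'n) \<Rightarrow> bool"
  where "right_linear A M N f \<longleftrightarrow> additive_map M N f \<and>
    (\<forall>x\<in>carrier M. \<forall>a\<in>carrier A. f (ract M x a) = ract N (f x) a)"

definition left_linear ::
  "('a, 's) ring_scheme \<Rightarrow> ('a, 'm, 'y) bimodule_scheme \<Rightarrow> ('a, 'n, 'z) bimodule_scheme \<Rightarrow> ('m \<Rightarrow> 'n) \<Rightarrow> bool"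
  where "left_linear A M N f \<longleftrightarrow> additive_map M N f \<and>
    (\<forall>x\<in>carrier M. \<forall>a\<in>carrier A. f (lact M a x) = lact N a (f x))"

lemma right_linear_additive: "right_linear A M N f \<Longrightarrow> additive_map M N f"
  by (simp add: right_linear_def)

lemma left_linear_additive: "left_linear A M N f \<Longrightarrow> additive_map M N f"
  by (simp add: left_linear_def)

lemma bimodule_hom_iff:
  "f \<in> bimodule_hom A M N \<longleftrightarrow>
    f \<in> extensional (carrier M) \<and> right_linear A M N f \<and> left_linear A M N f"
  by (auto simp: bimodule_hom_def right_linear_def left_linear_def additive_map_def PiE_def)

lemma bimodule_homI:
  assumes "f \<in> extensional (carrier M)" "additive_map M N f"
    and "\<And>a x. a \<in> carrier A \<Longrightarrow> x \<in> carrier M \<Longrightarrow> f (lact M a x) = lact N a (f x)"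
    and "\<And>a x. a \<in> carrier A \<Longrightarrow> x \<in> carrier M \<Longrightarrow> f (ract M x a) = ract N (f x) a"
  shows "f \<in> bimodule_hom A M N"
  using assms by (auto simp: bimodule_hom_iff right_linear_def left_linear_def)

lemma bimodule_hom_right: "f \<in> bimodule_hom A M N \<Longrightarrow> right_linear A M N f"
  by (simp add: bimodule_hom_iff)

lemma bimodule_hom_left: "f \<in> bimodule_hom A M N \<Longrightarrow> left_linear A M N f"
  by (simp add: bimodule_hom_iff)

lemma bimodule_hom_additive: "f \<in> bimodule_hom A M N \<Longrightarrow> additive_map M N f"
  by (simp add: bimodule_hom_iff right_linear_def)

lemma bimodule_hom_closed: "f \<in> bimodule_hom A M N \<Longrightarrow> x \<in> carrier M \<Longrightarrow> f x \<in> carrier N"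
  by (auto simp: bimodule_hom_def)

lemma bimodule_hom_lact:
  "f \<in> bimodule_hom A M N \<Longrightarrow> x \<in> carrier M \<Longrightarrow> a \<in> carrier A \<Longrightarrow> f (lact M a x) = lact N a (f x)"
  by (auto simp: bimodule_hom_def)

lemma bimodule_hom_ract:
  "f \<in> bimodule_hom A M N \<Longrightarrow> x \<in> carrier M \<Longrightarrow> a \<in> carrier A \<Longrightarrow> f (ract M x a) = ract N (f x) a"
  by (auto simp: bimodule_hom_def)

lemma bimodule_hom_ext: "f \<in> bimodule_hom A M N \<Longrightarrow> f \<in> extensional (carrier M)"
  by (simp add: bimodule_hom_iff)

lemma bimodule_hom_eqI:
  "f \<in> bimodule_hom A M N \<Longrightarrow> g \<in> bimodule_hom A M N' \<Longrightarrow> (\<And>x. x \<in> carrier M \<Longrightarrow> f x = g x) \<Longrightarrow> f = g"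
  by (meson bimodule_hom_ext extensionalityI)

lemma right_linear_id: "right_module A M \<Longrightarrow> right_linear A M M (\<lambda>x\<in>carrier M. x)"
  using abelian_group.axioms(1)[OF right_module_abelian, of A M]
  by (auto simp: right_linear_def additive_map_def right_module.ract_closed abelian_monoid.a_closed)

lemma left_linear_id: "left_module A M \<Longrightarrow> left_linear A M M (\<lambda>x\<in>carrier M. x)"
  using abelian_group.axioms(1)[OF left_module_abelian, of A M]
  by (auto simp: left_linear_def additive_map_def left_module.lact_closed abelian_monoid.a_closed)

lemma bimodule_hom_id: "bimodule A M \<Longrightarrow> (\<lambda>x\<in>carrier M. x) \<in> bimodule_hom A M M"
  by (simp add: bimodule_hom_iff right_linear_id left_linear_id bimodule_left bimodule_right)

lemma bimodule_hom_compose: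
  assumes M: "bimodule A M" and f: "f \<in> bimodule_hom A M N" and g: "g \<in> bimodule_hom A N L"
  shows "compose (carrier M) g f \<in> bimodule_hom A M L"
proof -
  interpret bimodule A M by fact
  show ?thesis
    using f g by (auto simp: bimodule_hom_def compose_def lact_closed ract_closed PiE_def Pi_iff)
qed


section \<open>Tensor products\<close>

lemma tensor_sel:
  "carrier (tensor A M N) = carrier (tensor_group A M N)"
  "add (tensor A M N) = add (tensor_group A M N)"
  "\<zero>\<^bsub>tensor A M N\<^esub> = \<zero>\<^bsub>tensor_group A M N\<^esub>"
  by (simp_all add: tensor_def ring.defs)

lemma additive_tensor_iff:
  "additive_map (tensor_group A M N) G f \<longleftrightarrow> additive_map (tensor A M N) G f"
  "additive_map G (tensor_group A M N) g \<longleftrightarrow> additive_map G (tensor A M N) g"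
  by (simp_all add: additive_map_def tensor_sel)

lemma keys_diff3: "Poly_Mapping.keys (frag_of u - frag_of v - frag_of w) \<subseteq> {u, v, w}"
  using keys_diff[of "frag_of u - frag_of v" "frag_of w"] keys_diff[of "frag_of u" "frag_of v"]
  by (auto simp: keys_frag_of)

lemma keys_diff2: "Poly_Mapping.keys (frag_of u - frag_of v) \<subseteq> {u, v}"
  using keys_diff[of "frag_of u" "frag_of v"] by (auto simp: keys_frag_of)

section \<open>Balanced maps and the universal property of the tensor product\<close>

definition balanced ::
  "('a, 's) ring_scheme \<Rightarrow> ('a, 'm, 'y) bimodule_scheme \<Rightarrow> ('a, 'n, 'z) bimodule_scheme
    \<Rightarrow> ('g, 'w) ring_scheme \<Rightarrow> ('m \<Rightarrow> 'n \<Rightarrow> 'g) \<Rightarrow> bool"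
  where "balanced A M N G b \<longleftrightarrow>
    (\<forall>x\<in>carrier M. additive_map N G (b x)) \<and> (\<forall>y\<in>carrier N. additive_map M G (\<lambda>x. b x y)) \<and>
    (\<forall>x\<in>carrier M. \<forall>a\<in>carrier A. \<forall>y\<in>carrier N. b (ract M x a) y = b x (lact N a y))"

text \<open>Only the two inner actions are constrained, so that the one-sided test modules of purity
  are covered along with bimodules.\<close>

locale tensor_pair =
  fixes A :: "('a, 's) ring_scheme" and M :: "('a, 'm, 'y) bimodule_scheme"
    and N :: "('a, 'n, 'z) bimodule_scheme"
  assumes right_M: "right_module A M" and left_N: "left_module A N"
begin

interpretation M: right_module A M by (rule right_M)
interpretation N: left_module A N by (rule left_N)

sublocale pres: presentation "carrier M \<times> carrier N" "tensor_rels A M N"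
proof
  fix r assume "r \<in> tensor_rels A M N"
  then show "Poly_Mapping.keys r \<subseteq> carrier M \<times> carrier N"
    unfolding tensor_rels_def
    by (elim UnE CollectE exE conjE; hypsubst)
      (rule order_trans[OF keys_diff3], simp add: N.lact_closed M.ract_closed,
       rule order_trans[OF keys_diff3], simp add: N.lact_closed M.ract_closed,
       rule order_trans[OF keys_diff2], simp add: N.lact_closed M.ract_closed)
qed

lemma abelian_tensor: "abelian_group (tensor A M N)"
proof -
  interpret G: abelian_group "tensor_group A M N"
    unfolding tensor_group_def by (rule pres.abelian_group_pres_group)
  have "\<exists>y\<in>carrier (tensor_group A M N). y \<oplus>\<^bsub>tensor_group A M N\<^esub> x = \<zero>\<^bsub>tensor_group A M N\<^esub>"
    if "x \<in> carrier (tensor_group A M N)" for x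
    using that G.l_neg G.a_inv_closed by blast
  then show ?thesis
    by (intro abelian_groupI) (simp_all add: tensor_sel G.a_ac)
qed

lemma tens_closed: "x \<in> carrier M \<Longrightarrow> y \<in> carrier N \<Longrightarrow> tens A M N x y \<in> carrier (tensor A M N)"
  by (simp add: tens_def tensor_sel tensor_group_def pres.pres_gen_closed)

lemma tens_add_left:
  assumes "x \<in> carrier M" "x' \<in> carrier M" "y \<in> carrier N"
  shows "tens A M N (x \<oplus>\<^bsub>M\<^esub> x') y = tens A M N x y \<oplus>\<^bsub>tensor A M N\<^esub> tens A M N x' y"
  unfolding tens_def tensor_sel tensor_group_def
  by (rule pres.pres_gen_rel3) (use assms in \<open>auto simp: tensor_rels_def\<close>)

lemma tens_add_right:
  assumes "x \<in> carrier M" "y \<in> carrier N" "y' \<in> carrier N"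
  shows "tens A M N x (y \<oplus>\<^bsub>N\<^esub> y') = tens A M N x y \<oplus>\<^bsub>tensor A M N\<^esub> tens A M N x y'"
  unfolding tens_def tensor_sel tensor_group_def
  by (rule pres.pres_gen_rel3) (use assms in \<open>auto simp: tensor_rels_def\<close>)

lemma tens_balanced:
  assumes "x \<in> carrier M" "a \<in> carrier A" "y \<in> carrier N"
  shows "tens A M N (ract M x a) y = tens A M N x (lact N a y)"
  unfolding tens_def
  by (rule pres.pres_gen_rel2)
    (use assms in \<open>auto simp: tensor_rels_def N.lact_closed M.ract_closed\<close>)

lemma balanced_tens: "balanced A M N (tensor A M N) (tens A M N)"
  by (auto simp: balanced_def tens_balanced tens_closed tens_add_left tens_add_right
      intro!: additive_mapI)

lemma tens_minus_left:
  assumes "x \<in> carrier M" "y \<in> carrier N"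
  shows "tens A M N (\<ominus>\<^bsub>M\<^esub> x) y = \<ominus>\<^bsub>tensor A M N\<^esub> tens A M N x y"
proof -
  have "additive_map M (tensor A M N) (\<lambda>x. tens A M N x y)"
    using balanced_tens assms by (simp add: balanced_def)
  from additive_minus[OF right_module_abelian[OF right_M] abelian_tensor this] show ?thesis
    using assms by simp
qed

lemma tens_zero_left: "y \<in> carrier N \<Longrightarrow> tens A M N \<zero>\<^bsub>M\<^esub> y = \<zero>\<^bsub>tensor A M N\<^esub>"
proof -
  assume "y \<in> carrier N"
  then have "additive_map M (tensor A M N) (\<lambda>x. tens A M N x y)"
    using balanced_tens by (simp add: balanced_def)
  from additive_zero[OF right_module_abelian[OF right_M] abelian_tensor this] show ?thesis
    by simp
qed

text \<open>\<open>tensor\<close> extends \<open>tensor_group\<close> by the actions, but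
  \<open>a_inv\<close> takes the whole record as argument. The identity is an additive map between
  the two records and carries negatives over.\<close>

lemma a_inv_tensor_group:
  assumes "t \<in> carrier (tensor A M N)"
  shows "\<ominus>\<^bsub>tensor_group A M N\<^esub> t = \<ominus>\<^bsub>tensor A M N\<^esub> t"
proof -
  have "abelian_group (tensor_group A M N)"
    unfolding tensor_group_def by (rule pres.abelian_group_pres_group)
  moreover have "additive_map (tensor_group A M N) (tensor A M N) (\<lambda>t. t)"
    by (simp add: additive_map_def tensor_sel)
  ultimately show ?thesis
    using additive_minus[OF _ abelian_tensor] assms by (simp add: tensor_sel)
qed

text \<open>Zero and negatives need no cases of their own, being the pure tensors
  \<open>0 \<otimes> 0\<close> and \<open>(- x) \<otimes> y\<close>.\<close>

lemma tensor_induct [consumes 1, case_names tens add]: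
  assumes t: "t \<in> carrier (tensor A M N)"
    and tens: "\<And>x y. x \<in> carrier M \<Longrightarrow> y \<in> carrier N \<Longrightarrow> P (tens A M N x y)"
    and add: "\<And>t u. t \<in> carrier (tensor A M N) \<Longrightarrow> u \<in> carrier (tensor A M N) \<Longrightarrow> P t \<Longrightarrow> P u \<Longrightarrow>
      P (t \<oplus>\<^bsub>tensor A M N\<^esub> u)"
  shows "P t"
  using t unfolding tensor_sel tensor_group_def
proof (induction rule: pres.pres_induct)
  case zero
  then show ?case
    using tens[of "\<zero>\<^bsub>M\<^esub>" "\<zero>\<^bsub>N\<^esub>"] tens_zero_left[of "\<zero>\<^bsub>N\<^esub>"]
    by (simp add: tensor_sel tensor_group_def)
next
  case (gen s)
  then show ?case
    using tens by (auto simp: tens_def)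
next
  case (minus_gen s)
  then obtain x y where s: "s = (x, y)" "x \<in> carrier M" "y \<in> carrier N"
    by auto
  then have "P (\<ominus>\<^bsub>tensor_group A M N\<^esub> tens A M N x y)"
    using tens[of "\<ominus>\<^bsub>M\<^esub> x" y] by (simp add: tens_minus_left a_inv_tensor_group tens_closed right_module_abelian[OF right_M, THEN abelian_group.a_inv_closed])
  then show ?case
    by (simp add: tens_def s tensor_group_def)
next
  case (add t u)
  then show ?case
    using assms(3) by (simp add: tensor_sel tensor_group_def)
qed

lemma tensor_eqI:
  assumes "additive_map (tensor A M N) G f" "additive_map (tensor A M N) G g"
    and "\<And>x y. x \<in> carrier M \<Longrightarrow> y \<in> carrier N \<Longrightarrow> f (tens A M N x y) = g (tens A M N x y)"
    and "t \<in> carrier (tensor A M N)"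
  shows "f t = g t"
  using assms(4) by (induction rule: tensor_induct) (use assms in \<open>auto simp: additive_add\<close>)

context
  fixes G :: "('g, 'w) ring_scheme" and b
  assumes G: "abelian_group G" and b: "balanced A M N G b"
begin

interpretation G: abelian_group G by (rule G)

lemma balanced_closed: "x \<in> carrier M \<Longrightarrow> y \<in> carrier N \<Longrightarrow> b x y \<in> carrier G"
  using b by (auto simp: balanced_def dest: additive_closed)

lemma balanced_respects: "r \<in> tensor_rels A M N \<Longrightarrow> free_lift G (\<lambda>(x, y). b x y) r = \<zero>\<^bsub>G\<^esub>"
  unfolding tensor_rels_def
proof (elim UnE CollectE exE conjE; hypsubst)
  fix x x' y assume "x \<in> carrier M" "x' \<in> carrier M" "y \<in> carrier N"
  moreover from this have "b (x \<oplus>\<^bsub>M\<^esub> x') y = b x y \<oplus>\<^bsub>G\<^esub> b x' y"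
    using b by (auto simp: balanced_def additive_map_def)
  ultimately show "free_lift G (\<lambda>(x, y). b x y) (frag_of (x \<oplus>\<^bsub>M\<^esub> x', y) - frag_of (x, y) - frag_of (x', y)) = \<zero>\<^bsub>G\<^esub>"
    by (intro G.free_lift_rel3) (simp_all add: balanced_closed)
next
  fix x y y' assume "x \<in> carrier M" "y \<in> carrier N" "y' \<in> carrier N"
  moreover from this have "b x (y \<oplus>\<^bsub>N\<^esub> y') = b x y \<oplus>\<^bsub>G\<^esub> b x y'"
    using b by (auto simp: balanced_def additive_map_def)
  ultimately show "free_lift G (\<lambda>(x, y). b x y) (frag_of (x, y \<oplus>\<^bsub>N\<^esub> y') - frag_of (x, y) - frag_of (x, y')) = \<zero>\<^bsub>G\<^esub>"
    by (intro G.free_lift_rel3) (simp_all add: balanced_closed)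
next
  fix x a y assume "x \<in> carrier M" "a \<in> carrier A" "y \<in> carrier N"
  moreover from this have "b (ract M x a) y = b x (lact N a y)"
    using b by (auto simp: balanced_def)
  ultimately show "free_lift G (\<lambda>(x, y). b x y) (frag_of (ract M x a, y) - frag_of (x, lact N a y)) = \<zero>\<^bsub>G\<^esub>"
    by (intro G.free_lift_rel2) (simp_all add: balanced_closed M.ract_closed N.lact_closed)
qed

lemma tensor_lift_tens:
  assumes "x \<in> carrier M" "y \<in> carrier N"
  shows "pres_lift G (\<lambda>(x, y). b x y) (tens A M N x y) = b x y"
  using pres.pres_lift_gen[OF G _ balanced_respects, of "(x, y)"] assms balanced_closed
  by (auto simp: tens_def)

lemma additive_tensor_lift: "additive_map (tensor A M N) G (pres_lift G (\<lambda>(x, y). b x y))"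
proof -
  have "additive_map (pres_group (carrier M \<times> carrier N) (tensor_rels A M N)) G (pres_lift G (\<lambda>(x, y). b x y))"
    by (rule pres.additive_pres_lift[OF G _ balanced_respects]) (auto simp: balanced_closed)
  then show ?thesis
    by (simp flip: additive_tensor_iff tensor_group_def)
qed

end

lemma balanced_linear:
  assumes M': "right_module A M'" and N': "left_module A N'"
    and f: "right_linear A M M' f" and g: "left_linear A N N' g"
  shows "balanced A M N (tensor A M' N') (\<lambda>x y. tens A M' N' (f x) (g y))"
proof -
  interpret T: tensor_pair A M' N' by (rule tensor_pair.intro) fact+
  show ?thesis
    using f g
    by (auto simp: balanced_def right_linear_def left_linear_def additive_closed additive_add
        T.tens_balanced T.tens_closed T.tens_add_left T.tens_add_right intro!: additive_mapI)
qed

end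

lemma additive_plus:
  assumes N: "abelian_group N" and f: "additive_map M N f" and g: "additive_map M N g"
  shows "additive_map M N (\<lambda>x. f x \<oplus>\<^bsub>N\<^esub> g x)"
proof -
  interpret N: abelian_group N by (rule N)
  show ?thesis
    using f g by (auto simp: additive_map_def Pi_iff N.a_ac)
qed

lemma additive_id: "additive_map M M (\<lambda>x. x)"
  by (simp add: additive_map_def)

lemma tensor_pairI: "right_module A M \<Longrightarrow> left_module A N \<Longrightarrow> tensor_pair A M N"
  by (rule tensor_pair.intro)

lemma tensor_pair_bimodule: "bimodule A M \<Longrightarrow> bimodule A N \<Longrightarrow> tensor_pair A M N"
  by (simp add: tensor_pairI bimodule_left bimodule_right)

text \<open>The actions of \<open>tensor\<close> are defined by lifts into
  \<open>tensor_group\<close>, while the universal property is stated for \<open>tensor\<close>.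
  Sums and multiples agree because they read only fields that the two records share.\<close>

lemma pres_lift_tensor_group:
  fixes b :: "'g \<Rightarrow> _"
  shows "pres_lift (tensor_group A M N) b t = pres_lift (tensor A M N) b t"
proof -
  have "finsum (tensor_group A M N) h X = finsum (tensor A M N) h X" for h and X :: "'g set"
    by (simp add: finsum_def finprod_def tensor_sel)
  moreover have "add_pow (tensor_group A M N) k x = add_pow (tensor A M N) k x" for k :: int and x
    by (simp add: add_pow_def int_pow_def nat_pow_def m_inv_def tensor_sel Let_def)
  ultimately show ?thesis
    by (simp add: pres_lift_def)
qed

lemma lact_tensor_lift:
  "lact (tensor A M N) a = pres_lift (tensor A M N) (\<lambda>(x, y). tens A M N (lact M a x) y)"
  unfolding pres_lift_tensor_group[symmetric, abs_def] by (simp add: tensor_def ring.defs)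

lemma ract_tensor_lift:
  "ract (tensor A M N) t a = pres_lift (tensor A M N) (\<lambda>(x, y). tens A M N x (ract N y a)) t"
  unfolding pres_lift_tensor_group[symmetric] by (simp add: tensor_def ring.defs)

context
  fixes A :: "('a, 's) ring_scheme" and M :: "('a, 'm, 'y) bimodule_scheme"
    and N :: "('a, 'n, 'z) bimodule_scheme"
  assumes M: "bimodule A M" and N: "bimodule A N"
begin

interpretation M: bimodule A M by (rule M)
interpretation N: bimodule A N by (rule N)
interpretation T: tensor_pair A M N by (rule tensor_pair_bimodule[OF M N])

lemma lact_tensor_balanced:
  "a \<in> carrier A \<Longrightarrow> balanced A M N (tensor A M N) (\<lambda>x y. tens A M N (lact M a x) y)"
  by (auto simp: balanced_def T.tens_closed M.lact_closed M.ract_closed N.lact_closed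
      M.lact_add T.tens_add_left T.tens_add_right T.tens_balanced intro!: additive_mapI simp flip: M.lact_ract)

lemma ract_tensor_balanced:
  "a \<in> carrier A \<Longrightarrow> balanced A M N (tensor A M N) (\<lambda>x y. tens A M N x (ract N y a))"
  by (auto simp: balanced_def T.tens_closed N.lact_closed N.ract_closed M.ract_closed
      N.ract_add T.tens_add_left T.tens_add_right N.lact_ract T.tens_balanced intro!: additive_mapI)

lemma lact_tens:
  assumes "a \<in> carrier A" "x \<in> carrier M" "y \<in> carrier N"
  shows "lact (tensor A M N) a (tens A M N x y) = tens A M N (lact M a x) y"
  using T.tensor_lift_tens[OF T.abelian_tensor lact_tensor_balanced] assms
  by (simp add: lact_tensor_lift)

lemma ract_tens:
  assumes "a \<in> carrier A" "x \<in> carrier M" "y \<in> carrier N"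
  shows "ract (tensor A M N) (tens A M N x y) a = tens A M N x (ract N y a)"
  using T.tensor_lift_tens[OF T.abelian_tensor ract_tensor_balanced] assms
  by (simp add: ract_tensor_lift)

lemma additive_lact_tensor:
  assumes "a \<in> carrier A"
  shows "additive_map (tensor A M N) (tensor A M N) (lact (tensor A M N) a)"
  unfolding lact_tensor_lift
  by (rule T.additive_tensor_lift[OF T.abelian_tensor lact_tensor_balanced[OF assms]])

lemma additive_ract_tensor:
  assumes "a \<in> carrier A"
  shows "additive_map (tensor A M N) (tensor A M N) (\<lambda>t. ract (tensor A M N) t a)"
  unfolding ract_tensor_lift
  by (rule T.additive_tensor_lift[OF T.abelian_tensor ract_tensor_balanced[OF assms]])

text \<open>Apart from closure and additivity, each axiom equates two additive functions of the
  tensor, so it is compared on pure tensors, where it reduces to axioms of \<open>M\<close> or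
  \<open>N\<close>.\<close>

lemma bimodule_tensor: "bimodule A (tensor A M N)"
proof -
  note l = additive_lact_tensor and r = additive_ract_tensor
  note simps = lact_tens ract_tens M.lact_closed M.ract_closed N.lact_closed N.ract_closed
  show ?thesis
  proof (intro bimoduleI left_moduleI right_moduleI)
    show "ring A" "abelian_group (tensor A M N)" "ring A" "abelian_group (tensor A M N)"
      by (simp_all add: M.A.ring_axioms T.abelian_tensor)
  next
    fix a x assume "a \<in> carrier A" "x \<in> carrier (tensor A M N)"
    then show "lact (tensor A M N) a x \<in> carrier (tensor A M N)"
        "ract (tensor A M N) x a \<in> carrier (tensor A M N)"
      by (rule additive_closed[OF l], rule additive_closed[OF r])
  next
    fix a x y assume "a \<in> carrier A" "x \<in> carrier (tensor A M N)" "y \<in> carrier (tensor A M N)"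
    then show "lact (tensor A M N) a (x \<oplus>\<^bsub>tensor A M N\<^esub> y) =
        lact (tensor A M N) a x \<oplus>\<^bsub>tensor A M N\<^esub> lact (tensor A M N) a y"
       "ract (tensor A M N) (x \<oplus>\<^bsub>tensor A M N\<^esub> y) a =
        ract (tensor A M N) x a \<oplus>\<^bsub>tensor A M N\<^esub> ract (tensor A M N) y a"
      by (rule additive_add[OF l], rule additive_add[OF r])
  next
    fix a b t assume ab: "a \<in> carrier A" "b \<in> carrier A" and t: "t \<in> carrier (tensor A M N)"
    show "lact (tensor A M N) (a \<oplus>\<^bsub>A\<^esub> b) t = lact (tensor A M N) a t \<oplus>\<^bsub>tensor A M N\<^esub> lact (tensor A M N) b t"
      by (rule T.tensor_eqI[OF l additive_plus[OF T.abelian_tensor l l] _ t])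
        (use ab in \<open>simp_all add: simps M.add_lact T.tens_add_left\<close>)
    show "ract (tensor A M N) t (a \<oplus>\<^bsub>A\<^esub> b) = ract (tensor A M N) t a \<oplus>\<^bsub>tensor A M N\<^esub> ract (tensor A M N) t b"
      by (rule T.tensor_eqI[OF r additive_plus[OF T.abelian_tensor r r] _ t])
        (use ab in \<open>simp_all add: simps N.add_ract T.tens_add_right\<close>)
    show "lact (tensor A M N) (a \<otimes>\<^bsub>A\<^esub> b) t = lact (tensor A M N) a (lact (tensor A M N) b t)"
      by (rule T.tensor_eqI[OF l additive_comp[OF l l] _ t])
        (use ab in \<open>simp_all add: simps M.mult_lact\<close>)
    show "ract (tensor A M N) t (a \<otimes>\<^bsub>A\<^esub> b) = ract (tensor A M N) (ract (tensor A M N) t a) b"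
      by (rule T.tensor_eqI[OF r additive_comp[OF r r] _ t])
        (use ab in \<open>simp_all add: simps N.mult_ract\<close>)
    show "ract (tensor A M N) (lact (tensor A M N) a t) b = lact (tensor A M N) a (ract (tensor A M N) t b)"
      by (rule T.tensor_eqI[OF additive_comp[OF l r] additive_comp[OF r l] _ t])
        (use ab in \<open>simp_all add: simps\<close>)
  next
    fix t assume t: "t \<in> carrier (tensor A M N)"
    show "lact (tensor A M N) \<one>\<^bsub>A\<^esub> t = t"
      by (rule T.tensor_eqI[OF l additive_id _ t]) (simp_all add: simps M.one_lact)
    show "ract (tensor A M N) t \<one>\<^bsub>A\<^esub> = t"
      by (rule T.tensor_eqI[OF r additive_id _ t]) (simp_all add: simps N.one_ract)
  qed
qed

end

lemma bimodule_regular: "ring A \<Longrightarrow> bimodule A (regular A)"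
proof -
  assume "ring A"
  then interpret ring A .
  have "abelian_group (regular A)"
    by (rule abelian_groupI) (auto simp: regular_def a_assoc intro: a_comm l_neg)
  then show ?thesis
    by (intro bimoduleI left_moduleI right_moduleI)
      (simp_all add: regular_def ring_axioms l_distr r_distr m_assoc)
qed

section \<open>Functoriality of the tensor product\<close>

context
  fixes A :: "('a, 's) ring_scheme"
    and M :: "('a, 'm, 'y1) bimodule_scheme" and N :: "('a, 'n, 'y2) bimodule_scheme"
    and M' :: "('a, 'm2, 'y3) bimodule_scheme" and N' :: "('a, 'n2, 'y4) bimodule_scheme" and f g
  assumes M: "right_module A M" and N: "left_module A N"
    and M': "right_module A M'" and N': "left_module A N'"
    and f: "right_linear A M M' f" and g: "left_linear A N N' g"
begin

interpretation T: tensor_pair A M N by (rule tensor_pairI[OF M N])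
interpretation T': tensor_pair A M' N' by (rule tensor_pairI[OF M' N'])

lemma tensor_map_tens:
  "x \<in> carrier M \<Longrightarrow> y \<in> carrier N \<Longrightarrow>
    tensor_map A M N M' N' f g (tens A M N x y) = tens A M' N' (f x) (g y)"
  using T.tensor_lift_tens[OF T'.abelian_tensor T.balanced_linear[OF M' N' f g]]
  by (simp add: tensor_map_def T.tens_closed)

lemma additive_tensor_map: "additive_map (tensor A M N) (tensor A M' N') (tensor_map A M N M' N' f g)"
  by (rule additive_cong[OF T.additive_tensor_lift[OF T'.abelian_tensor T.balanced_linear[OF M' N' f g]]])
    (simp_all add: tensor_map_def T.abelian_tensor abelian_group.axioms)

end

lemma tensor_map_closed:
  assumes "right_module A M" "left_module A N" "right_module A M'" "left_module A N'"
    "right_linear A M M' f" "left_linear A N N' g" "t \<in> carrier (tensor A M N)"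
  shows "tensor_map A M N M' N' f g t \<in> carrier (tensor A M' N')"
  using additive_closed[OF additive_tensor_map] assms by blast

text \<open>The composites enter as \<open>h\<close> and \<open>k\<close>, tied to
  \<open>f'\<close>, \<open>f\<close>, \<open>g'\<close>, \<open>g\<close> only by their values on
  the carriers. Hence restricted identities and maps built with \<open>compose\<close> are covered
  without further rewriting.\<close>

lemma tensor_map_comp:
  assumes m: "right_module A M" "left_module A N" "right_module A M'" "left_module A N'"
      "right_module A M''" "left_module A N''"
    and f: "right_linear A M M' f" "right_linear A M' M'' f'"
    and g: "left_linear A N N' g" "left_linear A N' N'' g'"
    and h: "right_linear A M M'' h" "\<And>x. x \<in> carrier M \<Longrightarrow> h x = f' (f x)"
    and k: "left_linear A N N'' k" "\<And>x. x \<in> carrier N \<Longrightarrow> k x = g' (g x)"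
    and t: "t \<in> carrier (tensor A M N)"
  shows "tensor_map A M' N' M'' N'' f' g' (tensor_map A M N M' N' f g t) =
    tensor_map A M N M'' N'' h k t"
proof -
  interpret T: tensor_pair A M N by (rule tensor_pairI) fact+
  have fc: "f x \<in> carrier M'" if "x \<in> carrier M" for x
    using additive_closed[OF right_linear_additive[OF f(1)] that] .
  have gc: "g x \<in> carrier N'" if "x \<in> carrier N" for x
    using additive_closed[OF left_linear_additive[OF g(1)] that] .
  show ?thesis
  proof (rule T.tensor_eqI[OF additive_comp[OF additive_tensor_map additive_tensor_map] additive_tensor_map _ t])
    fix x y assume "x \<in> carrier M" "y \<in> carrier N"
    then show "tensor_map A M' N' M'' N'' f' g' (tensor_map A M N M' N' f g (tens A M N x y)) =
        tensor_map A M N M'' N'' h k (tens A M N x y)"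
      by (simp add: tensor_map_tens m f g h k fc gc)
  qed (fact+)
qed

lemma tensor_map_hom:
  assumes m: "bimodule A M" "bimodule A N" "bimodule A M'" "bimodule A N'"
    and f: "f \<in> bimodule_hom A M M'" and g: "g \<in> bimodule_hom A N N'"
  shows "tensor_map A M N M' N' f g \<in> bimodule_hom A (tensor A M N) (tensor A M' N')"
proof (rule bimodule_homI)
  interpret T: tensor_pair A M N by (rule tensor_pair_bimodule) fact+
  interpret M: bimodule A M by fact
  interpret N: bimodule A N by fact
  note mm = bimodule_right[OF m(1)] bimodule_left[OF m(2)] bimodule_right[OF m(3)] bimodule_left[OF m(4)]
    bimodule_hom_right[OF f] bimodule_hom_left[OF g]
  show "tensor_map A M N M' N' f g \<in> extensional (carrier (tensor A M N))"
    by (simp add: tensor_map_def)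
  show add: "additive_map (tensor A M N) (tensor A M' N') (tensor_map A M N M' N' f g)"
    by (rule additive_tensor_map[OF mm])
  note simps = tensor_map_tens[OF mm] lact_tens ract_tens m bimodule_hom_closed[OF f] bimodule_hom_closed[OF g]
    M.lact_closed N.ract_closed bimodule_hom_lact[OF f] bimodule_hom_ract[OF g]
  fix a t assume a: "a \<in> carrier A" and t: "t \<in> carrier (tensor A M N)"
  note l = additive_lact_tensor[OF _ _ a] and r = additive_ract_tensor[OF _ _ a]
  show "tensor_map A M N M' N' f g (lact (tensor A M N) a t) = lact (tensor A M' N') a (tensor_map A M N M' N' f g t)"
    by (rule T.tensor_eqI[OF additive_comp[OF l[OF m(1,2)] add] additive_comp[OF add l[OF m(3,4)]] _ t])
      (simp add: simps a)
  show "tensor_map A M N M' N' f g (ract (tensor A M N) t a) = ract (tensor A M' N') (tensor_map A M N M' N' f g t) a"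
    by (rule T.tensor_eqI[OF additive_comp[OF r[OF m(1,2)] add] additive_comp[OF add r[OF m(3,4)]] _ t])
      (simp add: simps a)
qed

section \<open>Trilinear maps and the associator\<close>

context
  fixes A :: "('a, 's) ring_scheme" and L :: "('a, 'l, 'y1) bimodule_scheme"
    and M :: "('a, 'm, 'y2) bimodule_scheme" and N :: "('a, 'n, 'y3) bimodule_scheme"
    and G :: "('g, 'w) ring_scheme" and b :: "'l \<Rightarrow> 'm \<Rightarrow> 'n \<Rightarrow> 'g"
  assumes L: "bimodule A L" and M: "bimodule A M" and N: "bimodule A N" and G: "abelian_group G"
    and add1: "\<And>y z. y \<in> carrier M \<Longrightarrow> z \<in> carrier N \<Longrightarrow> additive_map L G (\<lambda>x. b x y z)"
    and add2: "\<And>x z. x \<in> carrier L \<Longrightarrow> z \<in> carrier N \<Longrightarrow> additive_map M G (\<lambda>y. b x y z)"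
    and add3: "\<And>x y. x \<in> carrier L \<Longrightarrow> y \<in> carrier M \<Longrightarrow> additive_map N G (\<lambda>z. b x y z)"
    and bal1: "\<And>x a y z. x \<in> carrier L \<Longrightarrow> a \<in> carrier A \<Longrightarrow> y \<in> carrier M \<Longrightarrow> z \<in> carrier N \<Longrightarrow>
      b (ract L x a) y z = b x (lact M a y) z"
    and bal2: "\<And>x a y z. x \<in> carrier L \<Longrightarrow> a \<in> carrier A \<Longrightarrow> y \<in> carrier M \<Longrightarrow> z \<in> carrier N \<Longrightarrow>
      b x (ract M y a) z = b x y (lact N a z)"
begin

interpretation L: bimodule A L by (rule L)
interpretation M: bimodule A M by (rule M)
interpretation N: bimodule A N by (rule N)
interpretation G: abelian_group G by (rule G)
interpretation LM: tensor_pair A L M by (rule tensor_pair_bimodule[OF L M])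
interpretation MN: tensor_pair A M N by (rule tensor_pair_bimodule[OF M N])
interpretation LM_N: tensor_pair A "tensor A L M" N by (rule tensor_pair_bimodule[OF bimodule_tensor[OF L M] N])
interpretation L_MN: tensor_pair A L "tensor A M N" by (rule tensor_pair_bimodule[OF L bimodule_tensor[OF M N]])

lemma bal_left: "z \<in> carrier N \<Longrightarrow> balanced A L M G (\<lambda>x y. b x y z)"
  using add1 add2 bal1 by (simp add: balanced_def)

lemma bal_right: "x \<in> carrier L \<Longrightarrow> balanced A M N G (b x)"
  using add2 add3 bal2 by (simp add: balanced_def)

text \<open>After lifting over the first two arguments, additivity and balance in \<open>z\<close>
  are equations between additive functions of \<open>u\<close>, hence follow from the case of pure
  tensors \<open>u\<close>.\<close>

lemma trilinear_left_balanced: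
  "balanced A (tensor A L M) N G (\<lambda>u z. pres_lift G (\<lambda>(x, y). b x y z) u)"
proof -
  note lift = LM.additive_tensor_lift[OF G bal_left] and lt = LM.tensor_lift_tens[OF G bal_left]
  have "additive_map N G (\<lambda>z. pres_lift G (\<lambda>(x, y). b x y z) u)" if u: "u \<in> carrier (tensor A L M)" for u
  proof (rule additive_mapI)
    fix z z' assume z: "z \<in> carrier N" "z' \<in> carrier N"
    show "pres_lift G (\<lambda>(x, y). b x y (z \<oplus>\<^bsub>N\<^esub> z')) u =
        pres_lift G (\<lambda>(x, y). b x y z) u \<oplus>\<^bsub>G\<^esub> pres_lift G (\<lambda>(x, y). b x y z') u"
      by (rule LM.tensor_eqI[OF lift additive_plus[OF G lift lift] _ u])
        (use z in \<open>simp_all add: lt additive_add[OF add3]\<close>)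
  qed (rule additive_closed[OF lift u])
  moreover have "pres_lift G (\<lambda>(x, y). b x y z) (ract (tensor A L M) u a) =
      pres_lift G (\<lambda>(x, y). b x y (lact N a z)) u"
    if u: "u \<in> carrier (tensor A L M)" and "a \<in> carrier A" "z \<in> carrier N" for u a z
    by (rule LM.tensor_eqI[OF additive_comp[OF additive_ract_tensor lift] lift _ u])
      (use that in \<open>simp_all add: L M lt ract_tens bal2 N.lact_closed M.ract_closed\<close>)
  ultimately show ?thesis
    using lift by (simp add: balanced_def)
qed

lemma trilinear_right_balanced:
  "balanced A L (tensor A M N) G (\<lambda>x. pres_lift G (\<lambda>(y, z). b x y z))"
proof -
  note lift = MN.additive_tensor_lift[OF G bal_right] and lt = MN.tensor_lift_tens[OF G bal_right]
  have "additive_map L G (\<lambda>x. pres_lift G (\<lambda>(y, z). b x y z) u)" if u: "u \<in> carrier (tensor A M N)" for u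
  proof (rule additive_mapI)
    fix x x' assume x: "x \<in> carrier L" "x' \<in> carrier L"
    show "pres_lift G (\<lambda>(y, z). b (x \<oplus>\<^bsub>L\<^esub> x') y z) u =
        pres_lift G (\<lambda>(y, z). b x y z) u \<oplus>\<^bsub>G\<^esub> pres_lift G (\<lambda>(y, z). b x' y z) u"
      by (rule MN.tensor_eqI[OF lift additive_plus[OF G lift lift] _ u])
        (use x in \<open>simp_all add: lt additive_add[OF add1]\<close>)
  qed (rule additive_closed[OF lift u])
  moreover have "pres_lift G (\<lambda>(y, z). b (ract L x a) y z) u =
      pres_lift G (\<lambda>(y, z). b x y z) (lact (tensor A M N) a u)"
    if u: "u \<in> carrier (tensor A M N)" and "a \<in> carrier A" "x \<in> carrier L" for u a x
    by (rule MN.tensor_eqI[OF lift additive_comp[OF additive_lact_tensor lift] _ u])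
      (use that in \<open>simp_all add: M N lt lact_tens bal1 L.ract_closed M.lact_closed\<close>)
  ultimately show ?thesis
    using lift by (simp add: balanced_def)
qed

lemma additive_trilinear_left:
  "additive_map (tensor A (tensor A L M) N) G
    (pres_lift G (\<lambda>(u, z). pres_lift G (\<lambda>(x, y). b x y z) u))"
  by (rule LM_N.additive_tensor_lift[OF G trilinear_left_balanced])

lemma trilinear_left_tens:
  assumes "x \<in> carrier L" "y \<in> carrier M" "z \<in> carrier N"
  shows "pres_lift G (\<lambda>(u, z). pres_lift G (\<lambda>(x, y). b x y z) u)
    (tens A (tensor A L M) N (tens A L M x y) z) = b x y z"
  using LM_N.tensor_lift_tens[OF G trilinear_left_balanced, of "tens A L M x y" z] assms
    LM.tensor_lift_tens[OF G bal_left]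
  by (simp add: LM.tens_closed)

lemma additive_trilinear_right:
  "additive_map (tensor A L (tensor A M N)) G
    (pres_lift G (\<lambda>(x, u). pres_lift G (\<lambda>(y, z). b x y z) u))"
  by (rule L_MN.additive_tensor_lift[OF G trilinear_right_balanced])

lemma trilinear_right_tens:
  assumes "x \<in> carrier L" "y \<in> carrier M" "z \<in> carrier N"
  shows "pres_lift G (\<lambda>(x, u). pres_lift G (\<lambda>(y, z). b x y z) u)
    (tens A L (tensor A M N) x (tens A M N y z)) = b x y z"
  using L_MN.tensor_lift_tens[OF G trilinear_right_balanced, of x "tens A M N y z"] assms
    MN.tensor_lift_tens[OF G bal_right]
  by (simp add: MN.tens_closed)

end

context
  fixes A :: "('a, 's) ring_scheme" and L :: "('a, 'l, 'y1) bimodule_scheme"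
    and M :: "('a, 'm, 'y2) bimodule_scheme" and N :: "('a, 'n, 'y3) bimodule_scheme"
  assumes L: "bimodule A L" and M: "bimodule A M" and N: "bimodule A N"
begin

interpretation L: bimodule A L by (rule L)
interpretation M: bimodule A M by (rule M)
interpretation N: bimodule A N by (rule N)
interpretation LM: tensor_pair A L M by (rule tensor_pair_bimodule[OF L M])
interpretation MN: tensor_pair A M N by (rule tensor_pair_bimodule[OF M N])
interpretation LM_N: tensor_pair A "tensor A L M" N by (rule tensor_pair_bimodule[OF bimodule_tensor[OF L M] N])
interpretation L_MN: tensor_pair A L "tensor A M N" by (rule tensor_pair_bimodule[OF L bimodule_tensor[OF M N]])

lemma tens3_trilinear:
  shows "y \<in> carrier M \<Longrightarrow> z \<in> carrier N \<Longrightarrow>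
      additive_map L (tensor A L (tensor A M N)) (\<lambda>x. tens A L (tensor A M N) x (tens A M N y z))"
    and "x \<in> carrier L \<Longrightarrow> z \<in> carrier N \<Longrightarrow>
      additive_map M (tensor A L (tensor A M N)) (\<lambda>y. tens A L (tensor A M N) x (tens A M N y z))"
    and "x \<in> carrier L \<Longrightarrow> y \<in> carrier M \<Longrightarrow>
      additive_map N (tensor A L (tensor A M N)) (\<lambda>z. tens A L (tensor A M N) x (tens A M N y z))"
    and "x \<in> carrier L \<Longrightarrow> a \<in> carrier A \<Longrightarrow> y \<in> carrier M \<Longrightarrow> z \<in> carrier N \<Longrightarrow>
      tens A L (tensor A M N) (ract L x a) (tens A M N y z) =
      tens A L (tensor A M N) x (tens A M N (lact M a y) z)"
    and "x \<in> carrier L \<Longrightarrow> a \<in> carrier A \<Longrightarrow> y \<in> carrier M \<Longrightarrow> z \<in> carrier N \<Longrightarrow>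
      tens A L (tensor A M N) x (tens A M N (ract M y a) z) =
      tens A L (tensor A M N) x (tens A M N y (lact N a z))"
  by (auto intro!: additive_mapI
      simp: L_MN.tens_closed MN.tens_closed L_MN.tens_add_left L_MN.tens_add_right
        MN.tens_add_left MN.tens_add_right MN.tens_balanced L_MN.tens_balanced lact_tens[OF M N])

lemma tensor_assoc_tens:
  "x \<in> carrier L \<Longrightarrow> y \<in> carrier M \<Longrightarrow> z \<in> carrier N \<Longrightarrow>
    tensor_assoc A L M N (tens A (tensor A L M) N (tens A L M x y) z) =
    tens A L (tensor A M N) x (tens A M N y z)"
  using trilinear_left_tens[OF L M N L_MN.abelian_tensor tens3_trilinear]
  by (simp add: tensor_assoc_def LM_N.tens_closed LM.tens_closed)

lemma additive_tensor_assoc: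
  "additive_map (tensor A (tensor A L M) N) (tensor A L (tensor A M N)) (tensor_assoc A L M N)"
  by (rule additive_cong[OF additive_trilinear_left[OF L M N L_MN.abelian_tensor tens3_trilinear]])
    (simp_all add: tensor_assoc_def LM_N.abelian_tensor abelian_group.axioms)

end

text \<open>Two records may carry the same bimodule and differ in the fields for multiplication,
  comultiplication or counit. Tensor products read none of those fields, so they are equal and not
  just isomorphic; a coring can thus be exchanged for its bare bimodule inside them.\<close>

definition same_ops :: "('a, 'm, 'y) bimodule_scheme \<Rightarrow> ('a, 'm, 'z) bimodule_scheme \<Rightarrow> bool"
  where "same_ops M N \<longleftrightarrow> carrier M = carrier N \<and> add M = add N \<and> \<zero>\<^bsub>M\<^esub> = \<zero>\<^bsub>N\<^esub> \<and>
    lact M = lact N \<and> ract M = ract N"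

context
  fixes M :: "('a, 'm, 'y1) bimodule_scheme" and M' :: "('a, 'm, 'y2) bimodule_scheme"
  assumes M: "same_ops M M'"
begin

lemma abelian_group_same_ops: "abelian_group M \<Longrightarrow> abelian_group M'"
  using M abelian_groupE[of M] by (intro abelian_groupI) (simp_all add: same_ops_def)

lemma bimodule_same_ops: "bimodule A M \<Longrightarrow> bimodule A M'"
proof -
  assume "bimodule A M"
  then interpret M: bimodule A M .
  have [simp]: "carrier M' = carrier M" "add M' = add M" "lact M' = lact M" "ract M' = ract M"
    using M by (simp_all add: same_ops_def)
  show ?thesis
    using abelian_group_same_ops[OF M.M.abelian_group_axioms]
    by (intro bimoduleI left_moduleI right_moduleI)
      (simp_all add: M.A.ring_axioms M.lact_closed M.ract_closed M.lact_add M.ract_add M.add_lact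
        M.add_ract M.mult_lact M.mult_ract M.one_lact M.one_ract M.lact_ract)
qed

lemma additive_same_ops: "additive_map M H f \<longleftrightarrow> additive_map M' H f" "additive_map H M g \<longleftrightarrow> additive_map H M' g"
  using M by (simp_all add: additive_map_def same_ops_def)

lemma bimodule_hom_same_ops:
  "bimodule_hom A M N = bimodule_hom A M' N" "bimodule_hom A N M = bimodule_hom A N M'"
  using M by (simp_all add: bimodule_hom_def same_ops_def)

end

lemma tensor_rels_same_ops:
  "same_ops M M' \<Longrightarrow> same_ops N N' \<Longrightarrow> tensor_rels A M N = tensor_rels A M' N'"
  by (simp add: same_ops_def tensor_rels_def)

lemma tens_same_ops: "same_ops M M' \<Longrightarrow> same_ops N N' \<Longrightarrow> tens A M N = tens A M' N'"
  using tensor_rels_same_ops[of M M' N N' A] by (intro ext) (simp add: same_ops_def tens_def)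

lemma tensor_same_ops:
  "same_ops M M' \<Longrightarrow> same_ops N N' \<Longrightarrow> tensor A M N = tensor A M' N'"
  using tensor_rels_same_ops[of M M' N N' A] tens_same_ops[of M M' N N' A]
  by (simp add: same_ops_def tensor_def tensor_group_def)

lemma tensor_map_same_ops:
  assumes "same_ops M M1" "same_ops N N1" "same_ops M' M1'" "same_ops N' N1'"
  shows "tensor_map A M N M' N' = tensor_map A M1 N1 M1' N1'"
  using tensor_same_ops[OF assms(1,2), of A] tensor_same_ops[OF assms(3,4), of A]
    tens_same_ops[OF assms(3,4), of A]
  by (intro ext) (simp add: tensor_map_def)

lemma same_ops_refl: "same_ops M M"
  by (simp add: same_ops_def)


section \<open>Unit isomorphisms\<close>

context
  fixes A :: "('a, 's) ring_scheme" and M :: "('a, 'm, 'y1) bimodule_scheme"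
  assumes M: "bimodule A M"
begin

interpretation M: bimodule A M by (rule M)
interpretation RM: tensor_pair A "regular A" M
  by (rule tensor_pair_bimodule[OF bimodule_regular[OF bimodule_ring[OF M]] M])
interpretation MR: tensor_pair A M "regular A"
  by (rule tensor_pair_bimodule[OF M bimodule_regular[OF bimodule_ring[OF M]]])

lemma lact_balanced: "balanced A (regular A) M M (lact M)"
  by (auto simp: balanced_def regular_def M.lact_closed M.lact_add M.add_lact M.mult_lact intro!: additive_mapI)

lemma ract_balanced: "balanced A M (regular A) M (ract M)"
  by (auto simp: balanced_def regular_def M.ract_closed M.ract_add M.add_ract M.mult_ract intro!: additive_mapI)

lemma tensor_lunit_tens:
  "a \<in> carrier A \<Longrightarrow> x \<in> carrier M \<Longrightarrow> tensor_lunit A M (tens A (regular A) M a x) = lact M a x"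
  using RM.tensor_lift_tens[OF bimodule_abelian[OF M] lact_balanced, of a x] RM.tens_closed[of a x]
  by (simp add: tensor_lunit_def regular_def)

lemma tensor_runit_tens:
  "a \<in> carrier A \<Longrightarrow> x \<in> carrier M \<Longrightarrow> tensor_runit A M (tens A M (regular A) x a) = ract M x a"
  using MR.tensor_lift_tens[OF bimodule_abelian[OF M] ract_balanced, of x a] MR.tens_closed[of x a]
  by (simp add: tensor_runit_def regular_def)

lemma additive_tensor_lunit: "additive_map (tensor A (regular A) M) M (tensor_lunit A M)"
  by (rule additive_cong[OF RM.additive_tensor_lift[OF bimodule_abelian[OF M] lact_balanced]])
    (simp_all add: tensor_lunit_def RM.abelian_tensor abelian_group.axioms)

lemma additive_tensor_runit: "additive_map (tensor A M (regular A)) M (tensor_runit A M)"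
  by (rule additive_cong[OF MR.additive_tensor_lift[OF bimodule_abelian[OF M] ract_balanced]])
    (simp_all add: tensor_runit_def MR.abelian_tensor abelian_group.axioms)

end


section \<open>Corings and their morphisms\<close>

text \<open>A coring without its three laws. Naturality of the laws along a morphism uses only this
  much, so a structure can be built on its own and its laws imported from another coring
  afterwards.\<close>

definition precoring :: "('a, 's) ring_scheme \<Rightarrow> ('a, 'c) coring \<Rightarrow> bool"
  where "precoring A C \<longleftrightarrow> bimodule A C \<and> comult C \<in> bimodule_hom A C (tensor A C C) \<and>
    counit C \<in> bimodule_hom A C (regular A)"

definition coassoc_left where
  "coassoc_left A C x = tensor_assoc A C C C
    (tensor_map A C C (tensor A C C) C (comult C) (\<lambda>y\<in>carrier C. y) (comult C x))"

definition coassoc_right where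
  "coassoc_right A C x = tensor_map A C C C (tensor A C C) (\<lambda>y\<in>carrier C. y) (comult C) (comult C x)"

definition counit_left where
  "counit_left A C x = tensor_lunit A C
    (tensor_map A C C (regular A) C (counit C) (\<lambda>y\<in>carrier C. y) (comult C x))"

definition counit_right where
  "counit_right A C x = tensor_runit A C
    (tensor_map A C C C (regular A) (\<lambda>y\<in>carrier C. y) (counit C) (comult C x))"

lemma coring_iff:
  "coring A C \<longleftrightarrow> precoring A C \<and>
    (\<forall>x\<in>carrier C. coassoc_left A C x = coassoc_right A C x \<and>
      counit_left A C x = x \<and> counit_right A C x = x)"
  by (auto simp: coring_def coring_axioms_def precoring_def coassoc_left_def coassoc_right_def
      counit_left_def counit_right_def)

lemma coring_precoring: "coring A C \<Longrightarrow> precoring A C"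
  by (simp add: coring_iff)

lemma coring_bimodule: "coring A C \<Longrightarrow> bimodule A C"
  by (simp add: coring_def)

lemma precoring_bimodule: "precoring A C \<Longrightarrow> bimodule A C"
  by (simp add: precoring_def)

lemma precoring_comult: "precoring A C \<Longrightarrow> comult C \<in> bimodule_hom A C (tensor A C C)"
  by (simp add: precoring_def)

lemma precoring_counit: "precoring A C \<Longrightarrow> counit C \<in> bimodule_hom A C (regular A)"
  by (simp add: precoring_def)

context
  fixes A :: "('a, 's) ring_scheme" and C :: "('a, 'c) coring"
  assumes C: "precoring A C"
begin

interpretation C: bimodule A C by (rule precoring_bimodule[OF C])
interpretation CC: tensor_pair A C C by (rule tensor_pair_bimodule[OF C.bimodule_axioms C.bimodule_axioms])

text \<open>Cited by position below: 1, 2 are the right and left sides of \<open>C\<close>, 3, 4 of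
  \<open>C \<otimes> C\<close>, 5, 6 of \<open>A\<close>; then right and left linearity of the
  identity (7, 8), of \<open>comult\<close> (9, 10) and of \<open>counit\<close> (11, 12).\<close>

lemmas mods = bimodule_right[OF C.bimodule_axioms] bimodule_left[OF C.bimodule_axioms]
  bimodule_right[OF bimodule_tensor[OF C.bimodule_axioms C.bimodule_axioms]]
  bimodule_left[OF bimodule_tensor[OF C.bimodule_axioms C.bimodule_axioms]]
  bimodule_right[OF bimodule_regular[OF C.A.ring_axioms]] bimodule_left[OF bimodule_regular[OF C.A.ring_axioms]]
  right_linear_id[OF C.right_module_axioms] left_linear_id[OF C.left_module_axioms]
  bimodule_hom_right[OF precoring_comult[OF C]] bimodule_hom_left[OF precoring_comult[OF C]]
  bimodule_hom_right[OF precoring_counit[OF C]] bimodule_hom_left[OF precoring_counit[OF C]]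

text \<open>Formulated for any \<open>t\<close> in \<open>C \<otimes> C\<close> and not only for
  values of \<open>comult\<close>, so that naturality can be verified on pure tensors.\<close>

lemma additive_coassoc_left_map:
  "additive_map (tensor A C C) (tensor A C (tensor A C C)) (\<lambda>t. tensor_assoc A C C C
    (tensor_map A C C (tensor A C C) C (comult C) (\<lambda>y\<in>carrier C. y) t))"
  by (rule additive_comp[OF additive_tensor_map additive_tensor_assoc]) (fact mods C.bimodule_axioms)+

lemma additive_coassoc_right_map:
  "additive_map (tensor A C C) (tensor A C (tensor A C C))
    (tensor_map A C C C (tensor A C C) (\<lambda>y\<in>carrier C. y) (comult C))"
  by (rule additive_tensor_map) (fact mods)+

lemma additive_counit_left_map:
  "additive_map (tensor A C C) C (\<lambda>t. tensor_lunit A C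
    (tensor_map A C C (regular A) C (counit C) (\<lambda>y\<in>carrier C. y) t))"
  by (rule additive_comp[OF additive_tensor_map additive_tensor_lunit]) (fact mods C.bimodule_axioms)+

lemma additive_counit_right_map:
  "additive_map (tensor A C C) C (\<lambda>t. tensor_runit A C
    (tensor_map A C C C (regular A) (\<lambda>y\<in>carrier C. y) (counit C) t))"
  by (rule additive_comp[OF additive_tensor_map additive_tensor_runit]) (fact mods C.bimodule_axioms)+

lemmas additive_comult = bimodule_hom_additive[OF precoring_comult[OF C]]

lemma additive_coassoc_left: "additive_map C (tensor A C (tensor A C C)) (coassoc_left A C)"
  using additive_comp[OF additive_comult additive_coassoc_left_map] by (simp add: coassoc_left_def[abs_def])

lemma additive_coassoc_right: "additive_map C (tensor A C (tensor A C C)) (coassoc_right A C)"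
  using additive_comp[OF additive_comult additive_coassoc_right_map] by (simp add: coassoc_right_def[abs_def])

lemma additive_counit_left: "additive_map C C (counit_left A C)"
  using additive_comp[OF additive_comult additive_counit_left_map] by (simp add: counit_left_def[abs_def])

lemma additive_counit_right: "additive_map C C (counit_right A C)"
  using additive_comp[OF additive_comult additive_counit_right_map] by (simp add: counit_right_def[abs_def])

end

lemma coring_hom_bimodule_hom: "f \<in> coring_hom A C D \<Longrightarrow> f \<in> bimodule_hom A C D"
  by (simp add: coring_hom_def)

lemma coring_hom_comult:
  "f \<in> coring_hom A C D \<Longrightarrow> x \<in> carrier C \<Longrightarrow> comult D (f x) = tensor_map A C C D D f f (comult C x)"
  by (simp add: coring_hom_def)

lemma coring_hom_counit: "f \<in> coring_hom A C D \<Longrightarrow> x \<in> carrier C \<Longrightarrow> counit D (f x) = counit C x"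
  by (simp add: coring_hom_def)

lemma coring_hom_closed: "f \<in> coring_hom A C D \<Longrightarrow> x \<in> carrier C \<Longrightarrow> f x \<in> carrier D"
  by (rule bimodule_hom_closed[OF coring_hom_bimodule_hom])

section \<open>Naturality of the coring laws along a morphism\<close>

context
  fixes A :: "('a, 's) ring_scheme" and C :: "('a, 'c) coring" and D :: "('a, 'd) coring" and g
  assumes C: "precoring A C" and D: "precoring A D" and g: "g \<in> coring_hom A C D"
begin

interpretation C: bimodule A C by (rule precoring_bimodule[OF C])
interpretation D: bimodule A D by (rule precoring_bimodule[OF D])
interpretation CC: tensor_pair A C C by (rule tensor_pair_bimodule[OF C.bimodule_axioms C.bimodule_axioms])
interpretation DD: tensor_pair A D D by (rule tensor_pair_bimodule[OF D.bimodule_axioms D.bimodule_axioms])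
interpretation CC_C: tensor_pair A "tensor A C C" C
  by (rule tensor_pair_bimodule[OF bimodule_tensor[OF C.bimodule_axioms C.bimodule_axioms] C.bimodule_axioms])
interpretation DD_D: tensor_pair A "tensor A D D" D
  by (rule tensor_pair_bimodule[OF bimodule_tensor[OF D.bimodule_axioms D.bimodule_axioms] D.bimodule_axioms])

lemmas g_hom = coring_hom_bimodule_hom[OF g]
lemmas gg_hom = tensor_map_hom[OF C.bimodule_axioms C.bimodule_axioms D.bimodule_axioms D.bimodule_axioms g_hom g_hom]
lemmas g_lin = bimodule_hom_right[OF g_hom] bimodule_hom_left[OF g_hom]
  bimodule_hom_right[OF gg_hom] bimodule_hom_left[OF gg_hom]
lemmas add_gg = bimodule_hom_additive[OF gg_hom]

lemma add_ggg: "additive_map (tensor A C (tensor A C C)) (tensor A D (tensor A D D))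
    (tensor_map A C (tensor A C C) D (tensor A D D) g (tensor_map A C C D D g g))"
  by (rule additive_tensor_map) (fact mods[OF C] mods[OF D] g_lin)+

lemmas simps = coring_hom_comult[OF g] coring_hom_counit[OF g] coring_hom_closed[OF g] bimodule_hom_closed[OF gg_hom]
  bimodule_hom_closed[OF precoring_comult[OF C]] CC.tens_closed DD.tens_closed
  bimodule_hom_closed[OF precoring_counit[OF C]] bimodule_hom_closed[OF precoring_counit[OF D]]

text \<open>The first factor is an arbitrary tensor \<open>u\<close>, because once
  \<open>comult\<close> has been applied to the first leg of a pure tensor, that leg is no longer
  pure.\<close>

lemma assoc_natural:
  assumes u: "u \<in> carrier (tensor A C C)" and y: "y \<in> carrier C"
  shows "tensor_assoc A D D D (tens A (tensor A D D) D (tensor_map A C C D D g g u) (g y)) =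
    tensor_map A C (tensor A C C) D (tensor A D D) g (tensor_map A C C D D g g)
      (tensor_assoc A C C C (tens A (tensor A C C) C u y))"
proof -
  have l: "additive_map (tensor A D D) (tensor A (tensor A D D) D) (\<lambda>u. tens A (tensor A D D) D u (g y))"
    using DD_D.balanced_tens coring_hom_closed[OF g y] by (simp add: balanced_def)
  have r: "additive_map (tensor A C C) (tensor A (tensor A C C) C) (\<lambda>u. tens A (tensor A C C) C u y)"
    using CC_C.balanced_tens y by (simp add: balanced_def)
  note assoc = additive_tensor_assoc[OF C.bimodule_axioms C.bimodule_axioms C.bimodule_axioms]
    additive_tensor_assoc[OF D.bimodule_axioms D.bimodule_axioms D.bimodule_axioms]
  note mt = tensor_map_tens[OF mods(1,2)[OF C] mods(1,2)[OF D] g_lin(1,2)]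
    tensor_map_tens[OF mods(1,4)[OF C] mods(1,4)[OF D] g_lin(1,4)]
  show ?thesis
    by (rule CC.tensor_eqI[OF additive_comp[OF additive_comp[OF add_gg l] assoc(2)]
          additive_comp[OF additive_comp[OF r assoc(1)] add_ggg] _ u])
      (simp add: mt simps y tensor_assoc_tens C.bimodule_axioms D.bimodule_axioms)
qed

text \<open>Since \<open>g\<close> commutes with \<open>comult\<close>, both sides are additive
  functions of the single tensor \<open>comult C x\<close>. On pure tensors the claim is once more
  compatibility of \<open>g\<close> with \<open>comult\<close>, followed by naturality of the
  associator.\<close>

lemma coassoc_left_natural:
  assumes "x \<in> carrier C"
  shows "coassoc_left A D (g x) =
    tensor_map A C (tensor A C C) D (tensor A D D) g (tensor_map A C C D D g g) (coassoc_left A C x)"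
proof -
  note mt = tensor_map_tens[OF mods(1,2)[OF C] mods(1,2)[OF D] g_lin(1,2)]
    tensor_map_tens[OF mods(1,2)[OF C] mods(3,2)[OF C] mods(9,8)[OF C]]
    tensor_map_tens[OF mods(1,2)[OF D] mods(3,2)[OF D] mods(9,8)[OF D]]
  have t: "comult C x \<in> carrier (tensor A C C)"
    using assms by (simp add: simps)
  show ?thesis
    unfolding coassoc_left_def coring_hom_comult[OF g assms]
    by (rule CC.tensor_eqI[OF additive_comp[OF add_gg additive_coassoc_left_map[OF D]]
          additive_comp[OF additive_coassoc_left_map[OF C] add_ggg] _ t])
      (simp add: mt simps assoc_natural)
qed

lemma coassoc_right_natural:
  assumes "x \<in> carrier C"
  shows "coassoc_right A D (g x) =
    tensor_map A C (tensor A C C) D (tensor A D D) g (tensor_map A C C D D g g) (coassoc_right A C x)"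
proof -
  note mt = tensor_map_tens[OF mods(1,2)[OF C] mods(1,2)[OF D] g_lin(1,2)]
    tensor_map_tens[OF mods(1,2)[OF C] mods(1,4)[OF C] mods(7,10)[OF C]]
    tensor_map_tens[OF mods(1,2)[OF D] mods(1,4)[OF D] mods(7,10)[OF D]]
    tensor_map_tens[OF mods(1,4)[OF C] mods(1,4)[OF D] g_lin(1,4)]
  have t: "comult C x \<in> carrier (tensor A C C)"
    using assms by (simp add: simps)
  show ?thesis
    unfolding coassoc_right_def coring_hom_comult[OF g assms]
    by (rule CC.tensor_eqI[OF additive_comp[OF add_gg additive_coassoc_right_map[OF D]]
          additive_comp[OF additive_coassoc_right_map[OF C] add_ggg] _ t])
      (simp add: mt simps)
qed

lemma carrier_regular: "carrier (regular A) = carrier A"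
  by (simp add: regular_def)

lemma counit_left_natural:
  assumes "x \<in> carrier C"
  shows "counit_left A D (g x) = g (counit_left A C x)"
proof -
  note mt = tensor_map_tens[OF mods(1,2)[OF C] mods(1,2)[OF D] g_lin(1,2)]
    tensor_map_tens[OF mods(1,2)[OF C] mods(5,2)[OF C] mods(11,8)[OF C]]
    tensor_map_tens[OF mods(1,2)[OF D] mods(5,2)[OF D] mods(11,8)[OF D]]
  have t: "comult C x \<in> carrier (tensor A C C)"
    using assms by (simp add: simps)
  show ?thesis
    unfolding counit_left_def coring_hom_comult[OF g assms]
    by (rule CC.tensor_eqI[OF additive_comp[OF add_gg additive_counit_left_map[OF D]]
          additive_comp[OF additive_counit_left_map[OF C] bimodule_hom_additive[OF g_hom]] _ t])
      (simp add: mt simps[unfolded carrier_regular] tensor_lunit_tens C.bimodule_axioms D.bimodule_axioms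
        bimodule_hom_lact[OF g_hom])
qed

lemma counit_right_natural:
  assumes "x \<in> carrier C"
  shows "counit_right A D (g x) = g (counit_right A C x)"
proof -
  note mt = tensor_map_tens[OF mods(1,2)[OF C] mods(1,2)[OF D] g_lin(1,2)]
    tensor_map_tens[OF mods(1,2)[OF C] mods(1,6)[OF C] mods(7,12)[OF C]]
    tensor_map_tens[OF mods(1,2)[OF D] mods(1,6)[OF D] mods(7,12)[OF D]]
  have t: "comult C x \<in> carrier (tensor A C C)"
    using assms by (simp add: simps)
  show ?thesis
    unfolding counit_right_def coring_hom_comult[OF g assms]
    by (rule CC.tensor_eqI[OF additive_comp[OF add_gg additive_counit_right_map[OF D]]
          additive_comp[OF additive_counit_right_map[OF C] bimodule_hom_additive[OF g_hom]] _ t])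
      (simp add: mt simps[unfolded carrier_regular] tensor_runit_tens C.bimodule_axioms D.bimodule_axioms
        bimodule_hom_ract[OF g_hom])
qed

text \<open>By naturality \<open>g\<close> carries the laws at \<open>x\<close> to the laws at
  \<open>g x\<close>. This serves structures that are covered by images of corings, such as copies
  and colimits.\<close>

lemma coring_axioms_image:
  assumes "coring A C" "x \<in> carrier C"
  shows "coassoc_left A D (g x) = coassoc_right A D (g x)" "counit_left A D (g x) = g x"
    "counit_right A D (g x) = g x"
  using assms coassoc_left_natural coassoc_right_natural counit_left_natural counit_right_natural
  by (simp_all add: coring_iff)

text \<open>The laws hold in \<open>D\<close> at \<open>g x\<close> and are pulled back through
  injectivity: in \<open>C\<close> itself for the counits, and in the threefold product for
  coassociativity.\<close>

lemma coring_reflect: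
  assumes D': "coring A D" and inj: "inj_on g (carrier C)"
    and inj3: "inj_on (tensor_map A C (tensor A C C) D (tensor A D D) g (tensor_map A C C D D g g))
      (carrier (tensor A C (tensor A C C)))"
  shows "coring A C"
proof -
  have "coassoc_left A C x = coassoc_right A C x \<and> counit_left A C x = x \<and> counit_right A C x = x"
    if x: "x \<in> carrier C" for x
  proof (intro conjI)
    have gx: "coassoc_left A D (g x) = coassoc_right A D (g x)" "counit_left A D (g x) = g x"
        "counit_right A D (g x) = g x"
      using D' coring_hom_closed[OF g x] by (simp_all add: coring_iff)
    show "coassoc_left A C x = coassoc_right A C x"
      using gx(1) x by (intro inj_onD[OF inj3])
        (simp_all add: coassoc_left_natural coassoc_right_natural
          additive_closed[OF additive_coassoc_left[OF C]] additive_closed[OF additive_coassoc_right[OF C]])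
    show "counit_left A C x = x"
      using gx(2) x by (intro inj_onD[OF inj])
        (simp_all add: counit_left_natural additive_closed[OF additive_counit_left[OF C]])
    show "counit_right A C x = x"
      using gx(3) x by (intro inj_onD[OF inj])
        (simp_all add: counit_right_natural additive_closed[OF additive_counit_right[OF C]])
  qed
  then show ?thesis
    using C by (simp add: coring_iff)
qed

end

lemma tensor_map_id:
  assumes M: "bimodule A M" and N: "bimodule A N" and t: "t \<in> carrier (tensor A M N)"
  shows "tensor_map A M N M N (\<lambda>x\<in>carrier M. x) (\<lambda>x\<in>carrier N. x) t = t"
proof -
  interpret T: tensor_pair A M N by (rule tensor_pair_bimodule[OF M N])
  note lin = T.right_M T.left_N T.right_M T.left_N right_linear_id[OF T.right_M] left_linear_id[OF T.left_N]
  show ?thesis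
    by (rule T.tensor_eqI[OF additive_tensor_map[OF lin] additive_id _ t]) (simp add: tensor_map_tens[OF lin])
qed

lemma coring_hom_id: "precoring A C \<Longrightarrow> (\<lambda>x\<in>carrier C. x) \<in> coring_hom A C C"
  by (simp add: coring_hom_def bimodule_hom_id precoring_bimodule tensor_map_id
      bimodule_hom_closed[OF precoring_comult])

lemma coring_hom_compose:
  assumes C: "precoring A C" and D: "precoring A D" and E: "precoring A E"
    and f: "f \<in> coring_hom A C D" and g: "g \<in> coring_hom A D E"
  shows "compose (carrier C) g f \<in> coring_hom A C E"
proof -
  note fh = coring_hom_bimodule_hom[OF f] and gh = coring_hom_bimodule_hom[OF g]
  note gfh = bimodule_hom_compose[OF precoring_bimodule[OF C] fh gh]
  have "tensor_map A D D E E g g (tensor_map A C C D D f f t) =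
      tensor_map A C C E E (compose (carrier C) g f) (compose (carrier C) g f) t"
    if t: "t \<in> carrier (tensor A C C)" for t
    by (rule tensor_map_comp[OF mods(1,2)[OF C] mods(1,2)[OF D] mods(1,2)[OF E]
          bimodule_hom_right[OF fh] bimodule_hom_right[OF gh] bimodule_hom_left[OF fh] bimodule_hom_left[OF gh]
          bimodule_hom_right[OF gfh] _ bimodule_hom_left[OF gfh] _ t]) (simp_all add: compose_def)
  then show ?thesis
    using gfh by (simp add: coring_hom_def compose_eq coring_hom_comult[OF f] coring_hom_comult[OF g]
        coring_hom_counit[OF f] coring_hom_counit[OF g] coring_hom_closed[OF f]
        bimodule_hom_closed[OF precoring_comult[OF C]])
qed

text \<open>Injectivity of \<open>g\<close> yields the factor as a map and makes it linear.
  Injectivity of \<open>g \<otimes> g\<close> makes it respect comultiplication, since that equation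
  lives in \<open>G \<otimes> G\<close>.\<close>

lemma coring_hom_factor:
  assumes H: "precoring A H" and G: "precoring A G" and E: "precoring A E"
    and k: "k \<in> coring_hom A H E" and g: "g \<in> coring_hom A G E"
    and inj: "inj_on g (carrier G)" and inj2: "inj_on (tensor_map A G G E E g g) (carrier (tensor A G G))"
    and sub: "k ` carrier H \<subseteq> g ` carrier G"
  obtains k' where "k' \<in> coring_hom A H G" "\<And>x. x \<in> carrier H \<Longrightarrow> g (k' x) = k x"
proof
  interpret H: bimodule A H by (rule precoring_bimodule[OF H])
  interpret G: bimodule A G by (rule precoring_bimodule[OF G])
  note gh = coring_hom_bimodule_hom[OF g] and kh = coring_hom_bimodule_hom[OF k]
  define k' where "k' = (\<lambda>x\<in>carrier H. inv_into (carrier G) g (k x))"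
  have cl: "k' x \<in> carrier G" and gk: "g (k' x) = k x" if "x \<in> carrier H" for x
  proof -
    have "k x \<in> g ` carrier G"
      using sub that by blast
    then show "k' x \<in> carrier G" "g (k' x) = k x"
      using that by (auto simp: k'_def inv_into_into f_inv_into_f)
  qed
  have eqI: "y = z" if "g y = g z" "y \<in> carrier G" "z \<in> carrier G" for y z
    using inj that by (auto dest: inj_onD)
  have k'h: "k' \<in> bimodule_hom A H G"
  proof (rule bimodule_homI)
    show "k' \<in> extensional (carrier H)"
      by (simp add: k'_def)
    show "additive_map H G k'"
    proof (rule additive_mapI)
      fix x y assume "x \<in> carrier H" "y \<in> carrier H"
      then show "k' (x \<oplus>\<^bsub>H\<^esub> y) = k' x \<oplus>\<^bsub>G\<^esub> k' y"
        by (intro eqI) (simp_all add: cl gk additive_add[OF bimodule_hom_additive[OF gh]]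
            additive_add[OF bimodule_hom_additive[OF kh]])
    qed (rule cl)
  next
    fix a x assume "a \<in> carrier A" "x \<in> carrier H"
    then show "k' (lact H a x) = lact G a (k' x)" "k' (ract H x a) = ract G (k' x) a"
      by (intro eqI; simp add: cl gk H.lact_closed G.lact_closed H.ract_closed G.ract_closed
          bimodule_hom_lact[OF gh] bimodule_hom_lact[OF kh] bimodule_hom_ract[OF gh] bimodule_hom_ract[OF kh])+
  qed
  have "comult G (k' x) = tensor_map A H H G G k' k' (comult H x)" if x: "x \<in> carrier H" for x
  proof (rule inj_onD[OF inj2])
    have t: "comult H x \<in> carrier (tensor A H H)"
      using bimodule_hom_closed[OF precoring_comult[OF H] x] .
    have "tensor_map A G G E E g g (tensor_map A H H G G k' k' (comult H x)) = tensor_map A H H E E k k (comult H x)"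
      by (rule tensor_map_comp[OF mods(1,2)[OF H] mods(1,2)[OF G] mods(1,2)[OF E]
            bimodule_hom_right[OF k'h] bimodule_hom_right[OF gh] bimodule_hom_left[OF k'h] bimodule_hom_left[OF gh]
            bimodule_hom_right[OF kh] _ bimodule_hom_left[OF kh] _ t]) (simp_all add: gk)
    then show "tensor_map A G G E E g g (comult G (k' x)) =
        tensor_map A G G E E g g (tensor_map A H H G G k' k' (comult H x))"
      using x by (simp add: cl gk coring_hom_comult[OF k] flip: coring_hom_comult[OF g])
    show "comult G (k' x) \<in> carrier (tensor A G G)"
      using bimodule_hom_closed[OF precoring_comult[OF G] cl[OF x]] .
    show "tensor_map A H H G G k' k' (comult H x) \<in> carrier (tensor A G G)"
      by (rule tensor_map_closed[OF mods(1,2)[OF H] mods(1,2)[OF G] bimodule_hom_right[OF k'h]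
            bimodule_hom_left[OF k'h] t])
  qed
  moreover have "counit G (k' x) = counit H x" if "x \<in> carrier H" for x
    using that cl gk coring_hom_counit[OF g] coring_hom_counit[OF k] by metis
  ultimately show "k' \<in> coring_hom A H G"
    using k'h by (simp add: coring_hom_def)
  show "\<And>x. x \<in> carrier H \<Longrightarrow> g (k' x) = k x"
    by (rule gk)
qed

section \<open>Cardinal bounds for closures\<close>

lemma lepoll_iff_ordLeq: "A \<lesssim> B \<longleftrightarrow> |A| \<le>o |B|"
  by (simp add: lepoll_def card_of_ordLeq)

lemma lepoll_UN:
  "infinite B \<Longrightarrow> I \<lesssim> B \<Longrightarrow> (\<And>i. i \<in> I \<Longrightarrow> X i \<lesssim> B) \<Longrightarrow> (\<Union>i\<in>I. X i) \<lesssim> B"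
  by (simp add: lepoll_iff_ordLeq card_of_UNION_ordLeq_infinite)

lemma lepoll_Times: "infinite B \<Longrightarrow> X \<lesssim> B \<Longrightarrow> Y \<lesssim> B \<Longrightarrow> X \<times> Y \<lesssim> B"
  by (simp add: lepoll_iff_ordLeq card_of_Times_ordLeq_infinite)

lemma lepoll_Un: "infinite B \<Longrightarrow> X \<lesssim> B \<Longrightarrow> Y \<lesssim> B \<Longrightarrow> X \<union> Y \<lesssim> B"
  by (simp add: lepoll_iff_ordLeq card_of_Un_ordLeq_infinite)

lemma lepoll_lists: "infinite B \<Longrightarrow> X \<lesssim> B \<Longrightarrow> lists X \<lesssim> B"
  unfolding lepoll_iff_ordLeq
  using ordLeq_ordIso_trans[OF card_of_lists_mono card_of_lists_infinite] by blast

lemma lepoll_countable: "countable X \<Longrightarrow> infinite B \<Longrightarrow> X \<lesssim> B"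
  by (meson countable_def infinite_le_lepoll lepoll_def lepoll_trans subset_UNIV)

text \<open>The disjoint sum stands for |S| + |X| + aleph_0. Its last summand is infinite, so it has
  the size of one of its terms; the disjunction expresses a maximum without naming
  cardinals.\<close>

lemma lepoll_max:
  assumes "D \<lesssim> S <+> (X <+> (UNIV :: nat set))"
  shows "D \<lesssim> S \<or> D \<lesssim> X \<or> D \<lesssim> (UNIV :: nat set)"
proof -
  have max: "Y <+> Z \<lesssim> Y \<or> Y <+> Z \<lesssim> Z" if "infinite Z" for Y :: "'x set" and Z :: "'y set"
  proof (cases "Y \<lesssim> Z")
    case True
    then show ?thesis
      using that card_of_Plus_infinite[of Z Y] by (auto simp: lepoll_iff_ordLeq ordIso_iff_ordLeq)
  next
    case False
    then have "Z \<lesssim> Y"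
      using ordLeq_total[OF card_of_Well_order card_of_Well_order, of Y Z] unfolding lepoll_iff_ordLeq by blast
    then show ?thesis
      using that card_of_Plus_infinite[of Y Z] lepoll_trans
      by (auto simp: lepoll_iff_ordLeq ordIso_iff_ordLeq card_of_ordLeq_infinite)
  qed
  have "infinite (X <+> (UNIV :: nat set))"
    by simp
  from max[OF this, of S] max[of "UNIV :: nat set" X] show ?thesis
    using assms lepoll_trans by (metis infinite_UNIV_nat)
qed

text \<open>The set is a union of countably many closing-off steps. Each step adds countable sets
  indexed by parameters and finite lists, hence stays below the infinite \<open>B\<close>. A finite
  list of elements of the union already occurs at one stage, and the next stage contains what it
  demands.\<close>

lemma closure_exists:
  fixes F :: "'p \<Rightarrow> 'c list \<Rightarrow> 'c set"
  assumes S: "S \<subseteq> U" "S \<lesssim> B" and P: "P \<lesssim> B" and B: "infinite B"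
    and F: "\<And>p ys. p \<in> P \<Longrightarrow> set ys \<subseteq> U \<Longrightarrow> F p ys \<subseteq> U"
      "\<And>p ys. p \<in> P \<Longrightarrow> set ys \<subseteq> U \<Longrightarrow> countable (F p ys)"
  shows "\<exists>D. S \<subseteq> D \<and> D \<subseteq> U \<and> D \<lesssim> B \<and> (\<forall>p\<in>P. \<forall>ys. set ys \<subseteq> D \<longrightarrow> F p ys \<subseteq> D)"
proof (intro exI conjI ballI allI impI)
  define step where "step X = X \<union> (\<Union>p\<in>P. \<Union>ys\<in>lists X. F p ys)" for X
  define X where "X n = (step ^^ n) S" for n
  have X: "X 0 = S" "X (Suc n) = step (X n)" for n
    by (simp_all add: X_def)
  have mono: "m \<le> n \<Longrightarrow> X m \<subseteq> X n" for m n
    by (rule lift_Suc_mono_le) (auto simp: X step_def)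
  have U: "X n \<subseteq> U" for n
  proof (induction n)
    case (Suc n)
    then show ?case
      using F(1) by (force simp: X step_def)
  qed (simp add: X S)
  have card: "X n \<lesssim> B" for n
  proof (induction n)
    case (Suc n)
    have "F p ys \<lesssim> B" if "p \<in> P" "ys \<in> lists (X n)" for p ys
      using F(2) that U[of n] B by (intro lepoll_countable) auto
    then show ?case
      unfolding X step_def using Suc P B by (intro lepoll_Un lepoll_UN lepoll_lists)
  qed (simp add: X S)
  show "S \<subseteq> (\<Union>n. X n)"
    using X(1) by blast
  show "(\<Union>n. X n) \<subseteq> U"
    using U by blast
  show "(\<Union>n. X n) \<lesssim> B"
    using card B infinite_le_lepoll by (intro lepoll_UN) auto
  fix p ys assume p: "p \<in> P" and ys: "set ys \<subseteq> (\<Union>n. X n)"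
  have "\<exists>n. set ys \<subseteq> X n"
    using ys
  proof (induction ys)
    case (Cons y ys)
    then obtain m n where "y \<in> X m" "set ys \<subseteq> X n"
      by auto
    then show ?case
      using mono[of m "max m n"] mono[of n "max m n"] by (intro exI[of _ "max m n"]) auto
  qed simp
  then obtain n where "set ys \<subseteq> X n" by blast
  then have "F p ys \<subseteq> X (Suc n)"
    using p by (force simp: X step_def in_lists_conv_set)
  then show "F p ys \<subseteq> (\<Union>n. X n)"
    by blast
qed


section \<open>Finite partial homomorphisms and purity\<close>

text \<open>Totality of \<open>\<sigma>\<close> guarantees that every renamed word is a word over
  \<open>N\<close>. The equations are confined to a fragment because one relation sees no more, and
  demanding them everywhere would ask for a true homomorphism, which need not exist.\<close>

definition local_hom ::
  "('a, 'm, 'y) bimodule_scheme \<Rightarrow> ('a, 'n, 'z) bimodule_scheme \<Rightarrow> 'm set \<Rightarrow> 'a set \<Rightarrow> ('m \<Rightarrow> 'n) \<Rightarrow> bool"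
  where "local_hom M N T B \<sigma> \<longleftrightarrow> \<sigma> \<in> carrier M \<rightarrow> carrier N \<and>
    (\<forall>x\<in>T. \<forall>y\<in>T. x \<oplus>\<^bsub>M\<^esub> y \<in> T \<longrightarrow> \<sigma> (x \<oplus>\<^bsub>M\<^esub> y) = \<sigma> x \<oplus>\<^bsub>N\<^esub> \<sigma> y) \<and>
    (\<forall>a\<in>B. \<forall>x\<in>T. lact M a x \<in> T \<longrightarrow> \<sigma> (lact M a x) = lact N a (\<sigma> x)) \<and>
    (\<forall>a\<in>B. \<forall>x\<in>T. ract M x a \<in> T \<longrightarrow> \<sigma> (ract M x a) = ract N (\<sigma> x) a)"

lemma local_hom_mono: "local_hom M N T B \<sigma> \<Longrightarrow> T' \<subseteq> T \<Longrightarrow> B' \<subseteq> B \<Longrightarrow> local_hom M N T' B' \<sigma>"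
  unfolding local_hom_def by blast

lemma local_homD:
  assumes "local_hom M N T B \<sigma>"
  shows "x \<in> carrier M \<Longrightarrow> \<sigma> x \<in> carrier N"
    and "x \<in> T \<Longrightarrow> y \<in> T \<Longrightarrow> x \<oplus>\<^bsub>M\<^esub> y \<in> T \<Longrightarrow> \<sigma> (x \<oplus>\<^bsub>M\<^esub> y) = \<sigma> x \<oplus>\<^bsub>N\<^esub> \<sigma> y"
    and "a \<in> B \<Longrightarrow> x \<in> T \<Longrightarrow> lact M a x \<in> T \<Longrightarrow> \<sigma> (lact M a x) = lact N a (\<sigma> x)"
    and "a \<in> B \<Longrightarrow> x \<in> T \<Longrightarrow> ract M x a \<in> T \<Longrightarrow> \<sigma> (ract M x a) = ract N (\<sigma> x) a"
  using assms unfolding local_hom_def by blast+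

lemma local_hom_id: "local_hom M M T B (\<lambda>x. x)"
  by (simp add: local_hom_def)

section \<open>Renaming generators, and the finite support of tensor relations\<close>

definition map_frag :: "('s \<Rightarrow> 't) \<Rightarrow> ('s \<Rightarrow>\<^sub>0 int) \<Rightarrow> ('t \<Rightarrow>\<^sub>0 int)"
  where "map_frag f = frag_extend (\<lambda>s. frag_of (f s))"

lemma map_frag_simps:
  "map_frag f (frag_of s) = frag_of (f s)" "map_frag f 0 = 0" "map_frag f (- z) = - map_frag f z"
  "map_frag f (z + w) = map_frag f z + map_frag f w" "map_frag f (z - w) = map_frag f z - map_frag f w"
  by (simp_all add: map_frag_def frag_extend_minus frag_extend_add frag_extend_diff)

lemma map_frag_comp: "map_frag f (map_frag g z) = map_frag (\<lambda>s. f (g s)) z"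
proof -
  have "Poly_Mapping.keys z \<subseteq> UNIV" by simp
  then show ?thesis
    by (induction z rule: frag_induction) (simp_all add: map_frag_simps)
qed

lemma map_frag_cong:
  "(\<And>s. s \<in> Poly_Mapping.keys z \<Longrightarrow> f s = g s) \<Longrightarrow> map_frag f z = map_frag g z"
  unfolding map_frag_def by (rule frag_extend_eq) simp

lemma map_frag_id:
  assumes "\<And>s. s \<in> Poly_Mapping.keys z \<Longrightarrow> f s = s"
  shows "map_frag f z = z"
proof -
  have "map_frag f z = frag_extend frag_of z"
    unfolding map_frag_def by (rule frag_extend_eq) (simp add: assms)
  then show ?thesis
    by (simp flip: frag_expansion)
qed

lemma keys_map_frag: "Poly_Mapping.keys (map_frag f z) \<subseteq> f ` Poly_Mapping.keys z"
  using keys_frag_extend[of "\<lambda>s. frag_of (f s)" z] by (auto simp: keys_frag_of map_frag_def)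

lemma (in tensor_pair) presentation: "presentation (carrier M \<times> carrier N) (tensor_rels A M N)"
  by (rule pres.presentation_axioms)

context
  fixes A :: "('a, 's) ring_scheme"
    and M :: "('a, 'm, 'y1) bimodule_scheme" and N :: "('a, 'n, 'y2) bimodule_scheme"
  assumes M: "right_module A M" and N: "left_module A N"
begin

interpretation M: right_module A M by (rule M)
interpretation N: left_module A N by (rule N)
interpretation T: tensor_pair A M N by (rule tensor_pairI[OF M N])

text \<open>Each relator is an instance of one law; its fragment consists of the elements it
  mentions, results of operations included, and of its scalar. The fragment depends on
  \<open>r\<close> alone and is fixed before targets and maps are chosen.\<close>

lemma tensor_rels_local:
  assumes "r \<in> tensor_rels A M N"
  obtains T U B where "finite T" "T \<subseteq> carrier M" "finite U" "U \<subseteq> carrier N" "finite B" "B \<subseteq> carrier A"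
    "\<And>(M' :: ('a, 'm2, 'y3) bimodule_scheme) (N' :: ('a, 'n2, 'y4) bimodule_scheme) \<sigma> \<tau>.
      local_hom M M' T B \<sigma> \<Longrightarrow> local_hom N N' U B \<tau> \<Longrightarrow>
      map_frag (\<lambda>(x, y). (\<sigma> x, \<tau> y)) r \<in> tensor_rels A M' N'"
  using assms unfolding tensor_rels_def[of A M N]
proof (elim UnE CollectE exE conjE)
  fix x x' y assume r: "r = frag_of (x \<oplus>\<^bsub>M\<^esub> x', y) - frag_of (x, y) - frag_of (x', y)"
    and *: "x \<in> carrier M" "x' \<in> carrier M" "y \<in> carrier N"
  show thesis
  proof (rule that[of "{x, x', x \<oplus>\<^bsub>M\<^esub> x'}" "{y}" "{}"])
    fix M' :: "('a, 'm2, 'y3) bimodule_scheme" and N' :: "('a, 'n2, 'y4) bimodule_scheme" and \<sigma> \<tau>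
    assume \<sigma>: "local_hom M M' {x, x', x \<oplus>\<^bsub>M\<^esub> x'} {} \<sigma>" and \<tau>: "local_hom N N' {y} {} \<tau>"
    have "\<sigma> (x \<oplus>\<^bsub>M\<^esub> x') = \<sigma> x \<oplus>\<^bsub>M'\<^esub> \<sigma> x'" "\<sigma> x \<in> carrier M'" "\<sigma> x' \<in> carrier M'" "\<tau> y \<in> carrier N'"
      using local_homD(1,2)[OF \<sigma>] local_homD(1)[OF \<tau>] * by simp_all
    then show "map_frag (\<lambda>(x, y). (\<sigma> x, \<tau> y)) r \<in> tensor_rels A M' N'"
      unfolding tensor_rels_def by (auto simp: r map_frag_simps)
  qed (use * in auto)
next
  fix x y y' assume r: "r = frag_of (x, y \<oplus>\<^bsub>N\<^esub> y') - frag_of (x, y) - frag_of (x, y')"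
    and *: "x \<in> carrier M" "y \<in> carrier N" "y' \<in> carrier N"
  show thesis
  proof (rule that[of "{x}" "{y, y', y \<oplus>\<^bsub>N\<^esub> y'}" "{}"])
    fix M' :: "('a, 'm2, 'y3) bimodule_scheme" and N' :: "('a, 'n2, 'y4) bimodule_scheme" and \<sigma> \<tau>
    assume \<sigma>: "local_hom M M' {x} {} \<sigma>" and \<tau>: "local_hom N N' {y, y', y \<oplus>\<^bsub>N\<^esub> y'} {} \<tau>"
    have "\<tau> (y \<oplus>\<^bsub>N\<^esub> y') = \<tau> y \<oplus>\<^bsub>N'\<^esub> \<tau> y'" "\<sigma> x \<in> carrier M'" "\<tau> y \<in> carrier N'" "\<tau> y' \<in> carrier N'"
      using local_homD(1)[OF \<sigma>] local_homD(1,2)[OF \<tau>] * by simp_all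
    then show "map_frag (\<lambda>(x, y). (\<sigma> x, \<tau> y)) r \<in> tensor_rels A M' N'"
      unfolding tensor_rels_def by (auto simp: r map_frag_simps)
  qed (use * in auto)
next
  fix x a y assume r: "r = frag_of (ract M x a, y) - frag_of (x, lact N a y)"
    and *: "x \<in> carrier M" "a \<in> carrier A" "y \<in> carrier N"
  show thesis
  proof (rule that[of "{x, ract M x a}" "{y, lact N a y}" "{a}"])
    fix M' :: "('a, 'm2, 'y3) bimodule_scheme" and N' :: "('a, 'n2, 'y4) bimodule_scheme" and \<sigma> \<tau>
    assume \<sigma>: "local_hom M M' {x, ract M x a} {a} \<sigma>" and \<tau>: "local_hom N N' {y, lact N a y} {a} \<tau>"
    have "\<sigma> (ract M x a) = ract M' (\<sigma> x) a" "\<tau> (lact N a y) = lact N' a (\<tau> y)"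
        "\<sigma> x \<in> carrier M'" "\<tau> y \<in> carrier N'"
      using local_homD(1,4)[OF \<sigma>] local_homD(1,3)[OF \<tau>] * by simp_all
    then show "map_frag (\<lambda>(x, y). (\<sigma> x, \<tau> y)) r \<in> tensor_rels A M' N'"
      unfolding tensor_rels_def using * by (auto simp: r map_frag_simps)
  qed (use * in \<open>auto simp: M.ract_closed N.lact_closed\<close>)
qed

text \<open>A derivation uses finitely many relators, so the union of their fragments suffices to
  replay it in another pair of modules. The target types are free, which later lets test modules
  move between types.\<close>

lemma tensor_pres_rel_local:
  assumes "z \<in> pres_rel (carrier M \<times> carrier N) (tensor_rels A M N)"
  shows "\<exists>T U B. (finite T \<and> T \<subseteq> carrier M \<and> finite U \<and> U \<subseteq> carrier N \<and> finite B \<and> B \<subseteq> carrier A) \<and>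
    (\<forall>(M' :: ('a, 'm2, 'y3) bimodule_scheme) (N' :: ('a, 'n2, 'y4) bimodule_scheme) \<sigma> \<tau>.
      tensor_pair A M' N' \<longrightarrow> local_hom M M' T B \<sigma> \<longrightarrow> local_hom N N' U B \<tau> \<longrightarrow>
      map_frag (\<lambda>(x, y). (\<sigma> x, \<tau> y)) z \<in> pres_rel (carrier M' \<times> carrier N') (tensor_rels A M' N'))"
    (is "\<exists>T U B. ?fin T U B \<and> ?loc z T U B")
  using assms
proof (induction rule: T.pres.pres_rel_induct)
  case zero
  have "?fin {} {} {}" by simp
  moreover have "?loc 0 {} {} {}"
    by (simp add: presentation.pres_rel_zero tensor_pair.presentation map_frag_simps)
  ultimately show ?case by (intro exI) (rule conjI)
next
  case (rel r)
  show ?case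
  proof (rule tensor_rels_local[OF rel])
    fix T U B assume fin: "finite T" "T \<subseteq> carrier M" "finite U" "U \<subseteq> carrier N" "finite B" "B \<subseteq> carrier A"
      and loc: "\<And>(M' :: ('a, 'm2, 'y3) bimodule_scheme) (N' :: ('a, 'n2, 'y4) bimodule_scheme) \<sigma> \<tau>.
        local_hom M M' T B \<sigma> \<Longrightarrow> local_hom N N' U B \<tau> \<Longrightarrow>
        map_frag (\<lambda>(x, y). (\<sigma> x, \<tau> y)) r \<in> tensor_rels A M' N'"
    have "?fin T U B"
      using fin by simp
    moreover have "?loc r T U B"
      by (intro allI impI presentation.pres_rel_incl[OF tensor_pair.presentation] loc)
    ultimately show ?thesis by (intro exI) (rule conjI)
  qed
next
  case (minus z)
  obtain T U B where *: "?fin T U B" "?loc z T U B"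
    using minus(2) by (elim exE) (erule conjE, rule that)
  have "?loc (- z) T U B"
    unfolding map_frag_simps
    by (intro allI impI presentation.pres_rel_minus[OF tensor_pair.presentation] *(2)[rule_format])
  with *(1) show ?case by (intro exI) (rule conjI)
next
  case (add z w)
  obtain T1 U1 B1 where 1: "?fin T1 U1 B1" "?loc z T1 U1 B1"
    using add(3) by (elim exE) (erule conjE, rule that)
  obtain T2 U2 B2 where 2: "?fin T2 U2 B2" "?loc w T2 U2 B2"
    using add(4) by (elim exE) (erule conjE, rule that)
  have loc: "?loc (z + w) (T1 \<union> T2) (U1 \<union> U2) (B1 \<union> B2)"
  proof (intro allI impI)
    fix M' :: "('a, 'm2, 'y3) bimodule_scheme" and N' :: "('a, 'n2, 'y4) bimodule_scheme" and \<sigma> \<tau>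
    assume p: "tensor_pair A M' N'"
      and "local_hom M M' (T1 \<union> T2) (B1 \<union> B2) \<sigma>" "local_hom N N' (U1 \<union> U2) (B1 \<union> B2) \<tau>"
    then have "local_hom M M' T1 B1 \<sigma>" "local_hom N N' U1 B1 \<tau>"
        "local_hom M M' T2 B2 \<sigma>" "local_hom N N' U2 B2 \<tau>"
      by (auto elim: local_hom_mono)
    then show "map_frag (\<lambda>(x, y). (\<sigma> x, \<tau> y)) (z + w) \<in> pres_rel (carrier M' \<times> carrier N') (tensor_rels A M' N')"
      unfolding map_frag_simps
      by (intro presentation.pres_rel_add[OF tensor_pair.presentation] p 1(2)[rule_format] 2(2)[rule_format])
  qed
  have fin: "?fin (T1 \<union> T2) (U1 \<union> U2) (B1 \<union> B2)"
    using 1(1) 2(1) by simp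
  show ?case
    by (rule exI, rule exI, rule exI, rule conjI[OF fin loc])
qed

end

text \<open>This is purity in the sense of model theory: a finite pattern of sums and scalar
  multiples with some entries in \<open>D\<close> is realised again inside \<open>D\<close> with
  those entries fixed. The map varies with the fragment; a single retraction of \<open>M\<close>
  onto \<open>D\<close> is not claimed.\<close>

definition locally_retract ::
  "('a, 's) ring_scheme \<Rightarrow> ('a, 'm, 'y) bimodule_scheme \<Rightarrow> 'm set \<Rightarrow> bool"
  where "locally_retract A M D \<longleftrightarrow> D \<subseteq> carrier M \<and>
    (\<forall>T B. finite T \<and> T \<subseteq> carrier M \<and> finite B \<and> B \<subseteq> carrier A \<longrightarrow>
      (\<exists>\<sigma>. local_hom M (M\<lparr>carrier := D\<rparr>) T B \<sigma> \<and> (\<forall>x\<in>T \<inter> D. \<sigma> x = x)))"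

lemma locally_retractE:
  assumes "locally_retract A M D" "finite T" "T \<subseteq> carrier M" "finite B" "B \<subseteq> carrier A"
  obtains \<sigma> where "local_hom M (M\<lparr>carrier := D\<rparr>) T B \<sigma>" "\<And>x. x \<in> T \<Longrightarrow> x \<in> D \<Longrightarrow> \<sigma> x = x"
proof -
  have "\<exists>\<sigma>. local_hom M (M\<lparr>carrier := D\<rparr>) T B \<sigma> \<and> (\<forall>x\<in>T \<inter> D. \<sigma> x = x)"
    using assms by (simp add: locally_retract_def)
  then obtain \<sigma> where "local_hom M (M\<lparr>carrier := D\<rparr>) T B \<sigma>" "\<forall>x\<in>T \<inter> D. \<sigma> x = x"
    by (elim exE conjE)
  then show thesis
    using that[of \<sigma>] by simp
qed

lemma sub_bimoduleD:
  assumes D: "sub_bimodule A D M"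
  shows "D \<subseteq> carrier M" "\<zero>\<^bsub>M\<^esub> \<in> D" "x \<in> D \<Longrightarrow> y \<in> D \<Longrightarrow> x \<oplus>\<^bsub>M\<^esub> y \<in> D"
    "x \<in> D \<Longrightarrow> a \<in> carrier A \<Longrightarrow> lact M a x \<in> D" "x \<in> D \<Longrightarrow> a \<in> carrier A \<Longrightarrow> ract M x a \<in> D"
  using D additive_subgroup.a_subset[of D M] additive_subgroup.zero_closed[of D M]
    additive_subgroup.a_closed[of D M]
  by (auto simp: sub_bimodule_def)

lemma restrict_abelian_group:
  assumes M: "abelian_group M" and D: "sub_bimodule A D M"
  shows "abelian_group (M\<lparr>carrier := D\<rparr>)"
proof -
  interpret M: abelian_group M by (rule M)
  note D' = sub_bimoduleD[OF D]
  have sub: "x \<in> D \<Longrightarrow> x \<in> carrier M" for x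
    using D'(1) by auto
  have neg: "\<exists>y\<in>D. x \<oplus>\<^bsub>M\<^esub> y = \<zero>\<^bsub>M\<^esub>" if "x \<in> D" for x
  proof
    show "\<ominus>\<^bsub>M\<^esub> x \<in> D"
      using D that subgroup.m_inv_closed[of D "add_monoid M" x]
      by (simp add: sub_bimodule_def additive_subgroup_def a_inv_def)
    show "x \<oplus>\<^bsub>M\<^esub> \<ominus>\<^bsub>M\<^esub> x = \<zero>\<^bsub>M\<^esub>"
      using that sub by (simp add: M.r_neg)
  qed
  show ?thesis
    by (rule abelian_groupI) (simp_all add: D' sub M.a_ac neg)
qed

lemma restrict_left_module:
  assumes M: "left_module A M" and D: "sub_bimodule A D M"
  shows "left_module A (M\<lparr>carrier := D\<rparr>)"
proof -
  interpret M: left_module A M by (rule M)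
  have sub: "x \<in> D \<Longrightarrow> x \<in> carrier M" for x
    using sub_bimoduleD(1)[OF D] by auto
  show ?thesis
    by (intro left_moduleI restrict_abelian_group[OF left_module_abelian[OF M] D])
      (simp_all add: M.A.ring_axioms sub_bimoduleD[OF D] sub M.lact_add M.add_lact M.mult_lact M.one_lact)
qed

lemma restrict_right_module:
  assumes M: "right_module A M" and D: "sub_bimodule A D M"
  shows "right_module A (M\<lparr>carrier := D\<rparr>)"
proof -
  interpret M: right_module A M by (rule M)
  have sub: "x \<in> D \<Longrightarrow> x \<in> carrier M" for x
    using sub_bimoduleD(1)[OF D] by auto
  show ?thesis
    by (intro right_moduleI restrict_abelian_group[OF right_module_abelian[OF M] D])
      (simp_all add: M.A.ring_axioms sub_bimoduleD[OF D] sub M.ract_add M.add_ract M.mult_ract M.one_ract)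
qed

context
  fixes A :: "('a, 's) ring_scheme" and M :: "('a, 'm, 'z) bimodule_scheme"
  assumes M: "bimodule A M"
begin

interpretation M: bimodule A M by (rule M)

lemma restrict_bimodule:
  assumes D: "sub_bimodule A D M"
  shows "bimodule A (M\<lparr>carrier := D\<rparr>)"
proof -
  have "x \<in> D \<Longrightarrow> x \<in> carrier M" for x
    using sub_bimoduleD(1)[OF D] by auto
  then show ?thesis
    by (intro bimoduleI restrict_left_module restrict_right_module M.left_module_axioms
        M.right_module_axioms D) (simp add: M.lact_ract)
qed

lemma incl_linear:
  assumes D: "sub_bimodule A D M"
  shows "right_linear A (M\<lparr>carrier := D\<rparr>) M (\<lambda>x\<in>D. x)" "left_linear A (M\<lparr>carrier := D\<rparr>) M (\<lambda>x\<in>D. x)"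
  using sub_bimoduleD[OF D] by (auto simp: right_linear_def left_linear_def additive_map_def)

text \<open>Use the fragment of one operation: with \<open>x\<close> and \<open>y\<close> fixed, the
  image of their sum is that same sum, and images lie in \<open>D\<close>. For zero, its image
  satisfies \<open>u = u + u\<close> and so is zero; for negatives, the image of \<open>- x\<close>
  is again an inverse of \<open>x\<close>.\<close>

lemma locally_retract_sub_bimodule:
  assumes D: "locally_retract A M D"
  shows "sub_bimodule A D M"
proof -
  have DM: "x \<in> D \<Longrightarrow> x \<in> carrier M" for x
    using D by (auto simp: locally_retract_def)
  have zero: "\<zero>\<^bsub>M\<^esub> \<in> D"
  proof (rule locally_retractE[OF D, of "{\<zero>\<^bsub>M\<^esub>}" "{}"])
    fix \<sigma> assume "local_hom M (M\<lparr>carrier := D\<rparr>) {\<zero>\<^bsub>M\<^esub>} {} \<sigma>"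
    note \<sigma> = local_homD[OF this]
    have "\<sigma> \<zero>\<^bsub>M\<^esub> = \<sigma> \<zero>\<^bsub>M\<^esub> \<oplus>\<^bsub>M\<^esub> \<sigma> \<zero>\<^bsub>M\<^esub>" "\<sigma> \<zero>\<^bsub>M\<^esub> \<in> D"
      using \<sigma>(1)[of "\<zero>\<^bsub>M\<^esub>"] \<sigma>(2)[of "\<zero>\<^bsub>M\<^esub>" "\<zero>\<^bsub>M\<^esub>"] by simp_all
    then show "\<zero>\<^bsub>M\<^esub> \<in> D"
      using DM M.M.add.l_cancel_one'[of "\<sigma> \<zero>\<^bsub>M\<^esub>" "\<sigma> \<zero>\<^bsub>M\<^esub>"] by metis
  qed auto
  have add: "x \<oplus>\<^bsub>M\<^esub> y \<in> D" if xy: "x \<in> D" "y \<in> D" for x y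
  proof (rule locally_retractE[OF D, of "{x, y, x \<oplus>\<^bsub>M\<^esub> y}" "{}"])
    fix \<sigma> assume "local_hom M (M\<lparr>carrier := D\<rparr>) {x, y, x \<oplus>\<^bsub>M\<^esub> y} {} \<sigma>"
      and s: "\<And>z. z \<in> {x, y, x \<oplus>\<^bsub>M\<^esub> y} \<Longrightarrow> z \<in> D \<Longrightarrow> \<sigma> z = z"
    note \<sigma> = local_homD[OF this(1)]
    show "x \<oplus>\<^bsub>M\<^esub> y \<in> D"
      using \<sigma>(1)[of "x \<oplus>\<^bsub>M\<^esub> y"] \<sigma>(2)[of x y] s[of x] s[of y] xy DM by simp
  qed (use xy DM in auto)
  have neg: "\<ominus>\<^bsub>M\<^esub> x \<in> D" if x: "x \<in> D" for x
  proof (rule locally_retractE[OF D, of "{x, \<ominus>\<^bsub>M\<^esub> x, \<zero>\<^bsub>M\<^esub>}" "{}"])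
    fix \<sigma> assume "local_hom M (M\<lparr>carrier := D\<rparr>) {x, \<ominus>\<^bsub>M\<^esub> x, \<zero>\<^bsub>M\<^esub>} {} \<sigma>"
      and s: "\<And>z. z \<in> {x, \<ominus>\<^bsub>M\<^esub> x, \<zero>\<^bsub>M\<^esub>} \<Longrightarrow> z \<in> D \<Longrightarrow> \<sigma> z = z"
    note \<sigma> = local_homD[OF this(1)]
    have e: "\<ominus>\<^bsub>M\<^esub> x \<oplus>\<^bsub>M\<^esub> x = \<zero>\<^bsub>M\<^esub>" and xM: "x \<in> carrier M"
      using x DM by (simp_all add: M.l_neg)
    have "\<sigma> (\<ominus>\<^bsub>M\<^esub> x \<oplus>\<^bsub>M\<^esub> x) = \<sigma> (\<ominus>\<^bsub>M\<^esub> x) \<oplus>\<^bsub>M\<lparr>carrier := D\<rparr>\<^esub> \<sigma> x"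
      by (rule \<sigma>(2)) (simp_all add: e)
    moreover have "\<sigma> x = x" "\<sigma> \<zero>\<^bsub>M\<^esub> = \<zero>\<^bsub>M\<^esub>"
      using x zero by (auto intro: s)
    ultimately have "\<sigma> (\<ominus>\<^bsub>M\<^esub> x) \<oplus>\<^bsub>M\<^esub> x = \<zero>\<^bsub>M\<^esub>"
      by (simp only: e) simp
    moreover have "\<sigma> (\<ominus>\<^bsub>M\<^esub> x) \<in> D"
      using \<sigma>(1)[of "\<ominus>\<^bsub>M\<^esub> x"] xM by simp
    ultimately show "\<ominus>\<^bsub>M\<^esub> x \<in> D"
      using xM DM M.M.minus_equality[of "\<sigma> (\<ominus>\<^bsub>M\<^esub> x)" x] by metis
  qed (use x DM in auto)
  have act: "lact M a x \<in> D \<and> ract M x a \<in> D" if x: "x \<in> D" and a: "a \<in> carrier A" for x a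
  proof (rule locally_retractE[OF D, of "{x, lact M a x, ract M x a}" "{a}"])
    fix \<sigma> assume "local_hom M (M\<lparr>carrier := D\<rparr>) {x, lact M a x, ract M x a} {a} \<sigma>"
      and s: "\<And>z. z \<in> {x, lact M a x, ract M x a} \<Longrightarrow> z \<in> D \<Longrightarrow> \<sigma> z = z"
    note \<sigma> = local_homD[OF this(1)]
    show "lact M a x \<in> D \<and> ract M x a \<in> D"
      using \<sigma>(1)[of "lact M a x"] \<sigma>(1)[of "ract M x a"] \<sigma>(3)[of a x] \<sigma>(4)[of a x] s[of x] x a DM
      by (simp add: M.lact_closed M.ract_closed)
  qed (use x a DM M.lact_closed M.ract_closed in auto)
  have "subgroup D (add_monoid M)"
    by (rule subgroup.intro) (use DM zero add neg in \<open>auto simp flip: a_inv_def\<close>)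
  then show ?thesis
    using act by (simp add: sub_bimodule_def additive_subgroup_def)
qed

text \<open>A Loewenheim--Skolem argument for positive systems: for every finite system of equations
  with constants from the set, a solution in \<open>M\<close> is thrown in whenever there is one.
  The set \<open>G x\<close> is a further demand attached to each element, later the tensor
  components of its comultiplication.\<close>

lemma locally_retract_exists:
  assumes S: "S \<subseteq> carrier M"
    and G: "\<And>x. x \<in> carrier M \<Longrightarrow> G x \<subseteq> carrier M" "\<And>x. x \<in> carrier M \<Longrightarrow> countable (G x)"
  obtains D where "S \<subseteq> D" "locally_retract A M D" "\<And>x. x \<in> D \<Longrightarrow> G x \<subseteq> D"
    "D \<lesssim> S <+> (carrier A <+> (UNIV :: nat set))"
proof -
  \<comment> \<open>An equation is a code \<open>(k, a, i, j, l)\<close>: \<open>k\<close> selects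
    sum, left multiple or right multiple, \<open>a\<close> is the scalar, and \<open>i\<close>,
    \<open>j\<close>, \<open>l\<close> number the variables.\<close>
  define sat :: "(nat \<Rightarrow> 'm) \<Rightarrow> nat \<times> 'a \<times> nat \<times> nat \<times> nat \<Rightarrow> bool"
    where "sat \<nu> = (\<lambda>(k, a, i, j, l). (k = 0 \<longrightarrow> \<nu> l = \<nu> i \<oplus>\<^bsub>M\<^esub> \<nu> j) \<and>
      (k = 1 \<longrightarrow> \<nu> l = lact M a (\<nu> i)) \<and> (k = 2 \<longrightarrow> \<nu> l = ract M (\<nu> i) a))" for \<nu>
  \<comment> \<open>The first \<open>length ys\<close> variables are bound to the constants
    \<open>ys\<close>, the others are unknowns. Variables are natural numbers, so the values of a
    solution form a countable set.\<close>
  define sol where "sol p ys \<nu> \<longleftrightarrow> range \<nu> \<subseteq> carrier M \<and> (\<forall>i<length ys. \<nu> i = ys ! i) \<and> (\<forall>f\<in>set p. sat \<nu> f)"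
    for p ys \<nu>
  define F where "F p ys = (if \<exists>\<nu>. sol p ys \<nu> then range (SOME \<nu>. sol p ys \<nu>) else {}) \<union> (\<Union>y\<in>set ys. G y)" for p ys
  define P :: "(nat \<times> 'a \<times> nat \<times> nat \<times> nat) list set" where "P = lists (UNIV \<times> carrier A \<times> UNIV \<times> UNIV \<times> UNIV)"
  define B where "B = S <+> (carrier A <+> (UNIV :: nat set))"
  have B: "infinite B"
    by (simp add: B_def)
  have le: "S \<lesssim> B" "carrier A \<lesssim> B" "(UNIV :: nat set) \<lesssim> B"
    unfolding B_def lepoll_iff_ordLeq
    by (rule card_of_Plus1, rule ordLeq_transitive[OF card_of_Plus1 card_of_Plus2],
        rule ordLeq_transitive[OF card_of_Plus2 card_of_Plus2])
  have P: "P \<lesssim> B"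
    unfolding P_def by (intro lepoll_lists lepoll_Times B le)
  have some: "sol p ys (SOME \<nu>. sol p ys \<nu>)" if "\<exists>\<nu>. sol p ys \<nu>" for p ys
    using that by (rule someI_ex)
  have F1: "F p ys \<subseteq> carrier M" if "set ys \<subseteq> carrier M" for p ys
  proof -
    have "range (SOME \<nu>. sol p ys \<nu>) \<subseteq> carrier M" if "\<exists>\<nu>. sol p ys \<nu>"
      using some[OF that] unfolding sol_def[of p ys "SOME \<nu>. sol p ys \<nu>"] by blast
    then show ?thesis
      using that G(1) unfolding F_def by (simp add: UN_subset_iff subset_iff[of "set ys"])
  qed
  have F2: "countable (F p ys)" if "set ys \<subseteq> carrier M" for p ys
    unfolding F_def by (intro countable_Un countable_UN) (use that G(2) in \<open>simp_all add: countable_finite subset_iff\<close>)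
  have "\<exists>D. S \<subseteq> D \<and> D \<subseteq> carrier M \<and> D \<lesssim> B \<and> (\<forall>p\<in>P. \<forall>ys. set ys \<subseteq> D \<longrightarrow> F p ys \<subseteq> D)"
    by (rule closure_exists[OF S le(1) P B F1 F2])
  then obtain D where D: "S \<subseteq> D" "D \<subseteq> carrier M" "D \<lesssim> B" "\<And>p ys. p \<in> P \<Longrightarrow> set ys \<subseteq> D \<Longrightarrow> F p ys \<subseteq> D"
    by blast
  show thesis
  proof (rule that[OF D(1)])
    show "D \<lesssim> S <+> (carrier A <+> (UNIV :: nat set))"
      using D(3) by (simp add: B_def)
    show "G x \<subseteq> D" if "x \<in> D" for x
      using D(4)[of "[]" "[x]"] that by (auto simp: P_def F_def)
    show "locally_retract A M D"
      unfolding locally_retract_def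
    proof (intro conjI allI impI D(2))
      fix T X assume "finite T \<and> T \<subseteq> carrier M \<and> finite X \<and> X \<subseteq> carrier A"
      then have T: "finite T" "T \<subseteq> carrier M" and X: "finite X" "X \<subseteq> carrier A"
        by auto
      obtain ys us where ys: "set ys = T \<inter> D" and us: "set us = T - D"
        using T(1) by (metis finite_Diff finite_Int finite_list)
      define ts where "ts = ys @ us"
      have ts: "set ts = T"
        using ys us by (auto simp: ts_def)
      \<comment> \<open>The fragment solves its own system. Its elements in \<open>D\<close> are
        listed first so that they become the constants; spare variables take the value zero, which
        keeps the range in the carrier.\<close>
      define \<mu> where "\<mu> i = (if i < length ts then ts ! i else \<zero>\<^bsub>M\<^esub>)" for i
      \<comment> \<open>All equations that hold in the fragment. A sum has no scalar, but its code
        needs one from \<open>A\<close>; the unit is inserted so that sums are recorded even for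
        empty \<open>X\<close>.\<close>
      define Fs where "Fs = {f \<in> {..2} \<times> insert \<one>\<^bsub>A\<^esub> X \<times> {..<length ts} \<times> {..<length ts} \<times> {..<length ts}. sat \<mu> f}"
      have "finite Fs"
        unfolding Fs_def using X(1) by simp
      then obtain p where p: "set p = Fs"
        using finite_list by blast
      have "p \<in> P"
        using X(2) by (auto simp: P_def p Fs_def)
      moreover have "sol p ys \<mu>"
        using ts T(2) by (auto simp: sol_def p Fs_def \<mu>_def ts_def nth_append subset_iff)
      ultimately have ex: "\<exists>\<nu>. sol p ys \<nu>" and sub: "F p ys \<subseteq> D"
        using D(4)[of p ys] ys by auto
      define \<nu> where "\<nu> = (SOME \<nu>. sol p ys \<nu>)"
      have \<nu>: "sol p ys \<nu>" "range \<nu> \<subseteq> D"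
        using some[OF ex] sub ex unfolding F_def \<nu>_def by (simp, simp only: if_True Un_subset_iff)
      define idx where "idx c = (SOME i. i < length ts \<and> ts ! i = c)" for c
      have idx: "idx c < length ts" "ts ! idx c = c" if "c \<in> T" for c
      proof -
        have "\<exists>i. i < length ts \<and> ts ! i = c"
          using that ts by (metis in_set_conv_nth)
        from someI_ex[OF this] show "idx c < length ts" "ts ! idx c = c"
          unfolding idx_def by blast+
      qed
      have \<mu>: "\<mu> (idx c) = c" if "c \<in> T" for c
        using idx[OF that] by (simp add: \<mu>_def)
      have fact: "sat \<nu> (k, a, idx x, idx y, idx z)"
        if "k \<le> 2" "a \<in> insert \<one>\<^bsub>A\<^esub> X" "x \<in> T" "y \<in> T" "z \<in> T" "sat \<mu> (k, a, idx x, idx y, idx z)" for k a x y z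
        using \<nu>(1) that idx(1) by (auto simp: sol_def p Fs_def)
      \<comment> \<open>Off the fragment any element of \<open>D\<close> will do, and all values of
        \<open>\<nu>\<close> lie in \<open>D\<close>.\<close>
      define \<sigma> where "\<sigma> c = \<nu> (if c \<in> T then idx c else 0)" for c
      have "\<sigma> x = x" if "x \<in> T \<inter> D" for x
      proof -
        \<comment> \<open>The chosen position of an element of \<open>D\<close> falls among the
          constants, because the tail \<open>us\<close> of the list avoids \<open>D\<close>; so the
          solution returns that element unchanged.\<close>
        have "idx x < length ys"
        proof (rule ccontr)
          assume "\<not> idx x < length ys"
          then have "x \<in> set us"
            using idx[of x] that by (auto simp: ts_def nth_append in_set_conv_nth intro!: exI[of _ "idx x - length ys"])
          then show False
            using us that by auto
        qed
        then show ?thesis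
          using \<nu>(1) idx(2)[of x] that by (simp add: sol_def \<sigma>_def ts_def nth_append)
      qed
      moreover have "local_hom M (M\<lparr>carrier := D\<rparr>) T X \<sigma>"
        unfolding local_hom_def
      proof (intro conjI ballI impI)
        show "\<sigma> \<in> carrier M \<rightarrow> carrier (M\<lparr>carrier := D\<rparr>)"
          using \<nu>(2) by (auto simp: \<sigma>_def)
        show "\<sigma> (x \<oplus>\<^bsub>M\<^esub> y) = \<sigma> x \<oplus>\<^bsub>M\<lparr>carrier := D\<rparr>\<^esub> \<sigma> y" if "x \<in> T" "y \<in> T" "x \<oplus>\<^bsub>M\<^esub> y \<in> T" for x y
          using fact[of 0 "\<one>\<^bsub>A\<^esub>" x y "x \<oplus>\<^bsub>M\<^esub> y"] that by (simp add: sat_def \<mu> \<sigma>_def)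
        show "\<sigma> (lact M a x) = lact (M\<lparr>carrier := D\<rparr>) a (\<sigma> x)" if "a \<in> X" "x \<in> T" "lact M a x \<in> T" for a x
          using fact[of 1 a x x "lact M a x"] that by (simp add: sat_def \<mu> \<sigma>_def)
        show "\<sigma> (ract M x a) = ract (M\<lparr>carrier := D\<rparr>) (\<sigma> x) a" if "a \<in> X" "x \<in> T" "ract M x a \<in> T" for a x
          using fact[of 2 a x x "ract M x a"] that by (simp add: sat_def \<mu> \<sigma>_def)
      qed
      ultimately show "\<exists>\<sigma>. local_hom M (M\<lparr>carrier := D\<rparr>) T X \<sigma> \<and> (\<forall>x\<in>T \<inter> D. \<sigma> x = x)"
        by blast
    qed
  qed
qed

end

section \<open>Tensors as classes of words, and injectivity of maps induced by inclusions\<close>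

lemma frag_additive_eqI:
  fixes f g :: "('x \<Rightarrow>\<^sub>0 int) \<Rightarrow> 'y"
  assumes G: "abelian_group G"
    and f: "\<And>z. Poly_Mapping.keys z \<subseteq> S \<Longrightarrow> f z \<in> carrier G"
      "\<And>z w. Poly_Mapping.keys z \<subseteq> S \<Longrightarrow> Poly_Mapping.keys w \<subseteq> S \<Longrightarrow> f (z + w) = f z \<oplus>\<^bsub>G\<^esub> f w"
    and g: "\<And>z. Poly_Mapping.keys z \<subseteq> S \<Longrightarrow> g z \<in> carrier G"
      "\<And>z w. Poly_Mapping.keys z \<subseteq> S \<Longrightarrow> Poly_Mapping.keys w \<subseteq> S \<Longrightarrow> g (z + w) = g z \<oplus>\<^bsub>G\<^esub> g w"
    and eq: "\<And>s. s \<in> S \<Longrightarrow> f (frag_of s) = g (frag_of s)"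
    and z: "Poly_Mapping.keys z \<subseteq> S"
  shows "f z = g z"
proof -
  interpret G: abelian_group G by (rule G)
  have hz: "h 0 = \<zero>\<^bsub>G\<^esub>" if "h 0 \<in> carrier G" "h 0 = h 0 \<oplus>\<^bsub>G\<^esub> h 0" for h :: "('x \<Rightarrow>\<^sub>0 int) \<Rightarrow> 'y"
    using that G.add.l_cancel_one'[of "h 0" "h 0"] by blast
  have "Poly_Mapping.keys z \<subseteq> S \<and> f z = g z"
    using z
  proof (induction z rule: frag_induction)
    case zero
    have "f 0 = \<zero>\<^bsub>G\<^esub>"
      by (rule hz) (use f(1)[of 0] f(2)[of 0 0, unfolded add_0] in simp_all)
    moreover have "g 0 = \<zero>\<^bsub>G\<^esub>"
      by (rule hz) (use g(1)[of 0] g(2)[of 0 0, unfolded add_0] in simp_all)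
    ultimately show ?case by simp
  next
    case (one s)
    then show ?case
      by (simp add: eq)
  next
    case (diff z w)
    then have k: "Poly_Mapping.keys (z - w) \<subseteq> S"
      using keys_diff[of z w] by auto
    have "f (z - w) \<oplus>\<^bsub>G\<^esub> f w = g (z - w) \<oplus>\<^bsub>G\<^esub> f w"
      using f(2)[OF k, of w] g(2)[OF k, of w] diff by simp
    then show ?case
      using k diff f(1) g(1) by simp
  qed
  then show ?thesis ..
qed

lemma (in abelian_group) free_lift_map_frag:
  assumes b: "\<And>s. s \<in> Poly_Mapping.keys z \<Longrightarrow> b (h s) \<in> carrier G"
  shows "free_lift G b (map_frag h z) = free_lift G (\<lambda>s. b (h s)) z"
proof -
  have k: "Poly_Mapping.keys (map_frag h w) \<subseteq> h ` Poly_Mapping.keys z"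
    if "Poly_Mapping.keys w \<subseteq> Poly_Mapping.keys z" for w
    using keys_map_frag[of h w] that by blast
  have c: "free_lift G b (map_frag h w) \<in> carrier G" if "Poly_Mapping.keys w \<subseteq> Poly_Mapping.keys z" for w
    using k[OF that] b by (intro free_lift_closed) blast
  have a: "free_lift G b (map_frag h (w + v)) = free_lift G b (map_frag h w) \<oplus> free_lift G b (map_frag h v)"
    if "Poly_Mapping.keys w \<subseteq> Poly_Mapping.keys z" "Poly_Mapping.keys v \<subseteq> Poly_Mapping.keys z" for w v
    unfolding map_frag_simps using k[OF that(1)] k[OF that(2)] b by (intro free_lift_add) auto
  show ?thesis
    by (rule frag_additive_eqI[where S = "Poly_Mapping.keys z", OF abelian_group_axioms])
      (auto simp: map_frag_simps(1) free_lift_of b c a intro!: free_lift_closed free_lift_add[of "Poly_Mapping.keys z"])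
qed

context tensor_pair
begin

definition tclass :: "('m \<times> 'n \<Rightarrow>\<^sub>0 int) \<Rightarrow> ('m \<times> 'n \<Rightarrow>\<^sub>0 int) set"
  where "tclass = pres_class (carrier M \<times> carrier N) (tensor_rels A M N)"

lemma tclass_closed: "Poly_Mapping.keys z \<subseteq> carrier M \<times> carrier N \<Longrightarrow> tclass z \<in> carrier (tensor A M N)"
  by (simp add: tclass_def tensor_sel tensor_group_def pres.pres_class_closed)

lemma tclass_surj:
  assumes "t \<in> carrier (tensor A M N)"
  obtains z where "Poly_Mapping.keys z \<subseteq> carrier M \<times> carrier N" "t = tclass z"
  using assms pres.pres_class_surj by (auto simp: tclass_def tensor_sel tensor_group_def)

lemma tclass_add:
  "Poly_Mapping.keys z \<subseteq> carrier M \<times> carrier N \<Longrightarrow> Poly_Mapping.keys w \<subseteq> carrier M \<times> carrier N \<Longrightarrow>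
    tclass (z + w) = tclass z \<oplus>\<^bsub>tensor A M N\<^esub> tclass w"
  by (simp add: tclass_def tensor_sel tensor_group_def pres.pres_class_add)

lemma tclass_eq_zero_iff:
  "Poly_Mapping.keys z \<subseteq> carrier M \<times> carrier N \<Longrightarrow>
    tclass z = \<zero>\<^bsub>tensor A M N\<^esub> \<longleftrightarrow> z \<in> pres_rel (carrier M \<times> carrier N) (tensor_rels A M N)"
  by (simp add: tclass_def tensor_sel tensor_group_def pres.pres_class_eq_zero_iff)

lemma tclass_of: "tclass (frag_of (x, y)) = tens A M N x y"
  by (simp add: tclass_def tens_def pres_gen_class)

end

context
  fixes A :: "('a, 's) ring_scheme"
    and M :: "('a, 'm, 'y1) bimodule_scheme" and N :: "('a, 'n, 'y2) bimodule_scheme"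
    and M' :: "('a, 'm2, 'y3) bimodule_scheme" and N' :: "('a, 'n2, 'y4) bimodule_scheme" and f g
  assumes T: "tensor_pair A M N" and T': "tensor_pair A M' N'"
    and f: "right_linear A M M' f" and g: "left_linear A N N' g"
begin

interpretation T: tensor_pair A M N by (rule T)
interpretation T': tensor_pair A M' N' by (rule T')

lemma tensor_map_tclass:
  assumes z: "Poly_Mapping.keys z \<subseteq> carrier M \<times> carrier N"
  shows "tensor_map A M N M' N' f g (T.tclass z) = T'.tclass (map_frag (\<lambda>(x, y). (f x, g y)) z)"
proof -
  note add = additive_tensor_map[OF T.right_M T.left_N T'.right_M T'.left_N f g]
  have fg: "f x \<in> carrier M'" "g y \<in> carrier N'" if "x \<in> carrier M" "y \<in> carrier N" for x y
    using additive_closed[OF right_linear_additive[OF f]] additive_closed[OF left_linear_additive[OF g]] that by auto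
  have k: "Poly_Mapping.keys (map_frag (\<lambda>(x, y). (f x, g y)) w) \<subseteq> carrier M' \<times> carrier N'"
    if "Poly_Mapping.keys w \<subseteq> carrier M \<times> carrier N" for w
    using order_trans[OF keys_map_frag image_mono[OF that]] fg by fastforce
  show ?thesis
    by (rule frag_additive_eqI[where S = "carrier M \<times> carrier N", OF T'.abelian_tensor _ _ _ _ _ z])
      (auto simp: T.tclass_closed T'.tclass_closed additive_closed[OF add] T.tclass_add additive_add[OF add]
        map_frag_simps(1,4) k T'.tclass_add T.tclass_of T'.tclass_of
        tensor_map_tens[OF T.right_M T.left_N T'.right_M T'.left_N f g])
qed

end

context
  fixes A :: "('a, 's) ring_scheme"
    and M :: "('a, 'm, 'y1) bimodule_scheme" and N :: "('a, 'n, 'y2) bimodule_scheme"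
    and M' :: "('a, 'm, 'y3) bimodule_scheme" and N' :: "('a, 'n, 'y4) bimodule_scheme" and f g
  assumes T: "tensor_pair A M N" and T': "tensor_pair A M' N'"
    and f: "right_linear A M M' f" and g: "left_linear A N N' g"
begin

interpretation T: tensor_pair A M N by (rule T)
interpretation T': tensor_pair A M' N' by (rule T')

text \<open>An element of the kernel is the class of a word over the smaller modules that is a
  relation over the larger ones; as the maps are inclusions, the word itself does not change. Purity
  thereby becomes a statement about relations, to which finite fragments apply.\<close>

lemma inj_tensor_map_incl_iff:
  assumes M: "carrier M \<subseteq> carrier M'" "\<And>x. x \<in> carrier M \<Longrightarrow> f x = x"
    and N: "carrier N \<subseteq> carrier N'" "\<And>x. x \<in> carrier N \<Longrightarrow> g x = x"
  shows "inj_on (tensor_map A M N M' N' f g) (carrier (tensor A M N)) \<longleftrightarrow>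
    (\<forall>z\<in>pres_rel (carrier M' \<times> carrier N') (tensor_rels A M' N').
      Poly_Mapping.keys z \<subseteq> carrier M \<times> carrier N \<longrightarrow> z \<in> pres_rel (carrier M \<times> carrier N) (tensor_rels A M N))"
    (is "?inj \<longleftrightarrow> ?rel")
proof -
  note add = additive_tensor_map[OF T.right_M T.left_N T'.right_M T'.left_N f g]
  have id: "map_frag (\<lambda>(x, y). (f x, g y)) z = z" if "Poly_Mapping.keys z \<subseteq> carrier M \<times> carrier N" for z
    by (rule map_frag_id) (use that M N in auto)
  have map: "tensor_map A M N M' N' f g (T.tclass z) = T'.tclass z"
    if "Poly_Mapping.keys z \<subseteq> carrier M \<times> carrier N" for z
    using tensor_map_tclass[OF T T' f g that] id[OF that] by simp
  have k: "Poly_Mapping.keys z \<subseteq> carrier M' \<times> carrier N'" if "Poly_Mapping.keys z \<subseteq> carrier M \<times> carrier N" for z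
    using that M N by blast
  show ?thesis
  proof
    assume inj: ?inj
    show ?rel
    proof (intro ballI impI)
      fix z assume z: "z \<in> pres_rel (carrier M' \<times> carrier N') (tensor_rels A M' N')"
        and kz: "Poly_Mapping.keys z \<subseteq> carrier M \<times> carrier N"
      have "tensor_map A M N M' N' f g (T.tclass z) = tensor_map A M N M' N' f g \<zero>\<^bsub>tensor A M N\<^esub>"
        using map[OF kz] T'.tclass_eq_zero_iff[OF k[OF kz]] z
          additive_zero[OF T.abelian_tensor T'.abelian_tensor add] by simp
      then have "T.tclass z = \<zero>\<^bsub>tensor A M N\<^esub>"
        using inj_onD[OF inj] T.tclass_closed[OF kz] abelian_groupE(2)[OF T.abelian_tensor] by blast
      then show "z \<in> pres_rel (carrier M \<times> carrier N) (tensor_rels A M N)"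
        using T.tclass_eq_zero_iff[OF kz] by simp
    qed
  next
    assume rel: ?rel
    show ?inj
    proof (rule additive_inj_on[OF T.abelian_tensor T'.abelian_tensor add])
      fix t assume t: "t \<in> carrier (tensor A M N)" and 0: "tensor_map A M N M' N' f g t = \<zero>\<^bsub>tensor A M' N'\<^esub>"
      obtain z where z: "Poly_Mapping.keys z \<subseteq> carrier M \<times> carrier N" "t = T.tclass z"
        by (rule T.tclass_surj[OF t])
      have "z \<in> pres_rel (carrier M' \<times> carrier N') (tensor_rels A M' N')"
        using 0 map[OF z(1)] z(2) T'.tclass_eq_zero_iff[OF k[OF z(1)]] by simp
      then show "t = \<zero>\<^bsub>tensor A M N\<^esub>"
        using rel z T.tclass_eq_zero_iff[OF z(1)] by simp
    qed
  qed
qed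

end

context
  fixes A :: "('a, 's) ring_scheme" and C :: "('a, 'c, 'z) bimodule_scheme" and D :: "'c set"
  assumes C: "bimodule A C" and D: "locally_retract A C D"
begin

lemmas D_sub = locally_retract_sub_bimodule[OF C D]
lemmas D_bimodule = restrict_bimodule[OF C D_sub]

text \<open>The first factor is left alone, and \<open>\<tau>\<close> is chosen to fix all second
  coordinates of \<open>z\<close>. Replaying the derivation under \<open>\<tau>\<close> moves it to
  \<open>D\<close> while the word stays what it was.\<close>

lemma locally_retract_rel_left:
  fixes Q :: "('a, 'q, 'w) bimodule_scheme"
  assumes Q: "right_module A Q" and z: "z \<in> pres_rel (carrier Q \<times> carrier C) (tensor_rels A Q C)"
    and k: "Poly_Mapping.keys z \<subseteq> carrier Q \<times> D"
  shows "z \<in> pres_rel (carrier Q \<times> D) (tensor_rels A Q (C\<lparr>carrier := D\<rparr>))"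
proof -
  have "\<exists>T U B. (finite T \<and> T \<subseteq> carrier Q \<and> finite U \<and> U \<subseteq> carrier C \<and> finite B \<and> B \<subseteq> carrier A) \<and>
    (\<forall>(M' :: ('a, 'q, 'w) bimodule_scheme) (N' :: ('a, 'c, 'z) bimodule_scheme) \<sigma> \<tau>.
      tensor_pair A M' N' \<longrightarrow> local_hom Q M' T B \<sigma> \<longrightarrow> local_hom C N' U B \<tau> \<longrightarrow>
      map_frag (\<lambda>(x, y). (\<sigma> x, \<tau> y)) z \<in> pres_rel (carrier M' \<times> carrier N') (tensor_rels A M' N'))"
    by (rule tensor_pres_rel_local[OF Q bimodule_left[OF C] z])
  then obtain T U B where fin: "finite U" "U \<subseteq> carrier C" "finite B" "B \<subseteq> carrier A"
    and loc: "\<And>(M' :: ('a, 'q, 'w) bimodule_scheme) (N' :: ('a, 'c, 'z) bimodule_scheme) \<sigma> \<tau>.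
      tensor_pair A M' N' \<Longrightarrow> local_hom Q M' T B \<sigma> \<Longrightarrow> local_hom C N' U B \<tau> \<Longrightarrow>
      map_frag (\<lambda>(x, y). (\<sigma> x, \<tau> y)) z \<in> pres_rel (carrier M' \<times> carrier N') (tensor_rels A M' N')"
    by metis
  have sD: "snd ` Poly_Mapping.keys z \<subseteq> D"
    using k by auto
  obtain \<tau> where \<tau>: "local_hom C (C\<lparr>carrier := D\<rparr>) (U \<union> snd ` Poly_Mapping.keys z) B \<tau>"
    and fix\<tau>: "\<And>y. y \<in> U \<union> snd ` Poly_Mapping.keys z \<Longrightarrow> y \<in> D \<Longrightarrow> \<tau> y = y"
    by (rule locally_retractE[OF D, of "U \<union> snd ` Poly_Mapping.keys z" B])
      (use fin sD sub_bimoduleD(1)[OF D_sub] in auto)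
  have "map_frag (\<lambda>(x, y). (x, \<tau> y)) z \<in> pres_rel (carrier Q \<times> carrier (C\<lparr>carrier := D\<rparr>)) (tensor_rels A Q (C\<lparr>carrier := D\<rparr>))"
    by (rule loc[OF tensor_pairI[OF Q bimodule_left[OF D_bimodule]] local_hom_id local_hom_mono[OF \<tau>]]) auto
  moreover have "map_frag (\<lambda>(x, y). (x, \<tau> y)) z = z"
    by (rule map_frag_id) (use fix\<tau> sD in force)
  ultimately show ?thesis by simp
qed

lemma locally_retract_rel_right:
  fixes Q :: "('a, 'q, 'w) bimodule_scheme"
  assumes Q: "left_module A Q" and z: "z \<in> pres_rel (carrier C \<times> carrier Q) (tensor_rels A C Q)"
    and k: "Poly_Mapping.keys z \<subseteq> D \<times> carrier Q"
  shows "z \<in> pres_rel (D \<times> carrier Q) (tensor_rels A (C\<lparr>carrier := D\<rparr>) Q)"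
proof -
  have "\<exists>T U B. (finite T \<and> T \<subseteq> carrier C \<and> finite U \<and> U \<subseteq> carrier Q \<and> finite B \<and> B \<subseteq> carrier A) \<and>
    (\<forall>(M' :: ('a, 'c, 'z) bimodule_scheme) (N' :: ('a, 'q, 'w) bimodule_scheme) \<sigma> \<tau>.
      tensor_pair A M' N' \<longrightarrow> local_hom C M' T B \<sigma> \<longrightarrow> local_hom Q N' U B \<tau> \<longrightarrow>
      map_frag (\<lambda>(x, y). (\<sigma> x, \<tau> y)) z \<in> pres_rel (carrier M' \<times> carrier N') (tensor_rels A M' N'))"
    by (rule tensor_pres_rel_local[OF bimodule_right[OF C] Q z])
  then obtain T U B where fin: "finite T" "T \<subseteq> carrier C" "finite B" "B \<subseteq> carrier A"
    and loc: "\<And>(M' :: ('a, 'c, 'z) bimodule_scheme) (N' :: ('a, 'q, 'w) bimodule_scheme) \<sigma> \<tau>.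
      tensor_pair A M' N' \<Longrightarrow> local_hom C M' T B \<sigma> \<Longrightarrow> local_hom Q N' U B \<tau> \<Longrightarrow>
      map_frag (\<lambda>(x, y). (\<sigma> x, \<tau> y)) z \<in> pres_rel (carrier M' \<times> carrier N') (tensor_rels A M' N')"
    by metis
  have sD: "fst ` Poly_Mapping.keys z \<subseteq> D"
    using k by auto
  obtain \<sigma> where \<sigma>: "local_hom C (C\<lparr>carrier := D\<rparr>) (T \<union> fst ` Poly_Mapping.keys z) B \<sigma>"
    and fix\<sigma>: "\<And>y. y \<in> T \<union> fst ` Poly_Mapping.keys z \<Longrightarrow> y \<in> D \<Longrightarrow> \<sigma> y = y"
    by (rule locally_retractE[OF D, of "T \<union> fst ` Poly_Mapping.keys z" B])
      (use fin sD sub_bimoduleD(1)[OF D_sub] in auto)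
  have "map_frag (\<lambda>(x, y). (\<sigma> x, y)) z \<in> pres_rel (carrier (C\<lparr>carrier := D\<rparr>) \<times> carrier Q) (tensor_rels A (C\<lparr>carrier := D\<rparr>) Q)"
    by (rule loc[OF tensor_pairI[OF bimodule_right[OF D_bimodule] Q] local_hom_mono[OF \<sigma>] local_hom_id]) auto
  moreover have "map_frag (\<lambda>(x, y). (\<sigma> x, y)) z = z"
    by (rule map_frag_id) (use fix\<sigma> sD in force)
  ultimately show ?thesis by simp
qed

text \<open>Two steps through \<open>C \<otimes> D\<close>: shrink the second factor with
  \<open>Q = C\<close>, and after that the first factor with \<open>Q = D\<close>.\<close>

lemma locally_retract_inj:
  "inj_on (tensor_map A (C\<lparr>carrier := D\<rparr>) (C\<lparr>carrier := D\<rparr>) C C (\<lambda>x\<in>D. x) (\<lambda>x\<in>D. x))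
    (carrier (tensor A (C\<lparr>carrier := D\<rparr>) (C\<lparr>carrier := D\<rparr>)))"
proof (subst inj_tensor_map_incl_iff[OF tensor_pair_bimodule[OF D_bimodule D_bimodule]
      tensor_pair_bimodule[OF C C] incl_linear[OF C D_sub]])
  have DC: "D \<subseteq> carrier C"
    using sub_bimoduleD(1)[OF D_sub] .
  show "\<forall>z\<in>pres_rel (carrier C \<times> carrier C) (tensor_rels A C C).
      Poly_Mapping.keys z \<subseteq> carrier (C\<lparr>carrier := D\<rparr>) \<times> carrier (C\<lparr>carrier := D\<rparr>) \<longrightarrow>
      z \<in> pres_rel (carrier (C\<lparr>carrier := D\<rparr>) \<times> carrier (C\<lparr>carrier := D\<rparr>))
        (tensor_rels A (C\<lparr>carrier := D\<rparr>) (C\<lparr>carrier := D\<rparr>))"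
  proof (intro ballI impI)
    fix z assume z: "z \<in> pres_rel (carrier C \<times> carrier C) (tensor_rels A C C)"
      and "Poly_Mapping.keys z \<subseteq> carrier (C\<lparr>carrier := D\<rparr>) \<times> carrier (C\<lparr>carrier := D\<rparr>)"
    then have k: "Poly_Mapping.keys z \<subseteq> D \<times> D" by simp
    have "z \<in> pres_rel (carrier C \<times> D) (tensor_rels A C (C\<lparr>carrier := D\<rparr>))"
      by (rule locally_retract_rel_left[OF bimodule_right[OF C] z]) (use k DC in auto)
    then have "z \<in> pres_rel (D \<times> carrier (C\<lparr>carrier := D\<rparr>)) (tensor_rels A (C\<lparr>carrier := D\<rparr>) (C\<lparr>carrier := D\<rparr>))"
      by (intro locally_retract_rel_right[OF bimodule_left[OF D_bimodule]]) (use k in auto)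
    then show "z \<in> pres_rel (carrier (C\<lparr>carrier := D\<rparr>) \<times> carrier (C\<lparr>carrier := D\<rparr>))
        (tensor_rels A (C\<lparr>carrier := D\<rparr>) (C\<lparr>carrier := D\<rparr>))"
      by simp
  qed
qed (use sub_bimoduleD(1)[OF D_sub] in auto)

end

section \<open>Triple tensor products\<close>

text \<open>\<open>M \<otimes> (M \<otimes> M)\<close> is also presented by triples. Purity does not give injectivity of
  \<open>D \<otimes> (D \<otimes> D) \<rightarrow> C \<otimes> (C \<otimes> C)\<close> one tensor factor at a time, since the middle step changes a factor
  inside a two-sided product; on the triple presentation all three factors are retracted at once.\<close>

definition triple_rels ::
  "('a, 's) ring_scheme \<Rightarrow> ('a, 'm, 'z) bimodule_scheme \<Rightarrow> ('m \<times> 'm \<times> 'm \<Rightarrow>\<^sub>0 int) set"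
  where "triple_rels A M =
    {frag_of (x \<oplus>\<^bsub>M\<^esub> x', y, w) - frag_of (x, y, w) - frag_of (x', y, w) | x x' y w.
        x \<in> carrier M \<and> x' \<in> carrier M \<and> y \<in> carrier M \<and> w \<in> carrier M} \<union>
    {map_frag (Pair x) r | x r. x \<in> carrier M \<and> r \<in> tensor_rels A M M} \<union>
    {frag_of (ract M x a, y, w) - frag_of (x, lact M a y, w) | x a y w.
        x \<in> carrier M \<and> a \<in> carrier A \<and> y \<in> carrier M \<and> w \<in> carrier M}"

lemma triple_relsI:
  "x \<in> carrier M \<Longrightarrow> x' \<in> carrier M \<Longrightarrow> y \<in> carrier M \<Longrightarrow> w \<in> carrier M \<Longrightarrow>
    frag_of (x \<oplus>\<^bsub>M\<^esub> x', y, w) - frag_of (x, y, w) - frag_of (x', y, w) \<in> triple_rels A M"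
  "x \<in> carrier M \<Longrightarrow> r \<in> tensor_rels A M M \<Longrightarrow> map_frag (Pair x) r \<in> triple_rels A M"
  "x \<in> carrier M \<Longrightarrow> a \<in> carrier A \<Longrightarrow> y \<in> carrier M \<Longrightarrow> w \<in> carrier M \<Longrightarrow>
    frag_of (ract M x a, y, w) - frag_of (x, lact M a y, w) \<in> triple_rels A M"
  unfolding triple_rels_def
  by (rule UnI1, rule UnI1, rule CollectI, intro exI conjI, rule refl, assumption+)
    (rule UnI1, rule UnI2, rule CollectI, intro exI conjI, rule refl, assumption+,
     rule UnI2, rule CollectI, intro exI conjI, rule refl, assumption+)

abbreviation triples :: "('a, 'm, 'z) bimodule_scheme \<Rightarrow> ('m \<times> 'm \<times> 'm) set"
  where "triples M \<equiv> carrier M \<times> carrier M \<times> carrier M"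

definition triple_tens ::
  "('a, 's) ring_scheme \<Rightarrow> ('a, 'm, 'z) bimodule_scheme \<Rightarrow> ('m \<times> 'm \<times> 'm \<Rightarrow>\<^sub>0 int)
    \<Rightarrow> ('m \<times> ('m \<times> 'm \<Rightarrow>\<^sub>0 int) set \<Rightarrow>\<^sub>0 int) set"
  where "triple_tens A M = free_lift (tensor A M (tensor A M M))
    (\<lambda>(x, y, w). tens A M (tensor A M M) x (tens A M M y w))"

context
  fixes A :: "('a, 's) ring_scheme" and M :: "('a, 'm, 'z) bimodule_scheme"
  assumes M: "bimodule A M"
begin

interpretation M: bimodule A M by (rule M)
interpretation T: tensor_pair A M M by (rule tensor_pair_bimodule[OF M M])
interpretation M_MM: tensor_pair A M "tensor A M M" by (rule tensor_pair_bimodule[OF M bimodule_tensor[OF M M]])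
interpretation G: abelian_group "tensor A M (tensor A M M)" by (rule M_MM.abelian_tensor)

lemma presentation_triple: "presentation (triples M) (triple_rels A M)"
proof
  fix r assume "r \<in> triple_rels A M"
  then show "Poly_Mapping.keys r \<subseteq> triples M"
    unfolding triple_rels_def
  proof (elim UnE CollectE exE conjE)
    fix x r' assume r: "r = map_frag (Pair x) r'" and x: "x \<in> carrier M" and r': "r' \<in> tensor_rels A M M"
    show "Poly_Mapping.keys r \<subseteq> triples M"
      unfolding r using keys_map_frag[of "Pair x" r'] T.pres.keys_rel[OF r'] x by blast
  next
    fix x x' y w
    assume r: "r = frag_of (x \<oplus>\<^bsub>M\<^esub> x', y, w) - frag_of (x, y, w) - frag_of (x', y, w)"
      and *: "x \<in> carrier M" "x' \<in> carrier M" "y \<in> carrier M" "w \<in> carrier M"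
    show "Poly_Mapping.keys r \<subseteq> triples M"
      unfolding r by (rule order_trans[OF keys_diff3]) (use * in simp)
  next
    fix x a y w
    assume r: "r = frag_of (ract M x a, y, w) - frag_of (x, lact M a y, w)"
      and *: "x \<in> carrier M" "a \<in> carrier A" "y \<in> carrier M" "w \<in> carrier M"
    show "Poly_Mapping.keys r \<subseteq> triples M"
      unfolding r by (rule order_trans[OF keys_diff2]) (use * in \<open>simp add: M.ract_closed M.lact_closed\<close>)
  qed
qed

interpretation T3: presentation "triples M" "triple_rels A M" by (rule presentation_triple)

lemma tens3_closed:
  "s \<in> triples M \<Longrightarrow>
    (\<lambda>(x, y, w). tens A M (tensor A M M) x (tens A M M y w)) s \<in> carrier (tensor A M (tensor A M M))"
  by (auto simp: M_MM.tens_closed T.tens_closed)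

lemma triple_tens_add:
  "Poly_Mapping.keys z \<subseteq> triples M \<Longrightarrow> Poly_Mapping.keys w \<subseteq> triples M \<Longrightarrow>
    triple_tens A M (z + w) = triple_tens A M z \<oplus>\<^bsub>tensor A M (tensor A M M)\<^esub> triple_tens A M w"
  unfolding triple_tens_def by (rule G.free_lift_add[of "triples M"]) (rule tens3_closed)

lemma triple_tens_closed:
  "Poly_Mapping.keys z \<subseteq> triples M \<Longrightarrow> triple_tens A M z \<in> carrier (tensor A M (tensor A M M))"
  unfolding triple_tens_def by (rule G.free_lift_closed) (rule tens3_closed, blast)

lemma triple_tens_of:
  "x \<in> carrier M \<Longrightarrow> y \<in> carrier M \<Longrightarrow> w \<in> carrier M \<Longrightarrow>
    triple_tens A M (frag_of (x, y, w)) = tens A M (tensor A M M) x (tens A M M y w)"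
  unfolding triple_tens_def by (subst G.free_lift_of) (simp_all add: M_MM.tens_closed T.tens_closed)

lemma keys_add_subset:
  "Poly_Mapping.keys z \<subseteq> S \<Longrightarrow> Poly_Mapping.keys w \<subseteq> S \<Longrightarrow> Poly_Mapping.keys (z + w) \<subseteq> S"
  using keys_add[of z w] by blast

text \<open>Together with the two lemmas on \<open>pres_rel\<close> below, this identifies the group
  presented by triples with the iterated tensor product.\<close>

lemma triple_tens_surj:
  assumes "u \<in> carrier (tensor A M (tensor A M M))"
  shows "\<exists>z. Poly_Mapping.keys z \<subseteq> triples M \<and> u = triple_tens A M z"
  using assms
proof (induction rule: M_MM.tensor_induct)
  case (tens x v)
  from tens(2) show ?case
  proof (induction rule: T.tensor_induct)
    case (tens y w)
    then show ?case
      using \<open>x \<in> carrier M\<close> by (intro exI[of _ "frag_of (x, y, w)"]) (simp add: triple_tens_of keys_frag_of)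
  next
    case (add v v')
    then obtain z z' where "Poly_Mapping.keys z \<subseteq> triples M" "tens A M (tensor A M M) x v = triple_tens A M z"
      "Poly_Mapping.keys z' \<subseteq> triples M" "tens A M (tensor A M M) x v' = triple_tens A M z'"
      by auto
    then show ?case
      using add(1,2) \<open>x \<in> carrier M\<close>
      by (intro exI[of _ "z + z'"] conjI keys_add_subset) (simp_all add: triple_tens_add M_MM.tens_add_right)
  qed
next
  case (add u u')
  then obtain z z' where "Poly_Mapping.keys z \<subseteq> triples M" "u = triple_tens A M z"
    "Poly_Mapping.keys z' \<subseteq> triples M" "u' = triple_tens A M z'"
    by auto
  then show ?case
    by (intro exI[of _ "z + z'"] conjI keys_add_subset) (simp_all add: triple_tens_add)
qed

text \<open>Relations in the last two slots arise by prefixing \<open>x\<close> to relations of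
  \<open>M \<otimes> M\<close>, and vanish because the triple tensor is balanced in \<open>y\<close>
  and \<open>w\<close>. The other two families vanish by the rules of the outer product.\<close>

lemma triple_tens_pres_rel:
  assumes "z \<in> pres_rel (triples M) (triple_rels A M)"
  shows "triple_tens A M z = \<zero>\<^bsub>tensor A M (tensor A M M)\<^esub>"
  unfolding triple_tens_def
proof (rule T3.free_lift_pres_rel[OF M_MM.abelian_tensor tens3_closed _ assms])
  let ?b = "\<lambda>(x, y, w). tens A M (tensor A M M) x (tens A M M y w)"
  fix r assume "r \<in> triple_rels A M"
  then show "free_lift (tensor A M (tensor A M M)) ?b r = \<zero>\<^bsub>tensor A M (tensor A M M)\<^esub>"
    unfolding triple_rels_def
  proof (elim UnE CollectE exE conjE)
    fix x r' assume r: "r = map_frag (Pair x) r'" and x: "x \<in> carrier M" and r': "r' \<in> tensor_rels A M M"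
    have "balanced A M M (tensor A M (tensor A M M)) (\<lambda>y w. tens A M (tensor A M M) x (tens A M M y w))"
      by (rule bal_right[OF M M M M_MM.abelian_tensor tens3_trilinear[OF M M M] x])
    from T.balanced_respects[OF M_MM.abelian_tensor this r']
    show "free_lift (tensor A M (tensor A M M)) ?b r = \<zero>\<^bsub>tensor A M (tensor A M M)\<^esub>"
      using tens3_closed T.pres.keys_rel[OF r'] x unfolding r
      by (subst G.free_lift_map_frag) auto
  next
    fix x x' y w
    assume r: "r = frag_of (x \<oplus>\<^bsub>M\<^esub> x', y, w) - frag_of (x, y, w) - frag_of (x', y, w)"
      and *: "x \<in> carrier M" "x' \<in> carrier M" "y \<in> carrier M" "w \<in> carrier M"
    show "free_lift (tensor A M (tensor A M M)) ?b r = \<zero>\<^bsub>tensor A M (tensor A M M)\<^esub>"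
      unfolding r by (rule G.free_lift_rel3) (use * in \<open>simp_all add: M_MM.tens_closed T.tens_closed M_MM.tens_add_left\<close>)
  next
    fix x a y w
    assume r: "r = frag_of (ract M x a, y, w) - frag_of (x, lact M a y, w)"
      and *: "x \<in> carrier M" "a \<in> carrier A" "y \<in> carrier M" "w \<in> carrier M"
    show "free_lift (tensor A M (tensor A M M)) ?b r = \<zero>\<^bsub>tensor A M (tensor A M M)\<^esub>"
      unfolding r by (rule G.free_lift_rel2)
        (use * tens3_trilinear(4)[OF M M M] in \<open>simp_all add: M_MM.tens_closed T.tens_closed M.lact_closed M.ract_closed\<close>)
  qed
qed

text \<open>The generators of the presented group depend on the triple in a trilinear and balanced
  way, so they induce a map \<open>\<theta>\<close> out of the iterated tensor product. It undoes
  \<open>triple_tens\<close>, hence a word with zero image is a relation.\<close>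

lemma pres_rel_triple_tens:
  assumes z: "Poly_Mapping.keys z \<subseteq> triples M" and 0: "triple_tens A M z = \<zero>\<^bsub>tensor A M (tensor A M M)\<^esub>"
  shows "z \<in> pres_rel (triples M) (triple_rels A M)"
proof -
  define gen where "gen x y w = pres_gen (triples M) (triple_rels A M) (x, y, w)" for x y w
  let ?P = "pres_group (triples M) (triple_rels A M)"
  have closed: "gen x y w \<in> carrier ?P" if "x \<in> carrier M" "y \<in> carrier M" "w \<in> carrier M" for x y w
    using that by (simp add: gen_def T3.pres_gen_closed)
  have inner: "map_frag (Pair x) r \<in> triple_rels A M" if "x \<in> carrier M" "r \<in> tensor_rels A M M" for x r
    using that by (rule triple_relsI(2))
  have add1: "additive_map M ?P (\<lambda>x. gen x y w)" if "y \<in> carrier M" "w \<in> carrier M" for y w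
  proof (rule additive_mapI)
    fix x x' assume "x \<in> carrier M" "x' \<in> carrier M"
    then show "gen (x \<oplus>\<^bsub>M\<^esub> x') y w = gen x y w \<oplus>\<^bsub>?P\<^esub> gen x' y w"
      unfolding gen_def using that by (intro T3.pres_gen_rel3 triple_relsI(1)) simp_all
  qed (use closed that in auto)
  have add2: "additive_map M ?P (\<lambda>y. gen x y w)" if "x \<in> carrier M" "w \<in> carrier M" for x w
  proof (rule additive_mapI)
    fix y y' assume y: "y \<in> carrier M" "y' \<in> carrier M"
    then have "frag_of (y \<oplus>\<^bsub>M\<^esub> y', w) - frag_of (y, w) - frag_of (y', w) \<in> tensor_rels A M M"
      using that unfolding tensor_rels_def by blast
    from inner[OF that(1) this] show "gen x (y \<oplus>\<^bsub>M\<^esub> y') w = gen x y w \<oplus>\<^bsub>?P\<^esub> gen x y' w"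
      unfolding gen_def using that y by (intro T3.pres_gen_rel3) (simp_all add: map_frag_simps)
  qed (use closed that in auto)
  have add3: "additive_map M ?P (\<lambda>w. gen x y w)" if "x \<in> carrier M" "y \<in> carrier M" for x y
  proof (rule additive_mapI)
    fix w w' assume w: "w \<in> carrier M" "w' \<in> carrier M"
    then have "frag_of (y, w \<oplus>\<^bsub>M\<^esub> w') - frag_of (y, w) - frag_of (y, w') \<in> tensor_rels A M M"
      using that unfolding tensor_rels_def by blast
    from inner[OF that(1) this] show "gen x y (w \<oplus>\<^bsub>M\<^esub> w') = gen x y w \<oplus>\<^bsub>?P\<^esub> gen x y w'"
      unfolding gen_def using that w by (intro T3.pres_gen_rel3) (simp_all add: map_frag_simps)
  qed (use closed that in auto)
  have bal1: "gen (ract M x a) y w = gen x (lact M a y) w"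
    if "x \<in> carrier M" "a \<in> carrier A" "y \<in> carrier M" "w \<in> carrier M" for x a y w
    unfolding gen_def using that
    by (intro T3.pres_gen_rel2 triple_relsI(3)) (simp_all add: M.lact_closed M.ract_closed)
  have bal2: "gen x (ract M y a) w = gen x y (lact M a w)"
    if "x \<in> carrier M" "a \<in> carrier A" "y \<in> carrier M" "w \<in> carrier M" for x a y w
  proof -
    have "frag_of (ract M y a, w) - frag_of (y, lact M a w) \<in> tensor_rels A M M"
      using that unfolding tensor_rels_def by blast
    from inner[OF that(1) this] show ?thesis
      unfolding gen_def using that
      by (intro T3.pres_gen_rel2) (simp_all add: map_frag_simps M.lact_closed M.ract_closed)
  qed
  note tri = M M M T3.abelian_group_pres_group add1 add2 add3 bal1 bal2
  define \<theta> where "\<theta> = pres_lift ?P (\<lambda>(x, u). pres_lift ?P (\<lambda>(y, w). gen x y w) u)"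
  have \<theta>: "additive_map (tensor A M (tensor A M M)) ?P \<theta>"
    unfolding \<theta>_def by (rule additive_trilinear_right[OF tri])
  have "\<theta> (triple_tens A M z) = pres_class (triples M) (triple_rels A M) z"
  proof (rule frag_additive_eqI[where S = "triples M", OF T3.abelian_group_pres_group _ _ _ _ _ z])
    fix s assume "s \<in> triples M"
    then obtain x y w where s: "s = (x, y, w)" "x \<in> carrier M" "y \<in> carrier M" "w \<in> carrier M"
      by auto
    have "\<theta> (tens A M (tensor A M M) x (tens A M M y w)) = gen x y w"
      unfolding \<theta>_def by (rule trilinear_right_tens[OF tri s(2-4)])
    then show "\<theta> (triple_tens A M (frag_of s)) = pres_class (triples M) (triple_rels A M) (frag_of s)"
      by (simp add: s triple_tens_of gen_def pres_gen_class)
  qed (simp_all add: additive_closed[OF \<theta>] additive_add[OF \<theta>] triple_tens_closed triple_tens_add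
      T3.pres_class_closed T3.pres_class_add)
  then have "pres_class (triples M) (triple_rels A M) z = \<zero>\<^bsub>?P\<^esub>"
    using 0 additive_zero[OF M_MM.abelian_tensor T3.abelian_group_pres_group \<theta>] by simp
  then show ?thesis
    using T3.pres_class_eq_zero_iff[OF z] by simp
qed

lemma triple_rels_local:
  assumes "r \<in> triple_rels A M"
  obtains T B where "finite T" "T \<subseteq> carrier M" "finite B" "B \<subseteq> carrier A"
    "\<And>(M' :: ('a, 'm, 'z) bimodule_scheme) \<sigma>. local_hom M M' T B \<sigma> \<Longrightarrow>
      map_frag (\<lambda>(x, y, w). (\<sigma> x, \<sigma> y, \<sigma> w)) r \<in> triple_rels A M'"
  using assms unfolding triple_rels_def[of A M]
proof (elim UnE CollectE exE conjE)
  fix x x' y w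
  assume r: "r = frag_of (x \<oplus>\<^bsub>M\<^esub> x', y, w) - frag_of (x, y, w) - frag_of (x', y, w)"
    and *: "x \<in> carrier M" "x' \<in> carrier M" "y \<in> carrier M" "w \<in> carrier M"
  show thesis
  proof (rule that[of "{x, x', x \<oplus>\<^bsub>M\<^esub> x'}" "{}"])
    fix M' :: "('a, 'm, 'z) bimodule_scheme" and \<sigma>
    assume \<sigma>: "local_hom M M' {x, x', x \<oplus>\<^bsub>M\<^esub> x'} {} \<sigma>"
    have "\<sigma> (x \<oplus>\<^bsub>M\<^esub> x') = \<sigma> x \<oplus>\<^bsub>M'\<^esub> \<sigma> x'" "\<sigma> x \<in> carrier M'" "\<sigma> x' \<in> carrier M'"
        "\<sigma> y \<in> carrier M'" "\<sigma> w \<in> carrier M'"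
      using local_homD(1,2)[OF \<sigma>] * by simp_all
    then show "map_frag (\<lambda>(x, y, w). (\<sigma> x, \<sigma> y, \<sigma> w)) r \<in> triple_rels A M'"
      using triple_relsI(1) by (simp add: r map_frag_simps)
  qed (use * in auto)
next
  fix x r' assume r: "r = map_frag (Pair x) r'" and x: "x \<in> carrier M" and r': "r' \<in> tensor_rels A M M"
  show thesis
  proof (rule tensor_rels_local[OF M.right_module_axioms M.left_module_axioms r'])
    fix T U B assume fin: "finite T" "T \<subseteq> carrier M" "finite U" "U \<subseteq> carrier M" "finite B" "B \<subseteq> carrier A"
      and loc: "\<And>(M' :: ('a, 'm, 'z) bimodule_scheme) (N' :: ('a, 'm, 'z) bimodule_scheme) \<sigma> \<tau>.
        local_hom M M' T B \<sigma> \<Longrightarrow> local_hom M N' U B \<tau> \<Longrightarrow>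
        map_frag (\<lambda>(x, y). (\<sigma> x, \<tau> y)) r' \<in> tensor_rels A M' N'"
    \<comment> \<open>Both inner slots are renamed by the same map, so the fragments of the two
      factors are merged.\<close>
    show thesis
    proof (rule that[of "T \<union> U" B])
      fix M' :: "('a, 'm, 'z) bimodule_scheme" and \<sigma>
      assume \<sigma>: "local_hom M M' (T \<union> U) B \<sigma>"
      have "map_frag (\<lambda>(x, y). (\<sigma> x, \<sigma> y)) r' \<in> tensor_rels A M' M'"
        by (rule loc[OF local_hom_mono[OF \<sigma>] local_hom_mono[OF \<sigma>]]) auto
      moreover have "map_frag (\<lambda>(x, y, w). (\<sigma> x, \<sigma> y, \<sigma> w)) r =
          map_frag (Pair (\<sigma> x)) (map_frag (\<lambda>(x, y). (\<sigma> x, \<sigma> y)) r')"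
        unfolding r map_frag_comp by (rule map_frag_cong) auto
      ultimately show "map_frag (\<lambda>(x, y, w). (\<sigma> x, \<sigma> y, \<sigma> w)) r \<in> triple_rels A M'"
        using triple_relsI(2)[OF local_homD(1)[OF \<sigma> x]] by simp
    qed (use fin in auto)
  qed
next
  fix x a y w
  assume r: "r = frag_of (ract M x a, y, w) - frag_of (x, lact M a y, w)"
    and *: "x \<in> carrier M" "a \<in> carrier A" "y \<in> carrier M" "w \<in> carrier M"
  show thesis
  proof (rule that[of "{x, ract M x a, y, lact M a y}" "{a}"])
    fix M' :: "('a, 'm, 'z) bimodule_scheme" and \<sigma>
    assume \<sigma>: "local_hom M M' {x, ract M x a, y, lact M a y} {a} \<sigma>"
    have "\<sigma> (ract M x a) = ract M' (\<sigma> x) a" "\<sigma> (lact M a y) = lact M' a (\<sigma> y)"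
        "\<sigma> x \<in> carrier M'" "\<sigma> y \<in> carrier M'" "\<sigma> w \<in> carrier M'"
      using local_homD(1)[OF \<sigma>] local_homD(3)[OF \<sigma>, of a y] local_homD(4)[OF \<sigma>, of a x] * by simp_all
    then show "map_frag (\<lambda>(x, y, w). (\<sigma> x, \<sigma> y, \<sigma> w)) r \<in> triple_rels A M'"
      using triple_relsI(3)[of "\<sigma> x" M' a A "\<sigma> y" "\<sigma> w"] * by (simp add: r map_frag_simps)
  qed (use * in \<open>auto simp: M.ract_closed M.lact_closed\<close>)
qed

end

lemma triple_pres_rel_local:
  fixes M M' :: "('a, 'm, 'z) bimodule_scheme"
  assumes M: "bimodule A M" and M': "bimodule A M'"
    and "z \<in> pres_rel (triples M) (triple_rels A M)"
  shows "\<exists>T B. (finite T \<and> T \<subseteq> carrier M \<and> finite B \<and> B \<subseteq> carrier A) \<and>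
    (\<forall>\<sigma>. local_hom M M' T B \<sigma> \<longrightarrow>
      map_frag (\<lambda>(x, y, w). (\<sigma> x, \<sigma> y, \<sigma> w)) z \<in> pres_rel (triples M') (triple_rels A M'))"
    (is "\<exists>T B. ?fin T B \<and> ?loc z T B")
proof -
  interpret T: presentation "triples M" "triple_rels A M" by (rule presentation_triple[OF M])
  interpret T': presentation "triples M'" "triple_rels A M'" by (rule presentation_triple[OF M'])
  show ?thesis
    using assms(3)
  proof (induction rule: T.pres_rel_induct)
    case zero
    have "?fin {} {}" "?loc 0 {} {}"
      by (simp_all add: T'.pres_rel_zero map_frag_simps)
    then show ?case by (intro exI) (rule conjI)
  next
    case (rel r)
    show ?case
    proof (rule triple_rels_local[OF M rel])
      fix T B assume fin: "finite T" "T \<subseteq> carrier M" "finite B" "B \<subseteq> carrier A"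
        and loc: "\<And>(M' :: ('a, 'm, 'z) bimodule_scheme) \<sigma>. local_hom M M' T B \<sigma> \<Longrightarrow>
          map_frag (\<lambda>(x, y, w). (\<sigma> x, \<sigma> y, \<sigma> w)) r \<in> triple_rels A M'"
      have "?fin T B" "?loc r T B"
        using fin by (auto intro!: T'.pres_rel_incl loc)
      then show ?thesis by (intro exI) (rule conjI)
    qed
  next
    case (minus z)
    obtain T B where *: "?fin T B" "?loc z T B"
      using minus(2) by (elim exE) (erule conjE, rule that)
    have "?loc (- z) T B"
      unfolding map_frag_simps by (intro allI impI T'.pres_rel_minus *(2)[rule_format])
    with *(1) show ?case by (intro exI) (rule conjI)
  next
    case (add z w)
    obtain T1 B1 where 1: "?fin T1 B1" "?loc z T1 B1"
      using add(3) by (elim exE) (erule conjE, rule that)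
    obtain T2 B2 where 2: "?fin T2 B2" "?loc w T2 B2"
      using add(4) by (elim exE) (erule conjE, rule that)
    have "?loc (z + w) (T1 \<union> T2) (B1 \<union> B2)"
    proof (intro allI impI)
      fix \<sigma> assume "local_hom M M' (T1 \<union> T2) (B1 \<union> B2) \<sigma>"
      then have "local_hom M M' T1 B1 \<sigma>" "local_hom M M' T2 B2 \<sigma>"
        by (auto elim: local_hom_mono)
      then show "map_frag (\<lambda>(x, y, w). (\<sigma> x, \<sigma> y, \<sigma> w)) (z + w) \<in> pres_rel (triples M') (triple_rels A M')"
        unfolding map_frag_simps by (intro T'.pres_rel_add 1(2)[rule_format] 2(2)[rule_format])
    qed
    moreover have "?fin (T1 \<union> T2) (B1 \<union> B2)"
      using 1(1) 2(1) by simp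
    ultimately show ?case by (intro exI) (rule conjI)
  qed
qed

lemma locally_retract_inj3:
  assumes C: "bimodule A C" and D: "locally_retract A C D"
  defines "D0 \<equiv> C\<lparr>carrier := D\<rparr>" and "\<iota> \<equiv> \<lambda>x\<in>D. x"
  shows "inj_on (tensor_map A D0 (tensor A D0 D0) C (tensor A C C) \<iota> (tensor_map A D0 D0 C C \<iota> \<iota>))
    (carrier (tensor A D0 (tensor A D0 D0)))"
proof -
  note D_sub = locally_retract_sub_bimodule[OF C D]
  have DC: "D \<subseteq> carrier C"
    by (rule sub_bimoduleD(1)[OF D_sub])
  have D0: "bimodule A D0"
    unfolding D0_def by (rule restrict_bimodule[OF C D_sub])
  have cD0: "carrier D0 = D"
    by (simp add: D0_def)
  have \<iota>: "\<iota> \<in> bimodule_hom A D0 C"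
    using incl_linear[OF C D_sub] by (simp add: bimodule_hom_iff D0_def \<iota>_def)
  have \<iota>_id: "x \<in> D \<Longrightarrow> \<iota> x = x" for x
    by (simp add: \<iota>_def)
  note CC = bimodule_tensor[OF C C] and DD = bimodule_tensor[OF D0 D0]
  note \<kappa> = tensor_map_hom[OF D0 D0 C C \<iota> \<iota>]
  let ?\<kappa> = "tensor_map A D0 D0 C C \<iota> \<iota>"
  let ?f = "tensor_map A D0 (tensor A D0 D0) C (tensor A C C) \<iota> ?\<kappa>"
  have f: "additive_map (tensor A D0 (tensor A D0 D0)) (tensor A C (tensor A C C)) ?f"
    by (rule bimodule_hom_additive[OF tensor_map_hom[OF D0 DD C CC \<iota> \<kappa>]])
  interpret DD: tensor_pair A D0 D0 by (rule tensor_pair_bimodule[OF D0 D0])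
  interpret D_DD: tensor_pair A D0 "tensor A D0 D0" by (rule tensor_pair_bimodule[OF D0 DD])
  interpret C_CC: tensor_pair A C "tensor A C C" by (rule tensor_pair_bimodule[OF C CC])
  have trip: "triples D0 \<subseteq> triples C"
    using DC by (auto simp: cD0)
  \<comment> \<open>On words the induced map is the inclusion, so an element of the kernel is
    represented by a word over \<open>D\<close> that is a relation over \<open>C\<close>.\<close>
  have map: "?f (triple_tens A D0 z) = triple_tens A C z" if z: "Poly_Mapping.keys z \<subseteq> triples D0" for z
  proof (rule frag_additive_eqI[where S = "triples D0", OF C_CC.abelian_tensor _ _ _ _ _ z])
    fix s assume "s \<in> triples D0"
    then obtain x y w where s: "s = (x, y, w)" "x \<in> D" "y \<in> D" "w \<in> D"
      by (auto simp: cD0)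
    have "?f (tens A D0 (tensor A D0 D0) x (tens A D0 D0 y w)) = tens A C (tensor A C C) (\<iota> x) (?\<kappa> (tens A D0 D0 y w))"
      by (rule tensor_map_tens[OF bimodule_right[OF D0] bimodule_left[OF DD] bimodule_right[OF C] bimodule_left[OF CC]
            bimodule_hom_right[OF \<iota>] bimodule_hom_left[OF \<kappa>]]) (simp_all add: s cD0 DD.tens_closed)
    also have "?\<kappa> (tens A D0 D0 y w) = tens A C C (\<iota> y) (\<iota> w)"
      by (rule tensor_map_tens[OF bimodule_right[OF D0] bimodule_left[OF D0] bimodule_right[OF C] bimodule_left[OF C]
            bimodule_hom_right[OF \<iota>] bimodule_hom_left[OF \<iota>]]) (simp_all add: s cD0)
    finally show "?f (triple_tens A D0 (frag_of s)) = triple_tens A C (frag_of s)"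
      using s DC by (simp add: triple_tens_of[OF D0] triple_tens_of[OF C] cD0 \<iota>_id subset_iff)
  next
    fix z w :: "_ \<Rightarrow>\<^sub>0 int" assume k: "Poly_Mapping.keys z \<subseteq> triples D0" "Poly_Mapping.keys w \<subseteq> triples D0"
    show "triple_tens A C (z + w) = triple_tens A C z \<oplus>\<^bsub>tensor A C (tensor A C C)\<^esub> triple_tens A C w"
      by (rule triple_tens_add[OF C order_trans[OF k(1) trip] order_trans[OF k(2) trip]])
    show "?f (triple_tens A D0 (z + w)) = ?f (triple_tens A D0 z) \<oplus>\<^bsub>tensor A C (tensor A C C)\<^esub> ?f (triple_tens A D0 w)"
      unfolding triple_tens_add[OF D0 k]
      by (rule additive_add[OF f triple_tens_closed[OF D0 k(1)] triple_tens_closed[OF D0 k(2)]])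
  next
    fix z :: "_ \<Rightarrow>\<^sub>0 int" assume k: "Poly_Mapping.keys z \<subseteq> triples D0"
    show "triple_tens A C z \<in> carrier (tensor A C (tensor A C C))"
      by (rule triple_tens_closed[OF C order_trans[OF k trip]])
    show "?f (triple_tens A D0 z) \<in> carrier (tensor A C (tensor A C C))"
      by (rule additive_closed[OF f triple_tens_closed[OF D0 k]])
  qed
  show ?thesis
  proof (rule additive_inj_on[OF D_DD.abelian_tensor C_CC.abelian_tensor f])
    fix u assume u: "u \<in> carrier (tensor A D0 (tensor A D0 D0))" and 0: "?f u = \<zero>\<^bsub>tensor A C (tensor A C C)\<^esub>"
    obtain z where z: "Poly_Mapping.keys z \<subseteq> triples D0" "u = triple_tens A D0 z"
      using triple_tens_surj[OF D0 u] by blast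
    have "z \<in> pres_rel (triples C) (triple_rels A C)"
      by (rule pres_rel_triple_tens[OF C]) (use z trip map[OF z(1)] 0 in auto)
    from triple_pres_rel_local[OF C D0 this] obtain T B where fin: "finite T" "T \<subseteq> carrier C" "finite B" "B \<subseteq> carrier A"
      and loc: "\<And>\<sigma>. local_hom C D0 T B \<sigma> \<Longrightarrow>
        map_frag (\<lambda>(x, y, w). (\<sigma> x, \<sigma> y, \<sigma> w)) z \<in> pres_rel (triples D0) (triple_rels A D0)"
      by metis
    \<comment> \<open>All entries of the word. When \<open>\<sigma>\<close> fixes them, renaming
      returns the same word, now as a relation over \<open>D\<close>.\<close>
    define K where "K = (\<Union>(x, y, w)\<in>Poly_Mapping.keys z. {x, y, w})"
    have K: "finite K" "K \<subseteq> D"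
      using z(1) by (auto simp: K_def cD0)
    obtain \<sigma> where \<sigma>: "local_hom C (C\<lparr>carrier := D\<rparr>) (T \<union> K) B \<sigma>" "\<And>x. x \<in> T \<union> K \<Longrightarrow> x \<in> D \<Longrightarrow> \<sigma> x = x"
      by (rule locally_retractE[OF D, of "T \<union> K" B]) (use fin K DC in auto)
    have "map_frag (\<lambda>(x, y, w). (\<sigma> x, \<sigma> y, \<sigma> w)) z \<in> pres_rel (triples D0) (triple_rels A D0)"
      by (rule loc) (use local_hom_mono[OF \<sigma>(1), of T B] in \<open>simp add: D0_def\<close>)
    moreover have "map_frag (\<lambda>(x, y, w). (\<sigma> x, \<sigma> y, \<sigma> w)) z = z"
    proof (rule map_frag_id)
      fix s assume s: "s \<in> Poly_Mapping.keys z"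
      obtain x y w where xyw: "s = (x, y, w)"
        by (cases s)
      have "{x, y, w} \<subseteq> K"
        unfolding K_def using s xyw by (intro UN_upper[of s, THEN order_trans[rotated]]) simp_all
      then show "(case s of (x, y, w) \<Rightarrow> (\<sigma> x, \<sigma> y, \<sigma> w)) = s"
        using \<sigma>(2)[of x] \<sigma>(2)[of y] \<sigma>(2)[of w] K(2) by (simp add: xyw subset_iff)
    qed
    ultimately show "u = \<zero>\<^bsub>tensor A D0 (tensor A D0 D0)\<^esub>"
      using triple_tens_pres_rel[OF D0, of z] z(2) by simp
  qed
qed

section \<open>Pure subcorings\<close>

text \<open>The assumption \<open>rep\<close> puts \<open>comult C x\<close> into the image of
  \<open>D \<otimes> D\<close>; the embedding of \<open>D \<otimes> D\<close> makes the preimage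
  unique and, by the same token, linear in \<open>x\<close>. The laws are reflected along the
  inclusion, for which the threefold product has to embed as well.\<close>

lemma locally_retract_subcoring:
  assumes C: "coring A C" and D: "locally_retract A C D"
    and rep: "\<And>x. x \<in> D \<Longrightarrow> \<exists>z. Poly_Mapping.keys z \<subseteq> D \<times> D \<and>
      comult C x = pres_class (carrier C \<times> carrier C) (tensor_rels A C C) z"
  shows "\<exists>E. carrier E = D \<and> same_ops E (C\<lparr>carrier := D\<rparr>) \<and> subcoring A E C"
proof -
  note pC = coring_precoring[OF C] and bC = coring_bimodule[OF C]
  note D_sub = locally_retract_sub_bimodule[OF bC D]
  have DC: "x \<in> D \<Longrightarrow> x \<in> carrier C" for x
    using sub_bimoduleD(1)[OF D_sub] by auto
  define D0 where "D0 = C\<lparr>carrier := D\<rparr>"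
  define \<iota> where "\<iota> = (\<lambda>x\<in>D. x)"
  define \<kappa> where "\<kappa> = tensor_map A D0 D0 C C \<iota> \<iota>"
  have D0: "bimodule A D0"
    unfolding D0_def by (rule restrict_bimodule[OF bC D_sub])
  have D0_sel: "carrier D0 = D" "add D0 = add C" "lact D0 = lact C" "ract D0 = ract C"
    by (simp_all add: D0_def)
  have \<iota>: "\<iota> \<in> bimodule_hom A D0 C"
    using incl_linear[OF bC D_sub] by (simp add: bimodule_hom_iff D0_def \<iota>_def)
  have \<iota>_id: "x \<in> D \<Longrightarrow> \<iota> x = x" for x
    by (simp add: \<iota>_def)
  interpret D0: bimodule A D0 by (rule D0)
  interpret DD: tensor_pair A D0 D0 by (rule tensor_pair_bimodule[OF D0 D0])
  interpret DDb: bimodule A "tensor A D0 D0" by (rule bimodule_tensor[OF D0 D0])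
  interpret CC: tensor_pair A C C by (rule tensor_pair_bimodule[OF bC bC])
  have \<kappa>: "\<kappa> \<in> bimodule_hom A (tensor A D0 D0) (tensor A C C)"
    unfolding \<kappa>_def by (rule tensor_map_hom[OF D0 D0 bC bC \<iota> \<iota>])
  have inj: "inj_on \<kappa> (carrier (tensor A D0 D0))"
    unfolding \<kappa>_def D0_def \<iota>_def by (rule locally_retract_inj[OF bC D])
  define \<delta> where "\<delta> x = inv_into (carrier (tensor A D0 D0)) \<kappa> (comult C x)" for x
  have \<delta>: "\<delta> x \<in> carrier (tensor A D0 D0)" "\<kappa> (\<delta> x) = comult C x" if x: "x \<in> D" for x
  proof -
    obtain z where z: "Poly_Mapping.keys z \<subseteq> D \<times> D" "comult C x = CC.tclass z"
      using rep[OF x] by (auto simp: CC.tclass_def)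
    have "\<kappa> (DD.tclass z) = CC.tclass (map_frag (\<lambda>(x, y). (\<iota> x, \<iota> y)) z)"
      unfolding \<kappa>_def
      by (rule tensor_map_tclass[OF DD.tensor_pair_axioms CC.tensor_pair_axioms bimodule_hom_right[OF \<iota>] bimodule_hom_left[OF \<iota>]])
        (use z in \<open>simp add: D0_sel\<close>)
    also have "map_frag (\<lambda>(x, y). (\<iota> x, \<iota> y)) z = z"
      by (rule map_frag_id) (use z(1) \<iota>_id in auto)
    finally have "comult C x \<in> \<kappa> ` carrier (tensor A D0 D0)"
      using z DD.tclass_closed[of z] by (metis D0_sel(1) imageI)
    then show "\<delta> x \<in> carrier (tensor A D0 D0)" "\<kappa> (\<delta> x) = comult C x"
      unfolding \<delta>_def by (rule inv_into_into, rule f_inv_into_f)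
  qed
  \<comment> \<open>\<open>D0\<close> still holds the comultiplication of \<open>C\<close> and
    stands for the bare bimodule; \<open>E\<close> has the corrected fields and the same bimodule
    operations.\<close>
  define E where "E = C\<lparr>carrier := D, comult := \<lambda>x\<in>D. \<delta> x, counit := \<lambda>x\<in>D. counit C x\<rparr>"
  have so: "same_ops E D0"
    by (simp add: same_ops_def E_def D0_def)
  have so': "same_ops D0 E"
    using so by (simp add: same_ops_def)
  have E_sel: "carrier E = D" "comult E = (\<lambda>x\<in>D. \<delta> x)" "counit E = (\<lambda>x\<in>D. counit C x)"
    by (simp_all add: E_def)
  have EE: "tensor A E E = tensor A D0 D0"
    by (rule tensor_same_ops[OF so so])
  have mE: "tensor_map A E E C C = tensor_map A D0 D0 C C"
    by (rule tensor_map_same_ops[OF so so same_ops_refl same_ops_refl])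
  note cm = precoring_comult[OF pC]
  have "(\<lambda>x\<in>D. \<delta> x) \<in> bimodule_hom A D0 (tensor A D0 D0)"
  proof (rule bimodule_homI)
    show "additive_map D0 (tensor A D0 D0) (\<lambda>x\<in>D. \<delta> x)"
    proof (rule additive_mapI)
      fix x y assume xy: "x \<in> carrier D0" "y \<in> carrier D0"
      then have xyD: "x \<in> D" "y \<in> D" "x \<oplus>\<^bsub>C\<^esub> y \<in> D"
        using sub_bimoduleD(3)[OF D_sub] by (simp_all add: D0_sel)
      have "\<delta> (x \<oplus>\<^bsub>C\<^esub> y) = \<delta> x \<oplus>\<^bsub>tensor A D0 D0\<^esub> \<delta> y"
        by (rule inj_onD[OF inj])
          (use xyD DC in \<open>simp_all add: \<delta> DDb.M.a_closed additive_add[OF bimodule_hom_additive[OF \<kappa>]]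
            additive_add[OF bimodule_hom_additive[OF cm]]\<close>)
      then show "(\<lambda>x\<in>D. \<delta> x) (x \<oplus>\<^bsub>D0\<^esub> y) = (\<lambda>x\<in>D. \<delta> x) x \<oplus>\<^bsub>tensor A D0 D0\<^esub> (\<lambda>x\<in>D. \<delta> x) y"
        using xyD by (simp add: D0_sel)
    qed (simp add: D0_sel \<delta>)
  next
    fix a x assume a: "a \<in> carrier A" and "x \<in> carrier D0"
    then have x: "x \<in> D" "lact C a x \<in> D" "ract C x a \<in> D"
      using sub_bimoduleD(4,5)[OF D_sub] by (simp_all add: D0_sel)
    have "\<delta> (lact C a x) = lact (tensor A D0 D0) a (\<delta> x)"
      by (rule inj_onD[OF inj])
        (use x a DC in \<open>simp_all add: \<delta> DDb.lact_closed bimodule_hom_lact[OF \<kappa>] bimodule_hom_lact[OF cm]\<close>)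
    then show "(\<lambda>x\<in>D. \<delta> x) (lact D0 a x) = lact (tensor A D0 D0) a ((\<lambda>x\<in>D. \<delta> x) x)"
      using x by (simp add: D0_sel)
    have "\<delta> (ract C x a) = ract (tensor A D0 D0) (\<delta> x) a"
      by (rule inj_onD[OF inj])
        (use x a DC in \<open>simp_all add: \<delta> DDb.ract_closed bimodule_hom_ract[OF \<kappa>] bimodule_hom_ract[OF cm]\<close>)
    then show "(\<lambda>x\<in>D. \<delta> x) (ract D0 x a) = ract (tensor A D0 D0) ((\<lambda>x\<in>D. \<delta> x) x) a"
      using x by (simp add: D0_sel)
  qed (simp add: D0_sel)
  moreover have "(\<lambda>x\<in>D. counit C x) \<in> bimodule_hom A D0 (regular A)"
    using bimodule_hom_compose[OF D0 \<iota> precoring_counit[OF pC]]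
    by (simp add: compose_def D0_sel \<iota>_id cong: restrict_cong)
  ultimately have pE: "precoring A E"
    using bimodule_same_ops[OF so' D0] by (simp add: precoring_def E_sel EE bimodule_hom_same_ops(1)[OF so])
  have \<iota>E: "\<iota> \<in> coring_hom A E C"
    using \<iota> \<iota>_id \<delta> DC unfolding coring_hom_def bimodule_hom_same_ops(1)[OF so] mE
    by (simp add: E_sel flip: \<kappa>_def)
  have "coring A E"
  proof (rule coring_reflect[OF pE pC \<iota>E C])
    show "inj_on \<iota> (carrier E)"
      by (simp add: inj_on_def E_sel \<iota>_id)
    have "tensor_map A E (tensor A E E) C (tensor A C C) = tensor_map A D0 (tensor A D0 D0) C (tensor A C C)"
      unfolding EE by (rule tensor_map_same_ops[OF so same_ops_refl same_ops_refl same_ops_refl])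
    moreover have "tensor A E (tensor A E E) = tensor A D0 (tensor A D0 D0)"
      unfolding EE by (rule tensor_same_ops[OF so same_ops_refl])
    ultimately show "inj_on (tensor_map A E (tensor A E E) C (tensor A C C) \<iota> (tensor_map A E E C C \<iota> \<iota>))
        (carrier (tensor A E (tensor A E E)))"
      using locally_retract_inj3[OF bC D] by (simp only: mE D0_def \<iota>_def)
  qed
  then have "subcoring A E C"
    using D_sub \<iota>E by (simp add: subcoring_def E_sel \<iota>_def)
  then show ?thesis
    using so by (intro exI[of _ E]) (simp add: E_sel D0_def)
qed

lemma same_ops_sym: "same_ops M N \<Longrightarrow> same_ops N M"
  by (simp add: same_ops_def)

context
  fixes A :: "('a, 's) ring_scheme" and C :: "('a, 'c, 'y) bimodule_scheme" and E :: "('a, 'c, 'z) bimodule_scheme" and D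
  assumes C: "bimodule A C" and D: "locally_retract A C D" and E: "same_ops E (C\<lparr>carrier := D\<rparr>)"
begin

lemmas retract_sub = locally_retract_sub_bimodule[OF C D]

lemma retract_carrier: "carrier E = D" "carrier E \<subseteq> carrier C"
  using E sub_bimoduleD(1)[OF retract_sub] by (simp_all add: same_ops_def)

lemma retract_bimodule: "bimodule A E"
  by (rule bimodule_same_ops[OF same_ops_sym[OF E] restrict_bimodule[OF C retract_sub]])

lemma retract_incl: "(\<lambda>x\<in>carrier E. x) \<in> bimodule_hom A E C"
  unfolding retract_carrier(1) bimodule_hom_same_ops(1)[OF E]
  using incl_linear[OF C retract_sub] by (simp add: bimodule_hom_iff)

lemma retract_pure_left: "pure_left T A E C"
  unfolding pure_left_def
proof (intro allI impI)
  fix Q :: "('a, 'q) bimodule" assume Q: "right_module A Q"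
  show "inj_on (tensor_map A Q E Q C (\<lambda>q\<in>carrier Q. q) (\<lambda>x\<in>carrier E. x)) (carrier (tensor A Q E))"
  proof (subst inj_tensor_map_incl_iff[OF tensor_pairI[OF Q bimodule_left[OF retract_bimodule]]
        tensor_pairI[OF Q bimodule_left[OF C]] right_linear_id[OF Q] bimodule_hom_left[OF retract_incl]])
    show "\<forall>z\<in>pres_rel (carrier Q \<times> carrier C) (tensor_rels A Q C).
        Poly_Mapping.keys z \<subseteq> carrier Q \<times> carrier E \<longrightarrow>
        z \<in> pres_rel (carrier Q \<times> carrier E) (tensor_rels A Q E)"
      unfolding retract_carrier(1) tensor_rels_same_ops[OF same_ops_refl E]
      using locally_retract_rel_left[OF C D Q] by (intro ballI impI)
  qed (use retract_carrier(2) in auto)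
qed

lemma retract_pure_right: "pure_right T A E C"
  unfolding pure_right_def
proof (intro allI impI)
  fix Q :: "('a, 'q) bimodule" assume Q: "left_module A Q"
  show "inj_on (tensor_map A E Q C Q (\<lambda>x\<in>carrier E. x) (\<lambda>q\<in>carrier Q. q)) (carrier (tensor A E Q))"
  proof (subst inj_tensor_map_incl_iff[OF tensor_pairI[OF bimodule_right[OF retract_bimodule] Q]
        tensor_pairI[OF bimodule_right[OF C] Q] bimodule_hom_right[OF retract_incl] left_linear_id[OF Q]])
    show "\<forall>z\<in>pres_rel (carrier C \<times> carrier Q) (tensor_rels A C Q).
        Poly_Mapping.keys z \<subseteq> carrier E \<times> carrier Q \<longrightarrow>
        z \<in> pres_rel (carrier E \<times> carrier Q) (tensor_rels A E Q)"
      unfolding retract_carrier(1) tensor_rels_same_ops[OF E same_ops_refl]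
      using locally_retract_rel_right[OF C D Q] by (intro ballI impI)
  qed (use retract_carrier(2) in auto)
qed

lemma retract_inj_tensor:
  "inj_on (tensor_map A E E C C (\<lambda>x\<in>carrier E. x) (\<lambda>x\<in>carrier E. x)) (carrier (tensor A E E))"
  unfolding tensor_map_same_ops[OF E E same_ops_refl same_ops_refl] tensor_same_ops[OF E E] retract_carrier(1)
  by (rule locally_retract_inj[OF C D])

end

text \<open>\<open>G x\<close> collects the finitely many components of one chosen word for
  \<open>comult C x\<close>, so closing off under \<open>G\<close> keeps that word over
  \<open>D\<close>. The set \<open>S\<close> is arbitrary because pieces are later grown around
  finite sets and around unions of images.\<close>

lemma pure_subcoring_exists:
  assumes C: "coring A C" and S: "S \<subseteq> carrier C"
  shows "\<exists>E. subcoring A E C \<and> S \<subseteq> carrier E \<and> locally_retract A C (carrier E) \<and>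
    same_ops E (C\<lparr>carrier := carrier E\<rparr>) \<and> carrier E \<lesssim> S <+> (carrier A <+> (UNIV :: nat set))"
proof -
  note bC = coring_bimodule[OF C]
  interpret CC: tensor_pair A C C by (rule tensor_pair_bimodule[OF bC bC])
  have "\<exists>z. Poly_Mapping.keys z \<subseteq> carrier C \<times> carrier C \<and> comult C x = CC.tclass z" if "x \<in> carrier C" for x
    using CC.tclass_surj[OF bimodule_hom_closed[OF precoring_comult[OF coring_precoring[OF C]] that]] by metis
  then obtain rep where rep: "\<And>x. x \<in> carrier C \<Longrightarrow> Poly_Mapping.keys (rep x) \<subseteq> carrier C \<times> carrier C"
      "\<And>x. x \<in> carrier C \<Longrightarrow> comult C x = CC.tclass (rep x)"
    by metis
  define G where "G x = fst ` Poly_Mapping.keys (rep x) \<union> snd ` Poly_Mapping.keys (rep x)" for x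
  obtain D where D: "S \<subseteq> D" "locally_retract A C D" "\<And>x. x \<in> D \<Longrightarrow> G x \<subseteq> D"
      "D \<lesssim> S <+> (carrier A <+> (UNIV :: nat set))"
  proof (rule locally_retract_exists[OF bC S])
    show "G x \<subseteq> carrier C" if "x \<in> carrier C" for x
      using rep(1)[OF that] by (auto simp: G_def)
    show "countable (G x)" for x
      by (simp add: G_def countable_finite)
  qed (rule that)
  have "x \<in> D \<Longrightarrow> x \<in> carrier C" for x
    using D(2) by (auto simp: locally_retract_def)
  moreover have "Poly_Mapping.keys (rep x) \<subseteq> D \<times> D" if "x \<in> D" for x
    using D(3)[OF that] by (force simp: G_def)
  ultimately have "\<exists>z. Poly_Mapping.keys z \<subseteq> D \<times> D \<and>
      comult C x = pres_class (carrier C \<times> carrier C) (tensor_rels A C C) z" if "x \<in> D" for x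
    using that by (intro exI[of _ "rep x"]) (simp add: rep(2) CC.tclass_def)
  then have "\<exists>E. carrier E = D \<and> same_ops E (C\<lparr>carrier := D\<rparr>) \<and> subcoring A E C"
    by (rule locally_retract_subcoring[OF C D(2)])
  then show ?thesis
    using D by auto
qed


section \<open>Transport of structure and change of type\<close>

text \<open>Of the actions only closure is asked, since the lemma is applied to a one-sided module
  whose other action has been replaced by a trivial one. The finite \<open>T\<close> adds nothing
  beyond aleph_0 to the bound.\<close>

lemma small_sub_bimodule:
  assumes A: "ring A" and Q: "abelian_group Q"
    and act: "\<And>a x. a \<in> carrier A \<Longrightarrow> x \<in> carrier Q \<Longrightarrow> lact Q a x \<in> carrier Q"
      "\<And>a x. a \<in> carrier A \<Longrightarrow> x \<in> carrier Q \<Longrightarrow> ract Q x a \<in> carrier Q"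
    and T: "finite T" "T \<subseteq> carrier Q"
  shows "\<exists>D. T \<subseteq> D \<and> sub_bimodule A D Q \<and> (D \<lesssim> carrier A \<or> D \<lesssim> (UNIV :: nat set))"
proof -
  interpret Q: abelian_group Q by (rule Q)
  interpret A: ring A by (rule A)
  define B where "B = T <+> (carrier A <+> (UNIV :: nat set))"
  define F where "F a ys = insert \<zero>\<^bsub>Q\<^esub> ((\<lambda>(x, y). x \<oplus>\<^bsub>Q\<^esub> y) ` (set ys \<times> set ys)) \<union>
    (a_inv Q ` set ys \<union> lact Q a ` set ys \<union> (\<lambda>x. ract Q x a) ` set ys)" for a ys
  have "\<exists>D. T \<subseteq> D \<and> D \<subseteq> carrier Q \<and> D \<lesssim> B \<and> (\<forall>a\<in>carrier A. \<forall>ys. set ys \<subseteq> D \<longrightarrow> F a ys \<subseteq> D)"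
  proof (rule closure_exists[OF T(2)])
    show "T \<lesssim> B" "carrier A \<lesssim> B"
      unfolding B_def lepoll_iff_ordLeq
      by (rule card_of_Plus1, rule ordLeq_transitive[OF card_of_Plus1 card_of_Plus2])
    show "infinite B"
      by (simp add: B_def)
    show "F a ys \<subseteq> carrier Q" if "a \<in> carrier A" "set ys \<subseteq> carrier Q" for a ys
      using that act[OF that(1)] by (auto simp: F_def)
    show "countable (F a ys)" for a ys
      unfolding F_def by (rule countable_finite) simp
  qed
  then obtain D where D: "T \<subseteq> D" "D \<subseteq> carrier Q" "D \<lesssim> B" "\<And>a ys. a \<in> carrier A \<Longrightarrow> set ys \<subseteq> D \<Longrightarrow> F a ys \<subseteq> D"
    by blast
  have cl: "\<zero>\<^bsub>Q\<^esub> \<in> D" "\<ominus>\<^bsub>Q\<^esub> x \<in> D" "lact Q a x \<in> D" "ract Q x a \<in> D" "x \<oplus>\<^bsub>Q\<^esub> y \<in> D"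
    if "x \<in> D" "y \<in> D" "a \<in> carrier A" for x y a
    using D(4)[of a "[x, y]"] that by (auto simp: F_def)
  have zero: "\<zero>\<^bsub>Q\<^esub> \<in> D"
    using D(4)[of "\<zero>\<^bsub>A\<^esub>" "[]"] by (simp add: F_def)
  have "subgroup D (add_monoid Q)"
    by (rule subgroup.intro) (use D(2) zero cl[of _ _ "\<zero>\<^bsub>A\<^esub>"] in \<open>auto simp flip: a_inv_def\<close>)
  then have "sub_bimodule A D Q"
    using cl by (auto simp: sub_bimodule_def additive_subgroup_def)
  moreover have "D \<lesssim> T \<or> D \<lesssim> carrier A \<or> D \<lesssim> (UNIV :: nat set)"
    using D(3) unfolding B_def by (rule lepoll_max)
  moreover have "T \<lesssim> (UNIV :: nat set)"
    using T(1) by (simp add: finite_lepoll_infinite)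
  ultimately show ?thesis
    using D(1) lepoll_trans by blast
qed

lemma small_injection:
  fixes X :: "'q set" and Y :: "'a set"
  assumes "X \<lesssim> Y \<or> X \<lesssim> (UNIV :: nat set)"
  obtains \<phi> :: "'q \<Rightarrow> 'a + nat" where "inj_on \<phi> X" "\<phi> ` X \<subseteq> Inl ` Y \<or> \<phi> ` X \<subseteq> range Inr"
  using assms
proof
  assume "X \<lesssim> Y"
  then obtain f where "inj_on f X" "f ` X \<subseteq> Y"
    by (auto simp: lepoll_def)
  then show thesis
    by (intro that[of "\<lambda>x. Inl (f x)"]) (auto simp: inj_on_def)
next
  assume "X \<lesssim> (UNIV :: nat set)"
  then obtain f :: "'q \<Rightarrow> nat" where "inj_on f X"
    by (auto simp: lepoll_def)
  then show thesis
    by (intro that[of "\<lambda>x. Inr (f x)"]) (auto simp: inj_on_def)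
qed

definition transport :: "('m \<Rightarrow> 'n) \<Rightarrow> ('a, 'm, 'z) bimodule_scheme \<Rightarrow> ('a, 'n) bimodule"
  where "transport \<phi> M = (let \<psi> = inv_into (carrier M) \<phi> in
    \<lparr>carrier = \<phi> ` carrier M, monoid.mult = undefined, monoid.one = undefined, ring.zero = \<phi> \<zero>\<^bsub>M\<^esub>,
     ring.add = (\<lambda>x y. \<phi> (\<psi> x \<oplus>\<^bsub>M\<^esub> \<psi> y)), lact = (\<lambda>a x. \<phi> (lact M a (\<psi> x))),
     ract = (\<lambda>x a. \<phi> (ract M (\<psi> x) a))\<rparr>)"

context
  fixes \<phi> :: "'m \<Rightarrow> 'n" and M :: "('a, 'm, 'z) bimodule_scheme"
  assumes inj: "inj_on \<phi> (carrier M)"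
begin

lemma transport_carrier: "carrier (transport \<phi> M) = \<phi> ` carrier M"
  by (simp add: transport_def Let_def)

lemma transport_zero: "\<zero>\<^bsub>transport \<phi> M\<^esub> = \<phi> \<zero>\<^bsub>M\<^esub>"
  by (simp add: transport_def Let_def)

lemma transport_add: "x \<in> carrier M \<Longrightarrow> y \<in> carrier M \<Longrightarrow> \<phi> x \<oplus>\<^bsub>transport \<phi> M\<^esub> \<phi> y = \<phi> (x \<oplus>\<^bsub>M\<^esub> y)"
  using inj by (simp add: transport_def Let_def)

lemma transport_lact: "x \<in> carrier M \<Longrightarrow> lact (transport \<phi> M) a (\<phi> x) = \<phi> (lact M a x)"
  using inj by (simp add: transport_def Let_def)

lemma transport_ract: "x \<in> carrier M \<Longrightarrow> ract (transport \<phi> M) (\<phi> x) a = \<phi> (ract M x a)"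
  using inj by (simp add: transport_def Let_def)

lemmas transport_simps = transport_carrier transport_zero transport_add transport_lact transport_ract

lemma transport_abelian_group:
  assumes "abelian_group M"
  shows "abelian_group (transport \<phi> M)"
proof -
  interpret M: abelian_group M by fact
  show ?thesis
  proof (rule abelian_groupI)
    fix x assume "x \<in> carrier (transport \<phi> M)"
    then obtain x' where x': "x = \<phi> x'" "x' \<in> carrier M"
      by (auto simp: transport_carrier)
    then show "\<exists>y\<in>carrier (transport \<phi> M). y \<oplus>\<^bsub>transport \<phi> M\<^esub> x = \<zero>\<^bsub>transport \<phi> M\<^esub>"
      by (intro bexI[of _ "\<phi> (\<ominus>\<^bsub>M\<^esub> x')"]) (simp_all add: transport_simps M.l_neg)
  qed (auto simp: transport_simps M.a_ac)
qed

lemma transport_left_module: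
  assumes "left_module A M"
  shows "left_module A (transport \<phi> M)"
proof -
  interpret M: left_module A M by fact
  show ?thesis
    by (intro left_moduleI transport_abelian_group left_module_abelian[OF assms])
      (auto simp: transport_simps M.A.ring_axioms M.lact_closed M.lact_add M.add_lact M.mult_lact M.one_lact)
qed

lemma transport_right_module:
  assumes "right_module A M"
  shows "right_module A (transport \<phi> M)"
proof -
  interpret M: right_module A M by fact
  show ?thesis
    by (intro right_moduleI transport_abelian_group right_module_abelian[OF assms])
      (auto simp: transport_simps M.A.ring_axioms M.ract_closed M.ract_add M.add_ract M.mult_ract M.one_ract)
qed

lemma transport_bimodule:
  assumes "bimodule A M"
  shows "bimodule A (transport \<phi> M)"
proof -
  interpret M: bimodule A M by fact
  show ?thesis
    by (intro bimoduleI transport_left_module transport_right_module M.left_module_axioms M.right_module_axioms)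
      (auto simp: transport_simps M.lact_closed M.ract_closed M.lact_ract)
qed

end

text \<open>The two maps lead from a module to the copy of a small part of it, and back. Elements
  outside \<open>D\<close> have no copy, yet \<open>local_hom\<close> requires a value for them;
  \<open>\<phi> d\<close> supplies it.\<close>

lemma transport_local_hom:
  fixes Q :: "('a, 'q) bimodule" and \<phi> :: "'q \<Rightarrow> 'p"
  assumes inj: "inj_on \<phi> D" and D: "D \<subseteq> carrier Q" "d \<in> D"
    and cl: "\<And>x y. x \<in> D \<Longrightarrow> y \<in> D \<Longrightarrow> x \<oplus>\<^bsub>Q\<^esub> y \<in> D"
      "\<And>a x. a \<in> carrier A \<Longrightarrow> x \<in> D \<Longrightarrow> lact Q a x \<in> D"
      "\<And>a x. a \<in> carrier A \<Longrightarrow> x \<in> D \<Longrightarrow> ract Q x a \<in> D"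
  shows "T \<subseteq> D \<Longrightarrow> local_hom Q (transport \<phi> (Q\<lparr>carrier := D\<rparr>)) T B (\<lambda>x. if x \<in> D then \<phi> x else \<phi> d)"
    and "T' \<subseteq> \<phi> ` D \<Longrightarrow> B' \<subseteq> carrier A \<Longrightarrow>
      local_hom (transport \<phi> (Q\<lparr>carrier := D\<rparr>)) Q T' B' (inv_into D \<phi>)"
proof -
  let ?R = "Q\<lparr>carrier := D\<rparr>"
  have injR: "inj_on \<phi> (carrier ?R)"
    using inj by simp
  note simps = transport_simps[OF injR]
  show "local_hom Q (transport \<phi> ?R) T B (\<lambda>x. if x \<in> D then \<phi> x else \<phi> d)" if T: "T \<subseteq> D"
  proof -
    have "x \<in> T \<Longrightarrow> x \<in> D" for x
      using T by auto
    then show ?thesis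
      using D(2) simps by (simp add: local_hom_def)
  qed
  show "local_hom (transport \<phi> ?R) Q T' B' (inv_into D \<phi>)" if T': "T' \<subseteq> \<phi> ` D" and B': "B' \<subseteq> carrier A"
    unfolding local_hom_def
  proof (intro conjI ballI impI)
    show "inv_into D \<phi> \<in> carrier (transport \<phi> ?R) \<rightarrow> carrier Q"
      using D(1) simps(1) by (auto simp: inv_into_into intro: subsetD)
  next
    fix u v assume "u \<in> T'" "v \<in> T'"
    then obtain x y where "u = \<phi> x" "v = \<phi> y" "x \<in> D" "y \<in> D"
      using T' by blast
    then show "inv_into D \<phi> (u \<oplus>\<^bsub>transport \<phi> ?R\<^esub> v) = inv_into D \<phi> u \<oplus>\<^bsub>Q\<^esub> inv_into D \<phi> v"
      using inj cl(1) simps(3)[of x y] by simp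
  next
    fix a u assume "a \<in> B'" "u \<in> T'"
    then obtain x where "u = \<phi> x" "x \<in> D" "a \<in> carrier A"
      using T' B' by blast
    then show "inv_into D \<phi> (lact (transport \<phi> ?R) a u) = lact Q a (inv_into D \<phi> u)"
      "inv_into D \<phi> (ract (transport \<phi> ?R) u a) = ract Q (inv_into D \<phi> u) a"
      using inj cl(2,3) simps(4)[of x a] simps(5)[of x a] by simp_all
  qed
qed

section \<open>Independence of purity from the type of the test modules\<close>

context
  fixes A :: "('a, 's) ring_scheme" and N :: "('a, 'm, 'y) bimodule_scheme" and M :: "('a, 'm, 'z) bimodule_scheme"
  assumes NM: "carrier N \<subseteq> carrier M"
begin

text \<open>A relation in \<open>Q \<otimes> M\<close> involves finitely many elements of
  \<open>Q\<close>. They lie in a small submodule, which has a copy in \<open>'a + nat\<close>. Push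
  the relation there, use purity, and pull the resulting relation over \<open>N\<close> back to
  \<open>Q\<close> along the inverse of the copy map.\<close>

lemma pure_left_change_type:
  fixes T :: "'q itself"
  assumes N: "left_module A N" and M: "left_module A M" and incl: "left_linear A N M (\<lambda>x\<in>carrier N. x)"
    and pure: "pure_left TYPE('a + nat) A N M"
  shows "pure_left T A N M"
  unfolding pure_left_def
proof (intro allI impI)
  fix Q :: "('a, 'q) bimodule" assume Q: "right_module A Q"
  interpret Q: right_module A Q by (rule Q)
  \<comment> \<open>The relations of the tensor product do not involve the left action of
    \<open>Q\<close>, about which nothing is known; a trivial one allows sub-bimodules to be used
    for submodules.\<close>
  define Q1 where "Q1 = Q\<lparr>lact := \<lambda>a x. x\<rparr>"
  have Q1_sel: "carrier Q1 = carrier Q" "add Q1 = add Q" "\<zero>\<^bsub>Q1\<^esub> = \<zero>\<^bsub>Q\<^esub>" "ract Q1 = ract Q" "lact Q1 = (\<lambda>a x. x)"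
    by (simp_all add: Q1_def)
  have aQ1: "abelian_group Q1"
    by (rule abelian_groupI) (use abelian_groupE[OF Q.M.abelian_group_axioms] in \<open>simp_all add: Q1_sel\<close>)
  have Q1: "right_module A Q1"
    by (rule right_moduleI[OF Q.A.ring_axioms aQ1])
      (simp_all add: Q1_sel Q.ract_closed Q.ract_add Q.add_ract Q.mult_ract Q.one_ract)
  have rels: "tensor_rels A Q1 X = tensor_rels A Q X" for X :: "('a, 'm, 'w) bimodule_scheme"
    by (simp add: tensor_rels_def Q1_sel)
  show "inj_on (tensor_map A Q N Q M (\<lambda>q\<in>carrier Q. q) (\<lambda>x\<in>carrier N. x)) (carrier (tensor A Q N))"
  proof (subst inj_tensor_map_incl_iff[OF tensor_pairI[OF Q N] tensor_pairI[OF Q M] right_linear_id[OF Q] incl])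
    show "\<forall>z\<in>pres_rel (carrier Q \<times> carrier M) (tensor_rels A Q M).
        Poly_Mapping.keys z \<subseteq> carrier Q \<times> carrier N \<longrightarrow> z \<in> pres_rel (carrier Q \<times> carrier N) (tensor_rels A Q N)"
    proof (intro ballI impI)
      fix z assume z: "z \<in> pres_rel (carrier Q \<times> carrier M) (tensor_rels A Q M)"
        and k: "Poly_Mapping.keys z \<subseteq> carrier Q \<times> carrier N"
      have z1: "z \<in> pres_rel (carrier Q1 \<times> carrier M) (tensor_rels A Q1 M)"
        using z by (simp add: rels Q1_sel)
      obtain T U B where fin: "finite T" "T \<subseteq> carrier Q1" "finite U" "U \<subseteq> carrier M" "finite B" "B \<subseteq> carrier A"
        and loc: "\<And>(M' :: ('a, 'a + nat) bimodule) (N' :: ('a, 'm, 'z) bimodule_scheme) \<sigma> \<tau>.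
          tensor_pair A M' N' \<Longrightarrow> local_hom Q1 M' T B \<sigma> \<Longrightarrow> local_hom M N' U B \<tau> \<Longrightarrow>
          map_frag (\<lambda>(x, y). (\<sigma> x, \<tau> y)) z \<in> pres_rel (carrier M' \<times> carrier N') (tensor_rels A M' N')"
        using tensor_pres_rel_local[OF Q1 M z1] by metis
      have "\<exists>D. T \<union> fst ` Poly_Mapping.keys z \<subseteq> D \<and> sub_bimodule A D Q1 \<and> (D \<lesssim> carrier A \<or> D \<lesssim> (UNIV :: nat set))"
        by (rule small_sub_bimodule[OF Q.A.ring_axioms aQ1]) (use fin k Q.ract_closed in \<open>auto simp: Q1_sel\<close>)
      then obtain D where D: "T \<subseteq> D" "fst ` Poly_Mapping.keys z \<subseteq> D" "sub_bimodule A D Q1"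
          and small: "D \<lesssim> carrier A \<or> D \<lesssim> (UNIV :: nat set)"
        by (metis Un_subset_iff)
      obtain \<phi> :: "'q \<Rightarrow> 'a + nat" where \<phi>: "inj_on \<phi> D"
        using small_injection[OF small] by metis
      note Ds = sub_bimoduleD[OF D(3)]
      let ?R = "Q1\<lparr>carrier := D\<rparr>"
      have injR: "inj_on \<phi> (carrier ?R)" using \<phi> by simp
      let ?Q2 = "transport \<phi> ?R"
      have Q2: "right_module A ?Q2"
        by (rule transport_right_module[OF injR restrict_right_module[OF Q1 D(3)]])
      have cQ2: "carrier ?Q2 = \<phi> ` D"
        using transport_carrier[OF injR] by simp
      define \<sigma> where "\<sigma> x = (if x \<in> D then \<phi> x else \<phi> \<zero>\<^bsub>Q1\<^esub>)" for x
      let ?w = "map_frag (\<lambda>(x, y). (\<sigma> x, y)) z"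
      have kw: "Poly_Mapping.keys ?w \<subseteq> carrier ?Q2 \<times> carrier N"
        by (rule order_trans[OF order_trans[OF keys_map_frag image_mono[OF k]]])
          (use Ds(2) in \<open>auto simp: cQ2 \<sigma>_def\<close>)
      have "?w \<in> pres_rel (carrier ?Q2 \<times> carrier M) (tensor_rels A ?Q2 M)"
        by (rule loc[OF tensor_pairI[OF Q2 M] _ local_hom_id], unfold \<sigma>_def,
            rule transport_local_hom(1)[OF \<phi> Ds(1,2), where A = A]) (use Ds(3-5) D(1) in auto)
      moreover have "inj_on (tensor_map A ?Q2 N ?Q2 M (\<lambda>q\<in>carrier ?Q2. q) (\<lambda>x\<in>carrier N. x)) (carrier (tensor A ?Q2 N))"
        using pure Q2 by (simp add: pure_left_def)
      ultimately have w: "?w \<in> pres_rel (carrier ?Q2 \<times> carrier N) (tensor_rels A ?Q2 N)"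
        using kw inj_tensor_map_incl_iff[OF tensor_pairI[OF Q2 N] tensor_pairI[OF Q2 M] right_linear_id[OF Q2] incl] NM
        by simp
      obtain T' U' B' where fin': "T' \<subseteq> carrier ?Q2" "B' \<subseteq> carrier A"
        and loc': "\<And>(M' :: ('a, 'q) bimodule) (N' :: ('a, 'm, 'y) bimodule_scheme) \<sigma> \<tau>.
          tensor_pair A M' N' \<Longrightarrow> local_hom ?Q2 M' T' B' \<sigma> \<Longrightarrow> local_hom N N' U' B' \<tau> \<Longrightarrow>
          map_frag (\<lambda>(x, y). (\<sigma> x, \<tau> y)) ?w \<in> pres_rel (carrier M' \<times> carrier N') (tensor_rels A M' N')"
        using tensor_pres_rel_local[OF Q2 N w] by metis
      have "map_frag (\<lambda>(x, y). (inv_into D \<phi> x, y)) ?w \<in> pres_rel (carrier Q1 \<times> carrier N) (tensor_rels A Q1 N)"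
        by (rule loc'[OF tensor_pairI[OF Q1 N] _ local_hom_id],
            rule transport_local_hom(2)[OF \<phi> Ds(1,2)]) (use Ds(3-5) fin' cQ2 in auto)
      \<comment> \<open>The round trip fixes the word, because its first coordinates belong to
        \<open>D\<close>, where \<open>inv_into\<close> inverts \<open>\<phi>\<close>.\<close>
      moreover have "map_frag (\<lambda>(x, y). (inv_into D \<phi> x, y)) ?w = z"
        unfolding map_frag_comp by (rule map_frag_id) (use D(2) \<phi> in \<open>force simp: \<sigma>_def\<close>)
      ultimately show "z \<in> pres_rel (carrier Q \<times> carrier N) (tensor_rels A Q N)"
        by (simp add: rels Q1_sel)
    qed
  qed (use NM in auto)
qed

text \<open>Mirror image of the left-sided case; here the right action of \<open>Q\<close> is the
  one made trivial.\<close>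

lemma pure_right_change_type:
  fixes T :: "'q itself"
  assumes N: "right_module A N" and M: "right_module A M" and incl: "right_linear A N M (\<lambda>x\<in>carrier N. x)"
    and pure: "pure_right TYPE('a + nat) A N M"
  shows "pure_right T A N M"
  unfolding pure_right_def
proof (intro allI impI)
  fix Q :: "('a, 'q) bimodule" assume Q: "left_module A Q"
  interpret Q: left_module A Q by (rule Q)
  define Q1 where "Q1 = Q\<lparr>ract := \<lambda>x a. x\<rparr>"
  have Q1_sel: "carrier Q1 = carrier Q" "add Q1 = add Q" "\<zero>\<^bsub>Q1\<^esub> = \<zero>\<^bsub>Q\<^esub>" "lact Q1 = lact Q" "ract Q1 = (\<lambda>x a. x)"
    by (simp_all add: Q1_def)
  have aQ1: "abelian_group Q1"
    by (rule abelian_groupI) (use abelian_groupE[OF Q.M.abelian_group_axioms] in \<open>simp_all add: Q1_sel\<close>)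
  have Q1: "left_module A Q1"
    by (rule left_moduleI[OF Q.A.ring_axioms aQ1])
      (simp_all add: Q1_sel Q.lact_closed Q.lact_add Q.add_lact Q.mult_lact Q.one_lact)
  have rels: "tensor_rels A X Q1 = tensor_rels A X Q" for X :: "('a, 'm, 'w) bimodule_scheme"
    by (simp add: tensor_rels_def Q1_sel)
  show "inj_on (tensor_map A N Q M Q (\<lambda>x\<in>carrier N. x) (\<lambda>q\<in>carrier Q. q)) (carrier (tensor A N Q))"
  proof (subst inj_tensor_map_incl_iff[OF tensor_pairI[OF N Q] tensor_pairI[OF M Q] incl left_linear_id[OF Q]])
    show "\<forall>z\<in>pres_rel (carrier M \<times> carrier Q) (tensor_rels A M Q).
        Poly_Mapping.keys z \<subseteq> carrier N \<times> carrier Q \<longrightarrow> z \<in> pres_rel (carrier N \<times> carrier Q) (tensor_rels A N Q)"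
    proof (intro ballI impI)
      fix z assume z: "z \<in> pres_rel (carrier M \<times> carrier Q) (tensor_rels A M Q)"
        and k: "Poly_Mapping.keys z \<subseteq> carrier N \<times> carrier Q"
      have z1: "z \<in> pres_rel (carrier M \<times> carrier Q1) (tensor_rels A M Q1)"
        using z by (simp add: rels Q1_sel)
      obtain T U B where fin: "finite T" "T \<subseteq> carrier M" "finite U" "U \<subseteq> carrier Q1" "finite B" "B \<subseteq> carrier A"
        and loc: "\<And>(M' :: ('a, 'm, 'z) bimodule_scheme) (N' :: ('a, 'a + nat) bimodule) \<sigma> \<tau>.
          tensor_pair A M' N' \<Longrightarrow> local_hom M M' T B \<sigma> \<Longrightarrow> local_hom Q1 N' U B \<tau> \<Longrightarrow>
          map_frag (\<lambda>(x, y). (\<sigma> x, \<tau> y)) z \<in> pres_rel (carrier M' \<times> carrier N') (tensor_rels A M' N')"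
        using tensor_pres_rel_local[OF M Q1 z1] by metis
      have "\<exists>D. U \<union> snd ` Poly_Mapping.keys z \<subseteq> D \<and> sub_bimodule A D Q1 \<and> (D \<lesssim> carrier A \<or> D \<lesssim> (UNIV :: nat set))"
        by (rule small_sub_bimodule[OF Q.A.ring_axioms aQ1]) (use fin k Q.lact_closed in \<open>auto simp: Q1_sel\<close>)
      then obtain D where D: "U \<subseteq> D" "snd ` Poly_Mapping.keys z \<subseteq> D" "sub_bimodule A D Q1"
          and small: "D \<lesssim> carrier A \<or> D \<lesssim> (UNIV :: nat set)"
        by (metis Un_subset_iff)
      obtain \<phi> :: "'q \<Rightarrow> 'a + nat" where \<phi>: "inj_on \<phi> D"
        using small_injection[OF small] by metis
      note Ds = sub_bimoduleD[OF D(3)]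
      let ?R = "Q1\<lparr>carrier := D\<rparr>"
      have injR: "inj_on \<phi> (carrier ?R)" using \<phi> by simp
      let ?Q2 = "transport \<phi> ?R"
      have Q2: "left_module A ?Q2"
        by (rule transport_left_module[OF injR restrict_left_module[OF Q1 D(3)]])
      have cQ2: "carrier ?Q2 = \<phi> ` D"
        using transport_carrier[OF injR] by simp
      define \<sigma> where "\<sigma> x = (if x \<in> D then \<phi> x else \<phi> \<zero>\<^bsub>Q1\<^esub>)" for x
      let ?w = "map_frag (\<lambda>(x, y). (x, \<sigma> y)) z"
      have kw: "Poly_Mapping.keys ?w \<subseteq> carrier N \<times> carrier ?Q2"
        by (rule order_trans[OF order_trans[OF keys_map_frag image_mono[OF k]]])
          (use Ds(2) in \<open>auto simp: cQ2 \<sigma>_def\<close>)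
      have "?w \<in> pres_rel (carrier M \<times> carrier ?Q2) (tensor_rels A M ?Q2)"
        by (rule loc[OF tensor_pairI[OF M Q2] local_hom_id], unfold \<sigma>_def,
            rule transport_local_hom(1)[OF \<phi> Ds(1,2), where A = A]) (use Ds(3-5) D(1) in auto)
      moreover have "inj_on (tensor_map A N ?Q2 M ?Q2 (\<lambda>x\<in>carrier N. x) (\<lambda>q\<in>carrier ?Q2. q)) (carrier (tensor A N ?Q2))"
        using pure Q2 by (simp add: pure_right_def)
      ultimately have w: "?w \<in> pres_rel (carrier N \<times> carrier ?Q2) (tensor_rels A N ?Q2)"
        using kw inj_tensor_map_incl_iff[OF tensor_pairI[OF N Q2] tensor_pairI[OF M Q2] incl left_linear_id[OF Q2]] NM
        by simp
      obtain T' U' B' where fin': "U' \<subseteq> carrier ?Q2" "B' \<subseteq> carrier A"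
        and loc': "\<And>(M' :: ('a, 'm, 'y) bimodule_scheme) (N' :: ('a, 'q) bimodule) \<sigma> \<tau>.
          tensor_pair A M' N' \<Longrightarrow> local_hom N M' T' B' \<sigma> \<Longrightarrow> local_hom ?Q2 N' U' B' \<tau> \<Longrightarrow>
          map_frag (\<lambda>(x, y). (\<sigma> x, \<tau> y)) ?w \<in> pres_rel (carrier M' \<times> carrier N') (tensor_rels A M' N')"
        using tensor_pres_rel_local[OF N Q2 w] by metis
      have "map_frag (\<lambda>(x, y). (x, inv_into D \<phi> y)) ?w \<in> pres_rel (carrier N \<times> carrier Q1) (tensor_rels A N Q1)"
        by (rule loc'[OF tensor_pairI[OF N Q1] local_hom_id],
            rule transport_local_hom(2)[OF \<phi> Ds(1,2)]) (use Ds(3-5) fin' cQ2 in auto)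
      moreover have "map_frag (\<lambda>(x, y). (x, inv_into D \<phi> y)) ?w = z"
        unfolding map_frag_comp by (rule map_frag_id) (use D(2) \<phi> in \<open>force simp: \<sigma>_def\<close>)
      ultimately show "z \<in> pres_rel (carrier N \<times> carrier Q) (tensor_rels A N Q)"
        by (simp add: rels Q1_sel)
    qed
  qed (use NM in auto)
qed

end

section \<open>Copies of corings along injections, and small pieces of a coring\<close>

definition transport_coring ::
  "('a, 's) ring_scheme \<Rightarrow> ('c \<Rightarrow> 'd) \<Rightarrow> ('a, 'c) coring \<Rightarrow> ('a, 'd) coring"
  where "transport_coring A \<phi> C = bimodule.extend (transport \<phi> C)
    \<lparr>comult = (\<lambda>y\<in>\<phi> ` carrier C. tensor_map A C C (transport \<phi> C) (transport \<phi> C)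
       (\<lambda>x\<in>carrier C. \<phi> x) (\<lambda>x\<in>carrier C. \<phi> x) (comult C (inv_into (carrier C) \<phi> y))),
     counit = (\<lambda>y\<in>\<phi> ` carrier C. counit C (inv_into (carrier C) \<phi> y))\<rparr>"

context
  fixes A :: "('a, 's) ring_scheme" and \<phi> :: "'c \<Rightarrow> 'd" and C :: "('a, 'c) coring"
  assumes C: "coring A C" and inj: "inj_on \<phi> (carrier C)"
begin

interpretation C: bimodule A C by (rule coring_bimodule[OF C])

lemma transport_coring_sel:
  "carrier (transport_coring A \<phi> C) = \<phi> ` carrier C"
  "same_ops (transport_coring A \<phi> C) (transport \<phi> C)"
  "same_ops (transport \<phi> C) (transport_coring A \<phi> C)"
  "x \<in> carrier C \<Longrightarrow> comult (transport_coring A \<phi> C) (\<phi> x) = tensor_map A C C (transport \<phi> C) (transport \<phi> C)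
    (\<lambda>x\<in>carrier C. \<phi> x) (\<lambda>x\<in>carrier C. \<phi> x) (comult C x)"
  "x \<in> carrier C \<Longrightarrow> counit (transport_coring A \<phi> C) (\<phi> x) = counit C x"
  using inj by (simp_all add: transport_coring_def bimodule.defs same_ops_def transport_carrier[OF inj])

lemma transport_hom:
  "(\<lambda>x\<in>carrier C. \<phi> x) \<in> bimodule_hom A C (transport \<phi> C)"
  "(\<lambda>y\<in>\<phi> ` carrier C. inv_into (carrier C) \<phi> y) \<in> bimodule_hom A (transport \<phi> C) C"
  using inj by (auto simp: bimodule_hom_def transport_simps[OF inj] C.lact_closed C.ract_closed)

lemma transport_coring_precoring: "precoring A (transport_coring A \<phi> C)"
proof -
  let ?T = "transport \<phi> C" and ?G = "transport_coring A \<phi> C"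
  let ?f = "\<lambda>x\<in>carrier C. \<phi> x" and ?g = "\<lambda>y\<in>\<phi> ` carrier C. inv_into (carrier C) \<phi> y"
  note T = transport_bimodule[OF inj C.bimodule_axioms]
  note so = transport_coring_sel(2)
  note TT = tensor_same_ops[OF so so]
  note cm = precoring_comult[OF coring_precoring[OF C]] and cu = precoring_counit[OF coring_precoring[OF C]]
  note ff = tensor_map_hom[OF C.bimodule_axioms C.bimodule_axioms T T transport_hom(1) transport_hom(1)]
  have "comult ?G = compose (carrier ?T) (compose (carrier C) (tensor_map A C C ?T ?T ?f ?f) (comult C)) ?g"
    using inj by (auto simp: transport_coring_def bimodule.defs compose_def transport_carrier[OF inj] fun_eq_iff)
  moreover have "compose (carrier ?T) (compose (carrier C) (tensor_map A C C ?T ?T ?f ?f) (comult C)) ?g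
      \<in> bimodule_hom A ?T (tensor A ?T ?T)"
    by (rule bimodule_hom_compose[OF T transport_hom(2) bimodule_hom_compose[OF C.bimodule_axioms cm ff]])
  moreover have "counit ?G = compose (carrier ?T) (counit C) ?g"
    by (auto simp: transport_coring_def bimodule.defs compose_def transport_carrier[OF inj] fun_eq_iff)
  moreover have "compose (carrier ?T) (counit C) ?g \<in> bimodule_hom A ?T (regular A)"
    by (rule bimodule_hom_compose[OF T transport_hom(2) cu])
  ultimately show ?thesis
    using bimodule_same_ops[OF transport_coring_sel(3) T]
    by (simp add: precoring_def TT bimodule_hom_same_ops(1)[OF so])
qed

lemma transport_coring_hom: "(\<lambda>x\<in>carrier C. \<phi> x) \<in> coring_hom A C (transport_coring A \<phi> C)"
proof -
  note so = transport_coring_sel(2)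
  show ?thesis
    using transport_hom(1)
    by (simp add: coring_hom_def bimodule_hom_same_ops(2)[OF so] transport_coring_sel(4,5)
        tensor_map_same_ops[OF same_ops_refl same_ops_refl so so])
qed

text \<open>Every element of the copy is an image point, so naturality along the bijection supplies
  all the laws.\<close>

lemma transport_coring: "coring A (transport_coring A \<phi> C)"
proof -
  have "coassoc_left A (transport_coring A \<phi> C) y = coassoc_right A (transport_coring A \<phi> C) y \<and>
      counit_left A (transport_coring A \<phi> C) y = y \<and> counit_right A (transport_coring A \<phi> C) y = y"
    if y: "y \<in> carrier (transport_coring A \<phi> C)" for y
  proof -
    obtain x where "x \<in> carrier C" "y = \<phi> x"
      using y by (auto simp: transport_coring_sel(1))
    then show ?thesis
      using coring_axioms_image[OF coring_precoring[OF C] transport_coring_precoring transport_coring_hom C, of x]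
      by simp
  qed
  then show ?thesis
    using transport_coring_precoring by (simp add: coring_iff)
qed

lemma transport_coring_inverse:
  "(\<lambda>y\<in>\<phi> ` carrier C. inv_into (carrier C) \<phi> y) \<in> coring_hom A (transport_coring A \<phi> C) C"
proof -
  let ?G = "transport_coring A \<phi> C"
  let ?f = "\<lambda>x\<in>carrier C. \<phi> x" and ?g = "\<lambda>y\<in>\<phi> ` carrier C. inv_into (carrier C) \<phi> y"
  note pC = coring_precoring[OF C] and pG = transport_coring_precoring
  note so = transport_coring_sel(2)
  have g: "?g \<in> bimodule_hom A ?G C"
    using transport_hom(2) by (simp add: bimodule_hom_same_ops(1)[OF so])
  note f = coring_hom_bimodule_hom[OF transport_coring_hom]
  have "comult C (?g y) = tensor_map A ?G ?G C C ?g ?g (comult ?G y)" if "y \<in> \<phi> ` carrier C" for y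
  proof -
    obtain x where x: "x \<in> carrier C" "y = \<phi> x" "?g y = x"
      using \<open>y \<in> \<phi> ` carrier C\<close> inj by auto
    have "tensor_map A ?G ?G C C ?g ?g (comult ?G (?f x)) =
        tensor_map A ?G ?G C C ?g ?g (tensor_map A C C ?G ?G ?f ?f (comult C x))"
      using coring_hom_comult[OF transport_coring_hom x(1)] by simp
    also have "\<dots> = tensor_map A C C C C (\<lambda>x\<in>carrier C. x) (\<lambda>x\<in>carrier C. x) (comult C x)"
      by (rule tensor_map_comp[OF mods(1,2)[OF pC] mods(1,2)[OF pG] mods(1,2)[OF pC]
            bimodule_hom_right[OF f] bimodule_hom_right[OF g] bimodule_hom_left[OF f] bimodule_hom_left[OF g]
            mods(7)[OF pC] _ mods(8)[OF pC] _ bimodule_hom_closed[OF precoring_comult[OF pC] x(1)]])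
        (use inj in simp_all)
    also have "\<dots> = comult C x"
      using coring_hom_comult[OF coring_hom_id[OF pC] x(1)] x(1) by simp
    finally show ?thesis
      using x(1,2) x(3) by simp
  qed
  moreover have "counit C (?g y) = counit ?G y" if "y \<in> \<phi> ` carrier C" for y
    using that inj by (auto simp: transport_coring_sel(5))
  ultimately show ?thesis
    using g by (simp add: coring_hom_def transport_coring_sel(1))
qed

lemma transport_coring_iso: "coring_iso A C (transport_coring A \<phi> C)"
  unfolding coring_iso_def
proof (intro bexI conjI)
  show "compose (carrier C) (\<lambda>y\<in>\<phi> ` carrier C. inv_into (carrier C) \<phi> y) (\<lambda>x\<in>carrier C. \<phi> x) = (\<lambda>x\<in>carrier C. x)"
    using inj by (auto simp: compose_def fun_eq_iff)
  show "compose (carrier (transport_coring A \<phi> C)) (\<lambda>x\<in>carrier C. \<phi> x) (\<lambda>y\<in>\<phi> ` carrier C. inv_into (carrier C) \<phi> y) =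
      (\<lambda>x\<in>carrier (transport_coring A \<phi> C). x)"
    using inj by (auto simp: compose_def fun_eq_iff transport_coring_sel(1))
qed (rule transport_coring_inverse transport_coring_hom)+

end

lemma small_coring_iso:
  assumes "coring A G" "carrier G \<lesssim> carrier A \<or> carrier G \<lesssim> (UNIV :: nat set)"
  obtains G' f g where "G' \<in> small_corings A" "coring_iso A G G'" "f \<in> coring_hom A G G'" "g \<in> coring_hom A G' G"
    "\<And>x. x \<in> carrier G \<Longrightarrow> g (f x) = x" "\<And>y. y \<in> carrier G' \<Longrightarrow> f (g y) = y"
proof -
  obtain \<phi> :: "_ \<Rightarrow> 'a + nat" where \<phi>: "inj_on \<phi> (carrier G)"
    using small_injection[OF assms(2)] by metis
  have "\<phi> ` carrier G \<lesssim> carrier G"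
    by (rule image_lepoll)
  then have "\<phi> ` carrier G \<lesssim> carrier A \<or> \<phi> ` carrier G \<lesssim> (UNIV :: nat set)"
    using assms(2) lepoll_trans[of "\<phi> ` carrier G" "carrier G" "carrier A"]
      lepoll_trans[of "\<phi> ` carrier G" "carrier G" "UNIV :: nat set"] by argo
  then have "transport_coring A \<phi> G \<in> small_corings A"
    using transport_coring[OF assms(1) \<phi>]
    by (simp add: small_corings_def transport_coring_sel(1)[OF assms(1) \<phi>])
  then show thesis
    by (rule that[OF _ transport_coring_iso[OF assms(1) \<phi>] transport_coring_hom[OF assms(1) \<phi>]
          transport_coring_inverse[OF assms(1) \<phi>]])
      (use \<phi> in \<open>auto simp: transport_coring_sel(1)[OF assms(1) \<phi>]\<close>)
qed

lemma small_corings_coring: "G \<in> small_corings A \<Longrightarrow> coring A G"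
  by (simp add: small_corings_def)

text \<open>The two injectivity conditions are those of \<open>coring_hom_factor\<close>: a coring
  morphism into \<open>E\<close> whose image lies in that of \<open>g\<close> factors through
  \<open>G\<close>. A small coring with a morphism to \<open>E\<close> need not have this
  property.\<close>

definition piece ::
  "('a, 's) ring_scheme \<Rightarrow> ('a, 'e) coring \<Rightarrow> ('a, 'a + nat) coring \<Rightarrow> ('a + nat \<Rightarrow> 'e) \<Rightarrow> bool"
  where "piece A E G g \<longleftrightarrow> G \<in> small_corings A \<and> g \<in> coring_hom A G E \<and> inj_on g (carrier G) \<and>
    inj_on (tensor_map A G G E E g g) (carrier (tensor A G G))"

text \<open>Take a pure subcoring around \<open>S\<close>. With \<open>S\<close> small the bound
  leaves only |A| or aleph_0, so there is an isomorphic copy in \<open>'a + nat\<close>. Injectivity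
  on tensors combines invertibility of the copy map with the embedding of
  \<open>D \<otimes> D\<close> into \<open>E \<otimes> E\<close>.\<close>

lemma piece_exists:
  assumes E: "coring A E" and S: "S \<subseteq> carrier E" and small: "S \<lesssim> carrier A \<or> S \<lesssim> (UNIV :: nat set)"
  obtains G g where "piece A E G g" "S \<subseteq> g ` carrier G"
proof -
  obtain D where D: "subcoring A D E" "S \<subseteq> carrier D" "locally_retract A E (carrier D)"
    "same_ops D (E\<lparr>carrier := carrier D\<rparr>)" "carrier D \<lesssim> S <+> (carrier A <+> (UNIV :: nat set))"
    using pure_subcoring_exists[OF E S] by metis
  have cD: "coring A D" and \<iota>: "(\<lambda>x\<in>carrier D. x) \<in> coring_hom A D E"
    using D(1) by (simp_all add: subcoring_def)
  have "carrier D \<lesssim> carrier A \<or> carrier D \<lesssim> (UNIV :: nat set)"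
    using lepoll_max[OF D(5)] small lepoll_trans[of "carrier D" S "carrier A"]
      lepoll_trans[of "carrier D" S "UNIV :: nat set"] by argo
  then obtain G f g where G: "G \<in> small_corings A" "f \<in> coring_hom A D G" "g \<in> coring_hom A G D"
    "\<And>x. x \<in> carrier D \<Longrightarrow> g (f x) = x" "\<And>y. y \<in> carrier G \<Longrightarrow> f (g y) = y"
    using small_coring_iso[OF cD] by metis
  note pE = coring_precoring[OF E] and pD = coring_precoring[OF cD]
    and pG = coring_precoring[OF small_corings_coring[OF G(1)]]
  let ?\<iota> = "\<lambda>x\<in>carrier D. x"
  define h where "h = compose (carrier G) ?\<iota> g"
  have gD: "g y \<in> carrier D" if "y \<in> carrier G" for y
    by (rule coring_hom_closed[OF G(3) that])
  have hy: "h y = g y" if "y \<in> carrier G" for y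
    using gD[OF that] that by (simp add: h_def compose_eq)
  have h: "h \<in> coring_hom A G E"
    unfolding h_def by (rule coring_hom_compose[OF pG pD pE G(3) \<iota>])
  note gh = coring_hom_bimodule_hom[OF G(3)] and fh = coring_hom_bimodule_hom[OF G(2)]
    and hh = coring_hom_bimodule_hom[OF h] and \<iota>h = coring_hom_bimodule_hom[OF \<iota>]
  have gg_inj: "inj_on (tensor_map A G G D D g g) (carrier (tensor A G G))"
  proof (rule inj_on_inverseI)
    fix t assume t: "t \<in> carrier (tensor A G G)"
    have "tensor_map A D D G G f f (tensor_map A G G D D g g t) =
        tensor_map A G G G G (\<lambda>x\<in>carrier G. x) (\<lambda>x\<in>carrier G. x) t"
      by (rule tensor_map_comp[OF mods(1,2)[OF pG] mods(1,2)[OF pD] mods(1,2)[OF pG]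
            bimodule_hom_right[OF gh] bimodule_hom_right[OF fh] bimodule_hom_left[OF gh] bimodule_hom_left[OF fh]
            mods(7)[OF pG] _ mods(8)[OF pG] _ t]) (simp_all add: G(5))
    then show "tensor_map A D D G G f f (tensor_map A G G D D g g t) = t"
      using tensor_map_id[OF precoring_bimodule[OF pG] precoring_bimodule[OF pG] t] by simp
  qed
  have "inj_on (tensor_map A G G E E h h) (carrier (tensor A G G))"
  proof (rule inj_onI)
    fix t u assume tu: "t \<in> carrier (tensor A G G)" "u \<in> carrier (tensor A G G)"
      and eq: "tensor_map A G G E E h h t = tensor_map A G G E E h h u"
    have "tensor_map A D D E E ?\<iota> ?\<iota> (tensor_map A G G D D g g t) = tensor_map A G G E E h h t"
      if t: "t \<in> carrier (tensor A G G)" for t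
      by (rule tensor_map_comp[OF mods(1,2)[OF pG] mods(1,2)[OF pD] mods(1,2)[OF pE]
            bimodule_hom_right[OF gh] bimodule_hom_right[OF \<iota>h] bimodule_hom_left[OF gh] bimodule_hom_left[OF \<iota>h]
            bimodule_hom_right[OF hh] _ bimodule_hom_left[OF hh] _ t]) (simp_all add: hy gD)
    then have "tensor_map A D D E E ?\<iota> ?\<iota> (tensor_map A G G D D g g t) =
        tensor_map A D D E E ?\<iota> ?\<iota> (tensor_map A G G D D g g u)"
      using tu eq by simp
    then have "tensor_map A G G D D g g t = tensor_map A G G D D g g u"
      by (rule inj_onD[OF retract_inj_tensor[OF coring_bimodule[OF E] D(3,4)]])
        (rule tensor_map_closed[OF mods(1,2)[OF pG] mods(1,2)[OF pD] bimodule_hom_right[OF gh] bimodule_hom_left[OF gh]],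
         rule tu)+
    then show "t = u"
      using inj_onD[OF gg_inj] tu by blast
  qed
  moreover have "inj_on h (carrier G)"
    by (rule inj_on_inverseI[of _ f]) (simp add: hy G(5))
  ultimately have "piece A E G h"
    using G(1) h by (simp add: piece_def)
  moreover have "S \<subseteq> h ` carrier G"
  proof
    fix x assume "x \<in> S"
    then have "x \<in> carrier D" using D(2) by auto
    then show "x \<in> h ` carrier G"
      using G(4) coring_hom_closed[OF G(2)] hy by (metis image_eqI)
  qed
  ultimately show thesis by (rule that)
qed

section \<open>Colimits of corings\<close>

lemma abelian_group_ops_cong:
  assumes "abelian_group M" "carrier N = carrier M" "add N = add M" "\<zero>\<^bsub>N\<^esub> = \<zero>\<^bsub>M\<^esub>"
  shows "abelian_group N"
  using assms abelian_groupE[of M] by (intro abelian_groupI) simp_all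

locale coring_diagram =
  fixes A :: "('a, 's) ring_scheme" and J :: "'i set" and G :: "'i \<Rightarrow> ('a, 'g) coring"
    and arr :: "'i \<Rightarrow> 'i \<Rightarrow> ('g \<Rightarrow> 'g) set"
  assumes ring_A: "ring A" and coring_G: "i \<in> J \<Longrightarrow> coring A (G i)"
    and arr_hom: "i \<in> J \<Longrightarrow> j \<in> J \<Longrightarrow> \<phi> \<in> arr i j \<Longrightarrow> \<phi> \<in> coring_hom A (G i) (G j)"
begin

abbreviation "L \<equiv> colim_bimodule J G arr"
abbreviation "C \<equiv> colim_coring A J G arr"
abbreviation "inc \<equiv> colim_in J G arr"

lemma bimodule_G: "i \<in> J \<Longrightarrow> bimodule A (G i)"
  by (rule coring_bimodule[OF coring_G])

lemma precoring_G: "i \<in> J \<Longrightarrow> precoring A (G i)"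
  by (rule coring_precoring[OF coring_G])

lemma colim_relsE:
  assumes "r \<in> colim_rels J G arr"
  obtains i x y where "r = frag_of (i, x \<oplus>\<^bsub>G i\<^esub> y) - frag_of (i, x) - frag_of (i, y)"
      "i \<in> J" "x \<in> carrier (G i)" "y \<in> carrier (G i)"
    | i j \<phi> x where "r = frag_of (i, x) - frag_of (j, \<phi> x)"
      "i \<in> J" "j \<in> J" "\<phi> \<in> arr i j" "x \<in> carrier (G i)"
  using assms unfolding colim_rels_def by (elim UnE CollectE exE conjE) (rule that; assumption)+

lemma colim_gens_iff: "(i, x) \<in> colim_gens J G \<longleftrightarrow> i \<in> J \<and> x \<in> carrier (G i)"
  by (simp add: colim_gens_def)

sublocale pres: presentation "colim_gens J G" "colim_rels J G arr"
proof
  fix r assume "r \<in> colim_rels J G arr"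
  then show "Poly_Mapping.keys r \<subseteq> colim_gens J G"
  proof (cases rule: colim_relsE)
    case (1 i x y)
    interpret Gi: bimodule A "G i" by (rule bimodule_G[OF 1(2)])
    show ?thesis
      unfolding 1(1) by (rule order_trans[OF keys_diff3]) (use 1 in \<open>simp add: colim_gens_iff\<close>)
  next
    case (2 i j \<phi> x)
    show ?thesis
      unfolding 2(1) by (rule order_trans[OF keys_diff2])
        (use 2 coring_hom_closed[OF arr_hom[OF 2(2-4)]] in \<open>simp add: colim_gens_iff\<close>)
  qed
qed

abbreviation "P \<equiv> pres_group (colim_gens J G) (colim_rels J G arr)"

lemma colim_sel:
  "carrier L = carrier P" "add L = add P" "\<zero>\<^bsub>L\<^esub> = \<zero>\<^bsub>P\<^esub>"
  by (simp_all add: colim_bimodule_def Let_def ring.defs)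

lemma additive_colim_iff:
  "additive_map P H f \<longleftrightarrow> additive_map L H f" "additive_map H P g \<longleftrightarrow> additive_map H L g"
  by (simp_all add: additive_map_def colim_sel)

lemma abelian_colim: "abelian_group L"
  by (rule abelian_group_ops_cong[OF pres.abelian_group_pres_group]) (rule colim_sel)+

lemma inc_gen: "x \<in> carrier (G i) \<Longrightarrow> inc i x = pres_gen (colim_gens J G) (colim_rels J G arr) (i, x)"
  by (simp add: colim_in_def)

lemma inc_closed: "i \<in> J \<Longrightarrow> x \<in> carrier (G i) \<Longrightarrow> inc i x \<in> carrier L"
  by (simp add: inc_gen colim_sel pres.pres_gen_closed colim_gens_iff)

lemma additive_inc: "i \<in> J \<Longrightarrow> additive_map (G i) L (inc i)"
proof (rule additive_mapI)
  fix x y assume i: "i \<in> J" and xy: "x \<in> carrier (G i)" "y \<in> carrier (G i)"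
  interpret Gi: bimodule A "G i" by (rule bimodule_G[OF i])
  have "frag_of (i, x \<oplus>\<^bsub>G i\<^esub> y) - frag_of (i, x) - frag_of (i, y) \<in> colim_rels J G arr"
    unfolding colim_rels_def using i xy by blast
  then show "inc i (x \<oplus>\<^bsub>G i\<^esub> y) = inc i x \<oplus>\<^bsub>L\<^esub> inc i y"
    using i xy unfolding colim_sel
    by (simp add: inc_gen) (intro pres.pres_gen_rel3; simp add: colim_gens_iff)
qed (rule inc_closed)

lemma inc_arr:
  assumes "i \<in> J" "j \<in> J" "\<phi> \<in> arr i j" "x \<in> carrier (G i)"
  shows "inc j (\<phi> x) = inc i x"
proof -
  have "frag_of (i, x) - frag_of (j, \<phi> x) \<in> colim_rels J G arr"
    unfolding colim_rels_def using assms by blast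
  moreover have "\<phi> x \<in> carrier (G j)"
    using coring_hom_closed[OF arr_hom[OF assms(1-3)] assms(4)] .
  ultimately show ?thesis
    using assms pres.pres_gen_rel2[of "(i, x)" "(j, \<phi> x)"] by (simp add: inc_gen colim_gens_iff)
qed

lemma colim_eqI:
  assumes "abelian_group H" "additive_map L H f" "additive_map L H g"
    and eq: "\<And>i x. i \<in> J \<Longrightarrow> x \<in> carrier (G i) \<Longrightarrow> f (inc i x) = g (inc i x)"
    and t: "t \<in> carrier L"
  shows "f t = g t"
proof (rule pres.pres_additive_eqI[OF assms(1)])
  show "additive_map P H f" "additive_map P H g"
    using assms by (simp_all add: additive_colim_iff)
  show "t \<in> carrier P"
    using t by (simp add: colim_sel)
  fix s assume "s \<in> colim_gens J G"
  then show "f (pres_gen (colim_gens J G) (colim_rels J G arr) s) = g (pres_gen (colim_gens J G) (colim_rels J G arr) s)"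
    using eq by (cases s) (auto simp: colim_gens_iff inc_gen)
qed

section \<open>Maps out of the colimit, and its bimodule structure\<close>

context
  fixes H :: "('h, 'z) ring_scheme" and k :: "'i \<Rightarrow> 'g \<Rightarrow> 'h"
  assumes H: "abelian_group H" and k: "\<And>i. i \<in> J \<Longrightarrow> additive_map (G i) H (k i)"
    and k_arr: "\<And>i j \<phi>. i \<in> J \<Longrightarrow> j \<in> J \<Longrightarrow> \<phi> \<in> arr i j \<Longrightarrow> \<forall>x\<in>carrier (G i). k j (\<phi> x) = k i x"
begin

interpretation H: abelian_group H by (rule H)

lemma colim_lift_closed: "s \<in> colim_gens J G \<Longrightarrow> (\<lambda>(i, x). k i x) s \<in> carrier H"
  using additive_closed[OF k] by (auto simp: colim_gens_def)

lemma colim_lift_respects: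
  assumes "r \<in> colim_rels J G arr"
  shows "free_lift H (\<lambda>(i, x). k i x) r = \<zero>\<^bsub>H\<^esub>"
  using assms
proof (cases rule: colim_relsE)
  case (1 i x y)
  interpret Gi: bimodule A "G i" by (rule bimodule_G[OF 1(2)])
  show ?thesis
    unfolding 1(1) by (rule H.free_lift_rel3)
      (use 1 additive_closed[OF k[OF 1(2)]] additive_add[OF k[OF 1(2)]] in simp_all)
next
  case (2 i j \<phi> x)
  show ?thesis
    unfolding 2(1) by (rule H.free_lift_rel2)
      (use 2 additive_closed[OF k] coring_hom_closed[OF arr_hom[OF 2(2-4)]] k_arr in simp_all)
qed

lemma colim_lift_inc: "i \<in> J \<Longrightarrow> x \<in> carrier (G i) \<Longrightarrow> pres_lift H (\<lambda>(i, x). k i x) (inc i x) = k i x"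
  using pres.pres_lift_gen[where b = "\<lambda>(i, x). k i x", OF H colim_lift_closed colim_lift_respects, of "(i, x)"]
  by (simp add: inc_gen colim_gens_iff)

lemma additive_colim_lift: "additive_map L H (pres_lift H (\<lambda>(i, x). k i x))"
  using pres.additive_pres_lift[OF H colim_lift_closed colim_lift_respects]
  by (simp add: additive_colim_iff)

end

text \<open>The lifts exist because the arrows commute with the actions. They are defined into the
  presented group \<open>P\<close>, whereas later statements concern the record \<open>L\<close>
  with the same addition, so additivity is passed from one to the other.\<close>

lemma bimodule_colim_aux:
  assumes a: "a \<in> carrier A"
  shows "additive_map L L (lact L a)" "additive_map L L (\<lambda>t. ract L t a)"
    "i \<in> J \<Longrightarrow> x \<in> carrier (G i) \<Longrightarrow> lact L a (inc i x) = inc i (lact (G i) a x)"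
    "i \<in> J \<Longrightarrow> x \<in> carrier (G i) \<Longrightarrow> ract L (inc i x) a = inc i (ract (G i) x a)"
proof -
  have al: "additive_map (G i) P (\<lambda>x. inc i (lact (G i) a x))" if "i \<in> J" for i
  proof -
    interpret Gi: bimodule A "G i" by (rule bimodule_G[OF that])
    have "additive_map (G i) (G i) (lact (G i) a)"
      using a by (intro additive_mapI) (simp_all add: Gi.lact_closed Gi.lact_add)
    from additive_comp[OF this additive_inc[OF that]] show ?thesis
      by (simp add: additive_colim_iff)
  qed
  have ar: "additive_map (G i) P (\<lambda>x. inc i (ract (G i) x a))" if "i \<in> J" for i
  proof -
    interpret Gi: bimodule A "G i" by (rule bimodule_G[OF that])
    have "additive_map (G i) (G i) (\<lambda>x. ract (G i) x a)"
      using a by (intro additive_mapI) (simp_all add: Gi.ract_closed Gi.ract_add)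
    from additive_comp[OF this additive_inc[OF that]] show ?thesis
      by (simp add: additive_colim_iff)
  qed
  have arr: "\<forall>x\<in>carrier (G i). inc j (lact (G j) a (\<phi> x)) = inc i (lact (G i) a x)"
    "\<forall>x\<in>carrier (G i). inc j (ract (G j) (\<phi> x) a) = inc i (ract (G i) x a)"
    if "i \<in> J" "j \<in> J" "\<phi> \<in> arr i j" for i j \<phi>
  proof (rule_tac [!] ballI)
    interpret Gi: bimodule A "G i" by (rule bimodule_G[OF that(1)])
    note \<phi> = coring_hom_bimodule_hom[OF arr_hom[OF that]]
    fix x assume x: "x \<in> carrier (G i)"
    show "inc j (lact (G j) a (\<phi> x)) = inc i (lact (G i) a x)"
      "inc j (ract (G j) (\<phi> x) a) = inc i (ract (G i) x a)"
      using inc_arr[OF that, of "lact (G i) a x"] inc_arr[OF that, of "ract (G i) x a"]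
        bimodule_hom_lact[OF \<phi> x a] bimodule_hom_ract[OF \<phi> x a] a x
      by (simp_all add: Gi.lact_closed Gi.ract_closed)
  qed
  have L: "lact L a = pres_lift P (\<lambda>(i, x). inc i (lact (G i) a x))"
    "(\<lambda>t. ract L t a) = pres_lift P (\<lambda>(i, x). inc i (ract (G i) x a))"
    by (simp_all add: colim_bimodule_def Let_def ring.defs)
  have addl: "additive_map L P (pres_lift P (\<lambda>(i, x). inc i (lact (G i) a x)))"
    by (rule additive_colim_lift[where k = "\<lambda>i x. inc i (lact (G i) a x)"])
      (fact pres.abelian_group_pres_group al arr(1))+
  have addr: "additive_map L P (pres_lift P (\<lambda>(i, x). inc i (ract (G i) x a)))"
    by (rule additive_colim_lift[where k = "\<lambda>i x. inc i (ract (G i) x a)"])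
      (fact pres.abelian_group_pres_group ar arr(2))+
  show "additive_map L L (lact L a)"
    unfolding L(1) by (rule additive_colim_iff(2)[THEN iffD1, OF addl])
  show "additive_map L L (\<lambda>t. ract L t a)"
    by (subst L(2)) (rule additive_colim_iff(2)[THEN iffD1, OF addr])
  show "lact L a (inc i x) = inc i (lact (G i) a x)" if "i \<in> J" "x \<in> carrier (G i)"
    unfolding L(1)
    by (rule colim_lift_inc[where k = "\<lambda>i x. inc i (lact (G i) a x)"])
      (fact pres.abelian_group_pres_group al arr(1) that)+
  show "ract L (inc i x) a = inc i (ract (G i) x a)" if "i \<in> J" "x \<in> carrier (G i)"
    unfolding fun_cong[OF L(2), of "inc i x"]
    by (rule colim_lift_inc[where k = "\<lambda>i x. inc i (ract (G i) x a)"])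
      (fact pres.abelian_group_pres_group ar arr(2) that)+
qed

lemma bimodule_colim: "bimodule A L"
proof -
  interpret A: ring A by (rule ring_A)
  note l = bimodule_colim_aux(1) and r = bimodule_colim_aux(2)
  note ab = abelian_colim
  have G: "lact (G i) a x \<in> carrier (G i)" "ract (G i) x a \<in> carrier (G i)"
    "lact (G i) (a \<oplus>\<^bsub>A\<^esub> b) x = lact (G i) a x \<oplus>\<^bsub>G i\<^esub> lact (G i) b x"
    "ract (G i) x (a \<oplus>\<^bsub>A\<^esub> b) = ract (G i) x a \<oplus>\<^bsub>G i\<^esub> ract (G i) x b"
    "lact (G i) (a \<otimes>\<^bsub>A\<^esub> b) x = lact (G i) a (lact (G i) b x)"
    "ract (G i) x (a \<otimes>\<^bsub>A\<^esub> b) = ract (G i) (ract (G i) x a) b"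
    "ract (G i) (lact (G i) a x) b = lact (G i) a (ract (G i) x b)"
    "lact (G i) \<one>\<^bsub>A\<^esub> x = x" "ract (G i) x \<one>\<^bsub>A\<^esub> = x"
    if "i \<in> J" "x \<in> carrier (G i)" "a \<in> carrier A" "b \<in> carrier A" for i x a b
  proof -
    interpret Gi: bimodule A "G i" by (rule bimodule_G[OF that(1)])
    show "lact (G i) a x \<in> carrier (G i)" "ract (G i) x a \<in> carrier (G i)"
      "lact (G i) (a \<oplus>\<^bsub>A\<^esub> b) x = lact (G i) a x \<oplus>\<^bsub>G i\<^esub> lact (G i) b x"
      "ract (G i) x (a \<oplus>\<^bsub>A\<^esub> b) = ract (G i) x a \<oplus>\<^bsub>G i\<^esub> ract (G i) x b"
      "lact (G i) (a \<otimes>\<^bsub>A\<^esub> b) x = lact (G i) a (lact (G i) b x)"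
      "ract (G i) x (a \<otimes>\<^bsub>A\<^esub> b) = ract (G i) (ract (G i) x a) b"
      "ract (G i) (lact (G i) a x) b = lact (G i) a (ract (G i) x b)"
      "lact (G i) \<one>\<^bsub>A\<^esub> x = x" "ract (G i) x \<one>\<^bsub>A\<^esub> = x"
      using that by (simp_all add: Gi.lact_closed Gi.ract_closed Gi.add_lact Gi.add_ract Gi.mult_lact
          Gi.mult_ract Gi.lact_ract Gi.one_lact Gi.one_ract)
  qed
  note simps = bimodule_colim_aux(3,4) G(1-7) G(8,9)[OF _ _ A.one_closed A.one_closed] additive_add[OF additive_inc]
  show ?thesis
  proof (intro bimoduleI left_moduleI right_moduleI)
    fix a t assume "a \<in> carrier A" "t \<in> carrier L"
    then show "lact L a t \<in> carrier L" "ract L t a \<in> carrier L"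
      by (rule additive_closed[OF l], rule additive_closed[OF r])
  next
    fix a t u assume "a \<in> carrier A" "t \<in> carrier L" "u \<in> carrier L"
    then show "lact L a (t \<oplus>\<^bsub>L\<^esub> u) = lact L a t \<oplus>\<^bsub>L\<^esub> lact L a u"
      "ract L (t \<oplus>\<^bsub>L\<^esub> u) a = ract L t a \<oplus>\<^bsub>L\<^esub> ract L u a"
      by (rule additive_add[OF l], rule additive_add[OF r])
  next
    fix a b t assume ab': "a \<in> carrier A" "b \<in> carrier A" and t: "t \<in> carrier L"
    show "lact L (a \<oplus>\<^bsub>A\<^esub> b) t = lact L a t \<oplus>\<^bsub>L\<^esub> lact L b t"
      by (rule colim_eqI[OF ab l additive_plus[OF ab l l] _ t]) (use ab' in \<open>simp_all add: simps\<close>)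
    show "ract L t (a \<oplus>\<^bsub>A\<^esub> b) = ract L t a \<oplus>\<^bsub>L\<^esub> ract L t b"
      by (rule colim_eqI[OF ab r additive_plus[OF ab r r] _ t]) (use ab' in \<open>simp_all add: simps\<close>)
    show "lact L (a \<otimes>\<^bsub>A\<^esub> b) t = lact L a (lact L b t)"
      by (rule colim_eqI[OF ab l additive_comp[OF l l] _ t]) (use ab' in \<open>simp_all add: simps\<close>)
    show "ract L t (a \<otimes>\<^bsub>A\<^esub> b) = ract L (ract L t a) b"
      by (rule colim_eqI[OF ab r additive_comp[OF r r] _ t]) (use ab' in \<open>simp_all add: simps\<close>)
    show "ract L (lact L a t) b = lact L a (ract L t b)"
      by (rule colim_eqI[OF ab additive_comp[OF l r] additive_comp[OF r l] _ t]) (use ab' in \<open>simp_all add: simps\<close>)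
  next
    fix t assume t: "t \<in> carrier L"
    show "lact L \<one>\<^bsub>A\<^esub> t = t"
      by (rule colim_eqI[OF ab l additive_id _ t]) (simp_all add: simps)
    show "ract L t \<one>\<^bsub>A\<^esub> = t"
      by (rule colim_eqI[OF ab r additive_id _ t]) (simp_all add: simps)
  qed (rule ring_A abelian_colim)+
qed

lemma inc_hom: "i \<in> J \<Longrightarrow> inc i \<in> bimodule_hom A (G i) L"
  by (rule bimodule_homI) (simp_all add: additive_inc bimodule_colim_aux(3,4), simp add: colim_in_def)

lemma colim_bimodule_homI:
  assumes h: "h \<in> extensional (carrier L)" "additive_map L E h" and E: "bimodule A E"
    and k: "\<And>i. i \<in> J \<Longrightarrow> compose (carrier (G i)) h (inc i) \<in> bimodule_hom A (G i) E"
  shows "h \<in> bimodule_hom A L E"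
proof (rule bimodule_homI[OF h])
  interpret E: bimodule A E by (rule E)
  fix a t assume a: "a \<in> carrier A" and t: "t \<in> carrier L"
  have aE: "additive_map E E (lact E a)" "additive_map E E (\<lambda>x. ract E x a)"
    using a by (auto intro!: additive_mapI simp: E.lact_closed E.ract_closed E.lact_add E.ract_add)
  have hG: "h (inc i (lact (G i) a x)) = lact E a (h (inc i x))" "h (inc i (ract (G i) x a)) = ract E (h (inc i x)) a"
    if i: "i \<in> J" and x: "x \<in> carrier (G i)" for i x
  proof -
    interpret Gi: bimodule A "G i" by (rule bimodule_G[OF i])
    show "h (inc i (lact (G i) a x)) = lact E a (h (inc i x))" "h (inc i (ract (G i) x a)) = ract E (h (inc i x)) a"
      using bimodule_hom_lact[OF k[OF i] x a] bimodule_hom_ract[OF k[OF i] x a] x a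
      by (simp_all add: compose_eq Gi.lact_closed Gi.ract_closed)
  qed
  show "h (lact L a t) = lact E a (h t)"
    by (rule colim_eqI[OF E.M.abelian_group_axioms additive_comp[OF bimodule_colim_aux(1)[OF a] h(2)]
          additive_comp[OF h(2) aE(1)] _ t]) (simp add: bimodule_colim_aux(3)[OF a] hG)
  show "h (ract L t a) = ract E (h t) a"
    by (rule colim_eqI[OF E.M.abelian_group_axioms additive_comp[OF bimodule_colim_aux(2)[OF a] h(2)]
          additive_comp[OF h(2) aE(2)] _ t]) (simp add: bimodule_colim_aux(4)[OF a] hG)
qed

section \<open>The coring structure on the colimit of bimodules\<close>

lemma colim_coring_ops: "same_ops C L" "same_ops L C"
  by (simp_all add: colim_coring_def Let_def bimodule.defs same_ops_def)

lemma carrier_colim_coring: "carrier C = carrier L"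
  using colim_coring_ops(1) by (simp add: same_ops_def)

lemma tensor_colim: "tensor A C C = tensor A L L"
  by (rule tensor_same_ops[OF colim_coring_ops(1) colim_coring_ops(1)])

lemma tensor_map_colim:
  "tensor_map A X Y C C = tensor_map A X Y L L" "tensor_map A C C X Y = tensor_map A L L X Y"
  by (rule tensor_map_same_ops[OF same_ops_refl same_ops_refl colim_coring_ops(1) colim_coring_ops(1)],
      rule tensor_map_same_ops[OF colim_coring_ops(1) colim_coring_ops(1) same_ops_refl same_ops_refl])

abbreviation (input) "inc2 i \<equiv> tensor_map A (G i) (G i) L L (inc i) (inc i)"

lemma inc2_hom: "i \<in> J \<Longrightarrow> inc2 i \<in> bimodule_hom A (tensor A (G i) (G i)) (tensor A L L)"
  by (intro tensor_map_hom bimodule_G bimodule_colim inc_hom)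

lemma inc2_comult_hom:
  "i \<in> J \<Longrightarrow> compose (carrier (G i)) (inc2 i) (comult (G i)) \<in> bimodule_hom A (G i) (tensor A L L)"
  by (intro bimodule_hom_compose[OF bimodule_G precoring_comult[OF precoring_G] inc2_hom])

text \<open>The maps \<open>inc2 i\<close> after \<open>comult (G i)\<close> form a cocone: the
  tensor square of \<open>inc j\<close> after that of an arrow \<open>\<phi>\<close> is the tensor
  square of \<open>inc i\<close>, and \<open>\<phi>\<close> commutes with \<open>comult\<close>. So
  the comultiplication of the colimit is well defined.\<close>

lemma comult_colim_aux:
  "abelian_group (tensor A L L)"
  "i \<in> J \<Longrightarrow> additive_map (G i) (tensor A L L) (\<lambda>x. inc2 i (comult (G i) x))"
  "i \<in> J \<Longrightarrow> j \<in> J \<Longrightarrow> \<phi> \<in> arr i j \<Longrightarrow>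
    \<forall>x\<in>carrier (G i). inc2 j (comult (G j) (\<phi> x)) = inc2 i (comult (G i) x)"
proof -
  show "abelian_group (tensor A L L)"
    by (rule bimodule_abelian[OF bimodule_tensor[OF bimodule_colim bimodule_colim]])
  show "additive_map (G i) (tensor A L L) (\<lambda>x. inc2 i (comult (G i) x))" if "i \<in> J"
    using additive_comp[OF bimodule_hom_additive[OF precoring_comult[OF precoring_G[OF that]]]
        bimodule_hom_additive[OF inc2_hom[OF that]]] .
  assume i: "i \<in> J" and j: "j \<in> J" and \<phi>: "\<phi> \<in> arr i j"
  show "\<forall>x\<in>carrier (G i). inc2 j (comult (G j) (\<phi> x)) = inc2 i (comult (G i) x)"
  proof
  fix x assume x: "x \<in> carrier (G i)"
  note pi = precoring_G[OF i] and pj = precoring_G[OF j] and f = arr_hom[OF i j \<phi>]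
  note fh = coring_hom_bimodule_hom[OF f]
  have "inc2 j (tensor_map A (G i) (G i) (G j) (G j) \<phi> \<phi> (comult (G i) x)) = inc2 i (comult (G i) x)"
    by (rule tensor_map_comp[OF mods(1,2)[OF pi] mods(1,2)[OF pj] bimodule_right[OF bimodule_colim]
          bimodule_left[OF bimodule_colim] bimodule_hom_right[OF fh] bimodule_hom_right[OF inc_hom[OF j]]
          bimodule_hom_left[OF fh] bimodule_hom_left[OF inc_hom[OF j]] bimodule_hom_right[OF inc_hom[OF i]] _
          bimodule_hom_left[OF inc_hom[OF i]] _ bimodule_hom_closed[OF precoring_comult[OF pi] x]])
      (simp_all add: inc_arr[OF i j \<phi>])
  then show "inc2 j (comult (G j) (\<phi> x)) = inc2 i (comult (G i) x)"
    by (simp add: coring_hom_comult[OF f x])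
  qed
qed

lemma counit_colim_aux:
  "abelian_group (regular A)"
  "i \<in> J \<Longrightarrow> additive_map (G i) (regular A) (counit (G i))"
  "i \<in> J \<Longrightarrow> j \<in> J \<Longrightarrow> \<phi> \<in> arr i j \<Longrightarrow> \<forall>x\<in>carrier (G i). counit (G j) (\<phi> x) = counit (G i) x"
  using bimodule_abelian[OF bimodule_regular[OF ring_A]]
    bimodule_hom_additive[OF precoring_counit[OF precoring_G]] coring_hom_counit[OF arr_hom]
  by blast+

lemma colim_coring_comult:
  "comult C = (\<lambda>t\<in>carrier L. pres_lift (tensor A L L) (\<lambda>(i, x). inc2 i (comult (G i) x)) t)"
  "counit C = (\<lambda>t\<in>carrier L. pres_lift (regular A) (\<lambda>(i, x). counit (G i) x) t)"
  by (simp_all add: colim_coring_def Let_def bimodule.defs)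

lemma comult_colim_inc:
  assumes "i \<in> J" "x \<in> carrier (G i)"
  shows "comult C (inc i x) = inc2 i (comult (G i) x)"
proof -
  have "pres_lift (tensor A L L) (\<lambda>(i, x). inc2 i (comult (G i) x)) (inc i x) = inc2 i (comult (G i) x)"
    by (rule colim_lift_inc[where k = "\<lambda>i x. inc2 i (comult (G i) x)"]) (fact comult_colim_aux assms)+
  then show ?thesis
    using inc_closed[OF assms] by (simp add: colim_coring_comult)
qed

lemma counit_colim_inc:
  assumes "i \<in> J" "x \<in> carrier (G i)"
  shows "counit C (inc i x) = counit (G i) x"
proof -
  have "pres_lift (regular A) (\<lambda>(i, x). counit (G i) x) (inc i x) = counit (G i) x"
    by (rule colim_lift_inc[where k = "\<lambda>i. counit (G i)"]) (fact counit_colim_aux assms)+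
  then show ?thesis
    using inc_closed[OF assms] by (simp add: colim_coring_comult)
qed

lemma colim_precoring: "precoring A C"
proof -
  note ab = abelian_group.axioms(1)[OF abelian_colim]
  have "additive_map L (tensor A L L) (pres_lift (tensor A L L) (\<lambda>(i, x). inc2 i (comult (G i) x)))"
    by (rule additive_colim_lift[where k = "\<lambda>i x. inc2 i (comult (G i) x)"]) (fact comult_colim_aux)+
  from additive_cong[OF this ab] have add1: "additive_map L (tensor A L L) (comult C)"
    by (simp add: colim_coring_comult)
  have "additive_map L (regular A) (pres_lift (regular A) (\<lambda>(i, x). counit (G i) x))"
    by (rule additive_colim_lift[where k = "\<lambda>i. counit (G i)"]) (fact counit_colim_aux)+
  from additive_cong[OF this ab] have add2: "additive_map L (regular A) (counit C)"
    by (simp add: colim_coring_comult)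
  note add = add1 add2
  have "comult C \<in> extensional (carrier L)" "counit C \<in> extensional (carrier L)"
    by (simp_all add: colim_coring_comult)
  moreover have "compose (carrier (G i)) (comult C) (inc i) \<in> bimodule_hom A (G i) (tensor A L L)" if "i \<in> J" for i
    using inc2_comult_hom[OF that] comult_colim_inc[OF that] by (simp add: compose_def cong: restrict_cong)
  moreover have "compose (carrier (G i)) (counit C) (inc i) \<in> bimodule_hom A (G i) (regular A)" if "i \<in> J" for i
  proof -
    have "compose (carrier (G i)) (counit C) (inc i) = counit (G i)"
      using counit_colim_inc[OF that] bimodule_hom_ext[OF precoring_counit[OF precoring_G[OF that]]]
      by (auto simp: compose_def fun_eq_iff extensional_def)
    then show ?thesis
      using precoring_counit[OF precoring_G[OF that]] by simp
  qed
  ultimately have "comult C \<in> bimodule_hom A L (tensor A L L)" "counit C \<in> bimodule_hom A L (regular A)"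
    using add by (auto intro!: colim_bimodule_homI bimodule_tensor bimodule_colim bimodule_regular ring_A)
  then show ?thesis
    using bimodule_same_ops[OF colim_coring_ops(2) bimodule_colim]
    by (simp add: precoring_def tensor_colim bimodule_hom_same_ops(1)[OF colim_coring_ops(1)])
qed

lemma inc_coring_hom: "i \<in> J \<Longrightarrow> inc i \<in> coring_hom A (G i) C"
  using inc_hom by (simp add: coring_hom_def bimodule_hom_same_ops(2)[OF colim_coring_ops(1)]
      tensor_map_colim comult_colim_inc counit_colim_inc)

text \<open>Each law is an equation of additive maps, so it is checked on the images of the
  \<open>G i\<close>, where naturality along \<open>inc i\<close> supplies it. This is why the
  colimit may be formed among bimodules.\<close>

lemma colim_coring: "coring A C"
proof -
  note p = colim_precoring
  note so = additive_same_ops[OF colim_coring_ops(1)]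
  have "abelian_group (tensor A C (tensor A C C))"
    by (intro bimodule_abelian[of A] bimodule_tensor precoring_bimodule[OF p])
  note ax = coring_axioms_image[OF precoring_G p inc_coring_hom coring_G]
  have "coassoc_left A C t = coassoc_right A C t \<and> counit_left A C t = t \<and> counit_right A C t = t"
    if t: "t \<in> carrier L" for t
  proof (intro conjI)
    show "coassoc_left A C t = coassoc_right A C t"
      by (rule colim_eqI[OF \<open>abelian_group (tensor A C (tensor A C C))\<close> _ _ _ t])
        (use additive_coassoc_left[OF p] additive_coassoc_right[OF p] ax(1) in \<open>simp_all add: so\<close>)
    show "counit_left A C t = t"
      by (rule colim_eqI[OF abelian_colim _ additive_id _ t])
        (use additive_counit_left[OF p] ax(2) in \<open>simp_all add: so\<close>)
    show "counit_right A C t = t"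
      by (rule colim_eqI[OF abelian_colim _ additive_id _ t])
        (use additive_counit_right[OF p] ax(3) in \<open>simp_all add: so\<close>)
  qed
  then show ?thesis
    using p by (simp add: coring_iff carrier_colim_coring)
qed

text \<open>Compatibility with \<open>comult\<close> is again an equation of additive maps on the
  colimit. At \<open>inc i x\<close> it follows from that of \<open>h\<close> after
  \<open>inc i\<close> and from functoriality of the tensor square.\<close>

lemma colim_coring_homI:
  assumes h: "h \<in> extensional (carrier C)" "additive_map C E h" and E: "precoring A E"
    and k: "\<And>i. i \<in> J \<Longrightarrow> compose (carrier (G i)) h (inc i) \<in> coring_hom A (G i) E"
  shows "h \<in> coring_hom A C E"
proof -
  note p = colim_precoring and so = additive_same_ops[OF colim_coring_ops(1)]
  have hb: "h \<in> bimodule_hom A C E"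
    unfolding bimodule_hom_same_ops(1)[OF colim_coring_ops(1)]
    by (rule colim_bimodule_homI)
      (use h k precoring_bimodule[OF E] in \<open>simp_all add: carrier_colim_coring so coring_hom_bimodule_hom\<close>)
  note EE = bimodule_tensor[OF precoring_bimodule[OF E] precoring_bimodule[OF E]]
  note hh = tensor_map_hom[OF precoring_bimodule[OF p] precoring_bimodule[OF p] precoring_bimodule[OF E]
      precoring_bimodule[OF E] hb hb]
  have kx: "compose (carrier (G i)) h (inc i) x = h (inc i x)" if "x \<in> carrier (G i)" for i x
    using that by (simp add: compose_eq)
  have "comult E (h t) = tensor_map A C C E E h h (comult C t)" if t: "t \<in> carrier L" for t
  proof (rule colim_eqI[OF bimodule_abelian[OF EE] _ _ _ t])
    show "additive_map L (tensor A E E) (\<lambda>t. comult E (h t))"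
      using additive_comp[OF h(2) bimodule_hom_additive[OF precoring_comult[OF E]]] by (simp add: so)
    show "additive_map L (tensor A E E) (\<lambda>t. tensor_map A C C E E h h (comult C t))"
      using additive_comp[OF bimodule_hom_additive[OF precoring_comult[OF p]] bimodule_hom_additive[OF hh]]
      by (simp add: so)
    fix i x assume i: "i \<in> J" and x: "x \<in> carrier (G i)"
    note pi = precoring_G[OF i] and ih = coring_hom_bimodule_hom[OF inc_coring_hom[OF i]]
      and kh = coring_hom_bimodule_hom[OF k[OF i]]
    have "tensor_map A C C E E h h (tensor_map A (G i) (G i) C C (inc i) (inc i) (comult (G i) x)) =
        tensor_map A (G i) (G i) E E (compose (carrier (G i)) h (inc i)) (compose (carrier (G i)) h (inc i)) (comult (G i) x)"
      by (rule tensor_map_comp[OF mods(1,2)[OF pi] mods(1,2)[OF p] mods(1,2)[OF E]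
            bimodule_hom_right[OF ih] bimodule_hom_right[OF hb] bimodule_hom_left[OF ih] bimodule_hom_left[OF hb]
            bimodule_hom_right[OF kh] _ bimodule_hom_left[OF kh] _ bimodule_hom_closed[OF precoring_comult[OF pi] x]])
        (simp_all add: kx)
    then show "comult E (h (inc i x)) = tensor_map A C C E E h h (comult C (inc i x))"
      using coring_hom_comult[OF inc_coring_hom[OF i] x] coring_hom_comult[OF k[OF i] x] by (simp add: kx x)
  qed
  moreover have "counit E (h t) = counit C t" if t: "t \<in> carrier L" for t
  proof (rule colim_eqI[OF bimodule_abelian[OF bimodule_regular[OF ring_A]] _ _ _ t])
    show "additive_map L (regular A) (\<lambda>t. counit E (h t))"
      using additive_comp[OF h(2) bimodule_hom_additive[OF precoring_counit[OF E]]] by (simp add: so)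
    show "additive_map L (regular A) (counit C)"
      using bimodule_hom_additive[OF precoring_counit[OF p]] by (simp add: so)
    show "counit E (h (inc i x)) = counit C (inc i x)" if "i \<in> J" "x \<in> carrier (G i)" for i x
      using coring_hom_counit[OF inc_coring_hom[OF that(1)] that(2)] coring_hom_counit[OF k[OF that(1)] that(2)]
      by (simp add: kx that)
  qed
  ultimately show ?thesis
    using hb by (simp add: coring_hom_def carrier_colim_coring)
qed

lemma colim_hom_eqI:
  assumes "abelian_group H" "additive_map C H f" "additive_map C H g"
    "f \<in> extensional (carrier C)" "g \<in> extensional (carrier C)"
    and "\<And>i x. i \<in> J \<Longrightarrow> x \<in> carrier (G i) \<Longrightarrow> f (inc i x) = g (inc i x)"
  shows "f = g"
proof (rule extensionalityI[OF assms(4,5)])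
  note so = additive_same_ops(1)[OF colim_coring_ops(1)]
  fix t assume "t \<in> carrier C"
  then have t: "t \<in> carrier L"
    by (simp add: carrier_colim_coring)
  show "f t = g t"
    by (rule colim_eqI[OF assms(1) assms(2)[unfolded so] assms(3)[unfolded so] _ t]) (rule assms(6))
qed

lemma colimit: "coring_colimit T A J G arr C inc"
  unfolding coring_colimit_def
proof (intro conjI ballI allI impI)
  show "coring A C"
    by (rule colim_coring)
  show "inc i \<in> coring_hom A (G i) C" if "i \<in> J" for i
    by (rule inc_coring_hom[OF that])
  show "compose (carrier (G i)) (inc j) \<phi> = inc i" if "i \<in> J" "j \<in> J" "\<phi> \<in> arr i j" for i j \<phi>
    using inc_arr[OF that] by (auto simp: compose_def fun_eq_iff colim_in_def)
  fix E :: "('a, 'e) coring" and k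
  assume *: "coring A E \<and> (\<forall>i\<in>J. k i \<in> coring_hom A (G i) E) \<and>
    (\<forall>i\<in>J. \<forall>j\<in>J. \<forall>\<phi>\<in>arr i j. compose (carrier (G i)) (k j) \<phi> = k i)"
  then have E: "coring A E" and k: "\<And>i. i \<in> J \<Longrightarrow> k i \<in> coring_hom A (G i) E"
    and ka: "\<And>i j \<phi>. i \<in> J \<Longrightarrow> j \<in> J \<Longrightarrow> \<phi> \<in> arr i j \<Longrightarrow> compose (carrier (G i)) (k j) \<phi> = k i"
    by blast+
  have k_arr: "\<forall>x\<in>carrier (G i). k j (\<phi> x) = k i x" if "i \<in> J" "j \<in> J" "\<phi> \<in> arr i j" for i j \<phi>
    using fun_cong[OF ka[OF that]] by (metis compose_eq)
  note lift = bimodule_abelian[OF coring_bimodule[OF E]]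
    bimodule_hom_additive[OF coring_hom_bimodule_hom[OF k]] k_arr
  define h where "h = (\<lambda>t\<in>carrier C. pres_lift E (\<lambda>(i, x). k i x) t)"
  have h_inc: "h (inc i x) = k i x" if "i \<in> J" "x \<in> carrier (G i)" for i x
  proof -
    have "pres_lift E (\<lambda>(i, x). k i x) (inc i x) = k i x"
      by (rule colim_lift_inc[where k = k]) (fact lift that)+
    then show ?thesis
      using inc_closed[OF that] by (simp add: h_def carrier_colim_coring)
  qed
  have h_ext: "h \<in> extensional (carrier C)"
    by (simp add: h_def)
  have "additive_map L E (pres_lift E (\<lambda>(i, x). k i x))"
    by (rule additive_colim_lift[where k = k]) (fact lift)+
  from additive_cong[OF this abelian_group.axioms(1)[OF abelian_colim]] have h_add: "additive_map C E h"
    by (simp add: h_def carrier_colim_coring additive_same_ops[OF colim_coring_ops(1)])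
  have h_comp: "compose (carrier (G i)) h (inc i) = k i" if "i \<in> J" for i
    using h_inc[OF that] bimodule_hom_ext[OF coring_hom_bimodule_hom[OF k[OF that]]]
    by (auto simp: compose_def fun_eq_iff extensional_def)
  show "\<exists>!h. h \<in> coring_hom A C E \<and> (\<forall>i\<in>J. compose (carrier (G i)) h (inc i) = k i)"
  proof (rule ex1I[of _ h], intro conjI ballI)
    show "h \<in> coring_hom A C E"
      by (rule colim_coring_homI[OF h_ext h_add coring_precoring[OF E]]) (simp add: h_comp k)
    show "compose (carrier (G i)) h (inc i) = k i" if "i \<in> J" for i
      by (rule h_comp[OF that])
    fix h' assume h': "h' \<in> coring_hom A C E \<and> (\<forall>i\<in>J. compose (carrier (G i)) h' (inc i) = k i)"
    note b = coring_hom_bimodule_hom[OF conjunct1[OF h']]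
    show "h' = h"
    proof (rule colim_hom_eqI[OF lift(1) bimodule_hom_additive[OF b] h_add bimodule_hom_ext[OF b] h_ext])
      fix i x assume "i \<in> J" "x \<in> carrier (G i)"
      then have "compose (carrier (G i)) h' (inc i) x = k i x"
        using h' by simp
      then show "h' (inc i x) = h (inc i x)"
        using h_inc \<open>i \<in> J\<close> \<open>x \<in> carrier (G i)\<close> by (simp add: compose_eq)
    qed
  qed
qed

end

section \<open>Final objects from small corings\<close>

lemma compose_eqI:
  "p \<in> extensional X \<Longrightarrow> (\<And>x. x \<in> X \<Longrightarrow> g (f x) = p x) \<Longrightarrow> compose X g f = p"
  by (rule extensionalityI[of _ X]) (simp_all add: compose_def)

text \<open>Domination by one infinite set passes to unions at once, which the disjunction does not
  make visible.\<close>

lemma small_iff: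
  "X \<lesssim> Y \<or> X \<lesssim> (UNIV :: nat set) \<longleftrightarrow> X \<lesssim> Y <+> (UNIV :: nat set)"
proof
  have "Y \<lesssim> Y <+> (UNIV :: nat set)" "(UNIV :: nat set) \<lesssim> Y <+> (UNIV :: nat set)"
    unfolding lepoll_iff_ordLeq by (rule card_of_Plus1, rule card_of_Plus2)
  then show "X \<lesssim> Y \<or> X \<lesssim> (UNIV :: nat set) \<Longrightarrow> X \<lesssim> Y <+> (UNIV :: nat set)"
    by (elim disjE) (erule lepoll_trans, assumption)+
  assume X: "X \<lesssim> Y <+> (UNIV :: nat set)"
  have "Y <+> (UNIV :: nat set) \<lesssim> ({} :: nat set) <+> (Y <+> (UNIV :: nat set))"
    unfolding lepoll_iff_ordLeq by (rule card_of_Plus2)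
  from lepoll_max[OF lepoll_trans[OF X this]] show "X \<lesssim> Y \<or> X \<lesssim> (UNIV :: nat set)"
    by auto
qed

lemma small_image_Un:
  assumes "G \<lesssim> Y \<or> G \<lesssim> (UNIV :: nat set)" "H \<lesssim> Y \<or> H \<lesssim> (UNIV :: nat set)"
  shows "g ` G \<union> h ` H \<lesssim> Y \<or> g ` G \<union> h ` H \<lesssim> (UNIV :: nat set)"
  using assms unfolding small_iff
  by (intro lepoll_Un) (auto intro: lepoll_trans[OF image_lepoll])

lemma small_corings_card: "G \<in> small_corings A \<Longrightarrow> carrier G \<lesssim> carrier A \<or> carrier G \<lesssim> (UNIV :: nat set)"
  by (simp add: small_corings_def)

lemma small_corings_precoring: "G \<in> small_corings A \<Longrightarrow> precoring A G"
  by (rule coring_precoring[OF small_corings_coring])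

text \<open>The target is just an abelian group, because \<open>N\<close> is a bimodule for cofree
  corings and a coring for limits. Linearity of the induced map is recovered from its restrictions
  to the members of \<open>J\<close>.\<close>

locale pair_diagram =
  fixes A :: "('a, 's) ring_scheme" and J :: "(('a, 'a + nat) coring \<times> ('a + nat \<Rightarrow> 'n)) set"
    and N :: "('n, 'z) ring_scheme"
  assumes ring_A: "ring A" and abelian_N: "abelian_group N"
    and small: "(G, p) \<in> J \<Longrightarrow> G \<in> small_corings A"
    and additive_p: "(G, p) \<in> J \<Longrightarrow> additive_map G N p"
    and ext_p: "(G, p) \<in> J \<Longrightarrow> p \<in> extensional (carrier G)"
begin

sublocale D: coring_diagram A J fst "pair_arr A"
  by (rule coring_diagram.intro)
    (use small in \<open>auto simp: ring_A pair_arr_def intro: small_corings_coring\<close>)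

abbreviation "L \<equiv> pair_colim A J"
abbreviation "inc \<equiv> pair_in A J"
abbreviation "pL \<equiv> pair_map A J N"

lemmas colimit = D.colimit[folded pair_colim_def pair_in_def]
lemmas coring_L = D.colim_coring[folded pair_colim_def]
lemmas precoring_L = coring_precoring[OF coring_L]
lemmas bimodule_L = coring_bimodule[OF coring_L]

lemma inc_coring_hom: "(G, p) \<in> J \<Longrightarrow> inc (G, p) \<in> coring_hom A G L"
  using D.inc_coring_hom[of "(G, p)"] by (simp add: pair_colim_def pair_in_def)

lemma pair_map_lift: "(\<lambda>((G, p), x). p x) = (\<lambda>(i, x). snd i x)"
  by (auto simp: fun_eq_iff)

lemma pair_map_aux:
  "i \<in> J \<Longrightarrow> additive_map (fst i) N (snd i)"
  "i \<in> J \<Longrightarrow> j \<in> J \<Longrightarrow> \<phi> \<in> pair_arr A i j \<Longrightarrow> \<forall>x\<in>carrier (fst i). snd j (\<phi> x) = snd i x"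
proof -
  show "i \<in> J \<Longrightarrow> additive_map (fst i) N (snd i)"
    using additive_p by (cases i) auto
  assume "\<phi> \<in> pair_arr A i j"
  then have "compose (carrier (fst i)) (snd j) \<phi> = snd i"
    by (simp add: pair_arr_def)
  then show "\<forall>x\<in>carrier (fst i). snd j (\<phi> x) = snd i x"
    by (metis compose_eq)
qed

lemma pair_map_inc:
  assumes "(G, p) \<in> J" "x \<in> carrier G"
  shows "pL (inc (G, p) x) = p x"
proof -
  have "pres_lift N (\<lambda>(i, x). snd i x) (colim_in J fst (pair_arr A) (G, p) x) = snd (G, p) x"
    by (rule D.colim_lift_inc[where k = snd]) (fact abelian_N pair_map_aux | simp add: assms)+
  moreover have "inc (G, p) x \<in> carrier L"
    by (rule coring_hom_closed[OF inc_coring_hom]) fact+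
  ultimately show ?thesis
    by (simp add: pair_map_def pair_in_def pair_map_lift)
qed

lemma compose_pair_map_inc: "(G, p) \<in> J \<Longrightarrow> compose (carrier G) pL (inc (G, p)) = p"
  by (rule compose_eqI) (auto intro: ext_p pair_map_inc)

lemma pair_map_ext: "pL \<in> extensional (carrier L)"
  by (simp add: pair_map_def)

lemma additive_pair_map: "additive_map L N pL"
proof -
  have "additive_map D.L N (pres_lift N (\<lambda>(i, x). snd i x))"
    by (rule D.additive_colim_lift[where k = snd]) (fact abelian_N pair_map_aux)+
  then have "additive_map L N (pres_lift N (\<lambda>(i, x). snd i x))"
    by (simp add: pair_colim_def additive_same_ops(1)[OF D.colim_coring_ops(1)])
  from additive_cong[OF this abelian_group.axioms(1)[OF bimodule_abelian[OF bimodule_L]]] show ?thesis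
    by (simp add: pair_map_def pair_map_lift)
qed

lemma pair_hom_eqI:
  assumes "abelian_group H" "additive_map L H f" "additive_map L H g"
    "f \<in> extensional (carrier L)" "g \<in> extensional (carrier L)"
    and "\<And>G p x. (G, p) \<in> J \<Longrightarrow> x \<in> carrier G \<Longrightarrow> f (inc (G, p) x) = g (inc (G, p) x)"
  shows "f = g"
  by (rule D.colim_hom_eqI[OF assms(1-5)[unfolded pair_colim_def]])
    (use assms(6) in \<open>auto simp: pair_in_def\<close>)

lemma pair_bimodule_homI:
  assumes h: "h \<in> extensional (carrier L)" "additive_map L E h" and E: "bimodule A E"
    and k: "\<And>G p. (G, p) \<in> J \<Longrightarrow> compose (carrier G) h (inc (G, p)) \<in> bimodule_hom A G E"
  shows "h \<in> bimodule_hom A L E"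
  unfolding pair_colim_def bimodule_hom_same_ops(1)[OF D.colim_coring_ops(1)]
  by (rule D.colim_bimodule_homI)
    (use assms in \<open>auto simp: pair_colim_def pair_in_def D.carrier_colim_coring
      additive_same_ops(1)[OF D.colim_coring_ops(1)]\<close>)

lemma pair_coring_homI:
  assumes h: "h \<in> extensional (carrier L)" "additive_map L E h" and E: "precoring A E"
    and k: "\<And>G p. (G, p) \<in> J \<Longrightarrow> compose (carrier G) h (inc (G, p)) \<in> coring_hom A G E"
  shows "h \<in> coring_hom A L E"
  unfolding pair_colim_def
  by (rule D.colim_coring_homI) (use assms in \<open>auto simp: pair_colim_def pair_in_def\<close>)

text \<open>The small corings over \<open>E\<close> are then indices of the diagram, so each of them
  has a structure map into the colimit. These structure maps are the candidates for the restrictions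
  of a morphism from \<open>E\<close>.\<close>

definition admissible :: "('a, 'e) coring \<Rightarrow> ('e \<Rightarrow> 'n) \<Rightarrow> bool"
  where "admissible E p \<longleftrightarrow>
    (\<forall>G\<in>small_corings A. \<forall>g\<in>coring_hom A G E. (G, compose (carrier G) p g) \<in> J)"

text \<open>Choose a piece \<open>K\<close> containing both images. Both morphisms factor through
  \<open>K\<close> over \<open>N\<close>, so each side is a value of the structure map of
  \<open>K\<close>, and the two arguments there coincide because \<open>k\<close> is injective.
  Values on \<open>E\<close> can therefore be glued.\<close>

lemma admissible_inc_eq:
  assumes E: "coring A E" and p: "admissible E p"
    and G: "G \<in> small_corings A" "g \<in> coring_hom A G E" "y \<in> carrier G"
    and H: "H \<in> small_corings A" "h \<in> coring_hom A H E" "z \<in> carrier H"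
    and eq: "g y = h z"
  shows "inc (G, compose (carrier G) p g) y = inc (H, compose (carrier H) p h) z"
proof -
  note pE = coring_precoring[OF E]
  have sub: "g ` carrier G \<union> h ` carrier H \<subseteq> carrier E"
    using coring_hom_closed[OF G(2)] coring_hom_closed[OF H(2)] by auto
  obtain K k where K: "piece A E K k" "g ` carrier G \<union> h ` carrier H \<subseteq> k ` carrier K"
    by (rule piece_exists[OF E sub small_image_Un[OF small_corings_card[OF G(1)] small_corings_card[OF H(1)]]])
  have K': "K \<in> small_corings A" "k \<in> coring_hom A K E" "inj_on k (carrier K)"
    "inj_on (tensor_map A K K E E k k) (carrier (tensor A K K))"
    using K(1) by (simp_all add: piece_def)
  have lift: "\<exists>x'\<in>carrier K. k x' = f x \<and>
      inc (F, compose (carrier F) p f) x = inc (K, compose (carrier K) p k) x'"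
    if F: "F \<in> small_corings A" "f \<in> coring_hom A F E" "x \<in> carrier F" "f ` carrier F \<subseteq> k ` carrier K" for F f x
  proof -
    obtain f' where f': "f' \<in> coring_hom A F K" "\<And>x. x \<in> carrier F \<Longrightarrow> k (f' x) = f x"
      by (rule coring_hom_factor[OF small_corings_precoring[OF F(1)] small_corings_precoring[OF K'(1)] pE
            F(2) K'(2-4) F(4)]) (blast intro: that)
    let ?i = "(F, compose (carrier F) p f)" and ?j = "(K, compose (carrier K) p k)"
    have "f' \<in> pair_arr A ?i ?j"
      using f' coring_hom_closed[OF f'(1)] by (auto simp: pair_arr_def compose_def fun_eq_iff)
    moreover have "?i \<in> J" "?j \<in> J"
      using p F K' by (simp_all add: admissible_def)
    ultimately have "inc ?j (f' x) = inc ?i x"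
      using D.inc_arr[of ?i ?j f' x] F(3) by (simp add: pair_in_def)
    then show ?thesis
      using f'(2)[OF F(3)] coring_hom_closed[OF f'(1) F(3)] by auto
  qed
  obtain y' where y': "y' \<in> carrier K" "k y' = g y"
      "inc (G, compose (carrier G) p g) y = inc (K, compose (carrier K) p k) y'"
    using lift[OF G] K(2) by auto
  obtain z' where z': "z' \<in> carrier K" "k z' = h z"
      "inc (H, compose (carrier H) p h) z = inc (K, compose (carrier K) p k) z'"
    using lift[OF H] K(2) by auto
  have "y' = z'"
    by (rule inj_onD[OF K'(3)]) (use y' z' eq in auto)
  then show ?thesis
    using y' z' by simp
qed

text \<open>The morphism is glued from structure maps. Any two elements of \<open>E\<close> lie in
  one piece, where linearity is that of the structure map. For \<open>comult\<close> a piece around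
  \<open>x\<close> is enough, since the whole tensor \<open>comult G y\<close> is available inside
  it.\<close>

lemma admissible_hom_exists:
  assumes E: "coring A E" and p: "admissible E p"
  shows "\<exists>h\<in>coring_hom A E L. \<forall>G\<in>small_corings A. \<forall>g\<in>coring_hom A G E. \<forall>y\<in>carrier G.
    h (g y) = inc (G, compose (carrier G) p g) y"
proof -
  note pE = coring_precoring[OF E]
  interpret E: bimodule A E by (rule coring_bimodule[OF E])
  define is_val where "is_val x u \<longleftrightarrow> (\<exists>G g y. G \<in> small_corings A \<and> g \<in> coring_hom A G E \<and> y \<in> carrier G \<and>
    g y = x \<and> u = inc (G, compose (carrier G) p g) y)" for x u
  \<comment> \<open>The choice is harmless: by \<open>admissible_inc_eq\<close> there is at most one
    possible value.\<close>
  define h where "h = (\<lambda>x\<in>carrier E. SOME u. is_val x u)"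
  have h: "h (g y) = inc (G, compose (carrier G) p g) y"
    if G: "G \<in> small_corings A" "g \<in> coring_hom A G E" "y \<in> carrier G" for G g y
  proof -
    have "is_val (g y) (inc (G, compose (carrier G) p g) y)"
      unfolding is_val_def using G by blast
    then have "is_val (g y) (SOME u. is_val (g y) u)"
      by (rule someI)
    then obtain H f z where "H \<in> small_corings A" "f \<in> coring_hom A H E" "z \<in> carrier H" "f z = g y"
        "(SOME u. is_val (g y) u) = inc (H, compose (carrier H) p f) z"
      unfolding is_val_def[of "g y" "SOME u. is_val (g y) u"] by (elim exE conjE)
    then show ?thesis
      using admissible_inc_eq[OF E p, of H f z G g y] G coring_hom_closed[OF G(2,3)] by (simp add: h_def)
  qed
  have cover: "\<exists>G g. G \<in> small_corings A \<and> g \<in> coring_hom A G E \<and> {x, y} \<subseteq> g ` carrier G"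
    if "x \<in> carrier E" "y \<in> carrier E" for x y
  proof -
    have "{x, y} \<lesssim> carrier A \<or> {x, y} \<lesssim> (UNIV :: nat set)"
      by (simp add: finite_lepoll_infinite)
    then obtain G g where "piece A E G g" "{x, y} \<subseteq> g ` carrier G"
      using piece_exists[OF E, of "{x, y}"] \<open>x \<in> carrier E\<close> \<open>y \<in> carrier E\<close> by blast
    then show ?thesis
      by (auto simp: piece_def)
  qed
  have in_J: "(G, compose (carrier G) p g) \<in> J" if "G \<in> small_corings A" "g \<in> coring_hom A G E" for G g
    using p that by (simp add: admissible_def)
  have hb: "h \<in> bimodule_hom A E L"
  proof (rule bimodule_homI)
    show "h \<in> extensional (carrier E)"
      by (simp add: h_def)
    show "additive_map E L h"
    proof (rule additive_mapI)
      fix x assume "x \<in> carrier E"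
      then obtain G g x' where G: "G \<in> small_corings A" "g \<in> coring_hom A G E" "x' \<in> carrier G" "x = g x'"
        using cover[of x x] by auto
      then show "h x \<in> carrier L"
        using h[OF G(1-3)] coring_hom_closed[OF inc_coring_hom[OF in_J[OF G(1,2)]] G(3)] by simp
    next
      fix x y assume "x \<in> carrier E" "y \<in> carrier E"
      then obtain G g x' y' where G: "G \<in> small_corings A" "g \<in> coring_hom A G E"
          and xy: "x' \<in> carrier G" "y' \<in> carrier G" "x = g x'" "y = g y'"
        using cover[of x y] by auto
      interpret G: bimodule A G by (rule precoring_bimodule[OF small_corings_precoring[OF G(1)]])
      have "x \<oplus>\<^bsub>E\<^esub> y = g (x' \<oplus>\<^bsub>G\<^esub> y')"
        using additive_add[OF bimodule_hom_additive[OF coring_hom_bimodule_hom[OF G(2)]] xy(1,2)] xy by simp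
      then show "h (x \<oplus>\<^bsub>E\<^esub> y) = h x \<oplus>\<^bsub>L\<^esub> h y"
        using additive_add[OF bimodule_hom_additive[OF coring_hom_bimodule_hom[OF inc_coring_hom[OF in_J[OF G]]]] xy(1,2)]
        by (simp add: xy h[OF G])
    qed
  next
    fix a x assume a: "a \<in> carrier A" and "x \<in> carrier E"
    then obtain G g x' where G: "G \<in> small_corings A" "g \<in> coring_hom A G E" and x: "x' \<in> carrier G" "x = g x'"
      using cover[of x x] by auto
    interpret G: bimodule A G by (rule precoring_bimodule[OF small_corings_precoring[OF G(1)]])
    note gb = coring_hom_bimodule_hom[OF G(2)] and ib = coring_hom_bimodule_hom[OF inc_coring_hom[OF in_J[OF G]]]
    show "h (lact E a x) = lact L a (h x)"
      using h[OF G, of "lact G a x'"] h[OF G x(1)] a x bimodule_hom_lact[OF gb x(1) a] bimodule_hom_lact[OF ib x(1) a]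
      by (simp add: G.lact_closed)
    show "h (ract E x a) = ract L (h x) a"
      using h[OF G, of "ract G x' a"] h[OF G x(1)] a x bimodule_hom_ract[OF gb x(1) a] bimodule_hom_ract[OF ib x(1) a]
      by (simp add: G.ract_closed)
  qed
  have "comult L (h x) = tensor_map A E E L L h h (comult E x) \<and> counit L (h x) = counit E x" if x: "x \<in> carrier E" for x
  proof -
    obtain G g y where G: "G \<in> small_corings A" "g \<in> coring_hom A G E" and y: "y \<in> carrier G" "x = g y"
      using cover[OF x x] by auto
    note pG = small_corings_precoring[OF G(1)] and i = inc_coring_hom[OF in_J[OF G]]
    note gb = coring_hom_bimodule_hom[OF G(2)] and ib = coring_hom_bimodule_hom[OF i]
    have "tensor_map A E E L L h h (tensor_map A G G E E g g (comult G y)) =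
        tensor_map A G G L L (inc (G, compose (carrier G) p g)) (inc (G, compose (carrier G) p g)) (comult G y)"
      by (rule tensor_map_comp[OF mods(1,2)[OF pG] mods(1,2)[OF pE] mods(1,2)[OF precoring_L]
            bimodule_hom_right[OF gb] bimodule_hom_right[OF hb] bimodule_hom_left[OF gb] bimodule_hom_left[OF hb]
            bimodule_hom_right[OF ib] _ bimodule_hom_left[OF ib] _ bimodule_hom_closed[OF precoring_comult[OF pG] y(1)]])
        (simp_all add: h[OF G])
    then show ?thesis
      using coring_hom_comult[OF G(2) y(1)] coring_hom_comult[OF i y(1)]
        coring_hom_counit[OF G(2) y(1)] coring_hom_counit[OF i y(1)] h[OF G y(1)] y(2) by simp
  qed
  then have "h \<in> coring_hom A E L"
    using hb by (simp add: coring_hom_def)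
  then show ?thesis
    using h by blast
qed

text \<open>The endomorphism \<open>e\<close> of the colimit obtained from \<open>admissible_hom_exists\<close> fixes every structure
  map, so it is the identity; hence a morphism into the colimit is determined by its restrictions to
  small corings, which are structure maps.\<close>

lemma admissible_final:
  assumes L: "admissible L pL" and E: "coring A E" and p: "admissible E p" "p \<in> extensional (carrier E)"
  shows "\<exists>!h. h \<in> coring_hom A E L \<and> compose (carrier E) pL h = p"
proof -
  note pE = coring_precoring[OF E]
  have piece: "\<exists>G g y. G \<in> small_corings A \<and> g \<in> coring_hom A G E \<and> y \<in> carrier G \<and> x = g y" if "x \<in> carrier E" for x
  proof -
    have "{x} \<lesssim> carrier A \<or> {x} \<lesssim> (UNIV :: nat set)"
      by (simp add: finite_lepoll_infinite)
    then obtain G g where "piece A E G g" "{x} \<subseteq> g ` carrier G"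
      using piece_exists[OF E, of "{x}"] \<open>x \<in> carrier E\<close> by blast
    then show ?thesis
      by (auto simp: piece_def)
  qed
  obtain h where h: "h \<in> coring_hom A E L"
    "\<And>G g y. G \<in> small_corings A \<Longrightarrow> g \<in> coring_hom A G E \<Longrightarrow> y \<in> carrier G \<Longrightarrow>
      h (g y) = inc (G, compose (carrier G) p g) y"
    using admissible_hom_exists[OF E p(1)] by blast
  obtain e where e: "e \<in> coring_hom A L L"
    "\<And>G g y. G \<in> small_corings A \<Longrightarrow> g \<in> coring_hom A G L \<Longrightarrow> y \<in> carrier G \<Longrightarrow>
      e (g y) = inc (G, compose (carrier G) pL g) y"
    using admissible_hom_exists[OF coring_L L] by blast
  have "e = (\<lambda>x\<in>carrier L. x)"
  proof (rule pair_hom_eqI[OF bimodule_abelian[OF bimodule_L]])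
    show "additive_map L L e" "e \<in> extensional (carrier L)"
      using coring_hom_bimodule_hom[OF e(1)] by (simp_all add: bimodule_hom_additive bimodule_hom_ext)
    show "additive_map L L (\<lambda>x\<in>carrier L. x)"
      by (rule bimodule_hom_additive[OF bimodule_hom_id[OF bimodule_L]])
    fix G p x assume G: "(G, p) \<in> J" "x \<in> carrier G"
    then show "e (inc (G, p) x) = (\<lambda>x\<in>carrier L. x) (inc (G, p) x)"
      using e(2)[OF small[OF G(1)] inc_coring_hom[OF G(1)] G(2)] coring_hom_closed[OF inc_coring_hom[OF G(1)] G(2)]
      by (simp add: compose_pair_map_inc)
  qed simp
  then have e_id: "e x = x" if "x \<in> carrier L" for x
    using that by simp
  show ?thesis
  proof (rule ex1I[of _ h], intro conjI)
    show "h \<in> coring_hom A E L"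
      by (rule h(1))
    show "compose (carrier E) pL h = p"
    proof (rule extensionalityI[OF _ p(2)])
      fix x assume x: "x \<in> carrier E"
      then obtain G g y where G: "G \<in> small_corings A" "g \<in> coring_hom A G E" "y \<in> carrier G" "x = g y"
        using piece by blast
      have "(G, compose (carrier G) p g) \<in> J"
        using p(1) G by (simp add: admissible_def)
      then show "compose (carrier E) pL h x = p x"
        using x G h(2)[OF G(1-3)] pair_map_inc[of G "compose (carrier G) p g" y] by (simp add: compose_eq)
    qed (simp add: compose_def)
    fix k assume k: "k \<in> coring_hom A E L \<and> compose (carrier E) pL k = p"
    have pk: "pL (k x) = p x" if "x \<in> carrier E" for x
      using k that by (metis compose_eq)
    show "k = h"
    proof (rule bimodule_hom_eqI[OF coring_hom_bimodule_hom coring_hom_bimodule_hom[OF h(1)]])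
      show "k \<in> coring_hom A E L" using k by simp
      fix x assume "x \<in> carrier E"
      then obtain G g y where G: "G \<in> small_corings A" "g \<in> coring_hom A G E" "y \<in> carrier G" "x = g y"
        using piece by blast
      have kg: "compose (carrier G) k g \<in> coring_hom A G L"
        by (rule coring_hom_compose[OF small_corings_precoring[OF G(1)] pE precoring_L G(2)]) (use k in simp)
      \<comment> \<open>The composite of \<open>k\<close> and \<open>g\<close> is a small coring
        over the colimit with the same map to \<open>N\<close> as \<open>g\<close> has through
        \<open>p\<close>. Hence \<open>e\<close> sends its values to those of the structure map that
        also computes \<open>h\<close>.\<close>
      have "compose (carrier G) pL (compose (carrier G) k g) = compose (carrier G) p g"
        using pk coring_hom_closed[OF G(2)] by (auto simp: compose_def fun_eq_iff)
      then have "e (k (g y)) = h (g y)"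
        using e(2)[OF G(1) kg G(3)] h(2)[OF G(1-3)] G(3) by (simp add: compose_eq)
      then show "k x = h x"
        using e_id coring_hom_closed[OF kg G(3)] G by (simp add: compose_eq)
    qed
  qed
qed

end


section \<open>Cofree corings\<close>

context
  fixes A :: "('a, 's) ring_scheme" and V :: "('a, 'v, 'z) bimodule_scheme"
  assumes V: "bimodule A V"
begin

lemma cofree_pair_diagram: "pair_diagram A (cofree_pairs A V) V"
  by (rule pair_diagram.intro) (auto simp: cofree_pairs_def bimodule_hom_additive bimodule_hom_ext
      bimodule_ring[OF V] bimodule_abelian[OF V])

interpretation P: pair_diagram A "cofree_pairs A V" V by (rule cofree_pair_diagram)

lemma cofree_coring: "coring A (cofree_coring A V)"
  unfolding cofree_coring_def by (rule P.coring_L)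

lemma cofree_map_hom: "cofree_map A V \<in> bimodule_hom A (cofree_coring A V) V"
  unfolding cofree_coring_def cofree_map_def
  by (rule P.pair_bimodule_homI[OF P.pair_map_ext P.additive_pair_map V])
    (simp add: P.compose_pair_map_inc, simp add: cofree_pairs_def)

lemma cofree_admissible:
  assumes E: "coring A E" and f: "f \<in> bimodule_hom A E V"
  shows "P.admissible E f"
  unfolding P.admissible_def
proof (intro ballI)
  fix G g assume G: "G \<in> small_corings A" "g \<in> coring_hom A G E"
  then show "(G, compose (carrier G) f g) \<in> cofree_pairs A V"
    using bimodule_hom_compose[OF coring_bimodule[OF small_corings_coring[OF G(1)]] coring_hom_bimodule_hom[OF G(2)] f]
    by (simp add: cofree_pairs_def)
qed

text \<open>A bimodule map after a coring morphism is a bimodule map, so every coring over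
  \<open>V\<close> is admissible, in particular the colimit itself; finality in the general setting
  applies.\<close>

lemma cofree_universal:
  assumes E: "coring A E" and f: "f \<in> bimodule_hom A E V"
  shows "\<exists>!h. h \<in> coring_hom A E (cofree_coring A V) \<and> compose (carrier E) (cofree_map A V) h = f"
  unfolding cofree_coring_def cofree_map_def
  by (rule P.admissible_final[OF _ E cofree_admissible[OF E f] bimodule_hom_ext[OF f]])
    (rule cofree_admissible[OF P.coring_L cofree_map_hom[unfolded cofree_coring_def cofree_map_def]])

lemma cofree_is_cofree: "is_cofree T A V (cofree_coring A V) (cofree_map A V)"
  unfolding is_cofree_def
  by (intro conjI allI impI cofree_coring cofree_map_hom) (elim conjE, rule cofree_universal)

lemma cofree_colimit:
  "coring_colimit T A (cofree_pairs A V) fst (pair_arr A) (cofree_coring A V) (pair_in A (cofree_pairs A V))"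
  unfolding cofree_coring_def by (rule P.colimit)

lemma cofree_map_in:
  "(G, f) \<in> cofree_pairs A V \<Longrightarrow>
    compose (carrier G) (cofree_map A V) (pair_in A (cofree_pairs A V) (G, f)) = f"
  unfolding cofree_map_def by (rule P.compose_pair_map_inc)

end

section \<open>Limits\<close>

lemma bimodule_hom_funcset: "f \<in> bimodule_hom A M N \<Longrightarrow> f \<in> carrier M \<rightarrow> carrier N"
  by (auto intro: bimodule_hom_closed)

lemma coring_hom_funcset: "f \<in> coring_hom A C D \<Longrightarrow> f \<in> carrier C \<rightarrow> carrier D"
  by (auto intro: coring_hom_closed)

section \<open>The limit of the underlying bimodules\<close>

context coring_functor
begin

abbreviation "P \<equiv> lim_bimodule K F Fm"
abbreviation "q \<equiv> lim_proj K F Fm"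

lemma F_bimodule: "a \<in> Ob K \<Longrightarrow> bimodule A (F a)"
  by (rule coring_bimodule[OF F_coring])

lemma Fm_bimodule_hom: "u \<in> Ar K \<Longrightarrow> Fm u \<in> bimodule_hom A (F (Dom K u)) (F (Cod K u))"
  by (rule coring_hom_bimodule_hom[OF Fm_hom])

lemma lim_carrier:
  "x \<in> carrier P \<longleftrightarrow> x \<in> extensional (Ob K) \<and> (\<forall>a\<in>Ob K. x a \<in> carrier (F a)) \<and>
    (\<forall>u\<in>Ar K. Fm u (x (Dom K u)) = x (Cod K u))"
  by (auto simp: lim_bimodule_def PiE_def)

lemma lim_at: "x \<in> carrier P \<Longrightarrow> a \<in> Ob K \<Longrightarrow> x a \<in> carrier (F a)"
  by (simp add: lim_carrier)

lemma lim_compat: "x \<in> carrier P \<Longrightarrow> u \<in> Ar K \<Longrightarrow> Fm u (x (Dom K u)) = x (Cod K u)"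
  by (simp add: lim_carrier)

lemma lim_ops:
  "\<zero>\<^bsub>P\<^esub> = (\<lambda>a\<in>Ob K. \<zero>\<^bsub>F a\<^esub>)" "x \<oplus>\<^bsub>P\<^esub> y = (\<lambda>a\<in>Ob K. x a \<oplus>\<^bsub>F a\<^esub> y a)"
  "lact P b x = (\<lambda>a\<in>Ob K. lact (F a) b (x a))" "ract P x b = (\<lambda>a\<in>Ob K. ract (F a) (x a) b)"
  by (simp_all add: lim_bimodule_def)

lemma lim_eqI: "x \<in> carrier P \<Longrightarrow> y \<in> carrier P \<Longrightarrow> (\<And>a. a \<in> Ob K \<Longrightarrow> x a = y a) \<Longrightarrow> x = y"
  by (rule extensionalityI[of _ "Ob K"]) (simp_all add: lim_carrier)

lemma lim_closed:
  "\<zero>\<^bsub>P\<^esub> \<in> carrier P" "x \<in> carrier P \<Longrightarrow> y \<in> carrier P \<Longrightarrow> x \<oplus>\<^bsub>P\<^esub> y \<in> carrier P"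
  "b \<in> carrier A \<Longrightarrow> x \<in> carrier P \<Longrightarrow> lact P b x \<in> carrier P"
  "b \<in> carrier A \<Longrightarrow> x \<in> carrier P \<Longrightarrow> ract P x b \<in> carrier P"
proof -
  note cl = abelian_groupE(1,2)[OF bimodule_abelian[OF F_bimodule]]
    left_module.lact_closed[OF bimodule_left[OF F_bimodule]]
    right_module.ract_closed[OF bimodule_right[OF F_bimodule]]
  note z = additive_zero[OF bimodule_abelian[OF F_bimodule[OF K.Dom_in]] bimodule_abelian[OF F_bimodule[OF K.Cod_in]]
      bimodule_hom_additive[OF Fm_bimodule_hom]]
  note s = additive_add[OF bimodule_hom_additive[OF Fm_bimodule_hom]] bimodule_hom_lact[OF Fm_bimodule_hom]
    bimodule_hom_ract[OF Fm_bimodule_hom]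
  show "\<zero>\<^bsub>P\<^esub> \<in> carrier P"
    using z by (simp add: lim_carrier lim_ops cl K.Dom_in K.Cod_in)
  show "x \<in> carrier P \<Longrightarrow> y \<in> carrier P \<Longrightarrow> x \<oplus>\<^bsub>P\<^esub> y \<in> carrier P"
    "b \<in> carrier A \<Longrightarrow> x \<in> carrier P \<Longrightarrow> lact P b x \<in> carrier P"
    "b \<in> carrier A \<Longrightarrow> x \<in> carrier P \<Longrightarrow> ract P x b \<in> carrier P"
    by (simp_all add: lim_carrier lim_ops cl K.Dom_in K.Cod_in s)
qed

lemma lim_abelian: "abelian_group P"
proof (rule abelian_groupI)
  fix x y z assume "x \<in> carrier P" "y \<in> carrier P" "z \<in> carrier P"
  then show "(x \<oplus>\<^bsub>P\<^esub> y) \<oplus>\<^bsub>P\<^esub> z = x \<oplus>\<^bsub>P\<^esub> (y \<oplus>\<^bsub>P\<^esub> z)"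
    using abelian_groupE(3)[OF bimodule_abelian[OF F_bimodule]]
    by (intro lim_eqI) (simp_all only: lim_closed, simp add: lim_ops lim_at)
next
  fix x y assume "x \<in> carrier P" "y \<in> carrier P"
  then show "x \<oplus>\<^bsub>P\<^esub> y = y \<oplus>\<^bsub>P\<^esub> x"
    using abelian_groupE(4)[OF bimodule_abelian[OF F_bimodule]]
    by (intro lim_eqI) (simp_all only: lim_closed, simp add: lim_ops lim_at)
next
  fix x assume x: "x \<in> carrier P"
  then show "\<zero>\<^bsub>P\<^esub> \<oplus>\<^bsub>P\<^esub> x = x"
    using abelian_groupE(5)[OF bimodule_abelian[OF F_bimodule]]
    by (intro lim_eqI) (simp_all only: lim_closed, simp add: lim_ops lim_at)
  have neg: "\<ominus>\<^bsub>F a\<^esub> x a \<in> carrier (F a)" "\<ominus>\<^bsub>F a\<^esub> x a \<oplus>\<^bsub>F a\<^esub> x a = \<zero>\<^bsub>F a\<^esub>" if "a \<in> Ob K" for a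
    using abelian_group.a_inv_closed[OF bimodule_abelian[OF F_bimodule[OF that]]]
      abelian_group.l_neg[OF bimodule_abelian[OF F_bimodule[OF that]]] lim_at[OF x that] by simp_all
  have "Fm u (\<ominus>\<^bsub>F (Dom K u)\<^esub> x (Dom K u)) = \<ominus>\<^bsub>F (Cod K u)\<^esub> x (Cod K u)" if "u \<in> Ar K" for u
    using additive_minus[OF bimodule_abelian[OF F_bimodule[OF K.Dom_in[OF that]]]
        bimodule_abelian[OF F_bimodule[OF K.Cod_in[OF that]]] bimodule_hom_additive[OF Fm_bimodule_hom[OF that]]
        lim_at[OF x K.Dom_in[OF that]]] lim_compat[OF x that] by simp
  then have "(\<lambda>a\<in>Ob K. \<ominus>\<^bsub>F a\<^esub> x a) \<in> carrier P"
    using neg(1) by (simp add: lim_carrier K.Dom_in K.Cod_in)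
  moreover have "(\<lambda>a\<in>Ob K. \<ominus>\<^bsub>F a\<^esub> x a) \<oplus>\<^bsub>P\<^esub> x = \<zero>\<^bsub>P\<^esub>"
    using neg(2) by (simp add: lim_ops cong: restrict_cong)
  ultimately show "\<exists>y\<in>carrier P. y \<oplus>\<^bsub>P\<^esub> x = \<zero>\<^bsub>P\<^esub>"
    by blast
qed (rule lim_closed; assumption)+

lemma lim_bimodule: "bimodule A P"
proof (intro bimoduleI left_moduleI right_moduleI lim_abelian lim_closed A.ring_axioms)
  note L = bimodule_left[OF F_bimodule] and R = bimodule_right[OF F_bimodule]
  note simps = lim_ops lim_at left_module.lact_add[OF L] left_module.add_lact[OF L] left_module.mult_lact[OF L]
    left_module.one_lact[OF L] right_module.ract_add[OF R] right_module.add_ract[OF R] right_module.mult_ract[OF R]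
    right_module.one_ract[OF R] bimodule.lact_ract[OF F_bimodule]
  fix x assume x: "x \<in> carrier P"
  show "lact P \<one>\<^bsub>A\<^esub> x = x"
    by (rule lim_eqI) (simp_all only: lim_closed x A.one_closed, simp add: simps x)
  show "ract P x \<one>\<^bsub>A\<^esub> = x"
    by (rule lim_eqI) (simp_all only: lim_closed x A.one_closed, simp add: simps x)
  fix b assume b: "b \<in> carrier A"
  show "lact P b (x \<oplus>\<^bsub>P\<^esub> y) = lact P b x \<oplus>\<^bsub>P\<^esub> lact P b y" if y: "y \<in> carrier P" for y
    by (rule lim_eqI) (simp_all only: lim_closed x y b, simp add: simps x y b)
  show "ract P (x \<oplus>\<^bsub>P\<^esub> y) b = ract P x b \<oplus>\<^bsub>P\<^esub> ract P y b" if y: "y \<in> carrier P" for y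
    by (rule lim_eqI) (simp_all only: lim_closed x y b, simp add: simps x y b)
  fix c assume c: "c \<in> carrier A"
  show "lact P (b \<oplus>\<^bsub>A\<^esub> c) x = lact P b x \<oplus>\<^bsub>P\<^esub> lact P c x"
    by (rule lim_eqI) (simp_all only: lim_closed x b c A.a_closed, simp add: simps x b c)
  show "ract P x (b \<oplus>\<^bsub>A\<^esub> c) = ract P x b \<oplus>\<^bsub>P\<^esub> ract P x c"
    by (rule lim_eqI) (simp_all only: lim_closed x b c A.a_closed, simp add: simps x b c)
  show "lact P (b \<otimes>\<^bsub>A\<^esub> c) x = lact P b (lact P c x)"
    by (rule lim_eqI) (simp_all only: lim_closed x b c A.m_closed, simp add: simps x b c)
  show "ract P x (b \<otimes>\<^bsub>A\<^esub> c) = ract P (ract P x b) c"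
    by (rule lim_eqI) (simp_all only: lim_closed x b c A.m_closed, simp add: simps x b c)
  show "ract P (lact P b x) c = lact P b (ract P x c)"
    by (rule lim_eqI) (simp_all only: lim_closed x b c, simp add: simps x b c)
qed

lemma proj_eq: "x \<in> carrier P \<Longrightarrow> q a x = x a"
  by (simp add: lim_proj_def)

lemma proj_hom: "a \<in> Ob K \<Longrightarrow> q a \<in> bimodule_hom A P (F a)"
  by (auto simp: bimodule_hom_def proj_eq lim_closed lim_at) (simp_all add: lim_ops lim_proj_def)

lemma proj_compat: "u \<in> Ar K \<Longrightarrow> compose (carrier P) (Fm u) (q (Dom K u)) = q (Cod K u)"
  by (rule compose_eqI) (simp_all add: lim_proj_def lim_compat)

lemma lim_universal:
  assumes E: "bimodule A E" and r: "\<And>a. a \<in> Ob K \<Longrightarrow> r a \<in> bimodule_hom A E (F a)"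
    and compat: "\<And>u. u \<in> Ar K \<Longrightarrow> compose (carrier E) (Fm u) (r (Dom K u)) = r (Cod K u)"
  shows "\<exists>!h. h \<in> bimodule_hom A E P \<and> (\<forall>a\<in>Ob K. compose (carrier E) (q a) h = r a)"
proof (rule ex1I, intro conjI ballI)
  interpret E: bimodule A E by (rule E)
  define h where "h = (\<lambda>x\<in>carrier E. \<lambda>a\<in>Ob K. r a x)"
  have hP: "h x \<in> carrier P" if x: "x \<in> carrier E" for x
    using fun_cong[OF compat, of _ x] bimodule_hom_closed[OF r, of _ x] x
    by (simp add: lim_carrier h_def K.Dom_in K.Cod_in compose_eq)
  have ha: "h x a = r a x" if "x \<in> carrier E" "a \<in> Ob K" for x a
    using that by (simp add: h_def)
  note simps = ha hP lim_ops additive_add[OF bimodule_hom_additive[OF r]] bimodule_hom_lact[OF r] bimodule_hom_ract[OF r]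
    E.lact_closed E.ract_closed
  show "h \<in> bimodule_hom A E P"
  proof (rule bimodule_homI)
    show "h \<in> extensional (carrier E)"
      by (simp add: h_def)
    show "additive_map E P h"
      by (rule additive_mapI) (simp add: hP, rule lim_eqI, simp_all only: hP lim_closed E.M.a_closed, simp add: simps)
    fix a x assume a: "a \<in> carrier A" "x \<in> carrier E"
    show "h (lact E a x) = lact P a (h x)"
      by (rule lim_eqI) (simp_all only: hP lim_closed a E.lact_closed, simp add: simps a)
    show "h (ract E x a) = ract P (h x) a"
      by (rule lim_eqI) (simp_all only: hP lim_closed a E.ract_closed, simp add: simps a)
  qed
  show "compose (carrier E) (q a) h = r a" if "a \<in> Ob K" for a
    by (rule compose_eqI[OF bimodule_hom_ext[OF r[OF that]]]) (simp add: proj_eq hP ha that)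
  fix h' assume h': "h' \<in> bimodule_hom A E P \<and> (\<forall>a\<in>Ob K. compose (carrier E) (q a) h' = r a)"
  show "h' = h"
  proof (rule bimodule_hom_eqI[OF conjunct1[OF h'] \<open>h \<in> bimodule_hom A E P\<close>])
    fix x assume x: "x \<in> carrier E"
    have x': "h' x \<in> carrier P"
      using bimodule_hom_closed[OF conjunct1[OF h'] x] .
    show "h' x = h x"
    proof (rule lim_eqI[OF x' hP[OF x]])
      fix a assume a: "a \<in> Ob K"
      then have "compose (carrier E) (q a) h' x = r a x"
        using h' by simp
      then show "h' x a = h x a"
        using x x' a by (simp add: compose_eq proj_eq ha)
    qed
  qed
qed

lemma lim_bimodule_limit: "bimodule_limit T A K F Fm P q"
  unfolding bimodule_limit_def
  by (intro conjI ballI allI impI lim_bimodule proj_hom proj_compat) (assumption | rule lim_universal; blast)+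

section \<open>The limit of corings inside the cofree coring on the limit of bimodules\<close>

abbreviation "CP \<equiv> cofree_coring A P"
abbreviation "f \<equiv> cofree_map A P"

definition qf :: "'o \<Rightarrow> ('a, 'a + nat, 'o \<Rightarrow> 'c) pair_colim_elem \<Rightarrow> 'c"
  where "qf = (\<lambda>a. compose (carrier CP) (q a) f)"

abbreviation "J \<equiv> H'_pairs A CP (Ob K) F qf"
abbreviation "C0 \<equiv> pair_colim A J"
abbreviation "p0 \<equiv> pair_map A J CP"

lemma coring_CP: "coring A CP"
  by (rule cofree_coring[OF lim_bimodule])

lemma f_hom: "f \<in> bimodule_hom A CP P"
  by (rule cofree_map_hom[OF lim_bimodule])

lemma H'_objD:
  assumes "H'_obj A CP (Ob K) F qf E h"
  shows "coring A E" "h \<in> coring_hom A E CP"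
    "a \<in> Ob K \<Longrightarrow> compose (carrier E) (qf a) h \<in> coring_hom A E (F a)"
  using assms by (simp_all add: H'_obj_def H_obj_def)

lemma H'_objI:
  assumes "coring A E" "h \<in> coring_hom A E CP"
    "\<And>a. a \<in> Ob K \<Longrightarrow> compose (carrier E) (qf a) h \<in> coring_hom A E (F a)"
  shows "H'_obj A CP (Ob K) F qf E h"
  using assms by (simp add: H'_obj_def H_obj_def coring_hom_bimodule_hom)

lemma H'_pair_diagram: "pair_diagram A J CP"
proof (rule pair_diagram.intro)
  fix G p assume "(G, p) \<in> J"
  then have "G \<in> small_corings A" and p: "p \<in> coring_hom A G CP"
    by (simp_all add: H'_pairs_def H'_obj_def)
  then show "G \<in> small_corings A" "additive_map G CP p" "p \<in> extensional (carrier G)"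
    using coring_hom_bimodule_hom[OF p] by (simp_all add: bimodule_hom_additive bimodule_hom_ext)
qed (rule A.ring_axioms, rule bimodule_abelian[OF coring_bimodule[OF coring_CP]])

interpretation P: pair_diagram A J CP by (rule H'_pair_diagram)

text \<open>Being a morphism to \<open>CP\<close> and having coring morphisms as projections both
  survive precomposition with a coring morphism.\<close>

lemma H'_admissible:
  assumes E: "H'_obj A CP (Ob K) F qf E p"
  shows "P.admissible E p"
  unfolding P.admissible_def
proof (intro ballI)
  fix G g assume G: "G \<in> small_corings A" "g \<in> coring_hom A G E"
  note pG = small_corings_precoring[OF G(1)] and pE = coring_precoring[OF H'_objD(1)[OF E]]
  have "H'_obj A CP (Ob K) F qf G (compose (carrier G) p g)"
  proof (rule H'_objI)
    show "coring A G"
      by (rule small_corings_coring[OF G(1)])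
    show "compose (carrier G) p g \<in> coring_hom A G CP"
      by (rule coring_hom_compose[OF pG pE coring_precoring[OF coring_CP] G(2) H'_objD(2)[OF E]])
    fix a assume a: "a \<in> Ob K"
    have "compose (carrier G) (compose (carrier E) (qf a) p) g \<in> coring_hom A G (F a)"
      by (rule coring_hom_compose[OF pG pE coring_precoring[OF F_coring[OF a]] G(2) H'_objD(3)[OF E a]])
    then show "compose (carrier G) (qf a) (compose (carrier G) p g) \<in> coring_hom A G (F a)"
      unfolding compose_assoc[OF coring_hom_funcset[OF G(2)]] .
  qed
  then show "(G, compose (carrier G) p g) \<in> J"
    using G(1) by (simp add: H'_pairs_def)
qed

lemma coring_C0: "coring A C0"
  by (rule P.coring_L)

lemma p0_hom: "p0 \<in> coring_hom A C0 CP"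
  by (rule P.pair_coring_homI[OF P.pair_map_ext P.additive_pair_map coring_precoring[OF coring_CP]])
    (simp add: P.compose_pair_map_inc, simp add: H'_pairs_def H'_obj_def)

lemma qf_hom: "a \<in> Ob K \<Longrightarrow> qf a \<in> bimodule_hom A CP (F a)"
  unfolding qf_def by (rule bimodule_hom_compose[OF coring_bimodule[OF coring_CP] f_hom proj_hom])

text \<open>\<open>qf a\<close> is only known to be a bimodule map. After \<open>p0\<close> it
  respects the coring structure because morphisms out of the colimit are tested on the members of
  \<open>J\<close>, for which the condition is built into the definition.\<close>

lemma qf_p0_hom:
  assumes a: "a \<in> Ob K"
  shows "compose (carrier C0) (qf a) p0 \<in> coring_hom A C0 (F a)"
proof (rule P.pair_coring_homI[OF _ _ coring_precoring[OF F_coring[OF a]]])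
  have b: "compose (carrier C0) (qf a) p0 \<in> bimodule_hom A C0 (F a)"
    by (rule bimodule_hom_compose[OF coring_bimodule[OF coring_C0] coring_hom_bimodule_hom[OF p0_hom] qf_hom[OF a]])
  show "compose (carrier C0) (qf a) p0 \<in> extensional (carrier C0)" "additive_map C0 (F a) (compose (carrier C0) (qf a) p0)"
    using b by (simp_all add: bimodule_hom_ext bimodule_hom_additive)
  fix G p assume G: "(G, p) \<in> J"
  then have "H'_obj A CP (Ob K) F qf G p"
    by (simp add: H'_pairs_def)
  then show "compose (carrier G) (compose (carrier C0) (qf a) p0) (pair_in A J (G, p)) \<in> coring_hom A G (F a)"
    unfolding compose_assoc[OF coring_hom_funcset[OF P.inc_coring_hom[OF G]], symmetric] P.compose_pair_map_inc[OF G]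
    by (rule H'_objD(3)[OF _ a])
qed

lemma H'_obj_C0: "H'_obj A CP (Ob K) F qf C0 p0"
  by (rule H'_objI[OF coring_C0 p0_hom qf_p0_hom])

lemma H'_universal:
  assumes E: "H'_obj A CP (Ob K) F qf E p"
  shows "\<exists>!h. h \<in> coring_hom A E C0 \<and> compose (carrier E) p0 h = p"
  by (rule P.admissible_final[OF H'_admissible[OF H'_obj_C0] H'_objD(1)[OF E] H'_admissible[OF E]
        bimodule_hom_ext[OF coring_hom_bimodule_hom[OF H'_objD(2)[OF E]]]])

lemma H'_final_C0: "H'_final T A CP (Ob K) F qf C0 p0"
  unfolding H'_final_def by (intro conjI allI impI H'_obj_C0) (rule H'_universal)

definition fp0 :: "_ \<Rightarrow> 'o \<Rightarrow> 'c"
  where "fp0 = compose (carrier C0) f p0"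

lemma fp0_hom: "fp0 \<in> bimodule_hom A C0 P"
  unfolding fp0_def
  by (rule bimodule_hom_compose[OF coring_bimodule[OF coring_C0] coring_hom_bimodule_hom[OF p0_hom] f_hom])

lemma q_fp0: "compose (carrier C0) (q a) fp0 = compose (carrier C0) (qf a) p0"
  unfolding fp0_def compose_assoc[OF coring_hom_funcset[OF p0_hom]] by (simp only: qf_def)

text \<open>A bimodule map \<open>p\<close> from a coring to \<open>P\<close> is the same as a
  coring morphism \<open>k\<close> to the cofree coring, and projecting \<open>p\<close> by
  \<open>q a\<close> equals projecting \<open>k\<close> by \<open>qf a\<close>. So objects over
  \<open>P\<close> correspond to objects over \<open>CP\<close>, and finality passes from one
  category to the other; uniqueness uses both universal properties in turn.\<close>

lemma H_universal:
  assumes E: "coring A E" and p: "p \<in> bimodule_hom A E P"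
    and qp: "\<And>a. a \<in> Ob K \<Longrightarrow> compose (carrier E) (q a) p \<in> coring_hom A E (F a)"
  shows "\<exists>!h. h \<in> coring_hom A E C0 \<and> compose (carrier E) fp0 h = p"
proof -
  obtain k where k: "k \<in> coring_hom A E CP" "compose (carrier E) f k = p"
    and uniq: "\<And>k'. k' \<in> coring_hom A E CP \<Longrightarrow> compose (carrier E) f k' = p \<Longrightarrow> k' = k"
    using cofree_universal[OF lim_bimodule E p] by blast
  have "compose (carrier E) (qf a) k = compose (carrier E) (q a) p" for a
    unfolding qf_def compose_assoc[OF coring_hom_funcset[OF k(1)], symmetric] k(2) ..
  then have "H'_obj A CP (Ob K) F qf E k"
    using qp by (intro H'_objI[OF E k(1)]) simp
  from H'_universal[OF this] obtain h where h: "h \<in> coring_hom A E C0" "compose (carrier E) p0 h = k"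
    and uniq': "\<And>h'. h' \<in> coring_hom A E C0 \<Longrightarrow> compose (carrier E) p0 h' = k \<Longrightarrow> h' = h"
    by blast
  have fp: "compose (carrier E) fp0 h' = compose (carrier E) f (compose (carrier E) p0 h')" if "h' \<in> coring_hom A E C0" for h'
    unfolding fp0_def by (rule compose_assoc[OF coring_hom_funcset[OF that], symmetric])
  show ?thesis
  proof (rule ex1I[of _ h])
    show "h \<in> coring_hom A E C0 \<and> compose (carrier E) fp0 h = p"
      using h k(2) fp by simp
    fix h' assume h': "h' \<in> coring_hom A E C0 \<and> compose (carrier E) fp0 h' = p"
    have "compose (carrier E) p0 h' \<in> coring_hom A E CP"
      by (rule coring_hom_compose[OF coring_precoring[OF E] coring_precoring[OF coring_C0]
            coring_precoring[OF coring_CP] conjunct1[OF h'] p0_hom])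
    then have "compose (carrier E) p0 h' = k"
      by (rule uniq) (use h' fp[OF conjunct1[OF h']] in simp)
    then show "h' = h"
      using uniq' conjunct1[OF h'] by blast
  qed
qed

lemma H_final_C0: "H_final T A P (Ob K) F q C0 fp0"
  unfolding H_final_def H_obj_def
  by (intro conjI ballI allI impI coring_C0 fp0_hom) (simp add: q_fp0 qf_p0_hom, elim conjE, rule H_universal, auto)

text \<open>By the limit of bimodules, a cone of coring morphisms amounts to one bimodule map
  \<open>p\<close> into \<open>P\<close> all of whose projections are coring morphisms. Cones are
  therefore the objects over \<open>P\<close> among which \<open>C0\<close> is final.\<close>

lemma limit_C0: "coring_limit T A K F Fm C0 (\<lambda>a. compose (carrier C0) (qf a) p0)"
  unfolding coring_limit_def
proof (intro conjI ballI allI impI)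
  show "coring A C0"
    by (rule coring_C0)
  show "compose (carrier C0) (qf a) p0 \<in> coring_hom A C0 (F a)" if "a \<in> Ob K" for a
    by (rule qf_p0_hom[OF that])
  show "compose (carrier C0) (Fm u) (compose (carrier C0) (qf (Dom K u)) p0) = compose (carrier C0) (qf (Cod K u)) p0"
    if "u \<in> Ar K" for u
    unfolding q_fp0[symmetric] compose_assoc[OF bimodule_hom_funcset[OF fp0_hom]] proj_compat[OF that] ..
  fix E :: "('a, 'e) coring" and r
  assume *: "coring A E \<and> (\<forall>a\<in>Ob K. r a \<in> coring_hom A E (F a)) \<and>
    (\<forall>u\<in>Ar K. compose (carrier E) (Fm u) (r (Dom K u)) = r (Cod K u))"
  then have E: "coring A E" and r: "\<And>a. a \<in> Ob K \<Longrightarrow> r a \<in> coring_hom A E (F a)"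
    and compat: "\<And>u. u \<in> Ar K \<Longrightarrow> compose (carrier E) (Fm u) (r (Dom K u)) = r (Cod K u)"
    by blast+
  obtain p where p: "p \<in> bimodule_hom A E P" "\<And>a. a \<in> Ob K \<Longrightarrow> compose (carrier E) (q a) p = r a"
    and uniq: "\<And>p'. p' \<in> bimodule_hom A E P \<Longrightarrow> (\<And>a. a \<in> Ob K \<Longrightarrow> compose (carrier E) (q a) p' = r a) \<Longrightarrow> p' = p"
    using lim_universal[OF coring_bimodule[OF E] coring_hom_bimodule_hom[OF r] compat] by metis
  have pr: "compose (carrier E) (compose (carrier C0) (qf a) p0) h = compose (carrier E) (q a) (compose (carrier E) fp0 h)"
    if "h \<in> coring_hom A E C0" for h a
    unfolding q_fp0[symmetric] by (rule compose_assoc[OF coring_hom_funcset[OF that], symmetric])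
  \<comment> \<open>For a fixed \<open>h\<close>, the equations with all \<open>r a\<close> say that
    \<open>fp0\<close> after \<open>h\<close> has the projections of \<open>p\<close>; a map into
    the limit of bimodules is determined by these.\<close>
  have "(h \<in> coring_hom A E C0 \<and> (\<forall>a\<in>Ob K. compose (carrier E) (compose (carrier C0) (qf a) p0) h = r a)) \<longleftrightarrow>
    (h \<in> coring_hom A E C0 \<and> compose (carrier E) fp0 h = p)" for h
  proof (intro conj_cong refl)
    assume h: "h \<in> coring_hom A E C0"
    have "compose (carrier E) fp0 h \<in> bimodule_hom A E P"
      by (rule bimodule_hom_compose[OF coring_bimodule[OF E] coring_hom_bimodule_hom[OF h] fp0_hom])
    then show "(\<forall>a\<in>Ob K. compose (carrier E) (compose (carrier C0) (qf a) p0) h = r a) \<longleftrightarrow> compose (carrier E) fp0 h = p"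
      using uniq p(2) pr[OF h] by auto
  qed
  moreover have "\<exists>!h. h \<in> coring_hom A E C0 \<and> compose (carrier E) fp0 h = p"
    by (rule H_universal[OF E p(1)]) (simp add: p(2) r)
  ultimately show "\<exists>!h. h \<in> coring_hom A E C0 \<and>
      (\<forall>a\<in>Ob K. compose (carrier E) (compose (carrier C0) (qf a) p0) h = r a)"
    by simp
qed

lemma C0_colimit: "coring_colimit T A J fst (pair_arr A) C0 (pair_in A J)"
  by (rule P.colimit)

lemma p0_in: "(H, h) \<in> J \<Longrightarrow> compose (carrier H) p0 (pair_in A J (H, h)) = h"
  by (rule P.compose_pair_map_inc)

end

section \<open>The main theorem\<close>

lemma pure_subcoring:
  fixes C :: "('a, 'c) coring"
  assumes C: "coring A C" and S: "sub_bimodule A S C"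
  shows "\<exists>D. subcoring A D C \<and> S \<subseteq> carrier D \<and> pure_left (T :: 'q itself) A D C \<and> pure_right T A D C \<and>
    (carrier D \<lesssim> S \<or> carrier D \<lesssim> carrier A \<or> carrier D \<lesssim> (UNIV :: nat set))"
proof -
  obtain D where D: "subcoring A D C" "S \<subseteq> carrier D" "locally_retract A C (carrier D)"
    "same_ops D (C\<lparr>carrier := carrier D\<rparr>)" "carrier D \<lesssim> S <+> (carrier A <+> (UNIV :: nat set))"
    using pure_subcoring_exists[OF C sub_bimoduleD(1)[OF S]] by metis
  note r = coring_bimodule[OF C] D(3,4)
  show ?thesis
    using D(1,2) retract_pure_left[OF r] retract_pure_right[OF r] lepoll_max[OF D(5)] by blast
qed

lemma subcoring_pure_change_type:
  assumes C: "coring A C" and D: "subcoring A D C"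
  shows "pure_left TYPE('a + nat) A D C \<Longrightarrow> pure_left (T :: 'q itself) (A :: ('a, 's) ring_scheme) D C"
    and "pure_right TYPE('a + nat) A D C \<Longrightarrow> pure_right T A D C"
proof -
  have sub: "carrier D \<subseteq> carrier C" and bD: "bimodule A D" and i: "(\<lambda>x\<in>carrier D. x) \<in> bimodule_hom A D C"
    using D sub_bimoduleD(1)[of A "carrier D" C]
    by (simp_all add: subcoring_def coring_bimodule coring_hom_bimodule_hom)
  note bC = coring_bimodule[OF C]
  show "pure_left TYPE('a + nat) A D C \<Longrightarrow> pure_left T A D C"
    by (rule pure_left_change_type[OF sub bimodule_left[OF bD] bimodule_left[OF bC] bimodule_hom_left[OF i]])
  show "pure_right TYPE('a + nat) A D C \<Longrightarrow> pure_right T A D C"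
    by (rule pure_right_change_type[OF sub bimodule_right[OF bD] bimodule_right[OF bC] bimodule_hom_right[OF i]])
qed

text \<open>Distinct morphisms differ at some \<open>x\<close>, and the map from a piece around
  \<open>{x}\<close> tells them apart.\<close>

lemma small_corings_separate:
  assumes X: "coring A X" and uv: "u \<in> coring_hom A X Y" "v \<in> coring_hom A X Y" "u \<noteq> v"
  shows "\<exists>G\<in>small_corings A. \<exists>g\<in>coring_hom A G X. compose (carrier G) u g \<noteq> compose (carrier G) v g"
proof -
  obtain x where x: "x \<in> carrier X" "u x \<noteq> v x"
    using bimodule_hom_eqI[OF uv(1,2)[THEN coring_hom_bimodule_hom]] uv(3) by blast
  have "{x} \<lesssim> carrier A \<or> {x} \<lesssim> (UNIV :: nat set)"
    by (simp add: finite_lepoll_infinite)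
  then obtain G g where G: "piece A X G g" "{x} \<subseteq> g ` carrier G"
    using piece_exists[OF X, of "{x}"] x(1) by blast
  then obtain y where "y \<in> carrier G" "x = g y"
    by auto
  then have "compose (carrier G) u g y \<noteq> compose (carrier G) v g y"
    using x(2) by (simp add: compose_eq)
  then have "compose (carrier G) u g \<noteq> compose (carrier G) v g"
    by (rule contrapos_nn) simp
  moreover have "G \<in> small_corings A" "g \<in> coring_hom A G X"
    using G(1) by (simp_all add: piece_def)
  ultimately show ?thesis
    by blast
qed

text \<open>In (i) the subcoring is found before any type of test modules is named: purity is
  asserted at the single type \<open>'a + nat\<close>, and the second clause extends it to each type
  \<open>'q\<close>. The type \<open>'e\<close> of the corings in the universal properties is free
  in the same way. In (iv) the colimit is final over the cofree coring and, after composing with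
  \<open>f\<close>, final over the limit of bimodules; the latter is what makes it the limit of
  \<open>F\<close>.\<close>

theorem theorem3p5:
  fixes A :: "('a, 's) ring_scheme"
  assumes "ring A"
  shows
    \<comment> \<open>(i)\<close>
    "(\<forall>(C :: ('a, 'c) coring) S. coring A C \<and> sub_bimodule A S C \<longrightarrow>
        (\<exists>D. subcoring A D C \<and> S \<subseteq> carrier D \<and>
          pure_left TYPE('a + nat) A D C \<and> pure_right TYPE('a + nat) A D C \<and>
          (carrier D \<lesssim> S \<or> carrier D \<lesssim> carrier A \<or> carrier D \<lesssim> (UNIV :: nat set))) \<and>
        \<comment> \<open>purity against modules in \<open>'a + nat\<close> is purity against modules in every type\<close>
        (\<forall>D. subcoring A D C \<longrightarrow>
          (pure_left TYPE('a + nat) A D C \<longrightarrow> pure_left TYPE('q) A D C) \<and>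
          (pure_right TYPE('a + nat) A D C \<longrightarrow> pure_right TYPE('q) A D C)))
     \<and>
    \<comment> \<open>(ii)\<close>
     ((\<forall>G :: ('a, 'x) coring.
        coring A G \<and> (carrier G \<lesssim> carrier A \<or> carrier G \<lesssim> (UNIV :: nat set)) \<longrightarrow>
        (\<exists>G'\<in>small_corings A. coring_iso A G G')) \<and>
      (\<forall>(X :: ('a, 'x) coring) (Y :: ('a, 'y) coring).
        coring A X \<and> coring A Y \<longrightarrow>
        (\<forall>u\<in>coring_hom A X Y. \<forall>v\<in>coring_hom A X Y. u \<noteq> v \<longrightarrow>
          (\<exists>G\<in>small_corings A. \<exists>g\<in>coring_hom A G X.
            compose (carrier G) u g \<noteq> compose (carrier G) v g))))
     \<and>
    \<comment> \<open>(iii)\<close>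
     (\<forall>V :: ('a, 'v) bimodule. bimodule A V \<longrightarrow>
        is_cofree TYPE('e) A V (cofree_coring A V) (cofree_map A V) \<and>
        coring_colimit TYPE('e) A (cofree_pairs A V) fst (pair_arr A)
          (cofree_coring A V) (pair_in A (cofree_pairs A V)) \<and>
        (\<forall>(G, f)\<in>cofree_pairs A V.
          compose (carrier G) (cofree_map A V) (pair_in A (cofree_pairs A V) (G, f)) = f))
     \<and>
    \<comment> \<open>(iv)\<close>
     (\<forall>(K :: ('o, 'r) category) (F :: 'o \<Rightarrow> ('a, 'k) coring) Fm P q CP f qf J C0 p0.
        coring_functor A K F Fm \<and>
        P = lim_bimodule K F Fm \<and> q = lim_proj K F Fm \<and>
        CP = cofree_coring A P \<and> f = cofree_map A P \<and>
        qf = (\<lambda>a. compose (carrier CP) (q a) f) \<and>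
        J = H'_pairs A CP (Ob K) F qf \<and>
        C0 = pair_colim A J \<and> p0 = pair_map A J CP \<longrightarrow>
        bimodule_limit TYPE('e) A K F Fm P q \<and>
        coring_colimit TYPE('e) A J fst (pair_arr A) C0 (pair_in A J) \<and>
        (\<forall>(H, h)\<in>J. compose (carrier H) p0 (pair_in A J (H, h)) = h) \<and>
        H'_final TYPE('e) A CP (Ob K) F qf C0 p0 \<and>
        H_final TYPE('e) A P (Ob K) F q C0 (compose (carrier C0) f p0) \<and>
        coring_limit TYPE('e) A K F Fm C0 (\<lambda>a. compose (carrier C0) (qf a) p0))"
proof (intro conjI)
  show "\<forall>(C :: ('a, 'c) coring) S. coring A C \<and> sub_bimodule A S C \<longrightarrow>
      (\<exists>D. subcoring A D C \<and> S \<subseteq> carrier D \<and>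
        pure_left TYPE('a + nat) A D C \<and> pure_right TYPE('a + nat) A D C \<and>
        (carrier D \<lesssim> S \<or> carrier D \<lesssim> carrier A \<or> carrier D \<lesssim> (UNIV :: nat set))) \<and>
      (\<forall>D. subcoring A D C \<longrightarrow>
        (pure_left TYPE('a + nat) A D C \<longrightarrow> pure_left TYPE('q) A D C) \<and>
        (pure_right TYPE('a + nat) A D C \<longrightarrow> pure_right TYPE('q) A D C))"
    by (intro allI impI conjI; elim conjE)
      (rule pure_subcoring; assumption | rule subcoring_pure_change_type; assumption)+
  show "\<forall>G :: ('a, 'x) coring.
      coring A G \<and> (carrier G \<lesssim> carrier A \<or> carrier G \<lesssim> (UNIV :: nat set)) \<longrightarrow>
      (\<exists>G'\<in>small_corings A. coring_iso A G G')"
    by (intro allI impI, elim conjE) (erule (1) small_coring_iso, erule bexI[rotated])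
  show "\<forall>(X :: ('a, 'x) coring) (Y :: ('a, 'y) coring). coring A X \<and> coring A Y \<longrightarrow>
      (\<forall>u\<in>coring_hom A X Y. \<forall>v\<in>coring_hom A X Y. u \<noteq> v \<longrightarrow>
        (\<exists>G\<in>small_corings A. \<exists>g\<in>coring_hom A G X. compose (carrier G) u g \<noteq> compose (carrier G) v g))"
    by (intro allI impI ballI, elim conjE) (rule small_corings_separate)
  show "\<forall>V :: ('a, 'v) bimodule. bimodule A V \<longrightarrow>
      is_cofree TYPE('e) A V (cofree_coring A V) (cofree_map A V) \<and>
      coring_colimit TYPE('e) A (cofree_pairs A V) fst (pair_arr A)
        (cofree_coring A V) (pair_in A (cofree_pairs A V)) \<and>
      (\<forall>(G, f)\<in>cofree_pairs A V.
        compose (carrier G) (cofree_map A V) (pair_in A (cofree_pairs A V) (G, f)) = f)"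
    by (intro allI impI conjI cofree_is_cofree cofree_colimit) (auto intro: cofree_map_in)
  show "\<forall>(K :: ('o, 'r) category) (F :: 'o \<Rightarrow> ('a, 'k) coring) Fm P q CP f qf J C0 p0.
      coring_functor A K F Fm \<and>
      P = lim_bimodule K F Fm \<and> q = lim_proj K F Fm \<and>
      CP = cofree_coring A P \<and> f = cofree_map A P \<and>
      qf = (\<lambda>a. compose (carrier CP) (q a) f) \<and>
      J = H'_pairs A CP (Ob K) F qf \<and>
      C0 = pair_colim A J \<and> p0 = pair_map A J CP \<longrightarrow>
      bimodule_limit TYPE('e) A K F Fm P q \<and>
      coring_colimit TYPE('e) A J fst (pair_arr A) C0 (pair_in A J) \<and>
      (\<forall>(H, h)\<in>J. compose (carrier H) p0 (pair_in A J (H, h)) = h) \<and>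
      H'_final TYPE('e) A CP (Ob K) F qf C0 p0 \<and>
      H_final TYPE('e) A P (Ob K) F q C0 (compose (carrier C0) f p0) \<and>
      coring_limit TYPE('e) A K F Fm C0 (\<lambda>a. compose (carrier C0) (qf a) p0)"
  proof (intro allI impI, elim conjE)
    fix K :: "('o, 'r) category" and F :: "'o \<Rightarrow> ('a, 'k) coring" and Fm P q CP f qf J C0 p0
    assume K: "coring_functor A K F Fm" and P: "P = lim_bimodule K F Fm" "q = lim_proj K F Fm"
      "CP = cofree_coring A P" "f = cofree_map A P" "qf = (\<lambda>a. compose (carrier CP) (q a) f)"
      "J = H'_pairs A CP (Ob K) F qf" "C0 = pair_colim A J" "p0 = pair_map A J CP"
    interpret L: coring_functor A K F Fm by (rule K)
    \<comment> \<open>\<open>L.qf\<close> is a constant and not an abbreviation, so the two have to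
      be identified before the facts of the locale apply.\<close>
    have qf: "qf = L.qf"
      by (simp add: P L.qf_def)
    show "bimodule_limit TYPE('e) A K F Fm P q \<and>
      coring_colimit TYPE('e) A J fst (pair_arr A) C0 (pair_in A J) \<and>
      (\<forall>(H, h)\<in>J. compose (carrier H) p0 (pair_in A J (H, h)) = h) \<and>
      H'_final TYPE('e) A CP (Ob K) F qf C0 p0 \<and>
      H_final TYPE('e) A P (Ob K) F q C0 (compose (carrier C0) f p0) \<and>
      coring_limit TYPE('e) A K F Fm C0 (\<lambda>a. compose (carrier C0) (qf a) p0)"
      unfolding P(6-8) qf P(1-4)
      using L.p0_in by (intro conjI L.lim_bimodule_limit L.C0_colimit L.H'_final_C0 L.H_final_C0[unfolded L.fp0_def] L.limit_C0) blast
  qed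
qed

end
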